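(* Let $n\geqslant 1$ and let $T=(\Lambda_1,\dots,\Lambda_n)$ be an updown tableau with contents $(c_1,\dots,c_n)$. Then the primitive idempotent $E_T$ of the Brauer algebra $\mathcal{B}_n(\omega)$ is found by the consecutive evaluations $$E_T=\Omega_T(u_1,\dots,u_n)\big|_{u_1=c_1}\big|_{u_2=c_2}\dots\big|_{u_n=c_n},$$ where $$\Omega_T(u_1,\dots,u_n)=\prod_{r=2}^{n}\left(\frac{(u_r-c_r)(u_r+c_1-\varkappa)}{(u_r-c_1)(u_r+c_r-\varkappa)}\prod_{i=1}^{r-1}\frac{(u_r-u_i)^2}{(u_r-u_i)^2-1}\right)\Omega(u_1,\dots,u_n).$$
   Context: Let $\omega$ be an indeterminate. The Brauer algebra $\mathcal{B}_n(\omega)$ is the $\mathbb{C}(\omega)$-linear span of the $n$-diagrams (two rows of $n$ dots, the $2n$ dots being joined pairwise by $n$ edges, each dot lying on exactly one edge). The product $d_1d_2$ is obtained by placing $d_1$ above $d_2$, identifying the bottom row of $d_1$ with the top row of $d_2$, and multiplying the resulting diagram with loops deleted by $\omega^s$, where $s$ is the number of closed loops. For $1\leqslant i<j\leqslant n$, $s_{ij}=s_{ji}\in\mathcal{B}_n(\omega)$ is the diagram of the transposition $(i,j)$, and $\epsilon_{ij}=\epsilon_{ji}$ is the diagram in which the $i$-th and $j$-th dots of the top row are joined, the $i$-th and $j$-th dots of the bottom row are joined, and the $k$-th top dot is joined to the $k$-th bottom dot for $k\ne i,j$. $\mathcal{B}_{n-1}(\omega)$ is regarded as the subalgebra of $\mathcal{B}_n(\omega)$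 spanned by the diagrams in which the $n$-th top and bottom dots are joined. Jucys--Murphy elements: $x_r=\frac{\omega-1}{2}+\sum_{i=1}^{r-1}(s_{ir}-\epsilon_{ir})$, $r=1,\dots,n$. Partitions are identified with their Young diagrams; $(i,j)$ is the box in row $i$ and column $j$. For a partition $\lambda$ of $n-2f$, $0\leqslant f\leqslant\lfloor n/2\rfloor$, an updown $\lambda$-tableau is a sequence $T=(\Lambda_1,\dots,\Lambda_n)$ of diagrams with $\Lambda_n=\lambda$ such that for each $r=1,\dots,n$ the diagram $\Lambda_r$ is obtained from $\Lambda_{r-1}$ by adding or removing one box, where $\Lambda_0=\varnothing$. Its contents $(c_1,\dots,c_n)$ are $c_r=\frac{\omega-1}{2}+j-i$ if $\Lambda_r$ is obtained from $\Lambda_{r-1}$ by adding the box $(i,j)$, and $c_r=-\left(\frac{\omega-1}{2}+j-i\right)$ if it is obtained by removing the box $(i,j)$. The primitive idempotents $E_T$ are defined recursively by $E_T=1$ for $n=1$ and, for $n\geqslant 2$, with $U=(\Lambda_1,\dots,\Lambda_{n-1})$ and $\mu=\Lambda_{n-1}$, $$E_T=E_U\,\frac{(x_n-a_1)\cdots(x_n-a_k)}{(c_n-a_1)\cdots(c_n-a_k)},$$ where $\alpha$ is the box added to or removed from $\mu$ to get $\Lambda_n$ and $a_1,\dots,a_k$ are the contents (i.e. $\frac{\omega-1}{2}+j-i$ for an addable box $(i,j)$ and $-(\frac{\omega-1}{2}+j-i)$ for a removable box $(i,j)$) of all boxes, excluding $\alpha$, which can be added to or removed from $\mu$ to get a diagram.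 Set $\varkappa=\frac{\omega}{2}-1$ and $\rho_{ij}(u)=1-\frac{s_{ij}}{u}+\frac{\epsilon_{ij}}{u-\varkappa}$. Define the rational function in $u_1,\dots,u_n$ with values in $\mathcal{B}_n(\omega)$ $$\Omega(u_1,\dots,u_n)=\prod_{1\leqslant i<j\leqslant n}\rho_{ij}(-u_i-u_j+\varkappa)\prod_{1\leqslant i<j\leqslant n}\rho_{ij}(u_i-u_j),$$ with both products taken (left to right) in the lexicographic order on the pairs $(i,j)$. Consecutive evaluations means that one first sets $u_1=c_1$ in the rational function, then sets $u_2=c_2$ in the resulting (simplified) rational function of $u_2,\dots,u_n$, and so on. *)

theory Defs
  imports "HOL-Library.Poly_Mapping" "HOL-Computational_Algebra.Polynomial_Factorial"
begin

section \<open>Diagrams\<close>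

text \<open>
  Diagrams only use the dots \<open>Top i\<close> and \<open>Bot i\<close> with \<open>i \<in> {1..n}\<close>. The dots
  \<open>Mid i\<close> are the identified middle row which occurs when two diagrams are stacked.
\<close>

datatype dot = Top nat | Mid nat | Bot nat

type_synonym diagram = "dot set set"

definition is_diagram :: "nat \<Rightarrow> diagram \<Rightarrow> bool" where
  "is_diagram n d \<longleftrightarrow>
     (\<forall>e\<in>d. e \<subseteq> Top ` {1..n} \<union> Bot ` {1..n} \<and> card e = 2) \<and>
     (\<forall>x\<in>Top ` {1..n} \<union> Bot ` {1..n}. \<exists>!e. e \<in> d \<and> x \<in> e)"

definition diagrams :: "nat \<Rightarrow> diagram set" where
  "diagrams n = {d. is_diagram n d}"

fun bot_to_mid :: "dot \<Rightarrow> dot" where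
  "bot_to_mid (Bot i) = Mid i"
| "bot_to_mid x = x"

fun top_to_mid :: "dot \<Rightarrow> dot" where
  "top_to_mid (Top i) = Mid i"
| "top_to_mid x = x"

definition stacked :: "diagram \<Rightarrow> diagram \<Rightarrow> diagram" where
  "stacked d1 d2 = image bot_to_mid ` d1 \<union> image top_to_mid ` d2"

definition connected_dots :: "diagram \<Rightarrow> diagram \<Rightarrow> (dot \<times> dot) set" where
  "connected_dots d1 d2 = {(x, y). {x, y} \<in> stacked d1 d2}\<^sup>*"

definition compose_diagrams :: "nat \<Rightarrow> diagram \<Rightarrow> diagram \<Rightarrow> diagram" where
  "compose_diagrams n d1 d2 =
     {{x, y} | x y. x \<in> Top ` {1..n} \<union> Bot ` {1..n} \<and> y \<in> Top ` {1..n} \<union> Bot ` {1..n} \<and>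
                    x \<noteq> y \<and> (x, y) \<in> connected_dots d1 d2}"

text \<open>
  The closed loops are the connected components of the stacked diagram that lie entirely in
  the middle row; every other component is a path between two outer dots. Counting components
  is insensitive to the fact that \<open>stacked\<close> merges two parallel edges
  \<open>{Mid i, Mid j}\<close> (a loop made of two edges) into one.
\<close>

definition num_loops :: "nat \<Rightarrow> diagram \<Rightarrow> diagram \<Rightarrow> nat" where
  "num_loops n d1 d2 =
     card {C. (\<exists>i\<in>{1..n}. C = connected_dots d1 d2 `` {Mid i}) \<and> C \<subseteq> range Mid}"

section \<open>The Brauer algebra\<close>

text \<open>
  An element of the Brauer algebra with parameter \<open>\<delta> \<in> k\<close> over a commutative ring \<open>k\<close> is given
  by its coefficient function, which vanishes outside \<open>diagrams n\<close>.
\<close>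

type_synonym 'k brauer = "diagram \<Rightarrow> 'k"

definition basis :: "diagram \<Rightarrow> 'k::comm_ring_1 brauer" where
  "basis d = (\<lambda>d'. if d' = d then 1 else 0)"

definition bplus :: "'k::comm_ring_1 brauer \<Rightarrow> 'k brauer \<Rightarrow> 'k brauer" where
  "bplus a b = (\<lambda>d. a d + b d)"

definition bminus :: "'k::comm_ring_1 brauer \<Rightarrow> 'k brauer \<Rightarrow> 'k brauer" where
  "bminus a b = (\<lambda>d. a d - b d)"

definition bscale :: "'k::comm_ring_1 \<Rightarrow> 'k brauer \<Rightarrow> 'k brauer" where
  "bscale c a = (\<lambda>d. c * a d)"

definition bmult :: "nat \<Rightarrow> 'k::comm_ring_1 \<Rightarrow> 'k brauer \<Rightarrow> 'k brauer \<Rightarrow> 'k brauer" where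
  "bmult n \<delta> a b = (\<lambda>d. \<Sum>d1\<in>diagrams n. \<Sum>d2\<in>diagrams n.
     a d1 * b d2 * (\<delta> ^ num_loops n d1 d2 * basis (compose_diagrams n d1 d2) d))"

definition identity_diagram :: "nat \<Rightarrow> diagram" where
  "identity_diagram n = {{Top k, Bot k} | k. k \<in> {1..n}}"

definition bone :: "nat \<Rightarrow> 'k::comm_ring_1 brauer" where
  "bone n = basis (identity_diagram n)"

definition bprod_list :: "nat \<Rightarrow> 'k::comm_ring_1 \<Rightarrow> 'k brauer list \<Rightarrow> 'k brauer" where
  "bprod_list n \<delta> as = foldr (bmult n \<delta>) as (bone n)"

definition s_elem :: "nat \<Rightarrow> nat \<Rightarrow> nat \<Rightarrow> 'k::comm_ring_1 brauer" where
  "s_elem n i j =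
     basis ({{Top i, Bot j}, {Top j, Bot i}} \<union> {{Top k, Bot k} | k. k \<in> {1..n} - {i, j}})"

definition eps_elem :: "nat \<Rightarrow> nat \<Rightarrow> nat \<Rightarrow> 'k::comm_ring_1 brauer" where
  "eps_elem n i j =
     basis ({{Top i, Top j}, {Bot i, Bot j}} \<union> {{Top k, Bot k} | k. k \<in> {1..n} - {i, j}})"

text \<open>
  \<open>bembed n\<close> is the inclusion of the algebra on \<open>n - 1\<close> strands into the one on \<open>n\<close> strands,
  sending a diagram \<open>d\<close> to \<open>insert {Top n, Bot n} d\<close>.
\<close>

definition bembed :: "nat \<Rightarrow> 'k::comm_ring_1 brauer \<Rightarrow> 'k brauer" where
  "bembed n a = (\<lambda>d. if {Top n, Bot n} \<in> d then a (d - {{Top n, Bot n}}) else 0)"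

definition jucys_murphy :: "nat \<Rightarrow> 'k::field \<Rightarrow> nat \<Rightarrow> 'k brauer" where
  "jucys_murphy n \<delta> r =
     bplus (bscale ((\<delta> - 1) / 2) (bone n))
           (\<lambda>d. \<Sum>i = 1..r - 1. bminus (s_elem n i r) (eps_elem n i r) d)"

section \<open>Updown tableaux\<close>

type_synonym box = "nat \<times> nat"

definition is_partition :: "nat list \<Rightarrow> bool" where
  "is_partition p \<longleftrightarrow> sorted_wrt (\<ge>) p \<and> 0 \<notin> set p"

definition young_diagram :: "nat list \<Rightarrow> box set" where
  "young_diagram p = {(i, j). i \<in> {1..length p} \<and> j \<in> {1..p ! (i - 1)}}"

definition is_young_diagram :: "box set \<Rightarrow> bool" where
  "is_young_diagram \<mu> \<longleftrightarrow> (\<exists>p. is_partition p \<and> \<mu> = young_diagram p)"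

definition addable :: "box set \<Rightarrow> box set" where
  "addable \<mu> = {\<alpha>. \<alpha> \<notin> \<mu> \<and> is_young_diagram (insert \<alpha> \<mu>)}"

definition removable :: "box set \<Rightarrow> box set" where
  "removable \<mu> = {\<alpha>. \<alpha> \<in> \<mu> \<and> is_young_diagram (\<mu> - {\<alpha>})}"

text \<open>
  A tableau \<open>(\<Lambda>\<^sub>1, \<dots>, \<Lambda>\<^sub>n)\<close> is given by the function \<open>T\<close> with \<open>T r = \<Lambda>\<^sub>r\<close>, including
  \<open>T 0 = \<emptyset>\<close>; the values \<open>T r\<close> for \<open>r > n\<close> play no role.
\<close>

definition updown_tableau :: "nat \<Rightarrow> box set \<Rightarrow> (nat \<Rightarrow> box set) \<Rightarrow> bool" where
  "updown_tableau n lam T \<longleftrightarrow>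
     is_young_diagram lam \<and> (\<exists>f \<le> n div 2. card lam = n - 2 * f) \<and>
     T 0 = {} \<and> T n = lam \<and>
     (\<forall>r\<in>{1..n}. is_young_diagram (T r) \<and>
        ((\<exists>\<alpha>\<in>addable (T (r - 1)). T r = insert \<alpha> (T (r - 1))) \<or>
         (\<exists>\<alpha>\<in>removable (T (r - 1)). T r = T (r - 1) - {\<alpha>})))"

text \<open>The content of a box \<open>\<alpha>\<close> which is added to \<open>\<mu>\<close> (if \<open>\<alpha> \<notin> \<mu>\<close>) or removed from \<open>\<mu>\<close>.\<close>

definition box_content :: "'k::field \<Rightarrow> box set \<Rightarrow> box \<Rightarrow> 'k" where
  "box_content \<delta> \<mu> \<alpha> =
     (let c = (\<delta> - 1) / 2 + of_nat (snd \<alpha>) - of_nat (fst \<alpha>) in if \<alpha> \<in> \<mu> then - c else c)"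

definition step_box :: "(nat \<Rightarrow> box set) \<Rightarrow> nat \<Rightarrow> box" where
  "step_box T r = the_elem (sym_diff (T (r - 1)) (T r))"

definition tableau_content :: "'k::field \<Rightarrow> (nat \<Rightarrow> box set) \<Rightarrow> nat \<Rightarrow> 'k" where
  "tableau_content \<delta> T r = box_content \<delta> (T (r - 1)) (step_box T r)"

definition other_boxes :: "(nat \<Rightarrow> box set) \<Rightarrow> nat \<Rightarrow> box set" where
  "other_boxes T r = (addable (T (r - 1)) \<union> removable (T (r - 1))) - {step_box T r}"

section \<open>The primitive idempotents\<close>

text \<open>
  The factors \<open>x\<^sub>n - a\<^sub>1, \<dots>, x\<^sub>n - a\<^sub>k\<close> commute, so their product over the finite set of boxes
  does not depend on the order and is formed with \<open>Finite_Set.fold\<close>.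
  The value for \<open>n = 0\<close> is irrelevant.
\<close>

fun primitive_idempotent :: "'k::field \<Rightarrow> nat \<Rightarrow> (nat \<Rightarrow> box set) \<Rightarrow> 'k brauer" where
  "primitive_idempotent \<delta> 0 T = bone 0"
| "primitive_idempotent \<delta> (Suc 0) T = bone 1"
| "primitive_idempotent \<delta> (Suc (Suc m)) T =
     (let n = Suc (Suc m);
          a = box_content \<delta> (T (n - 1))
      in bmult n \<delta> (bembed n (primitive_idempotent \<delta> (Suc m) T))
           (bscale (1 / (\<Prod>\<beta>\<in>other_boxes T n. tableau_content \<delta> T n - a \<beta>))
             (Finite_Set.fold
               (\<lambda>\<beta>. bmult n \<delta> (bminus (jucys_murphy n \<delta> n) (bscale (a \<beta>) (bone n))))
               (bone n) (other_boxes T n))))"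

section \<open>Rational functions and their evaluation\<close>

text \<open>
  \<open>scalar\<close> is the field \<open>\<complex>(\<omega>)\<close>, and \<open>ratfun\<close> is the field of rational functions over it in
  the variables \<open>u\<^sub>0, u\<^sub>1, u\<^sub>2, \<dots>\<close>, of which only \<open>u\<^sub>1, \<dots>, u\<^sub>n\<close> are used. Rational functions with
  values in the Brauer algebra are the elements of the algebra with coefficients in \<open>ratfun\<close>.
\<close>

type_synonym scalar = "complex poly fract"
type_synonym mpoly = "(nat \<Rightarrow>\<^sub>0 nat) \<Rightarrow>\<^sub>0 scalar"
type_synonym ratfun = "mpoly fract"

definition \<omega> :: scalar where
  "\<omega> = to_fract [:0, 1:]"

definition const :: "scalar \<Rightarrow> ratfun" where
  "const c = to_fract (Poly_Mapping.single 0 c)"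

definition var :: "nat \<Rightarrow> ratfun" where
  "var r = to_fract (Poly_Mapping.single (Poly_Mapping.single r 1) 1)"

definition subst :: "nat \<Rightarrow> scalar \<Rightarrow> mpoly \<Rightarrow> mpoly" where
  "subst r c p =
     (\<Sum>m\<in>Poly_Mapping.keys p.
        Poly_Mapping.single (Poly_Mapping.update r 0 m)
          (Poly_Mapping.lookup p m * c ^ Poly_Mapping.lookup m r))"

text \<open>
  \<open>evaluates_to r c f g\<close>: the rational function \<open>f\<close>, after simplification, is defined at
  \<open>u\<^sub>r = c\<close>, and setting \<open>u\<^sub>r = c\<close> yields \<open>g\<close>. It suffices that some representation of \<open>f\<close> as a
  fraction has a denominator that does not vanish identically at \<open>u\<^sub>r = c\<close>; the value \<open>g\<close> is
  unique by \<open>evaluates_to_unique\<close> below.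
\<close>

definition evaluates_to :: "nat \<Rightarrow> scalar \<Rightarrow> ratfun \<Rightarrow> ratfun \<Rightarrow> bool" where
  "evaluates_to r c f g \<longleftrightarrow>
     (\<exists>p q. subst r c q \<noteq> 0 \<and> f = Fract p q \<and> g = Fract (subst r c p) (subst r c q))"

definition brauer_evaluates_to ::
    "nat \<Rightarrow> scalar \<Rightarrow> ratfun brauer \<Rightarrow> ratfun brauer \<Rightarrow> bool" where
  "brauer_evaluates_to r c F G \<longleftrightarrow> (\<forall>d. evaluates_to r c (F d) (G d))"

definition consecutive_evaluation ::
    "nat \<Rightarrow> (nat \<Rightarrow> scalar) \<Rightarrow> ratfun brauer \<Rightarrow> ratfun brauer \<Rightarrow> bool" where
  "consecutive_evaluation n c F G \<longleftrightarrow>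
     (\<exists>H. H 0 = F \<and> (\<forall>r\<in>{1..n}. brauer_evaluates_to r (c r) (H (r - 1)) (H r)) \<and> H n = G)"

lemma subst_superset:
  assumes "finite A" "Poly_Mapping.keys p \<subseteq> A"
  shows "subst r c p = (\<Sum>m\<in>A. Poly_Mapping.single (Poly_Mapping.update r 0 m)
          (Poly_Mapping.lookup p m * c ^ Poly_Mapping.lookup m r))"
  unfolding subst_def using assms
  by (intro sum.mono_neutral_left) (auto simp: in_keys_iff)

lemma subst_zero [simp]: "subst r c 0 = 0"
  by (simp add: subst_def)

lemma subst_add: "subst r c (p + q) = subst r c p + subst r c q"
proof -
  let ?A = "Poly_Mapping.keys p \<union> Poly_Mapping.keys q"
  show ?thesis
    using Poly_Mapping.keys_add[of p q]
    by (simp add: subst_superset[of ?A] lookup_add distrib_right single_add sum.distrib)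
qed

lemma subst_single:
  "subst r c (Poly_Mapping.single m a) =
     Poly_Mapping.single (Poly_Mapping.update r 0 m) (a * c ^ Poly_Mapping.lookup m r)"
  by (cases "a = 0") (simp_all add: subst_def)

lemma update_zero_add:
  "Poly_Mapping.update r 0 (m + m') =
     Poly_Mapping.update r 0 m + Poly_Mapping.update r (0::nat) m'"
  by (rule poly_mapping_eqI) (simp add: lookup_update lookup_add)

lemma mpoly_induct [case_names zero add_single]:
  fixes P :: "mpoly \<Rightarrow> bool"
  assumes "P 0" "\<And>p m a. P p \<Longrightarrow> P (p + Poly_Mapping.single m a)"
  shows "P p"
proof (induction p rule: Poly_Mapping.update_induct)
  case const
  show ?case using assms(1) .
next
  case (update f m a)
  have "Poly_Mapping.update m a f = f + Poly_Mapping.single m a"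
    using update(1)
    by (intro poly_mapping_eqI) (auto simp: lookup_update lookup_add lookup_single in_keys_iff)
  then show ?case using assms(2)[OF update(3)] by simp
qed

lemma subst_mult: "subst r c (p * q) = subst r c p * subst r c q"
proof (induction p rule: mpoly_induct)
  case zero
  show ?case by simp
next
  case (add_single p m a)
  have "subst r c (Poly_Mapping.single m a * q) = subst r c (Poly_Mapping.single m a) * subst r c q"
  proof (induction q rule: mpoly_induct)
    case zero
    show ?case by simp
  next
    case (add_single q m' b)
    have "subst r c (Poly_Mapping.single m a * Poly_Mapping.single m' b) =
        subst r c (Poly_Mapping.single m a) * subst r c (Poly_Mapping.single m' b)"
      by (simp add: mult_single subst_single update_zero_add lookup_add power_add mult_ac)
    then show ?case using add_single by (simp add: distrib_left subst_add)
  qed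
  then show ?case using add_single by (simp add: distrib_right subst_add)
qed

lemma evaluates_to_unique:
  assumes "evaluates_to r c f g" "evaluates_to r c f g'"
  shows "g = g'"
proof -
  obtain p q p' q' where
    *: "subst r c q \<noteq> 0" "f = Fract p q" "g = Fract (subst r c p) (subst r c q)"
       "subst r c q' \<noteq> 0" "f = Fract p' q'" "g' = Fract (subst r c p') (subst r c q')"
    using assms unfolding evaluates_to_def by blast
  then have "q \<noteq> 0" "q' \<noteq> 0" by auto
  with * have "p * q' = p' * q" by (simp add: eq_fract)
  then have "subst r c p * subst r c q' = subst r c p' * subst r c q"
    by (metis subst_mult)
  with * show ?thesis by (simp add: eq_fract)
qed

lemma consecutive_evaluation_unique:
  assumes "consecutive_evaluation n c F G" "consecutive_evaluation n c F G'"
  shows "G = G'"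
proof -
  obtain H H' where
    H: "H 0 = F" "\<And>r. r \<in> {1..n} \<Longrightarrow> brauer_evaluates_to r (c r) (H (r - 1)) (H r)" "H n = G" and
    H': "H' 0 = F" "\<And>r. r \<in> {1..n} \<Longrightarrow> brauer_evaluates_to r (c r) (H' (r - 1)) (H' r)" "H' n = G'"
    using assms unfolding consecutive_evaluation_def by blast
  have "r \<le> n \<Longrightarrow> H r = H' r" for r
  proof (induction r)
    case 0
    show ?case using H H' by simp
  next
    case (Suc r)
    then show ?case using H(2)[of "Suc r"] H'(2)[of "Suc r"]
      by (auto simp: brauer_evaluates_to_def fun_eq_iff intro: evaluates_to_unique)
  qed
  then show ?thesis using H H' by blast
qed

section \<open>The rational functions of the fusion procedure\<close>

definition \<kappa> :: ratfun where
  "\<kappa> = const (\<omega> / 2 - 1)"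

definition rho :: "nat \<Rightarrow> nat \<Rightarrow> nat \<Rightarrow> ratfun \<Rightarrow> ratfun brauer" where
  "rho n i j u =
     bplus (bminus (bone n) (bscale (1 / u) (s_elem n i j)))
           (bscale (1 / (u - \<kappa>)) (eps_elem n i j))"

definition lex_pairs :: "nat \<Rightarrow> (nat \<times> nat) list" where
  "lex_pairs n = [(i, j). i \<leftarrow> [1..<n + 1], j \<leftarrow> [i + 1..<n + 1]]"

definition Omega :: "nat \<Rightarrow> ratfun brauer" where
  "Omega n =
     bprod_list n (const \<omega>)
       (map (\<lambda>(i, j). rho n i j (- var i - var j + \<kappa>)) (lex_pairs n) @
        map (\<lambda>(i, j). rho n i j (var i - var j)) (lex_pairs n))"

definition Omega_T :: "nat \<Rightarrow> (nat \<Rightarrow> box set) \<Rightarrow> ratfun brauer" where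
  "Omega_T n T =
     (let c = (\<lambda>r. const (tableau_content \<omega> T r)); u = var in
      bscale
        (\<Prod>r = 2..n.
           ((u r - c r) * (u r + c 1 - \<kappa>)) / ((u r - c 1) * (u r + c r - \<kappa>)) *
           (\<Prod>i = 1..r - 1. (u r - u i)^2 / ((u r - u i)^2 - 1)))
        (Omega n))"

end

theory Submission
  imports Defs "HOL-Computational_Algebra.Formal_Power_Series"
begin

text \<open>
  \<^bold>\<open>Why the formula holds.\<close> Write \<open>\<kappa> = \<omega>/2 - 1\<close>. The Yang--Baxter equation and the commutation of factors
  on disjoint strands rearrange \<open>\<Omega>\<close> into \<open>F\<^sub>1 F\<^sub>2 \<cdots> F\<^sub>n\<close>, where \<open>F\<^sub>m\<close> collects the factors whose larger
  index is \<open>m\<close> (\<open>lex_prods_factorize\<close>, \<open>Omega_factorize\<close>). Suppose that \<open>u\<^sub>1, \<dots>, u\<^sub>r\<close> have been set to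
  \<open>c\<^sub>1, \<dots>, c\<^sub>r\<close>, and that \<open>F\<^sub>1 \<cdots> F\<^sub>r\<close> with its scalar factors has become \<open>E\<close>, the idempotent of the truncated
  tableau. The idempotent \<open>E\<close> is the sum of the idempotents \<open>E\<^sub>a\<close> of the tableaux with one more step, where
  \<open>a\<close> is the content of that step and the eigenvalue of \<open>x\<^bsub>r+1\<^esub>\<close>. With \<open>u = u\<^bsub>r+1\<^esub>\<close>, the fusion
  procedure (\<open>fusion_procedure\<close>) shows
  \<open>E F\<^bsub>r+1\<^esub> = (u - c\<^sub>1)/(u + c\<^sub>1 - \<kappa>) \<cdot> (\<Prod>i\<le>r. 1 - 1/(u - c\<^sub>i)\<^sup>2) \<cdot> (\<Sum>a. (u + a - \<kappa>)/(u - a) \<cdot> E\<^sub>a)\<close>.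
  The prefactor of the theorem cancels the first two scalars and multiplies by \<open>(u - c)/(u + c - \<kappa>)\<close> with
  \<open>c = c\<^bsub>r+1\<^esub>\<close>. At \<open>u = c\<close> the pole at \<open>a = c\<close> leaves \<open>E\<^sub>c\<close>, and the other summands vanish. This is one
  evaluation (\<open>fusion_at_content\<close>, \<open>partial_fusion_step\<close>).

  \<^bold>\<open>Why \<open>E\<^sub>T\<close> is an eigenvector.\<close> By definition \<open>E\<^sub>T\<close> is \<open>E\<close> times a Lagrange interpolation polynomial in
  \<open>x\<^sub>n\<close>, so it suffices that \<open>E P(x\<^sub>n) = 0\<close>, where \<open>P\<close> has the possible contents as its roots. For the cap
  \<open>e\<close> on the strands \<open>n\<close> and \<open>n + 1\<close>, the products \<open>E e x\<^sub>n\<^sup>k e\<close> are multiples of \<open>E e\<close>. Their generating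
  function satisfies a recursion in \<open>n\<close> (\<open>resolvent_recursion\<close>). By the combinatorics of contents
  (\<open>root_fps_step\<close>) its solution is a rational function whose denominator comes from \<open>P\<close>, and this gives
  \<open>e E P(x\<^sub>n)\<^sup>2 e = 0\<close> (\<open>cap_root_poly_cap\<close>). Over an ordered field with a parameter larger than all integers
  the diagrams carry a definite form for which \<open>e\<close> and the \<open>x\<^sub>i\<close> are self-adjoint (\<open>form_positive\<close>). Hence
  \<open>E P(x\<^sub>n) e = 0\<close>, and \<open>E P(x\<^sub>n) = 0\<close> because multiplication by \<open>e\<close> is injective on the algebra on \<open>n\<close>
  strands (\<open>cap_mult_injective\<close>). The field \<open>\<rat>(\<omega>)\<close> has such an order, and the identity is transported to
  \<open>\<complex>(\<omega>)\<close> along the inclusion of coefficients.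

  \<^bold>\<open>Why the algebra is associative.\<close> Identities between composites of diagrams are checked for the parameter
  \<open>2\<close>, where a diagram is the \<open>0\<close>-\<open>1\<close> matrix of the two-colourings of its dots that are constant on edges.
  Composition is matrix multiplication and a closed loop contributes the factor \<open>2\<close>
  (\<open>card_middle_colourings\<close>). A matrix determines the diagram and the number of loops, so identities
  between matrices give identities for every parameter.
\<close>

section \<open>Composition of diagrams\<close>

text \<open>
  A path in a union of two matchings is an orbit of the dihedral group generated by the two
  partner maps. The composite \<open>\<tau>\<close> of the two involutions acts on such an orbit as a rotation of
  \<open>\<int>/m\<close>, the involutions act as reflections, and two reflections \<open>k \<mapsto> -k\<close> and \<open>k \<mapsto> -k - 1\<close> of
  \<open>\<int>/m\<close> have exactly two fixed points together.
\<close>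

lemma dihedral_orbit_two_fixed_points:
  fixes a b :: "'x \<Rightarrow> 'x"
  assumes inv: "\<And>v. a (a v) = v" "\<And>v. b (b v) = v"
    and V: "finite V" "x \<in> V" "\<And>v. v \<in> V \<Longrightarrow> a v \<in> V" "\<And>v. v \<in> V \<Longrightarrow> b v \<in> V"
    and x: "b x = x" "a x \<noteq> x"
  defines "\<tau> \<equiv> \<lambda>v. b (a v)"
  defines "Orb \<equiv> range (\<lambda>k. (\<tau> ^^ k) x)"
  shows "v \<in> Orb \<Longrightarrow> a v \<in> Orb" "v \<in> Orb \<Longrightarrow> b v \<in> Orb"
    and "\<exists>!y. y \<in> Orb \<and> y \<noteq> x \<and> (a y = y \<or> b y = y)"
proof -
  have inj: "inj \<tau>" unfolding \<tau>_def by (metis injI inv)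
  have "(\<tau> ^^ k) x \<in> V" for k by (induction k) (auto simp: V \<tau>_def)
  then have "finite Orb" unfolding Orb_def using V(1) by (meson finite_subset image_subsetI)
  then have "finite {y. \<exists>k. y = (\<tau> ^^ k) x}"
    by (rule rev_finite_subset) (auto simp: Orb_def)
  then obtain m0 where "m0 > 0 \<and> (\<tau> ^^ m0) x = x"
    using funpow_inj_finite[OF inj] by metis
  define m where "m = (LEAST k. 0 < k \<and> (\<tau> ^^ k) x = x)"
  have m: "0 < m" "(\<tau> ^^ m) x = x"
    unfolding m_def using LeastI[of "\<lambda>k. 0 < k \<and> (\<tau> ^^ k) x = x", OF \<open>m0 > 0 \<and> _\<close>] by auto
  have least: "m \<le> k" if "0 < k" "(\<tau> ^^ k) x = x" for k
    unfolding m_def using that by (intro Least_le) auto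
  have "m \<noteq> 1" using m(2) x inv unfolding \<tau>_def by (metis funpow_0 One_nat_def comp_apply funpow.simps(2) id_apply funpow.simps(1))
  with m(1) have m2: "2 \<le> m" by linarith
  have injk: "inj (\<tau> ^^ k)" for k using inj by (induction k) (auto intro: inj_compose)
  have dist: "i = j" if "i < m" "j < m" "(\<tau> ^^ i) x = (\<tau> ^^ j) x" for i j
  proof -
    have *: False if "i < j" "j < m" "(\<tau> ^^ i) x = (\<tau> ^^ j) x" for i j
    proof -
      have "(\<tau> ^^ j) x = (\<tau> ^^ i) ((\<tau> ^^ (j - i)) x)"
        using that(1) by (metis comp_apply funpow_add le_add_diff_inverse less_imp_le)
      with that(3) have "(\<tau> ^^ (j - i)) x = x" using injk[of i] by (metis injD)
      with least[of "j - i"] that show False by auto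
    qed
    show ?thesis using *[of i j] *[of j i] that by (metis linorder_neqE_nat)
  qed
  have refl_b_to_a: "a ((\<tau> ^^ k) x) = (\<tau> ^^ (m - k - 1)) x"
    if "k < m" "b ((\<tau> ^^ k) x) = (\<tau> ^^ (m - k)) x" for k
  proof -
    have "\<tau> (a ((\<tau> ^^ k) x)) = (\<tau> ^^ (m - k)) x" using that(2) by (simp add: \<tau>_def inv)
    also have "m - k = Suc (m - k - 1)" using that(1) by simp
    then have "(\<tau> ^^ (m - k)) x = \<tau> ((\<tau> ^^ (m - k - 1)) x)" by simp
    finally show ?thesis using inj by (metis injD)
  qed
  have refl_b: "k \<le> m \<Longrightarrow> b ((\<tau> ^^ k) x) = (\<tau> ^^ (m - k)) x" for k
  proof (induction k)
    case 0 then show ?case by (simp add: x m)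
  next
    case (Suc k)
    then have "a ((\<tau> ^^ k) x) = (\<tau> ^^ (m - k - 1)) x" by (intro refl_b_to_a) auto
    then show ?case by (simp add: \<tau>_def inv)
  qed
  have refl_a: "a ((\<tau> ^^ k) x) = (\<tau> ^^ (m - k - 1)) x" if "k < m" for k
    using refl_b_to_a refl_b that by simp
  have Orb: "\<exists>k<m. v = (\<tau> ^^ k) x" if "v \<in> Orb" for v
  proof -
    obtain k where k: "v = (\<tau> ^^ k) x" using \<open>v \<in> Orb\<close> by (auto simp: Orb_def)
    have "((\<tau> ^^ m) ^^ q) x = x" for q by (induction q) (auto simp: m)
    then have "(\<tau> ^^ (m * q)) x = x" for q by (simp add: funpow_mult)
    then have "(\<tau> ^^ (k mod m + m * (k div m))) x = (\<tau> ^^ (k mod m)) x"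
      by (simp only: funpow_add comp_apply)
    with k have "v = (\<tau> ^^ (k mod m)) x" by (simp only: mod_mult_div_eq)
    then show ?thesis using m(1) by (intro exI[of _ "k mod m"]) simp
  qed
  show "v \<in> Orb \<Longrightarrow> a v \<in> Orb"
    using Orb[of v] refl_a by (auto simp: Orb_def)
  show "v \<in> Orb \<Longrightarrow> b v \<in> Orb"
    using Orb[of v] refl_b by (auto simp: Orb_def dest: less_imp_le)
  have fixed: "(a ((\<tau> ^^ k) x) = (\<tau> ^^ k) x \<or> b ((\<tau> ^^ k) x) = (\<tau> ^^ k) x) \<longleftrightarrow> k = m div 2"
    if "0 < k" "k < m" for k
  proof -
    have "b ((\<tau> ^^ k) x) = (\<tau> ^^ k) x \<longleftrightarrow> m - k = k"
      using refl_b[of k] dist[of "m - k" k] that by auto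
    moreover have "a ((\<tau> ^^ k) x) = (\<tau> ^^ k) x \<longleftrightarrow> m - k - 1 = k"
      using refl_a[of k] dist[of "m - k - 1" k] that by auto
    ultimately show ?thesis using that by linarith
  qed
  show "\<exists>!y. y \<in> Orb \<and> y \<noteq> x \<and> (a y = y \<or> b y = y)"
  proof (rule ex1I)
    have half: "0 < m div 2" "m div 2 < m" using m2 by auto
    then have "(\<tau> ^^ (m div 2)) x \<noteq> x" using least[of "m div 2"] by auto
    then show "(\<tau> ^^ (m div 2)) x \<in> Orb \<and> (\<tau> ^^ (m div 2)) x \<noteq> x \<and>
        (a ((\<tau> ^^ (m div 2)) x) = (\<tau> ^^ (m div 2)) x \<or>
         b ((\<tau> ^^ (m div 2)) x) = (\<tau> ^^ (m div 2)) x)"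
      using fixed[OF half] by (auto simp: Orb_def)
  next
    fix y assume y: "y \<in> Orb \<and> y \<noteq> x \<and> (a y = y \<or> b y = y)"
    then obtain k where k: "k < m" "y = (\<tau> ^^ k) x" using Orb by blast
    then have "0 < k" using y by (cases k) auto
    with k y fixed[of k] show "y = (\<tau> ^^ (m div 2)) x" by blast
  qed
qed

definition matching :: "'v set \<Rightarrow> 'v set set \<Rightarrow> bool" where
  "matching V M \<longleftrightarrow> (\<forall>e\<in>M. e \<subseteq> V \<and> card e = 2) \<and> (\<forall>x\<in>V. \<exists>!e. e \<in> M \<and> x \<in> e)"

text \<open>Dots outside the matched set are fixed, so that a partner map is an involution everywhere.\<close>

definition partner :: "'v set set \<Rightarrow> 'v \<Rightarrow> 'v" where
  "partner M x = (if x \<in> \<Union>M then THE y. {x, y} \<in> M else x)"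

lemma
  assumes "matching V M"
  shows matching_subset: "e \<in> M \<Longrightarrow> e \<subseteq> V"
    and matching_card: "e \<in> M \<Longrightarrow> card e = 2"
    and matching_ex1: "x \<in> V \<Longrightarrow> \<exists>!e. e \<in> M \<and> x \<in> e"
  using assms by (simp_all add: matching_def)

lemma matching_edge_unique:
  assumes "matching V M" "{x, y} \<in> M" "{x, z} \<in> M"
  shows "y = z"
proof -
  have "x \<in> V" using matching_subset[OF assms(1,2)] by simp
  then have "\<exists>!e. e \<in> M \<and> x \<in> e" by (rule matching_ex1[OF assms(1)])
  then have "{x, y} = {x, z}" using assms(2,3) by (elim ex1E) blast
  then show ?thesis by (auto simp: doubleton_eq_iff)
qed

lemma matching_edge_distinct: "matching V M \<Longrightarrow> {x, y} \<in> M \<Longrightarrow> x \<noteq> y"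
  using matching_card[of V M "{x, y}"] by auto

lemma matching_edge_in: "matching V M \<Longrightarrow> {x, y} \<in> M \<Longrightarrow> x \<in> V \<and> y \<in> V"
  using matching_subset[of V M "{x, y}"] by simp

lemma matching_edge_form: "matching V M \<Longrightarrow> e \<in> M \<Longrightarrow> \<exists>x y. e = {x, y}"
  using matching_card[of V M e] by (metis card_2_iff)

lemma matching_has_edge:
  assumes "matching V M" "x \<in> V" shows "\<exists>y. {x, y} \<in> M"
proof -
  obtain e where e: "e \<in> M" "x \<in> e" using matching_ex1[OF assms] by (elim ex1E) blast
  then obtain y z where "e = {y, z}" using assms(1) matching_edge_form by blast
  with e show ?thesis by (metis insertE insert_commute singletonD)
qed

lemma partner_edge:
  assumes "matching V M" "x \<in> V" shows "{x, partner M x} \<in> M"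
proof -
  obtain y where "{x, y} \<in> M" using matching_has_edge[OF assms] by blast
  then have "(THE y. {x, y} \<in> M) = y" "x \<in> \<Union>M"
    using matching_edge_unique[OF assms(1)] by (blast intro: the_equality)+
  with \<open>{x, y} \<in> M\<close> show ?thesis by (simp add: partner_def)
qed

lemma partner_eqI: "matching V M \<Longrightarrow> {x, y} \<in> M \<Longrightarrow> partner M x = y"
  using matching_edge_unique matching_edge_in partner_edge by metis

lemma partner_outside: "matching V M \<Longrightarrow> x \<notin> V \<Longrightarrow> partner M x = x"
  using matching_subset[of V M] by (auto simp: partner_def)

lemma partner_partner: "matching V M \<Longrightarrow> partner M (partner M x) = x"
  by (metis insert_commute partner_edge partner_eqI partner_outside)

lemma partner_fixed_iff: "matching V M \<Longrightarrow> partner M x = x \<longleftrightarrow> x \<notin> V"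
  by (metis matching_edge_distinct partner_edge partner_outside)

lemma partner_in: "matching V M \<Longrightarrow> x \<in> V \<Longrightarrow> partner M x \<in> V"
  using matching_edge_in partner_edge by metis

lemma matching_image:
  assumes M: "matching V M" and inj: "inj_on f V"
  shows "matching (f ` V) (image f ` M)"
  unfolding matching_def
proof (intro conjI ballI)
  fix e assume "e \<in> image f ` M"
  then obtain e' where e': "e' \<in> M" "e = f ` e'" by blast
  then have "e' \<subseteq> V" "card e' = 2" using matching_subset[OF M] matching_card[OF M] by auto
  then show "e \<subseteq> f ` V" "card e = 2"
    using e' card_image[OF inj_on_subset[OF inj]] by auto
next
  fix x assume "x \<in> f ` V"
  then obtain v where v: "v \<in> V" "x = f v" by blast
  have "\<exists>!e. e \<in> M \<and> v \<in> e" by (rule matching_ex1[OF M v(1)])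
  then obtain e where e: "e \<in> M" "v \<in> e" "\<And>e'. e' \<in> M \<Longrightarrow> v \<in> e' \<Longrightarrow> e' = e"
    by (elim ex1E) blast
  show "\<exists>!e. e \<in> image f ` M \<and> x \<in> e"
  proof (rule ex1I[of _ "f ` e"])
    show "f ` e \<in> image f ` M \<and> x \<in> f ` e" using e(1,2) v(2) by simp
    fix e' assume "e' \<in> image f ` M \<and> x \<in> e'"
    then obtain d where d: "d \<in> M" "e' = f ` d" "f v \<in> f ` d" using v(2) by (elim conjE imageE) simp
    then have "d \<subseteq> V" using matching_subset[OF M] by blast
    then have "v \<in> d" using d(3) v(1) inj_on_image_mem_iff[OF inj] by blast
    then have "d = e" using d(1) e(3) by simp
    with d(2) show "e' = f ` e" by simp
  qed
qed

definition outer_dots :: "nat \<Rightarrow> dot set" where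
  "outer_dots n = Top ` {1..n} \<union> Bot ` {1..n}"

lemma finite_outer_dots [simp]: "finite (outer_dots n)"
  by (simp add: outer_dots_def)

lemma is_diagram_matching: "is_diagram n d \<longleftrightarrow> matching (outer_dots n) d"
  by (simp add: is_diagram_def matching_def outer_dots_def)

lemma matching_upper:
  assumes "is_diagram n d"
  shows "matching (Top ` {1..n} \<union> Mid ` {1..n}) (image bot_to_mid ` d)"
proof -
  have "inj_on bot_to_mid (outer_dots n)"
    unfolding outer_dots_def by (rule inj_onI) (elim UnE imageE; simp)
  moreover have "bot_to_mid ` outer_dots n = Top ` {1..n} \<union> Mid ` {1..n}"
    by (auto simp: outer_dots_def image_Un image_image)
  ultimately show ?thesis
    using matching_image[of "outer_dots n" d bot_to_mid] assms by (simp add: is_diagram_matching)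
qed

lemma matching_lower:
  assumes "is_diagram n d"
  shows "matching (Mid ` {1..n} \<union> Bot ` {1..n}) (image top_to_mid ` d)"
proof -
  have "inj_on top_to_mid (outer_dots n)"
    unfolding outer_dots_def by (rule inj_onI) (elim UnE imageE; simp)
  moreover have "top_to_mid ` outer_dots n = Mid ` {1..n} \<union> Bot ` {1..n}"
    by (auto simp: outer_dots_def image_Un image_image)
  ultimately show ?thesis
    using matching_image[of "outer_dots n" d top_to_mid] assms by (simp add: is_diagram_matching)
qed

lemma connected_dots_sym: "(x, y) \<in> connected_dots d1 d2 \<Longrightarrow> (y, x) \<in> connected_dots d1 d2"
  unfolding connected_dots_def
  by (rule symD[OF sym_rtrancl]) (auto intro!: symI simp: insert_commute)

lemma connected_dots_trans:
  "(x, y) \<in> connected_dots d1 d2 \<Longrightarrow> (y, z) \<in> connected_dots d1 d2 \<Longrightarrow> (x, z) \<in> connected_dots d1 d2"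
  unfolding connected_dots_def by (rule rtrancl_trans)

lemma connected_dots_refl [simp]: "(x, x) \<in> connected_dots d1 d2"
  by (simp add: connected_dots_def)

text \<open>
  In the stacked diagram the partner maps of the two layers are involutions of all dots. An outer dot
  belongs to one layer only, so it is fixed by one of them, while a middle dot is fixed by neither. The
  component of an outer dot is an orbit of both maps, and its two fixed points are the outer dots in it.
\<close>

lemma connected_to_one_outer_dot:
  assumes d: "is_diagram n d1" "is_diagram n d2" and x: "x \<in> outer_dots n"
  shows "\<exists>!y. y \<in> outer_dots n \<and> y \<noteq> x \<and> (x, y) \<in> connected_dots d1 d2"
proof -
  define V1 where "V1 = Top ` {1..n} \<union> Mid ` {1..n}"
  define V2 where "V2 = Mid ` {1..n} \<union> Bot ` {1..n}"
  define M1 where "M1 = image bot_to_mid ` d1"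
  define M2 where "M2 = image top_to_mid ` d2"
  have M: "matching V1 M1" "matching V2 M2"
    unfolding V1_def V2_def M1_def M2_def
    by (rule matching_upper[OF d(1)], rule matching_lower[OF d(2)])
  \<comment> \<open>The situation is symmetric in the two layers: \<open>x\<close> lies in exactly one of them.\<close>
  have main: "\<exists>!y. y \<in> outer_dots n \<and> y \<noteq> x \<and> (x, y) \<in> connected_dots d1 d2"
    if N: "matching W1 N1" "matching W2 N2" "N1 \<union> N2 = M1 \<union> M2" "W1 \<union> W2 = V1 \<union> V2"
      "W1 \<inter> W2 = Mid ` {1..n}" and xW: "x \<in> W1" "x \<notin> W2" for W1 W2 :: "dot set" and N1 N2
  proof -
    define a where "a = partner N1"
    define b where "b = partner N2"
    define \<tau> where "\<tau> = (\<lambda>v. b (a v))"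
    define Orb where "Orb = range (\<lambda>k. (\<tau> ^^ k) x)"
    have V: "finite (V1 \<union> V2)" by (simp add: V1_def V2_def)
    have inv: "a (a v) = v" "b (b v) = v" for v by (simp_all add: a_def b_def partner_partner[OF N(1)] partner_partner[OF N(2)])
    have ab_in: "a v \<in> V1 \<union> V2" "b v \<in> V1 \<union> V2" if "v \<in> V1 \<union> V2" for v
      unfolding a_def b_def using that N(4) partner_in[OF N(1)] partner_in[OF N(2)]
        partner_outside[OF N(1)] partner_outside[OF N(2)] by (metis Un_iff)+
    have xx: "x \<in> V1 \<union> V2" "b x = x" "a x \<noteq> x"
      unfolding a_def b_def using xW N partner_fixed_iff by (blast, metis, metis)
    note dih = dihedral_orbit_two_fixed_points[where a=a and b=b and x=x, OF inv V xx(1) ab_in xx(2,3),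
        folded \<tau>_def, folded Orb_def]
    have step: "(v, a v) \<in> connected_dots d1 d2" "(v, b v) \<in> connected_dots d1 d2" for v
    proof -
      have *: "(v, partner N v) \<in> connected_dots d1 d2" if "matching W N" "N \<subseteq> M1 \<union> M2" for W N
        using that unfolding connected_dots_def stacked_def M1_def M2_def
        by (cases "v \<in> W") (auto simp: partner_outside dest!: partner_edge intro!: r_into_rtrancl)
      show "(v, a v) \<in> connected_dots d1 d2" "(v, b v) \<in> connected_dots d1 d2"
        unfolding a_def b_def using N by (auto intro!: *)
    qed
    have "(x, (\<tau> ^^ k) x) \<in> connected_dots d1 d2" for k
    proof (induction k)
      case (Suc k)
      then show ?case
        using connected_dots_trans[OF _ connected_dots_trans[OF step(1) step(2)]]
        by (simp add: \<tau>_def)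
    qed simp
    moreover have "y \<in> Orb" if "(x, y) \<in> connected_dots d1 d2" for y
      using that unfolding connected_dots_def
    proof (induction rule: rtrancl_induct)
      case base
      then show ?case unfolding Orb_def by (metis funpow_0 rangeI)
    next
      case (step y z)
      then have "{y, z} \<in> N1 \<union> N2" using N(3) by (simp add: stacked_def M1_def M2_def)
      then have "z = a y \<or> z = b y"
        unfolding a_def b_def using partner_eqI N(1,2) by (metis Un_iff)
      then show ?case using dih(1,2) step.IH by blast
    qed
    ultimately have Orb: "y \<in> Orb \<longleftrightarrow> (x, y) \<in> connected_dots d1 d2" for y
      by (auto simp: Orb_def)
    have OV: "y \<in> V1 \<union> V2" if "y \<in> Orb" for y
    proof -
      have "(\<tau> ^^ k) x \<in> V1 \<union> V2" for k
      proof (induction k)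
        case (Suc k)
        then show ?case using ab_in(2)[OF ab_in(1)[OF Suc]] by (simp add: \<tau>_def)
      qed (use xx(1) in simp)
      then show ?thesis using that by (auto simp: Orb_def)
    qed
    have outer: "outer_dots n = V1 \<union> V2 - Mid ` {1..n}"
      by (auto simp: V1_def V2_def outer_dots_def)
    have fixed: "y \<in> outer_dots n \<longleftrightarrow> a y = y \<or> b y = y" if "y \<in> V1 \<union> V2" for y
    proof -
      have "y \<in> outer_dots n \<longleftrightarrow> y \<notin> W1 \<inter> W2" using that unfolding outer N(5) by simp
      then show ?thesis
        by (simp add: a_def b_def partner_fixed_iff[OF N(1)] partner_fixed_iff[OF N(2)])
    qed
    have outer_V: "y \<in> outer_dots n \<Longrightarrow> y \<in> V1 \<union> V2" for y unfolding outer by simp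
    have "(y \<in> Orb \<and> y \<noteq> x \<and> (a y = y \<or> b y = y)) \<longleftrightarrow>
        (y \<in> outer_dots n \<and> y \<noteq> x \<and> (x, y) \<in> connected_dots d1 d2)" for y
      using Orb[of y] OV[of y] fixed[of y] outer_V[of y] by metis
    then show ?thesis using dih(3) by simp
  qed
  show ?thesis
  proof (cases "x \<in> V1")
    case True
    then have "x \<notin> V2" using x by (auto simp: V1_def V2_def outer_dots_def)
    then show ?thesis using M True by (intro main[of V1 M1 V2 M2]) (auto simp: V1_def V2_def)
  next
    case False
    then have "x \<in> V2" using x by (auto simp: V1_def V2_def outer_dots_def)
    then show ?thesis using M False by (intro main[of V2 M2 V1 M1]) (auto simp: V1_def V2_def)
  qed
qed

lemma compose_is_diagram:
  assumes d: "is_diagram n d1" "is_diagram n d2"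
  shows "is_diagram n (compose_diagrams n d1 d2)"
  unfolding is_diagram_matching matching_def
proof (intro conjI ballI)
  fix e assume "e \<in> compose_diagrams n d1 d2"
  then show "e \<subseteq> outer_dots n" "card e = 2"
    by (auto simp: compose_diagrams_def outer_dots_def)
next
  fix x assume x: "x \<in> outer_dots n"
  then obtain y where y: "y \<in> outer_dots n" "y \<noteq> x" "(x, y) \<in> connected_dots d1 d2"
    and uniq: "\<And>z. z \<in> outer_dots n \<Longrightarrow> z \<noteq> x \<Longrightarrow> (x, z) \<in> connected_dots d1 d2 \<Longrightarrow> z = y"
    using connected_to_one_outer_dot[OF d x] by blast
  show "\<exists>!e. e \<in> compose_diagrams n d1 d2 \<and> x \<in> e"
  proof (rule ex1I[of _ "{x, y}"])
    show "{x, y} \<in> compose_diagrams n d1 d2 \<and> x \<in> {x, y}"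
      using x y unfolding compose_diagrams_def outer_dots_def by blast
    fix e assume "e \<in> compose_diagrams n d1 d2 \<and> x \<in> e"
    then obtain p q where e: "e = {p, q}" "p \<in> outer_dots n" "q \<in> outer_dots n" "p \<noteq> q"
       "(p, q) \<in> connected_dots d1 d2" "x = p \<or> x = q"
      unfolding compose_diagrams_def outer_dots_def by blast
    then show "e = {x, y}" using uniq[of p] uniq[of q] connected_dots_sym by blast
  qed
qed

section \<open>Two-colourings of the dots\<close>

text \<open>
  A colouring of the three rows by two colours is given by the sets \<open>A\<close>, \<open>G\<close>, \<open>B\<close> of the
  top, middle and bottom dots of the first colour.
\<close>

fun colour :: "nat set \<Rightarrow> nat set \<Rightarrow> nat set \<Rightarrow> dot \<Rightarrow> bool" where
  "colour A G B (Top i) \<longleftrightarrow> i \<in> A"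
| "colour A G B (Mid i) \<longleftrightarrow> i \<in> G"
| "colour A G B (Bot i) \<longleftrightarrow> i \<in> B"

definition fits :: "diagram \<Rightarrow> nat set \<Rightarrow> nat set \<Rightarrow> bool" where
  "fits d A B \<longleftrightarrow> (\<forall>x y. {x, y} \<in> d \<longrightarrow> colour A {} B x = colour A {} B y)"

lemma doubleton_in_image: "{x, y} \<in> image f ` d \<Longrightarrow> (\<And>e. e \<in> d \<Longrightarrow> \<exists>p q. e = {p, q}) \<Longrightarrow>
    \<exists>p q. {p, q} \<in> d \<and> x = f p \<and> y = f q"
proof -
  assume "{x, y} \<in> image f ` d" and form: "\<And>e. e \<in> d \<Longrightarrow> \<exists>p q. e = {p, q}"
  then obtain e where e: "e \<in> d" "{x, y} = f ` e" by blast
  then obtain p q where "e = {p, q}" using form by blast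
  moreover from this e have "x = f p \<and> y = f q \<or> x = f q \<and> y = f p"
    by (simp add: doubleton_eq_iff)
  ultimately show ?thesis using e(1) by (metis insert_commute)
qed

lemma diagram_edge_form: "is_diagram n d \<Longrightarrow> e \<in> d \<Longrightarrow> \<exists>p q. e = {p, q}"
  unfolding is_diagram_matching by (rule matching_edge_form)

lemma diagram_edge_outer: "is_diagram n d \<Longrightarrow> {x, y} \<in> d \<Longrightarrow> x \<in> outer_dots n \<and> y \<in> outer_dots n"
  unfolding is_diagram_matching by (rule matching_edge_in)

lemma doubleton_image: "{x, y} \<in> d \<Longrightarrow> {f x, f y} \<in> image f ` d"
  using image_eqI[of "{f x, f y}" "image f" "{x, y}" d] by simp

lemma fits_relabelled:
  assumes d: "is_diagram n d" and f: "\<And>z. z \<in> outer_dots n \<Longrightarrow> h (f z) = colour A {} B z"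
  shows "(\<forall>x y. {x, y} \<in> image f ` d \<longrightarrow> h x = h y) \<longleftrightarrow> fits d A B"
  unfolding fits_def
proof (intro iffI; intro allI impI)
  fix x y assume "\<forall>x y. {x, y} \<in> image f ` d \<longrightarrow> h x = h y" "{x, y} \<in> d"
  moreover from this have "h (f x) = h (f y)" using doubleton_image[of x y d f] by blast
  ultimately show "colour A {} B x = colour A {} B y"
    using f[of x] f[of y] diagram_edge_outer[OF d, of x y] by simp
next
  fix x y assume *: "\<forall>x y. {x, y} \<in> d \<longrightarrow> colour A {} B x = colour A {} B y"
    and "{x, y} \<in> image f ` d"
  then obtain p q where pq: "{p, q} \<in> d" "x = f p" "y = f q"
    using doubleton_in_image[of x y f d] diagram_edge_form[OF d] by metis
  then show "h x = h y" using * f[of p] f[of q] diagram_edge_outer[OF d, of p q] by simp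
qed

lemma fits_upper:
  assumes "is_diagram n d"
  shows "(\<forall>x y. {x, y} \<in> image bot_to_mid ` d \<longrightarrow> colour A G B x = colour A G B y) \<longleftrightarrow> fits d A G"
  by (rule fits_relabelled[OF assms]) (auto simp: outer_dots_def)

lemma fits_lower:
  assumes "is_diagram n d"
  shows "(\<forall>x y. {x, y} \<in> image top_to_mid ` d \<longrightarrow> colour A G B x = colour A G B y) \<longleftrightarrow> fits d G B"
  by (rule fits_relabelled[OF assms]) (auto simp: outer_dots_def)

lemma constant_on_rtrancl:
  "(\<forall>x y. (x, y) \<in> E \<longrightarrow> h x = h y) \<longleftrightarrow> (\<forall>x y. (x, y) \<in> E\<^sup>* \<longrightarrow> h x = h y)"
proof
  assume *: "\<forall>x y. (x, y) \<in> E \<longrightarrow> h x = h y"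
  have "h x = h y" if "(x, y) \<in> E\<^sup>*" for x y
    using that by (induction rule: rtrancl_induct) (auto simp: *)
  then show "\<forall>x y. (x, y) \<in> E\<^sup>* \<longrightarrow> h x = h y" by blast
qed blast

lemma fits_stacked:
  assumes "is_diagram n d1" "is_diagram n d2"
  shows "fits d1 A G \<and> fits d2 G B \<longleftrightarrow>
    (\<forall>x y. (x, y) \<in> connected_dots d1 d2 \<longrightarrow> colour A G B x = colour A G B y)"
  unfolding connected_dots_def constant_on_rtrancl[symmetric] stacked_def
    fits_upper[OF assms(1), of A G B, symmetric] fits_lower[OF assms(2), of A G B, symmetric]
  unfolding mem_Collect_eq case_prod_conv Un_iff by metis

lemma connected_dots_range:
  assumes "is_diagram n d1" "is_diagram n d2" "(x, y) \<in> connected_dots d1 d2"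
  shows "x = y \<or> x \<in> outer_dots n \<union> Mid ` {1..n} \<and> y \<in> outer_dots n \<union> Mid ` {1..n}"
proof -
  have "p \<in> outer_dots n \<union> Mid ` {1..n} \<and> q \<in> outer_dots n \<union> Mid ` {1..n}"
    if "{p, q} \<in> stacked d1 d2" for p q
    using that matching_edge_in[OF matching_upper[OF assms(1)], of p q]
      matching_edge_in[OF matching_lower[OF assms(2)], of p q]
    unfolding stacked_def outer_dots_def by blast
  then have step: "p \<in> outer_dots n \<union> Mid ` {1..n} \<and> q \<in> outer_dots n \<union> Mid ` {1..n}"
    if "(p, q) \<in> {(x, y). {x, y} \<in> stacked d1 d2}" for p q using that by simp
  show ?thesis using assms(3) unfolding connected_dots_def
    by (induction rule: rtrancl_induct) (use step in blast)+
qed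

text \<open>
  A colouring of the outer rows extends to the middle row exactly if connected outer dots have
  the same colour. The extension is then forced except that each closed loop can be coloured
  freely. Thus composing diagrams with the weight \<open>2 ^ num_loops\<close> is multiplication of the
  \<open>0\<close>-\<open>1\<close> matrices \<open>fits d\<close>, and identities between products of diagrams can be checked on
  matrices.
\<close>

lemma card_middle_colourings:
  assumes d: "is_diagram n d1" "is_diagram n d2"
  shows "card {G \<in> Pow {1..n}. fits d1 A G \<and> fits d2 G B} =
    (if fits (compose_diagrams n d1 d2) A B then 2 ^ num_loops n d1 d2 else 0)"
proof -
  define R where "R = connected_dots d1 d2"
  define Loops where "Loops = {C. (\<exists>i\<in>{1..n}. C = R `` {Mid i}) \<and> C \<subseteq> range Mid}"
  define valid where "valid G \<longleftrightarrow> (\<forall>x y. (x, y) \<in> R \<longrightarrow> colour A G B x = colour A G B y)" for G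
  have valid: "fits d1 A G \<and> fits d2 G B \<longleftrightarrow> valid G" for G
    using fits_stacked[OF d] by (simp add: valid_def R_def)
  have R: "(x, x) \<in> R" "(x, y) \<in> R \<Longrightarrow> (y, x) \<in> R" "(x, y) \<in> R \<Longrightarrow> (y, z) \<in> R \<Longrightarrow> (x, z) \<in> R" for x y z
    by (auto simp: R_def intro: connected_dots_sym connected_dots_trans)
  have R_class: "R `` {x} = R `` {y}" if "(x, y) \<in> R" for x y
    using that R by blast
  have range: "x = y \<or> x \<in> outer_dots n \<union> Mid ` {1..n} \<and> y \<in> outer_dots n \<union> Mid ` {1..n}"
    if "(x, y) \<in> R" for x y using that connected_dots_range[OF d] by (simp add: R_def)
  have outer_colour: "colour A G B x = colour A {} B x" if "x \<in> outer_dots n" for G x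
    using that by (auto simp: outer_dots_def)
  have compose: "fits (compose_diagrams n d1 d2) A B \<longleftrightarrow>
    (\<forall>x\<in>outer_dots n. \<forall>y\<in>outer_dots n. (x, y) \<in> R \<longrightarrow> colour A {} B x = colour A {} B y)"
    (is "_ \<longleftrightarrow> ?C")
  proof
    assume l: "fits (compose_diagrams n d1 d2) A B"
    show ?C
    proof (intro ballI impI)
      fix x y assume "x \<in> outer_dots n" "y \<in> outer_dots n" "(x, y) \<in> R"
      then have "x = y \<or> {x, y} \<in> compose_diagrams n d1 d2"
        unfolding compose_diagrams_def outer_dots_def R_def by blast
      then show "colour A {} B x = colour A {} B y" using l unfolding fits_def by blast
    qed
  next
    assume r: ?C
    show "fits (compose_diagrams n d1 d2) A B"
      unfolding fits_def
    proof (intro allI impI)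
      fix x y assume "{x, y} \<in> compose_diagrams n d1 d2"
      then obtain p q where "{x, y} = {p, q}" "p \<in> outer_dots n" "q \<in> outer_dots n" "(p, q) \<in> R"
        unfolding compose_diagrams_def outer_dots_def R_def by blast
      then show "colour A {} B x = colour A {} B y" using r by (metis doubleton_eq_iff)
    qed
  qed
  have fin: "finite Loops" unfolding Loops_def
    by (rule finite_subset[of _ "(\<lambda>i. R `` {Mid i}) ` {1..n}"]) auto
  show ?thesis
  proof (cases "fits (compose_diagrams n d1 d2) A B")
    case False
    have "\<not> valid G" for G
      using False outer_colour[of _ G] unfolding compose valid_def by metis
    then show ?thesis using False by (simp add: valid)
  next
    case True
    define forced where "forced x \<longleftrightarrow> (\<exists>z\<in>outer_dots n. (x, z) \<in> R \<and> colour A {} B z)" for x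
    define ext where "ext S = {i \<in> {1..n}. forced (Mid i) \<or> R `` {Mid i} \<in> S}" for S
    define chosen where "chosen G = {C \<in> Loops. \<exists>i\<in>G. Mid i \<in> C}" for G
    have forced_outer: "forced x \<longleftrightarrow> colour A {} B x" if "x \<in> outer_dots n" for x
      using that True R(1) unfolding forced_def compose by blast
    have not_loop: "R `` {x} \<notin> Loops" if "z \<in> outer_dots n" "(x, z) \<in> R" for x z
      using that unfolding Loops_def outer_dots_def by auto
    have loop: "R `` {Mid i} \<in> Loops" if "i \<in> {1..n}" "\<forall>z\<in>outer_dots n. (Mid i, z) \<notin> R" for i
      using that range unfolding Loops_def by blast
    have valid_ext: "valid (ext S)" if S: "S \<subseteq> Loops" for S
    proof -
      have h: "colour A (ext S) B x \<longleftrightarrow> forced x \<or> R `` {x} \<in> S"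
        if "x \<in> outer_dots n \<union> Mid ` {1..n}" for x
      proof (cases "x \<in> outer_dots n")
        case True
        then show ?thesis using not_loop[OF True R(1)] S forced_outer[OF True] outer_colour[OF True] by blast
      next
        case False
        then show ?thesis using that by (auto simp: ext_def)
      qed
      show ?thesis unfolding valid_def
      proof (intro allI impI)
        fix x y assume xy: "(x, y) \<in> R"
        have "forced x \<longleftrightarrow> forced y" using xy R unfolding forced_def by blast
        then show "colour A (ext S) B x = colour A (ext S) B y"
          using range[OF xy] h[of x] h[of y] R_class[OF xy] by metis
      qed
    qed
    have "bij_betw ext (Pow Loops) {G \<in> Pow {1..n}. valid G}"
    proof (rule bij_betw_byWitness[where f' = chosen])
      show "\<forall>S\<in>Pow Loops. chosen (ext S) = S"
      proof
        fix S assume S: "S \<in> Pow Loops"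
        show "chosen (ext S) = S"
        proof (intro set_eqI iffI)
          fix C assume "C \<in> chosen (ext S)"
          then obtain i where i: "C \<in> Loops" "i \<in> ext S" "Mid i \<in> C" by (auto simp: chosen_def)
          then have C: "C = R `` {Mid i}" unfolding Loops_def using R_class by blast
          then have "\<not> forced (Mid i)" using i(1) not_loop unfolding forced_def by blast
          then show "C \<in> S" using i(2) C by (simp add: ext_def)
        next
          fix C assume C: "C \<in> S"
          then obtain i where "i \<in> {1..n}" "C = R `` {Mid i}" "C \<in> Loops"
            using S unfolding Loops_def by blast
          then show "C \<in> chosen (ext S)" using C R(1) unfolding chosen_def ext_def by blast
        qed
      qed
      show "\<forall>G\<in>{G \<in> Pow {1..n}. valid G}. ext (chosen G) = G"
      proof
        fix G assume "G \<in> {G \<in> Pow {1..n}. valid G}"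
        then have G: "G \<subseteq> {1..n}" and v: "valid G" by auto
        have "i \<in> ext (chosen G) \<longleftrightarrow> i \<in> G" if i: "i \<in> {1..n}" for i
        proof (cases "\<exists>z\<in>outer_dots n. (Mid i, z) \<in> R")
          case True
          then obtain z where z: "z \<in> outer_dots n" "(Mid i, z) \<in> R" by blast
          have "colour A G B (Mid i) = colour A G B z" using v z(2) unfolding valid_def by blast
          then have "i \<in> G \<longleftrightarrow> colour A {} B z" using outer_colour[OF z(1)] by simp
          also have "\<dots> \<longleftrightarrow> forced (Mid i)"
            using z R forced_outer[OF z(1)] unfolding forced_def by blast
          finally show ?thesis
            using i not_loop[OF z] by (auto simp: ext_def chosen_def)
        next
          case False
          then have nf: "\<not> forced (Mid i)" by (auto simp: forced_def)
          have "i \<in> G" if "j \<in> G" "(Mid i, Mid j) \<in> R" for j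
            using v that unfolding valid_def by (metis colour.simps(2))
          then show ?thesis using i nf loop[OF i] False R(1) unfolding ext_def chosen_def by blast
        qed
        then show "ext (chosen G) = G" using G unfolding ext_def by blast
      qed
      show "ext ` Pow Loops \<subseteq> {G \<in> Pow {1..n}. valid G}"
        using valid_ext by (auto simp: ext_def)
      show "chosen ` {G \<in> Pow {1..n}. valid G} \<subseteq> Pow Loops"
        by (auto simp: chosen_def)
    qed
    then have "card {G \<in> Pow {1..n}. valid G} = 2 ^ card Loops"
      using fin by (metis bij_betw_same_card card_Pow)
    moreover have "card Loops = num_loops n d1 d2"
      by (simp add: Loops_def num_loops_def R_def)
    ultimately show ?thesis using True by (simp add: valid)
  qed
qed

text \<open>
  This is the action of a diagram on the tensor power of a two-dimensional space, with the subsets of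
  \<open>{1..n}\<close> as the standard basis.
\<close>

definition transfer_op :: "nat \<Rightarrow> diagram \<Rightarrow> (nat set \<Rightarrow> nat) \<Rightarrow> nat set \<Rightarrow> nat" where
  "transfer_op n d \<phi> A = (\<Sum>G\<in>Pow {1..n}. if fits d A G then \<phi> G else 0)"

lemma transfer_op_compose:
  assumes d: "is_diagram n d1" "is_diagram n d2"
  shows "transfer_op n d1 (transfer_op n d2 \<phi>) A =
    2 ^ num_loops n d1 d2 * transfer_op n (compose_diagrams n d1 d2) \<phi> A"
proof -
  have "transfer_op n d1 (transfer_op n d2 \<phi>) A =
      (\<Sum>G\<in>Pow {1..n}. \<Sum>B\<in>Pow {1..n}. if fits d1 A G \<and> fits d2 G B then \<phi> B else 0)"
    unfolding transfer_op_def by (intro sum.cong) auto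
  also have "\<dots> = (\<Sum>B\<in>Pow {1..n}. \<Sum>G\<in>Pow {1..n}. if fits d1 A G \<and> fits d2 G B then \<phi> B else 0)"
    by (rule sum.swap)
  also have "\<dots> = (\<Sum>B\<in>Pow {1..n}. card {G \<in> Pow {1..n}. fits d1 A G \<and> fits d2 G B} * \<phi> B)"
    by (intro sum.cong refl) (simp add: sum.If_cases Int_def conj_commute del: Pow_iff flip: sum.inter_filter)
  also have "\<dots> = (\<Sum>B\<in>Pow {1..n}.
      2 ^ num_loops n d1 d2 * (if fits (compose_diagrams n d1 d2) A B then \<phi> B else 0))"
    unfolding card_middle_colourings[OF d] by (intro sum.cong refl) (simp split: if_split)
  finally show ?thesis by (simp add: transfer_op_def sum_distrib_left)
qed

lemma colour_empty [simp]: "\<not> colour {} {} {} z"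
  by (cases z) auto

lemma fits_empty [simp]: "fits d {} {}"
  by (simp add: fits_def)

text \<open>
  The colouring that singles out the two ends of one edge fits a diagram only if it contains this edge.
\<close>

lemma fits_determines_subset:
  assumes d: "is_diagram n d" "is_diagram n d'"
    and eq: "\<And>A B. A \<subseteq> {1..n} \<Longrightarrow> B \<subseteq> {1..n} \<Longrightarrow> fits d A B \<Longrightarrow> fits d' A B"
  shows "d \<subseteq> d'"
proof
  fix e assume e: "e \<in> d"
  then obtain x y where xy: "e = {x, y}" using diagram_edge_form[OF d(1)] by blast
  then have outer: "x \<in> outer_dots n" "y \<in> outer_dots n" using diagram_edge_outer[OF d(1)] e by auto
  define A where "A = {i \<in> {1..n}. Top i \<in> e}"
  define B where "B = {i \<in> {1..n}. Bot i \<in> e}"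
  have AB: "colour A {} B z \<longleftrightarrow> z \<in> e" if "z \<in> outer_dots n" for z
    using that by (auto simp: A_def B_def outer_dots_def)
  have "fits d A B"
    unfolding fits_def
  proof (intro allI impI)
    fix p q assume pq: "{p, q} \<in> d"
    have M: "matching (outer_dots n) d" using d(1) by (simp add: is_diagram_matching)
    have "{p, q} = e" if "r \<in> {p, q}" "r \<in> e" for r
    proof -
      have "\<exists>!e. e \<in> d \<and> r \<in> e" using that(1) matching_subset[OF M pq] by (intro matching_ex1[OF M]) auto
      then show ?thesis using pq e that by (elim ex1E) blast
    qed
    then have "p \<in> e \<longleftrightarrow> q \<in> e" by blast
    then show "colour A {} B p = colour A {} B q"
      using diagram_edge_outer[OF d(1) pq] AB by blast
  qed
  then have fd': "fits d' A B" by (intro eq) (auto simp: A_def B_def)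
  obtain z where z: "{x, z} \<in> d'"
    using matching_has_edge[OF d(2)[unfolded is_diagram_matching] outer(1)] by blast
  then have "z \<in> e" using fd' AB outer xy diagram_edge_outer[OF d(2) z] unfolding fits_def by blast
  moreover have "z \<noteq> x" using matching_edge_distinct[OF d(2)[unfolded is_diagram_matching] z] by simp
  ultimately show "e \<in> d'" using z xy by auto
qed

lemma transfer_op_single:
  assumes "B \<subseteq> {1..n}"
  shows "transfer_op n d (\<lambda>G. if G = B then 1 else 0) A = (if fits d A B then 1 else 0)"
proof -
  have "transfer_op n d (\<lambda>G. if G = B then 1 else 0) A =
      (\<Sum>G\<in>Pow {1..n}. if G = B then (if fits d A B then 1 else 0) else 0)"
    unfolding transfer_op_def by (intro sum.cong) auto
  then show ?thesis using assms by simp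
qed

text \<open>
  The empty colouring fits every diagram, so the matrix entry there isolates the power of two.
\<close>

lemma transfer_op_determines:
  assumes d: "is_diagram n d" "is_diagram n d'"
    and eq: "\<And>\<phi> A. A \<subseteq> {1..n} \<Longrightarrow> 2 ^ k * transfer_op n d \<phi> A = 2 ^ l * transfer_op n d' \<phi> A"
  shows "d = d'" "k = l"
proof -
  have *: "2 ^ k * (if fits d A B then 1 else 0) = 2 ^ l * (if fits d' A B then 1 else (0::nat))"
    if "A \<subseteq> {1..n}" "B \<subseteq> {1..n}" for A B
    using eq[OF that(1), of "\<lambda>G. if G = B then 1 else 0"] by (simp only: transfer_op_single[OF that(2)])
  have "(2::nat) ^ k = 2 ^ l" using *[of "{}" "{}"] d by simp
  then show "k = l" by simp
  have "fits d A B \<longleftrightarrow> fits d' A B" if "A \<subseteq> {1..n}" "B \<subseteq> {1..n}" for A B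
    using *[OF that] by (auto split: if_splits)
  then show "d = d'" using fits_determines_subset[OF d] fits_determines_subset[OF d(2,1)] by blast
qed

lemma compose_eqI:
  assumes "is_diagram n d1" "is_diagram n d2" "is_diagram n d3" 
    and "\<And>\<phi> A. A \<subseteq> {1..n} \<Longrightarrow> transfer_op n d1 (transfer_op n d2 \<phi>) A = 2 ^ k * transfer_op n d3 \<phi> A"
  shows "compose_diagrams n d1 d2 = d3" "num_loops n d1 d2 = k"
proof -
  have *: "2 ^ num_loops n d1 d2 * transfer_op n (compose_diagrams n d1 d2) \<phi> A = 2 ^ k * transfer_op n d3 \<phi> A"
    if "A \<subseteq> {1..n}" for \<phi> A
    using assms(4)[OF that] transfer_op_compose[OF assms(1,2)] by metis
  show "compose_diagrams n d1 d2 = d3" "num_loops n d1 d2 = k"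
    using transfer_op_determines[OF compose_is_diagram[OF assms(1,2)] assms(3) *] by auto
qed

lemma compose_eq_composeI:
  assumes "is_diagram n d1" "is_diagram n d2" "is_diagram n d3" "is_diagram n d4"
    and eq: "\<And>\<phi> A. A \<subseteq> {1..n} \<Longrightarrow>
      transfer_op n d1 (transfer_op n d2 \<phi>) A = transfer_op n d3 (transfer_op n d4 \<phi>) A"
  shows "compose_diagrams n d1 d2 = compose_diagrams n d3 d4" "num_loops n d1 d2 = num_loops n d3 d4"
proof -
  have *: "2 ^ num_loops n d1 d2 * transfer_op n (compose_diagrams n d1 d2) \<phi> A =
      2 ^ num_loops n d3 d4 * transfer_op n (compose_diagrams n d3 d4) \<phi> A"
    if "A \<subseteq> {1..n}" for \<phi> A
    using eq[OF that] transfer_op_compose assms(1-4) by metis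
  show "compose_diagrams n d1 d2 = compose_diagrams n d3 d4" "num_loops n d1 d2 = num_loops n d3 d4"
    using transfer_op_determines[OF compose_is_diagram[OF assms(1,2)] compose_is_diagram[OF assms(3,4)] *]
    by auto
qed

lemma compose_assoc:
  assumes "is_diagram n d1" "is_diagram n d2" "is_diagram n d3"
  shows "compose_diagrams n (compose_diagrams n d1 d2) d3 = compose_diagrams n d1 (compose_diagrams n d2 d3)"
    and "num_loops n d1 d2 + num_loops n (compose_diagrams n d1 d2) d3 =
         num_loops n d2 d3 + num_loops n d1 (compose_diagrams n d2 d3)"
proof -
  note c = compose_is_diagram
  have scale: "transfer_op n d (\<lambda>G. c * \<phi> G) A = c * transfer_op n d \<phi> A" for d c \<phi> A
    by (simp add: transfer_op_def sum_distrib_left if_distrib cong: if_cong)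
  have *: "2 ^ (num_loops n d1 d2 + num_loops n (compose_diagrams n d1 d2) d3) *
        transfer_op n (compose_diagrams n (compose_diagrams n d1 d2) d3) \<phi> A =
      2 ^ (num_loops n d2 d3 + num_loops n d1 (compose_diagrams n d2 d3)) *
        transfer_op n (compose_diagrams n d1 (compose_diagrams n d2 d3)) \<phi> A" for \<phi> A
  proof -
    have "transfer_op n d1 (transfer_op n d2 (transfer_op n d3 \<phi>)) A =
        2 ^ num_loops n d1 d2 * transfer_op n (compose_diagrams n d1 d2) (transfer_op n d3 \<phi>) A"
      by (rule transfer_op_compose[OF assms(1,2)])
    moreover have "transfer_op n d2 (transfer_op n d3 \<phi>) =
        (\<lambda>A. 2 ^ num_loops n d2 d3 * transfer_op n (compose_diagrams n d2 d3) \<phi> A)"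
      by (intro ext transfer_op_compose assms)
    ultimately show ?thesis
      by (simp add: transfer_op_compose c assms scale power_add)
  qed
  show "compose_diagrams n (compose_diagrams n d1 d2) d3 = compose_diagrams n d1 (compose_diagrams n d2 d3)"
    "num_loops n d1 d2 + num_loops n (compose_diagrams n d1 d2) d3 =
     num_loops n d2 d3 + num_loops n d1 (compose_diagrams n d2 d3)"
    using transfer_op_determines[OF _ _ *] c assms by blast+
qed

section \<open>Diagrams of the generators\<close>

definition swap_diagram :: "nat \<Rightarrow> nat \<Rightarrow> nat \<Rightarrow> diagram" where
  "swap_diagram n i j =
     {{Top i, Bot j}, {Top j, Bot i}} \<union> {{Top k, Bot k} | k. k \<in> {1..n} - {i, j}}"

definition cap_diagram :: "nat \<Rightarrow> nat \<Rightarrow> nat \<Rightarrow> diagram" where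
  "cap_diagram n i j =
     {{Top i, Top j}, {Bot i, Bot j}} \<union> {{Top k, Bot k} | k. k \<in> {1..n} - {i, j}}"

lemma s_elem_basis: "s_elem n i j = basis (swap_diagram n i j)"
  by (simp add: s_elem_def swap_diagram_def)

lemma eps_elem_basis: "eps_elem n i j = basis (cap_diagram n i j)"
  by (simp add: eps_elem_def cap_diagram_def)

lemma matching_of_involution:
  assumes p: "\<And>x. x \<in> V \<Longrightarrow> p x \<in> V" "\<And>x. x \<in> V \<Longrightarrow> p (p x) = x" "\<And>x. x \<in> V \<Longrightarrow> p x \<noteq> x"
  shows "matching V ((\<lambda>x. {x, p x}) ` V)"
  unfolding matching_def
proof (intro conjI ballI)
  fix e assume "e \<in> (\<lambda>x. {x, p x}) ` V"
  then obtain x where x: "x \<in> V" "e = {x, p x}" by (elim imageE)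
  then show "e \<subseteq> V" "card e = 2" using p(1)[OF x(1)] p(3)[OF x(1)] by auto
next
  fix x assume x: "x \<in> V"
  show "\<exists>!e. e \<in> (\<lambda>x. {x, p x}) ` V \<and> x \<in> e"
  proof (rule ex1I[of _ "{x, p x}"])
    fix e assume "e \<in> (\<lambda>x. {x, p x}) ` V \<and> x \<in> e"
    then obtain y where y: "y \<in> V" "e = {y, p y}" "x = y \<or> x = p y" by blast
    then show "e = {x, p x}" using p(2)[OF y(1)] by auto
  qed (use x in auto)
qed

lemma identity_is_diagram: "is_diagram n (identity_diagram n)"
proof -
  define p where "p x = (case x of Top k \<Rightarrow> Bot k | Bot k \<Rightarrow> Top k | Mid k \<Rightarrow> Mid k)" for x
  have eq: "identity_diagram n = (\<lambda>x. {x, p x}) ` outer_dots n"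
    by (auto simp: identity_diagram_def outer_dots_def p_def image_Un image_image insert_commute)
  show ?thesis unfolding is_diagram_matching eq
    by (rule matching_of_involution) (auto simp: outer_dots_def p_def)
qed

lemma swap_is_diagram:
  assumes "i \<in> {1..n}" "j \<in> {1..n}" "i \<noteq> j"
  shows "is_diagram n (swap_diagram n i j)"
proof -
  define t where "t k = (if k = i then j else if k = j then i else k)" for k
  define p where "p x = (case x of Top k \<Rightarrow> Bot (t k) | Bot k \<Rightarrow> Top (t k) | Mid k \<Rightarrow> Mid k)" for x
  have eq: "swap_diagram n i j = (\<lambda>x. {x, p x}) ` outer_dots n"
  proof (intro equalityI subsetI)
    fix e assume "e \<in> swap_diagram n i j"
    then consider "e = {Top i, p (Top i)}" | "e = {Top j, p (Top j)}"
      | k where "k \<in> {1..n}" "e = {Top k, p (Top k)}"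
      unfolding swap_diagram_def using assms(3) by (fastforce simp: p_def t_def)
    then show "e \<in> (\<lambda>x. {x, p x}) ` outer_dots n"
      using assms by cases (auto simp: outer_dots_def)
  next
    fix e assume "e \<in> (\<lambda>x. {x, p x}) ` outer_dots n"
    then obtain k where "k \<in> {1..n}" "e = {Top k, Bot (t k)} \<or> e = {Bot k, Top (t k)}"
      by (auto simp: outer_dots_def p_def)
    then show "e \<in> swap_diagram n i j"
      by (cases "k = i"; cases "k = j") (auto simp: swap_diagram_def t_def insert_commute)
  qed
  show ?thesis unfolding is_diagram_matching eq
    by (rule matching_of_involution) (use assms in \<open>auto simp: outer_dots_def p_def t_def\<close>)
qed

lemma cap_is_diagram:
  assumes "i \<in> {1..n}" "j \<in> {1..n}" "i \<noteq> j"
  shows "is_diagram n (cap_diagram n i j)"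
proof -
  define p where "p x = (case x of
      Top k \<Rightarrow> if k = i then Top j else if k = j then Top i else Bot k
    | Bot k \<Rightarrow> if k = i then Bot j else if k = j then Bot i else Top k | Mid k \<Rightarrow> Mid k)" for x
  have eq: "cap_diagram n i j = (\<lambda>x. {x, p x}) ` outer_dots n"
  proof (intro equalityI subsetI)
    fix e assume "e \<in> cap_diagram n i j"
    then consider "e = {Top i, p (Top i)}" | "e = {Bot i, p (Bot i)}"
      | k where "k \<in> {1..n}" "e = {Top k, p (Top k)}"
      unfolding cap_diagram_def using assms(3) by (fastforce simp: p_def)
    then show "e \<in> (\<lambda>x. {x, p x}) ` outer_dots n"
      using assms by cases (auto simp: outer_dots_def)
  next
    fix e assume "e \<in> (\<lambda>x. {x, p x}) ` outer_dots n"
    then obtain k where "k \<in> {1..n}" "e = {Top k, p (Top k)} \<or> e = {Bot k, p (Bot k)}"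
      by (auto simp: outer_dots_def)
    then show "e \<in> cap_diagram n i j"
      by (cases "k = i"; cases "k = j") (auto simp: cap_diagram_def p_def insert_commute)
  qed
  show ?thesis unfolding is_diagram_matching eq
    by (rule matching_of_involution) (use assms in \<open>auto simp: outer_dots_def p_def split: if_splits\<close>)
qed

lemma fits_insert: "fits (insert {x, y} d) A B \<longleftrightarrow> colour A {} B x = colour A {} B y \<and> fits d A B"
  unfolding fits_def insert_iff doubleton_eq_iff by metis

lemma fits_vertical: "fits {{Top k, Bot k} | k. k \<in> K} A B \<longleftrightarrow> (\<forall>k\<in>K. k \<in> A \<longleftrightarrow> k \<in> B)"
proof -
  have *: "{x, y} \<in> {{Top k, Bot k} | k. k \<in> K} \<longleftrightarrow>
      (\<exists>k\<in>K. x = Top k \<and> y = Bot k \<or> x = Bot k \<and> y = Top k)" for x y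
    by (auto simp: doubleton_eq_iff)
  show ?thesis unfolding fits_def * by (metis colour.simps(1,3))
qed

lemma fits_swap: "fits (swap_diagram n i j) A B \<longleftrightarrow>
    (i \<in> A \<longleftrightarrow> j \<in> B) \<and> (j \<in> A \<longleftrightarrow> i \<in> B) \<and> (\<forall>k\<in>{1..n} - {i, j}. k \<in> A \<longleftrightarrow> k \<in> B)"
  unfolding swap_diagram_def insert_is_Un[symmetric] Un_insert_left Un_empty_left fits_insert fits_vertical
  by simp

lemma fits_cap: "fits (cap_diagram n i j) A B \<longleftrightarrow>
    (i \<in> A \<longleftrightarrow> j \<in> A) \<and> (i \<in> B \<longleftrightarrow> j \<in> B) \<and> (\<forall>k\<in>{1..n} - {i, j}. k \<in> A \<longleftrightarrow> k \<in> B)"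
  unfolding cap_diagram_def Un_insert_left Un_empty_left fits_insert fits_vertical
  by simp

lemma transfer_op_sum: "transfer_op n d \<phi> A = (\<Sum>G | G \<subseteq> {1..n} \<and> fits d A G. \<phi> G)"
  unfolding transfer_op_def by (simp add: sum.inter_filter flip: Pow_iff)

definition swap_set :: "'a \<Rightarrow> 'a \<Rightarrow> 'a set \<Rightarrow> 'a set" where
  "swap_set i j A = {k. (if k = i then j else if k = j then i else k) \<in> A}"

lemma swap_set_subset: "i \<in> {1..n} \<Longrightarrow> j \<in> {1..n} \<Longrightarrow> A \<subseteq> {1..n} \<Longrightarrow> swap_set i j A \<subseteq> {1..n}"
  by (auto simp: swap_set_def split: if_splits)

lemma transfer_identity:
  assumes "A \<subseteq> {1..n}" shows "transfer_op n (identity_diagram n) \<phi> A = \<phi> A"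
proof -
  have "{G. G \<subseteq> {1..n} \<and> fits (identity_diagram n) A G} = {A}"
    using assms unfolding identity_diagram_def fits_vertical by auto
  then show ?thesis by (simp add: transfer_op_sum)
qed

lemma transfer_swap:
  assumes "i \<in> {1..n}" "j \<in> {1..n}" "A \<subseteq> {1..n}"
  shows "transfer_op n (swap_diagram n i j) \<phi> A = \<phi> (swap_set i j A)"
proof -
  have "G = swap_set i j A" if "G \<subseteq> {1..n}" "fits (swap_diagram n i j) A G" for G
    using that assms(3) unfolding fits_swap swap_set_def by (auto split: if_splits)
  moreover have "fits (swap_diagram n i j) A (swap_set i j A)"
    unfolding fits_swap swap_set_def by auto
  ultimately have "{G. G \<subseteq> {1..n} \<and> fits (swap_diagram n i j) A G} = {swap_set i j A}"
    using swap_set_subset[OF assms] by blast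
  then show ?thesis by (simp add: transfer_op_sum)
qed

lemma transfer_cap:
  assumes "i \<in> {1..n}" "j \<in> {1..n}" "A \<subseteq> {1..n}"
  shows "transfer_op n (cap_diagram n i j) \<phi> A =
    (if i \<in> A \<longleftrightarrow> j \<in> A then \<phi> (A - {i, j}) + \<phi> (A \<union> {i, j}) else 0)"
proof (cases "i \<in> A \<longleftrightarrow> j \<in> A")
  case True
  have "G = A - {i, j} \<or> G = A \<union> {i, j}" if "G \<subseteq> {1..n}" "fits (cap_diagram n i j) A G" for G
  proof (cases "i \<in> G")
    case True
    then have "G = A \<union> {i, j}" using that assms unfolding fits_cap by auto
    then show ?thesis ..
  next
    case False
    then have "G = A - {i, j}" using that assms unfolding fits_cap by auto
    then show ?thesis ..
  qed
  moreover have "fits (cap_diagram n i j) A (A - {i, j})" "fits (cap_diagram n i j) A (A \<union> {i, j})"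
    unfolding fits_cap using True by auto
  ultimately have "{G. G \<subseteq> {1..n} \<and> fits (cap_diagram n i j) A G} = {A - {i, j}, A \<union> {i, j}}"
    using assms by blast
  moreover have "A - {i, j} \<noteq> A \<union> {i, j}" by blast
  ultimately show ?thesis using True by (simp only: transfer_op_sum) simp
next
  case False
  then show ?thesis by (simp add: transfer_op_sum fits_cap)
qed

lemma swap_diagram_commute: "swap_diagram n i j = swap_diagram n j i"
  by (auto simp: swap_diagram_def)

lemma cap_diagram_commute: "cap_diagram n i j = cap_diagram n j i"
  by (auto simp: cap_diagram_def insert_commute)

section \<open>The Brauer algebra as an associative algebra\<close>

lemma finite_diagrams [simp]: "finite (diagrams n)"
proof (rule finite_subset)
  show "diagrams n \<subseteq> Pow (Pow (outer_dots n))"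
    unfolding diagrams_def is_diagram_matching using matching_subset by blast
qed simp

lemma diagrams_iff [simp]: "d \<in> diagrams n \<longleftrightarrow> is_diagram n d"
  by (simp add: diagrams_def)

text \<open>
  Coefficient functions of elements of the algebra; the type also contains functions with values at sets
  that are not diagrams.
\<close>

definition supported :: "nat \<Rightarrow> 'k::comm_ring_1 brauer \<Rightarrow> bool" where
  "supported n a \<longleftrightarrow> (\<forall>d. \<not> is_diagram n d \<longrightarrow> a d = 0)"

definition structure_const :: "nat \<Rightarrow> 'k::comm_ring_1 \<Rightarrow> diagram \<Rightarrow> diagram \<Rightarrow> diagram \<Rightarrow> 'k" where
  "structure_const n \<delta> d1 d2 d = (if d = compose_diagrams n d1 d2 then \<delta> ^ num_loops n d1 d2 else 0)"

lemma bmult_structure_const: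
  "bmult n \<delta> a b d = (\<Sum>d1\<in>diagrams n. \<Sum>d2\<in>diagrams n. a d1 * b d2 * structure_const n \<delta> d1 d2 d)"
  unfolding bmult_def structure_const_def basis_def by (intro sum.cong refl) simp

lemma structure_const_assoc:
  assumes "is_diagram n d1" "is_diagram n d2" "is_diagram n d3"
  shows "(\<Sum>e\<in>diagrams n. structure_const n \<delta> d1 d2 e * structure_const n \<delta> e d3 d) =
    (\<Sum>e\<in>diagrams n. structure_const n \<delta> d2 d3 e * structure_const n \<delta> d1 e d)"
proof -
  have "(\<Sum>e\<in>diagrams n. structure_const n \<delta> d1 d2 e * structure_const n \<delta> e d3 d) =
      (\<Sum>e\<in>diagrams n. if e = compose_diagrams n d1 d2
        then \<delta> ^ num_loops n d1 d2 * structure_const n \<delta> e d3 d else 0)"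
    by (intro sum.cong refl) (simp add: structure_const_def)
  moreover have "(\<Sum>e\<in>diagrams n. structure_const n \<delta> d2 d3 e * structure_const n \<delta> d1 e d) =
      (\<Sum>e\<in>diagrams n. if e = compose_diagrams n d2 d3
        then \<delta> ^ num_loops n d2 d3 * structure_const n \<delta> d1 e d else 0)"
    by (intro sum.cong refl) (simp add: structure_const_def)
  ultimately show ?thesis
    using compose_is_diagram[OF assms(1,2)] compose_is_diagram[OF assms(2,3)] compose_assoc[OF assms]
    by (simp add: structure_const_def flip: power_add)
qed

lemma sum_rotate:
  "(\<Sum>w\<in>A. \<Sum>x\<in>B. \<Sum>y\<in>C. \<Sum>z\<in>D. F w x y z) = (\<Sum>x\<in>B. \<Sum>y\<in>C. \<Sum>z\<in>D. \<Sum>w\<in>A. F w x y z)"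
  by (subst sum.swap, rule sum.cong[OF refl], subst sum.swap, rule sum.cong[OF refl], rule sum.swap)

lemma bmult_assoc:
  "bmult n \<delta> (bmult n \<delta> a b) c = bmult n \<delta> a (bmult n \<delta> b c)"
proof
  fix d
  let ?D = "diagrams n" and ?s = "structure_const n \<delta>"
  have "bmult n \<delta> (bmult n \<delta> a b) c d = (\<Sum>e\<in>?D. \<Sum>d3\<in>?D. \<Sum>d1\<in>?D. \<Sum>d2\<in>?D.
      a d1 * b d2 * c d3 * (?s d1 d2 e * ?s e d3 d))"
    by (simp add: bmult_structure_const sum_distrib_left sum_distrib_right mult_ac)
  also have "\<dots> = (\<Sum>d3\<in>?D. \<Sum>d1\<in>?D. \<Sum>d2\<in>?D. \<Sum>e\<in>?D.
      a d1 * b d2 * c d3 * (?s d1 d2 e * ?s e d3 d))"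
    by (rule sum_rotate)
  also have "\<dots> = (\<Sum>d3\<in>?D. \<Sum>d1\<in>?D. \<Sum>d2\<in>?D. a d1 * b d2 * c d3 * (\<Sum>e\<in>?D. ?s d1 d2 e * ?s e d3 d))"
    by (simp add: sum_distrib_left)
  also have "\<dots> = (\<Sum>d3\<in>?D. \<Sum>d1\<in>?D. \<Sum>d2\<in>?D. a d1 * b d2 * c d3 * (\<Sum>e\<in>?D. ?s d2 d3 e * ?s d1 e d))"
    by (intro sum.cong refl) (simp add: structure_const_assoc)
  also have "\<dots> = (\<Sum>d3\<in>?D. \<Sum>d1\<in>?D. \<Sum>d2\<in>?D. \<Sum>e\<in>?D. a d1 * b d2 * c d3 * (?s d2 d3 e * ?s d1 e d))"
    by (simp add: sum_distrib_left)
  also have "\<dots> = (\<Sum>d1\<in>?D. \<Sum>d2\<in>?D. \<Sum>e\<in>?D. \<Sum>d3\<in>?D. a d1 * b d2 * c d3 * (?s d2 d3 e * ?s d1 e d))"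
    by (rule sum_rotate)
  also have "\<dots> = (\<Sum>d1\<in>?D. \<Sum>e\<in>?D. \<Sum>d2\<in>?D. \<Sum>d3\<in>?D. a d1 * b d2 * c d3 * (?s d2 d3 e * ?s d1 e d))"
    by (rule sum.cong[OF refl], rule sum.swap)
  also have "\<dots> = bmult n \<delta> a (bmult n \<delta> b c) d"
    by (simp add: bmult_structure_const sum_distrib_left sum_distrib_right mult_ac)
  finally show "bmult n \<delta> (bmult n \<delta> a b) c d = bmult n \<delta> a (bmult n \<delta> b c) d" .
qed

lemma bmult_basis:
  assumes "is_diagram n d1" "is_diagram n d2"
  shows "bmult n \<delta> (basis d1) (basis d2) = bscale (\<delta> ^ num_loops n d1 d2) (basis (compose_diagrams n d1 d2))"
proof
  fix d
  have "bmult n \<delta> (basis d1) (basis d2) d = (\<Sum>e1\<in>diagrams n. \<Sum>e2\<in>diagrams n.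
      if e1 = d1 then (if e2 = d2 then structure_const n \<delta> d1 d2 d else 0) else 0)"
    unfolding bmult_structure_const by (intro sum.cong refl) (simp add: basis_def)
  also have "\<dots> = (\<Sum>e1\<in>diagrams n. if e1 = d1 then
      (\<Sum>e2\<in>diagrams n. if e2 = d2 then structure_const n \<delta> d1 d2 d else 0) else 0)"
    by (rule sum.cong) auto
  finally show "bmult n \<delta> (basis d1) (basis d2) d =
      bscale (\<delta> ^ num_loops n d1 d2) (basis (compose_diagrams n d1 d2)) d"
    using assms by (simp add: structure_const_def bscale_def basis_def)
qed

lemma bmult_supported: "supported n (bmult n \<delta> a b)"
  unfolding supported_def bmult_structure_const structure_const_def
  using compose_is_diagram by (fastforce intro!: sum.neutral)

lemma compose_identity:
  assumes "is_diagram n d"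
  shows "compose_diagrams n (identity_diagram n) d = d" "num_loops n (identity_diagram n) d = 0"
    "compose_diagrams n d (identity_diagram n) = d" "num_loops n d (identity_diagram n) = 0"
proof -
  have l: "transfer_op n (identity_diagram n) (transfer_op n d \<phi>) A = 2 ^ 0 * transfer_op n d \<phi> A"
    if "A \<subseteq> {1..n}" for \<phi> A using transfer_identity[OF that] by simp
  have r: "transfer_op n d (transfer_op n (identity_diagram n) \<phi>) A = 2 ^ 0 * transfer_op n d \<phi> A"
    if "A \<subseteq> {1..n}" for \<phi> A
    unfolding transfer_op_sum[of n d] by (simp add: transfer_identity)
  show "compose_diagrams n (identity_diagram n) d = d" "num_loops n (identity_diagram n) d = 0"
    using compose_eqI[OF identity_is_diagram assms assms l] by auto
  show "compose_diagrams n d (identity_diagram n) = d" "num_loops n d (identity_diagram n) = 0"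
    using compose_eqI[OF assms identity_is_diagram assms r] by auto
qed

lemma structure_const_identity:
  assumes "is_diagram n e"
  shows "structure_const n \<delta> (identity_diagram n) e d = (if d = e then 1 else 0)"
    "structure_const n \<delta> e (identity_diagram n) d = (if d = e then 1 else 0)"
  using compose_identity[OF assms] by (simp_all add: structure_const_def)

lemma bmult_bone_left:
  "bmult n \<delta> (bone n) a = (\<lambda>d. if is_diagram n d then a d else 0)"
proof
  fix d
  have "bmult n \<delta> (bone n) a d = (\<Sum>e2\<in>diagrams n. \<Sum>e1\<in>diagrams n.
      if e1 = identity_diagram n then a e2 * structure_const n \<delta> e1 e2 d else 0)"
    unfolding bmult_structure_const
    by (subst sum.swap, intro sum.cong refl) (simp add: bone_def basis_def)
  also have "\<dots> = (\<Sum>e2\<in>diagrams n. if d = e2 then a e2 else 0)"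
    by (intro sum.cong refl) (simp add: identity_is_diagram structure_const_identity)
  finally show "bmult n \<delta> (bone n) a d = (if is_diagram n d then a d else 0)" by simp
qed

lemma bmult_bone_right:
  "bmult n \<delta> a (bone n) = (\<lambda>d. if is_diagram n d then a d else 0)"
proof
  fix d
  have "bmult n \<delta> a (bone n) d = (\<Sum>e1\<in>diagrams n. \<Sum>e2\<in>diagrams n.
      if e2 = identity_diagram n then a e1 * structure_const n \<delta> e1 e2 d else 0)"
    unfolding bmult_structure_const
    by (intro sum.cong refl) (simp add: bone_def basis_def)
  also have "\<dots> = (\<Sum>e1\<in>diagrams n. if d = e1 then a e1 else 0)"
    by (intro sum.cong refl) (simp add: identity_is_diagram structure_const_identity)
  finally show "bmult n \<delta> a (bone n) d = (if is_diagram n d then a d else 0)" by simp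
qed

lemma supported_bmult_bone:
  "supported n a \<Longrightarrow> bmult n \<delta> (bone n) a = a" "supported n a \<Longrightarrow> bmult n \<delta> a (bone n) = a"
  by (auto simp: bmult_bone_left bmult_bone_right supported_def)

lemma supported_basis: "is_diagram n d \<Longrightarrow> supported n (basis d)"
  by (auto simp: supported_def basis_def)

lemma supported_bone: "supported n (bone n)"
  unfolding bone_def by (rule supported_basis[OF identity_is_diagram])

lemma supported_linear:
  "supported n a \<Longrightarrow> supported n b \<Longrightarrow> supported n (bplus a b)"
  "supported n a \<Longrightarrow> supported n b \<Longrightarrow> supported n (bminus a b)"
  "supported n a \<Longrightarrow> supported n (bscale c a)"
  by (auto simp: supported_def bplus_def bminus_def bscale_def)

section \<open>Relations between the generators\<close>

lemma mem_swap_set [simp]: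
  "i \<in> swap_set i j A \<longleftrightarrow> j \<in> A" "j \<in> swap_set i j A \<longleftrightarrow> i \<in> A"
  "k \<noteq> i \<Longrightarrow> k \<noteq> j \<Longrightarrow> k \<in> swap_set i j A \<longleftrightarrow> k \<in> A"
  by (auto simp: swap_set_def)

lemma swap_set_id:
  assumes "i \<in> A \<longleftrightarrow> j \<in> A" shows "swap_set i j A = A"
proof (rule set_eqI)
  fix k show "k \<in> swap_set i j A \<longleftrightarrow> k \<in> A"
    using assms by (cases "k = i"; cases "k = j") simp_all
qed

lemma swap_set_swap_set [simp]: "swap_set i j (swap_set i j A) = A"
  by (auto simp: swap_set_def split: if_splits)

lemma swap_set_minus_plus:
  "swap_set i j (A - {i, j}) = A - {i, j}" "swap_set i j (A \<union> {i, j}) = A \<union> {i, j}"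
  by (auto simp: swap_set_def split: if_splits)

lemma swap_set_three:
  assumes "i \<noteq> j" "i \<noteq> k" "j \<noteq> k"
  shows "swap_set j k (swap_set i j A) = swap_set i j (swap_set i k A)"
    and "swap_set i j A - {j, k} = swap_set i j (A - {i, k})"
    and "swap_set i j A \<union> {j, k} = swap_set i j (A \<union> {i, k})"
  using assms by (auto simp: swap_set_def split: if_splits)

lemma swap_set_cap:
  assumes "i \<noteq> j" "i \<noteq> k" "j \<noteq> k" "i \<in> A \<longleftrightarrow> j \<in> A"
  shows "swap_set i k (A - {i, j}) = (if k \<in> A then A \<union> {i, j} - {j, k} else A - {i, j} - {j, k})"
    and "swap_set i k (A \<union> {i, j}) = (if k \<in> A then A \<union> {i, j} \<union> {j, k} else A - {i, j} \<union> {j, k})"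
    and "swap_set i k A - {j, k} = (if k \<in> A then A \<union> {i, j} - {j, k} else A - {i, j} - {j, k})"
    and "swap_set i k A \<union> {j, k} = (if k \<in> A then A \<union> {i, j} \<union> {j, k} else A - {i, j} \<union> {j, k})"
  using assms by (auto simp: swap_set_def split: if_splits)

lemma swap_set_disjoint:
  assumes "i \<noteq> k" "i \<noteq> l" "j \<noteq> k" "j \<noteq> l"
  shows "swap_set k l (swap_set i j A) = swap_set i j (swap_set k l A)"
    and "swap_set i j A - {k, l} = swap_set i j (A - {k, l})"
    and "swap_set i j A \<union> {k, l} = swap_set i j (A \<union> {k, l})"
  using assms by (auto simp: swap_set_def split: if_splits)

lemma pair_difference_disjoint:
  assumes "i \<noteq> k" "i \<noteq> l" "j \<noteq> k" "j \<noteq> l"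
  shows "A - {i, j} - {k, l} = A - {k, l} - {i, j}"
    "A \<union> {i, j} \<union> {k, l} = A \<union> {k, l} \<union> {i, j}"
    "A - {i, j} \<union> {k, l} = A \<union> {k, l} - {i, j}"
    "A \<union> {i, j} - {k, l} = A - {k, l} \<union> {i, j}"
    "k \<in> A - {i, j} \<longleftrightarrow> k \<in> A" "l \<in> A - {i, j} \<longleftrightarrow> l \<in> A"
    "k \<in> A \<union> {i, j} \<longleftrightarrow> k \<in> A" "l \<in> A \<union> {i, j} \<longleftrightarrow> l \<in> A"
    "i \<in> A - {k, l} \<longleftrightarrow> i \<in> A" "j \<in> A - {k, l} \<longleftrightarrow> j \<in> A"
    "i \<in> A \<union> {k, l} \<longleftrightarrow> i \<in> A" "j \<in> A \<union> {k, l} \<longleftrightarrow> j \<in> A"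
  using assms by auto

text \<open>
  Both sides of each relation are products of at most two diagrams up to a power of the
  parameter, so it suffices to compare the transfer operators.
\<close>

lemma generator_relations:
  assumes "i \<in> {1..n}" "j \<in> {1..n}" "i \<noteq> j"
  shows "bmult n \<delta> (s_elem n i j) (s_elem n i j) = bone n"
    and "bmult n \<delta> (eps_elem n i j) (eps_elem n i j) = bscale \<delta> (eps_elem n i j)"
    and "bmult n \<delta> (s_elem n i j) (eps_elem n i j) = eps_elem n i j"
    and "bmult n \<delta> (eps_elem n i j) (s_elem n i j) = eps_elem n i j"
proof -
  note sw = swap_is_diagram[OF assms] and cp = cap_is_diagram[OF assms]
  note tr = transfer_identity transfer_swap[OF assms(1,2)] transfer_cap[OF assms(1,2)]
    swap_set_subset[OF assms(1,2)]
  have ss: "transfer_op n (swap_diagram n i j) (transfer_op n (swap_diagram n i j) \<phi>) A =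
      2 ^ 0 * transfer_op n (identity_diagram n) \<phi> A" if "A \<subseteq> {1..n}" for \<phi> A
    by (simp only: tr that power_0 mult_1 swap_set_swap_set)
  have ee: "transfer_op n (cap_diagram n i j) (transfer_op n (cap_diagram n i j) \<phi>) A =
      2 ^ 1 * transfer_op n (cap_diagram n i j) \<phi> A" if "A \<subseteq> {1..n}" for \<phi> A
  proof -
    have "A - {i, j} \<subseteq> {1..n}" "A \<union> {i, j} \<subseteq> {1..n}" using that assms by auto
    moreover have "A - {i, j} \<union> {i, j} = A \<union> {i, j}" "A \<union> {i, j} \<union> {i, j} = A \<union> {i, j}"
      "A \<union> {i, j} - {i, j} = A - {i, j}" "A - {i, j} - {i, j} = A - {i, j}"
      "i \<in> A - {i, j} \<longleftrightarrow> False" "j \<in> A - {i, j} \<longleftrightarrow> False"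
      "i \<in> A \<union> {i, j} \<longleftrightarrow> True" "j \<in> A \<union> {i, j} \<longleftrightarrow> True"
      by blast+
    ultimately show ?thesis
      by (cases "i \<in> A \<longleftrightarrow> j \<in> A") (simp_all only: tr that simp_thms if_True if_False, simp_all)
  qed
  have se: "transfer_op n (swap_diagram n i j) (transfer_op n (cap_diagram n i j) \<phi>) A =
      2 ^ 0 * transfer_op n (cap_diagram n i j) \<phi> A" if "A \<subseteq> {1..n}" for \<phi> A
  proof (cases "i \<in> A \<longleftrightarrow> j \<in> A")
    case True
    show ?thesis by (simp only: tr that swap_set_id[OF True] power_0 mult_1)
  next
    case False
    then have "\<not> (j \<in> A \<longleftrightarrow> i \<in> A)" by blast
    with False show ?thesis by (simp only: tr that mem_swap_set if_False mult_0_right)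
  qed
  have es: "transfer_op n (cap_diagram n i j) (transfer_op n (swap_diagram n i j) \<phi>) A =
      2 ^ 0 * transfer_op n (cap_diagram n i j) \<phi> A" if "A \<subseteq> {1..n}" for \<phi> A
  proof -
    have "A - {i, j} \<subseteq> {1..n}" "A \<union> {i, j} \<subseteq> {1..n}" using that assms by auto
    then show ?thesis by (simp only: tr that swap_set_minus_plus power_0 mult_1)
  qed
  show "bmult n \<delta> (s_elem n i j) (s_elem n i j) = bone n"
    using compose_eqI[OF sw sw identity_is_diagram ss]
    by (simp add: s_elem_basis bmult_basis sw bone_def bscale_def)
  show "bmult n \<delta> (eps_elem n i j) (eps_elem n i j) = bscale \<delta> (eps_elem n i j)"
    using compose_eqI[OF cp cp cp ee]
    by (simp add: eps_elem_basis bmult_basis cp)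
  show "bmult n \<delta> (s_elem n i j) (eps_elem n i j) = eps_elem n i j"
    using compose_eqI[OF sw cp cp se]
    by (simp add: s_elem_basis eps_elem_basis bmult_basis sw cp bscale_def)
  show "bmult n \<delta> (eps_elem n i j) (s_elem n i j) = eps_elem n i j"
    using compose_eqI[OF cp sw cp es]
    by (simp add: s_elem_basis eps_elem_basis bmult_basis sw cp bscale_def)
qed

lemma bmult_basis_eqI:
  assumes "is_diagram n d1" "is_diagram n d2" "is_diagram n d3" "is_diagram n d4"
    and "\<And>\<phi> A. A \<subseteq> {1..n} \<Longrightarrow>
      transfer_op n d1 (transfer_op n d2 \<phi>) A = transfer_op n d3 (transfer_op n d4 \<phi>) A"
  shows "bmult n \<delta> (basis d1) (basis d2) = bmult n \<delta> (basis d3) (basis d4)"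
  using compose_eq_composeI[OF assms] by (simp add: bmult_basis assms)

lemma generator_relations_three:
  assumes ijk: "i \<in> {1..n}" "j \<in> {1..n}" "k \<in> {1..n}" "i \<noteq> j" "i \<noteq> k" "j \<noteq> k"
  shows "bmult n \<delta> (s_elem n i j) (s_elem n j k) = bmult n \<delta> (s_elem n i k) (s_elem n i j)"
    and "bmult n \<delta> (s_elem n i j) (eps_elem n j k) = bmult n \<delta> (eps_elem n i k) (s_elem n i j)"
    and "bmult n \<delta> (eps_elem n i j) (eps_elem n j k) = bmult n \<delta> (eps_elem n i j) (s_elem n i k)"
    and "bmult n \<delta> (eps_elem n i j) (eps_elem n j k) = bmult n \<delta> (s_elem n i k) (eps_elem n j k)"
proof -
  note sw = swap_is_diagram[OF ijk(1,2,4)] swap_is_diagram[OF ijk(1,3,5)] swap_is_diagram[OF ijk(2,3,6)]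
  note cp = cap_is_diagram[OF ijk(1,2,4)] cap_is_diagram[OF ijk(1,3,5)] cap_is_diagram[OF ijk(2,3,6)]
  note tr = transfer_swap[OF ijk(1,2)] transfer_swap[OF ijk(1,3)] transfer_swap[OF ijk(2,3)]
    transfer_cap[OF ijk(1,2)] transfer_cap[OF ijk(1,3)] transfer_cap[OF ijk(2,3)]
  have sub: "swap_set i j A \<subseteq> {1..n}" "swap_set i k A \<subseteq> {1..n}" "swap_set j k A \<subseteq> {1..n}"
    "A - {i, j} \<subseteq> {1..n}" "A \<union> {i, j} \<subseteq> {1..n}" "A - {i, k} \<subseteq> {1..n}" "A \<union> {i, k} \<subseteq> {1..n}"
    "A - {j, k} \<subseteq> {1..n}" "A \<union> {j, k} \<subseteq> {1..n}" if "A \<subseteq> {1..n}" for A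
    using that swap_set_subset[OF ijk(1,2) that] swap_set_subset[OF ijk(1,3) that]
      swap_set_subset[OF ijk(2,3) that] ijk(1-3) by auto
  note neq = ijk(4-6) ijk(4-6)[symmetric]
  show "bmult n \<delta> (s_elem n i j) (s_elem n j k) = bmult n \<delta> (s_elem n i k) (s_elem n i j)"
    unfolding s_elem_basis
  proof (rule bmult_basis_eqI[OF sw(1,3,2,1)])
    fix \<phi> A assume A: "A \<subseteq> {1..n}"
    show "transfer_op n (swap_diagram n i j) (transfer_op n (swap_diagram n j k) \<phi>) A =
      transfer_op n (swap_diagram n i k) (transfer_op n (swap_diagram n i j) \<phi>) A"
      by (simp only: tr sub A swap_set_three[OF ijk(4-6)])
  qed
  show "bmult n \<delta> (s_elem n i j) (eps_elem n j k) = bmult n \<delta> (eps_elem n i k) (s_elem n i j)"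
    unfolding s_elem_basis eps_elem_basis
  proof (rule bmult_basis_eqI[OF sw(1) cp(3,2) sw(1)])
    fix \<phi> A assume A: "A \<subseteq> {1..n}"
    show "transfer_op n (swap_diagram n i j) (transfer_op n (cap_diagram n j k) \<phi>) A =
      transfer_op n (cap_diagram n i k) (transfer_op n (swap_diagram n i j) \<phi>) A"
      by (simp only: tr sub A swap_set_three[OF ijk(4-6)] mem_swap_set neq simp_thms)
  qed
  show "bmult n \<delta> (eps_elem n i j) (eps_elem n j k) = bmult n \<delta> (eps_elem n i j) (s_elem n i k)"
    unfolding s_elem_basis eps_elem_basis
  proof (rule bmult_basis_eqI[OF cp(1,3,1) sw(2)])
    fix \<phi> A assume A: "A \<subseteq> {1..n}"
    have mem: "j \<in> A - {i, j} \<longleftrightarrow> False" "j \<in> A \<union> {i, j} \<longleftrightarrow> True"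
      "k \<in> A - {i, j} \<longleftrightarrow> k \<in> A" "k \<in> A \<union> {i, j} \<longleftrightarrow> k \<in> A"
      using neq(2,3) by blast+
    show "transfer_op n (cap_diagram n i j) (transfer_op n (cap_diagram n j k) \<phi>) A =
      transfer_op n (cap_diagram n i j) (transfer_op n (swap_diagram n i k) \<phi>) A"
    proof (cases "i \<in> A \<longleftrightarrow> j \<in> A")
      case True
      show ?thesis
        by (cases "k \<in> A") (simp_all only: tr sub A mem swap_set_cap[OF ijk(4-6) True] simp_thms if_True if_False add_0_right add_0_left)
    next
      case False
      then show ?thesis by (simp only: tr sub A if_False)
    qed
  qed
  show "bmult n \<delta> (eps_elem n i j) (eps_elem n j k) = bmult n \<delta> (s_elem n i k) (eps_elem n j k)"
    unfolding s_elem_basis eps_elem_basis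
  proof (rule bmult_basis_eqI[OF cp(1,3) sw(2) cp(3)])
    fix \<phi> A assume A: "A \<subseteq> {1..n}"
    have mem: "j \<in> A - {i, j} \<longleftrightarrow> False" "j \<in> A \<union> {i, j} \<longleftrightarrow> True"
      "k \<in> A - {i, j} \<longleftrightarrow> k \<in> A" "k \<in> A \<union> {i, j} \<longleftrightarrow> k \<in> A"
      using neq(2,3) by blast+
    show "transfer_op n (cap_diagram n i j) (transfer_op n (cap_diagram n j k) \<phi>) A =
      transfer_op n (swap_diagram n i k) (transfer_op n (cap_diagram n j k) \<phi>) A"
    proof (cases "i \<in> A \<longleftrightarrow> j \<in> A")
      case True
      then have True': "(j \<in> A \<longleftrightarrow> i \<in> A) = True" by blast
      show ?thesis
        by (cases "k \<in> A") (simp_all only: tr sub A mem mem_swap_set neq swap_set_cap[OF ijk(4-6) True]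
          True True' simp_thms if_True if_False add_0_right add_0_left)
    next
      case False
      then have "(j \<in> A \<longleftrightarrow> i \<in> A) = False" by blast
      with False show ?thesis by (simp only: tr sub A mem_swap_set neq simp_thms if_False)
    qed
  qed
qed

lemma generator_relations_disjoint:
  assumes ijkl: "i \<in> {1..n}" "j \<in> {1..n}" "k \<in> {1..n}" "l \<in> {1..n}" "distinct [i, j, k, l]"
  shows "bmult n \<delta> (s_elem n i j) (s_elem n k l) = bmult n \<delta> (s_elem n k l) (s_elem n i j)"
    and "bmult n \<delta> (s_elem n i j) (eps_elem n k l) = bmult n \<delta> (eps_elem n k l) (s_elem n i j)"
    and "bmult n \<delta> (eps_elem n i j) (eps_elem n k l) = bmult n \<delta> (eps_elem n k l) (eps_elem n i j)"
proof -
  have ne: "i \<noteq> j" "k \<noteq> l" "i \<noteq> k" "i \<noteq> l" "j \<noteq> k" "j \<noteq> l" using ijkl(5) by auto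
  note sw = swap_is_diagram[OF ijkl(1,2) ne(1)] swap_is_diagram[OF ijkl(3,4) ne(2)]
  note cp = cap_is_diagram[OF ijkl(1,2) ne(1)] cap_is_diagram[OF ijkl(3,4) ne(2)]
  note tr = transfer_swap[OF ijkl(1,2)] transfer_swap[OF ijkl(3,4)]
    transfer_cap[OF ijkl(1,2)] transfer_cap[OF ijkl(3,4)]
  have sub: "swap_set i j A \<subseteq> {1..n}" "swap_set k l A \<subseteq> {1..n}"
    "A - {i, j} \<subseteq> {1..n}" "A \<union> {i, j} \<subseteq> {1..n}" "A - {k, l} \<subseteq> {1..n}" "A \<union> {k, l} \<subseteq> {1..n}"
    if "A \<subseteq> {1..n}" for A
    using that swap_set_subset[OF ijkl(1,2) that] swap_set_subset[OF ijkl(3,4) that] ijkl(1-4) by auto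
  note neq = ne ne[symmetric]
  show "bmult n \<delta> (s_elem n i j) (s_elem n k l) = bmult n \<delta> (s_elem n k l) (s_elem n i j)"
    unfolding s_elem_basis
  proof (rule bmult_basis_eqI[OF sw(1,2,2,1)])
    fix \<phi> A assume A: "A \<subseteq> {1..n}"
    show "transfer_op n (swap_diagram n i j) (transfer_op n (swap_diagram n k l) \<phi>) A =
      transfer_op n (swap_diagram n k l) (transfer_op n (swap_diagram n i j) \<phi>) A"
      by (simp only: tr sub A swap_set_disjoint[OF ne(3-6)])
  qed
  show "bmult n \<delta> (s_elem n i j) (eps_elem n k l) = bmult n \<delta> (eps_elem n k l) (s_elem n i j)"
    unfolding s_elem_basis eps_elem_basis
  proof (rule bmult_basis_eqI[OF sw(1) cp(2,2) sw(1)])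
    fix \<phi> A assume A: "A \<subseteq> {1..n}"
    show "transfer_op n (swap_diagram n i j) (transfer_op n (cap_diagram n k l) \<phi>) A =
      transfer_op n (cap_diagram n k l) (transfer_op n (swap_diagram n i j) \<phi>) A"
      by (simp only: tr sub A swap_set_disjoint[OF ne(3-6)] mem_swap_set neq simp_thms)
  qed
  show "bmult n \<delta> (eps_elem n i j) (eps_elem n k l) = bmult n \<delta> (eps_elem n k l) (eps_elem n i j)"
    unfolding eps_elem_basis
  proof (rule bmult_basis_eqI[OF cp(1,2,2,1)])
    fix \<phi> A assume A: "A \<subseteq> {1..n}"
    note sets = pair_difference_disjoint(1-2)[OF ne(3-6)] and sets' = pair_difference_disjoint(3-4)[OF ne(3-6)]
      and mem = pair_difference_disjoint(5-)[OF ne(3-6)]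
    show "transfer_op n (cap_diagram n i j) (transfer_op n (cap_diagram n k l) \<phi>) A =
      transfer_op n (cap_diagram n k l) (transfer_op n (cap_diagram n i j) \<phi>) A"
    proof (cases "(i \<in> A \<longleftrightarrow> j \<in> A) \<and> (k \<in> A \<longleftrightarrow> l \<in> A)")
      case True
      then show ?thesis
        by (simp only: tr sub A mem if_True simp_thms sets sets' add_ac)
    next
      case False
      then show ?thesis
        by (cases "i \<in> A \<longleftrightarrow> j \<in> A") (simp_all only: tr sub A mem if_True if_False simp_thms add_0_right if_cancel)
    qed
  qed
qed

section \<open>Adding a strand\<close>

lemma vertical_strand_diagram:
  assumes "is_diagram m d"
  shows "is_diagram (Suc m) (insert {Top (Suc m), Bot (Suc m)} d)" "{Top (Suc m), Bot (Suc m)} \<notin> d"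
proof -
  define v where "v = {Top (Suc m), Bot (Suc m)}"
  have M: "matching (outer_dots m) d" using assms by (simp add: is_diagram_matching)
  have outer: "outer_dots (Suc m) = outer_dots m \<union> v" "outer_dots m \<inter> v = {}"
    by (auto simp: outer_dots_def v_def)
  have disj: "e \<inter> v = {}" if "e \<in> d" for e using matching_subset[OF M that] outer(2) by blast
  show "v \<notin> d" using disj[of v] by (auto simp: v_def)
  show "is_diagram (Suc m) (insert v d)"
    unfolding is_diagram_matching matching_def outer(1)
  proof (intro conjI ballI)
    fix e assume "e \<in> insert v d"
    then show "e \<subseteq> outer_dots m \<union> v" "card e = 2"
      using matching_subset[OF M, of e] matching_card[OF M, of e] by (auto simp: v_def)
  next
    fix x assume x: "x \<in> outer_dots m \<union> v"
    show "\<exists>!e. e \<in> insert v d \<and> x \<in> e"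
    proof (cases "x \<in> v")
      case True
      then show ?thesis using disj by blast
    next
      case False
      then have "(e \<in> insert v d \<and> x \<in> e) = (e \<in> d \<and> x \<in> e)" for e by auto
      then show ?thesis using matching_ex1[OF M, of x] False x by simp
    qed
  qed
qed

lemma remove_vertical_strand:
  assumes "is_diagram (Suc m) d" "{Top (Suc m), Bot (Suc m)} \<in> d"
  shows "is_diagram m (d - {{Top (Suc m), Bot (Suc m)}})"
proof -
  define v where "v = {Top (Suc m), Bot (Suc m)}"
  have M: "matching (outer_dots (Suc m)) d" using assms by (simp add: is_diagram_matching)
  have outer: "outer_dots (Suc m) = outer_dots m \<union> v" "outer_dots m \<inter> v = {}"
    by (auto simp: outer_dots_def v_def)
  have vd: "v \<in> d" using assms by (simp add: v_def)
  have disj: "e \<inter> v = {}" if "e \<in> d" "e \<noteq> v" for e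
  proof -
    have "x \<notin> e" if "x \<in> v" for x
    proof -
      have "\<exists>!e. e \<in> d \<and> x \<in> e" using that outer by (intro matching_ex1[OF M]) auto
      then show ?thesis using that vd \<open>e \<in> d\<close> \<open>e \<noteq> v\<close> by (elim ex1E) blast
    qed
    then show ?thesis by blast
  qed
  show "is_diagram m (d - {v})"
    unfolding is_diagram_matching matching_def
  proof (intro conjI ballI)
    fix e assume "e \<in> d - {v}"
    then show "e \<subseteq> outer_dots m" "card e = 2"
      using matching_subset[OF M, of e] matching_card[OF M, of e] disj[of e] outer by auto
  next
    fix x assume x: "x \<in> outer_dots m"
    then have "(e \<in> d - {v} \<and> x \<in> e) = (e \<in> d \<and> x \<in> e)" for e using outer by auto
    then show "\<exists>!e. e \<in> d - {v} \<and> x \<in> e" using matching_ex1[OF M, of x] x outer by simp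
  qed
qed

lemma fits_restrict:
  assumes "is_diagram m d" shows "fits d (A \<inter> {1..m}) (B \<inter> {1..m}) \<longleftrightarrow> fits d A B"
proof -
  have "colour (A \<inter> {1..m}) {} (B \<inter> {1..m}) x = colour A {} B x" if "x \<in> outer_dots m" for x
    using that by (auto simp: outer_dots_def)
  then show ?thesis unfolding fits_def using diagram_edge_outer[OF assms] by metis
qed

text \<open>
  The colour of the new strand is the same at both ends, so it is a parameter of the smaller operator.
\<close>

lemma transfer_add_strand:
  assumes d: "is_diagram m d" and A: "A \<subseteq> {1..Suc m}"
  shows "transfer_op (Suc m) (insert {Top (Suc m), Bot (Suc m)} d) \<phi> A =
    transfer_op m d (\<lambda>G. \<phi> (G \<union> (A \<inter> {Suc m}))) (A \<inter> {1..m})"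
proof -
  have f: "fits d (A \<inter> {1..m}) (G \<inter> {1..m}) \<longleftrightarrow> fits d A G" for G
    by (rule fits_restrict[OF d])
  have f': "fits d (A \<inter> {1..m}) G \<longleftrightarrow> fits d A G" "fits d A (G \<union> (A \<inter> {Suc m})) \<longleftrightarrow> fits d A G"
    if "G \<subseteq> {1..m}" for G
  proof -
    have "G \<inter> {1..m} = G" "(G \<union> (A \<inter> {Suc m})) \<inter> {1..m} = G" using that by auto
    then show "fits d (A \<inter> {1..m}) G \<longleftrightarrow> fits d A G" "fits d A (G \<union> (A \<inter> {Suc m})) \<longleftrightarrow> fits d A G"
      using f[of G] f[of "G \<union> (A \<inter> {Suc m})"] by auto
  qed
  have low: "G \<inter> {1..m} \<union> (A \<inter> {Suc m}) = G" if "G \<subseteq> {1..Suc m}" "Suc m \<in> A \<longleftrightarrow> Suc m \<in> G" for G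
    using that by (auto simp: le_Suc_eq)
  show ?thesis unfolding transfer_op_sum fits_insert colour.simps
  proof (rule sum.reindex_bij_witness[of _ "\<lambda>G. G \<union> (A \<inter> {Suc m})" "\<lambda>G. G \<inter> {1..m}"])
    fix G assume G: "G \<in> {G. G \<subseteq> {1..Suc m} \<and> (Suc m \<in> A \<longleftrightarrow> Suc m \<in> G) \<and> fits d A G}"
    then show "G \<inter> {1..m} \<union> (A \<inter> {Suc m}) = G" using low by simp
    then show "\<phi> (G \<inter> {1..m} \<union> (A \<inter> {Suc m})) = \<phi> G" by simp
    show "G \<inter> {1..m} \<in> {G. G \<subseteq> {1..m} \<and> fits d (A \<inter> {1..m}) G}" using G f by simp
  next
    fix G assume G: "G \<in> {G. G \<subseteq> {1..m} \<and> fits d (A \<inter> {1..m}) G}"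
    then show "(G \<union> (A \<inter> {Suc m})) \<inter> {1..m} = G" by auto
    have "fits d A (G \<union> (A \<inter> {Suc m}))" "G \<union> (A \<inter> {Suc m}) \<subseteq> {1..Suc m}" using G f'[of G] by auto
    moreover have "Suc m \<in> A \<longleftrightarrow> Suc m \<in> G \<union> (A \<inter> {Suc m})" using G by auto
    ultimately show "G \<union> (A \<inter> {Suc m}) \<in>
        {G. G \<subseteq> {1..Suc m} \<and> (Suc m \<in> A \<longleftrightarrow> Suc m \<in> G) \<and> fits d A G}" by blast
  qed
qed

lemma compose_add_strand:
  assumes d: "is_diagram m d1" "is_diagram m d2"
  defines "v \<equiv> {Top (Suc m), Bot (Suc m)}"
  shows "compose_diagrams (Suc m) (insert v d1) (insert v d2) = insert v (compose_diagrams m d1 d2)"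
    and "num_loops (Suc m) (insert v d1) (insert v d2) = num_loops m d1 d2"
proof -
  note c = compose_is_diagram[OF d]
  have tr: "transfer_op (Suc m) (insert v d1) (transfer_op (Suc m) (insert v d2) \<phi>) A =
      2 ^ num_loops m d1 d2 * transfer_op (Suc m) (insert v (compose_diagrams m d1 d2)) \<phi> A"
    if A: "A \<subseteq> {1..Suc m}" for \<phi> A
  proof -
    let ?\<psi> = "\<lambda>G. \<phi> (G \<union> (A \<inter> {Suc m}))"
    have "transfer_op m d1 (\<lambda>G. transfer_op (Suc m) (insert v d2) \<phi> (G \<union> (A \<inter> {Suc m}))) (A \<inter> {1..m}) =
        transfer_op m d1 (transfer_op m d2 ?\<psi>) (A \<inter> {1..m})"
      unfolding transfer_op_sum[of m d1]
    proof (intro sum.cong refl)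
      fix G assume "G \<in> {G. G \<subseteq> {1..m} \<and> fits d1 (A \<inter> {1..m}) G}"
      then have "G \<union> (A \<inter> {Suc m}) \<subseteq> {1..Suc m}" "(G \<union> (A \<inter> {Suc m})) \<inter> {1..m} = G"
        "(G \<union> (A \<inter> {Suc m})) \<inter> {Suc m} = A \<inter> {Suc m}" by auto
      then show "transfer_op (Suc m) (insert v d2) \<phi> (G \<union> (A \<inter> {Suc m})) = transfer_op m d2 ?\<psi> G"
        unfolding v_def using transfer_add_strand[OF d(2), of "G \<union> (A \<inter> {Suc m})" \<phi>] by simp
    qed
    then show ?thesis unfolding v_def
      by (simp add: transfer_add_strand[OF d(1) A] transfer_add_strand[OF c A]
        transfer_op_compose[OF d] del: One_nat_def)
  qed
  note v = vertical_strand_diagram(1)[of m, folded v_def]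
  show "compose_diagrams (Suc m) (insert v d1) (insert v d2) = insert v (compose_diagrams m d1 d2)"
    "num_loops (Suc m) (insert v d1) (insert v d2) = num_loops m d1 d2"
    by (rule compose_eqI[OF v[OF d(1)] v[OF d(2)] v[OF c] tr], assumption)+
qed

lemma bembed_basis:
  assumes "is_diagram m d"
  shows "bembed (Suc m) (basis d) = basis (insert {Top (Suc m), Bot (Suc m)} d)"
  using vertical_strand_diagram(2)[OF assms] by (auto simp: bembed_def basis_def fun_eq_iff)

lemma bembed_linear:
  "bembed n (bplus a b) = bplus (bembed n a) (bembed n b)"
  "bembed n (bminus a b) = bminus (bembed n a) (bembed n b)"
  "bembed n (bscale c a) = bscale c (bembed n a)"
  "bembed n (\<lambda>d. \<Sum>i\<in>I. f i d) = (\<lambda>d. \<Sum>i\<in>I. bembed n (f i) d)"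
  by (auto simp: bembed_def bplus_def bminus_def bscale_def fun_eq_iff)

lemma bembed_bmult:
  fixes a b :: "'k::comm_ring_1 brauer"
  shows "bembed (Suc m) (bmult m \<delta> a b) = bmult (Suc m) \<delta> (bembed (Suc m) a) (bembed (Suc m) b)"
proof
  fix d
  let ?v = "{Top (Suc m), Bot (Suc m)}"
  define E where "E = {d \<in> diagrams (Suc m). ?v \<in> d}"
  have bij: "bij_betw (insert ?v) (diagrams m) E"
    by (rule bij_betw_byWitness[where f' = "\<lambda>d. d - {?v}"])
      (auto simp: E_def vertical_strand_diagram remove_vertical_strand)
  have emb: "bembed (Suc m) a (insert ?v e) = a e" if "e \<in> diagrams m" for a :: "'k brauer" and e
    using vertical_strand_diagram(2)[of m e] that by (simp add: bembed_def)
  have "bmult (Suc m) \<delta> (bembed (Suc m) a) (bembed (Suc m) b) d =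
      (\<Sum>d1\<in>E. \<Sum>d2\<in>E. bembed (Suc m) a d1 * bembed (Suc m) b d2 * structure_const (Suc m) \<delta> d1 d2 d)"
    unfolding bmult_structure_const
  proof (rule sum.mono_neutral_cong_right)
    fix d1 assume "d1 \<in> E"
    show "(\<Sum>d2\<in>diagrams (Suc m). bembed (Suc m) a d1 * bembed (Suc m) b d2 * structure_const (Suc m) \<delta> d1 d2 d) =
        (\<Sum>d2\<in>E. bembed (Suc m) a d1 * bembed (Suc m) b d2 * structure_const (Suc m) \<delta> d1 d2 d)"
      by (rule sum.mono_neutral_right) (auto simp: E_def bembed_def)
  qed (auto simp: E_def bembed_def)
  also have "\<dots> = (\<Sum>d1\<in>diagrams m. \<Sum>d2\<in>diagrams m.
      a d1 * b d2 * structure_const (Suc m) \<delta> (insert ?v d1) (insert ?v d2) d)"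
    unfolding sum.reindex_bij_betw[OF bij, symmetric] by (intro sum.cong refl) (simp add: emb)
  also have "\<dots> = (\<Sum>d1\<in>diagrams m. \<Sum>d2\<in>diagrams m.
      a d1 * b d2 * (if ?v \<in> d then structure_const m \<delta> d1 d2 (d - {?v}) else 0))"
  proof (intro sum.cong refl)
    fix d1 d2 assume d: "d1 \<in> diagrams m" "d2 \<in> diagrams m"
    have "?v \<notin> compose_diagrams m d1 d2"
      using vertical_strand_diagram(2) compose_is_diagram d by simp
    then have "d = insert ?v (compose_diagrams m d1 d2) \<longleftrightarrow>
        ?v \<in> d \<and> d - {?v} = compose_diagrams m d1 d2" by auto
    then show "a d1 * b d2 * structure_const (Suc m) \<delta> (insert ?v d1) (insert ?v d2) d =
      a d1 * b d2 * (if ?v \<in> d then structure_const m \<delta> d1 d2 (d - {?v}) else 0)"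
      using compose_add_strand[of m d1 d2] d by (simp add: structure_const_def)
  qed
  also have "\<dots> = bembed (Suc m) (bmult m \<delta> a b) d"
    by (simp add: bembed_def bmult_structure_const)
  finally show "bembed (Suc m) (bmult m \<delta> a b) d =
      bmult (Suc m) \<delta> (bembed (Suc m) a) (bembed (Suc m) b) d" ..
qed

lemma bembed_generators:
  assumes "i \<in> {1..m}" "j \<in> {1..m}" "i \<noteq> j"
  shows "bembed (Suc m) (s_elem m i j) = s_elem (Suc m) i j"
    and "bembed (Suc m) (eps_elem m i j) = eps_elem (Suc m) i j"
proof -
  have K: "{1..Suc m} - {i, j} = insert (Suc m) ({1..m} - {i, j})" using assms by auto
  have ins: "{{Top k, Bot k} | k. k \<in> insert a K} = insert {Top a, Bot a} {{Top k, Bot k} | k. k \<in> K}"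
    for a K by blast
  have "insert {Top (Suc m), Bot (Suc m)} (swap_diagram m i j) = swap_diagram (Suc m) i j"
    "insert {Top (Suc m), Bot (Suc m)} (cap_diagram m i j) = cap_diagram (Suc m) i j"
    unfolding swap_diagram_def cap_diagram_def K ins by (simp_all only: Un_insert_right)
  then show "bembed (Suc m) (s_elem m i j) = s_elem (Suc m) i j"
    "bembed (Suc m) (eps_elem m i j) = eps_elem (Suc m) i j"
    by (simp_all add: s_elem_basis eps_elem_basis bembed_basis swap_is_diagram[OF assms] cap_is_diagram[OF assms])
qed

lemma bembed_bone: "bembed (Suc m) (bone m) = bone (Suc m)"
proof -
  have "insert {Top (Suc m), Bot (Suc m)} (identity_diagram m) = identity_diagram (Suc m)"
    by (auto simp: identity_diagram_def le_Suc_eq)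
  then show ?thesis by (simp add: bone_def bembed_basis identity_is_diagram)
qed

lemma bembed_jucys_murphy:
  fixes \<delta> :: "'k::field"
  assumes "r \<in> {1..m}"
  shows "bembed (Suc m) (jucys_murphy m \<delta> r) = jucys_murphy (Suc m) \<delta> r"
proof -
  have "bembed (Suc m) (bminus (s_elem m i r) (eps_elem m i r :: 'k brauer)) = bminus (s_elem (Suc m) i r) (eps_elem (Suc m) i r)"
    if "i \<in> {1..r - 1}" for i
  proof -
    have i: "i \<in> {1..m}" "i \<noteq> r" using assms that by auto
    show ?thesis by (simp only: bembed_linear bembed_generators[OF i(1) assms i(2)])
  qed
  then have "(\<Sum>i = 1..r - 1. bembed (Suc m) (bminus (s_elem m i r) (eps_elem m i r :: 'k brauer)) d) =
      (\<Sum>i = 1..r - 1. bminus (s_elem (Suc m) i r) (eps_elem (Suc m) i r) d)" for d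
    by (intro sum.cong refl) (simp only:)
  then show ?thesis
    unfolding jucys_murphy_def bembed_linear bembed_bone by (simp only:)
qed

section \<open>Linear operators on the Brauer algebra\<close>

text \<open>
  The algebra is studied through its left regular representation, because linear operators form
  a type with a ring structure. The vectors are all functions on diagrams; the operator of
  multiplication by the unit of the algebra is a projection, not the identity.
\<close>

typedef (overloaded) 'k endo = "{f :: ('k::field) brauer \<Rightarrow> 'k brauer.
    (\<forall>x y. f (bplus x y) = bplus (f x) (f y)) \<and> (\<forall>c x. f (bscale c x) = bscale c (f x))}"
  morphisms app Abs_endo
  by (rule exI[of _ id]) simp

setup_lifting type_definition_endo

lemma app_bplus: "app f (bplus x y) = bplus (app f x) (app f y)"
  and app_bscale: "app f (bscale c x) = bscale c (app f x)"
  using app[of f] by simp_all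

lemma bminus_conv: "bminus a b = bplus a (bscale (-1) b)"
  by (simp add: bminus_def bplus_def bscale_def)

lemma app_zero: "app f (\<lambda>_. 0) = (\<lambda>_. 0)"
  using app_bscale[of f 0 "\<lambda>_. 0"] by (simp add: bscale_def)

instantiation endo :: (field) ring_1
begin

lift_definition zero_endo :: "'a endo" is "\<lambda>x d. 0" by (simp add: bplus_def bscale_def)
lift_definition one_endo :: "'a endo" is "\<lambda>x. x" by simp
lift_definition plus_endo :: "'a endo \<Rightarrow> 'a endo \<Rightarrow> 'a endo" is "\<lambda>f g x. bplus (f x) (g x)"
  by (auto simp: bplus_def bscale_def algebra_simps fun_eq_iff)
lift_definition minus_endo :: "'a endo \<Rightarrow> 'a endo \<Rightarrow> 'a endo" is "\<lambda>f g x. bminus (f x) (g x)"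
  by (auto simp: bplus_def bminus_def bscale_def algebra_simps fun_eq_iff)
lift_definition uminus_endo :: "'a endo \<Rightarrow> 'a endo" is "\<lambda>f x. bscale (-1) (f x)"
  by (auto simp: bplus_def bscale_def algebra_simps fun_eq_iff)
lift_definition times_endo :: "'a endo \<Rightarrow> 'a endo \<Rightarrow> 'a endo" is "\<lambda>f g x. f (g x)" by simp

instance
proof
  show "(0::'a endo) \<noteq> 1"
  proof transfer
    have "(\<lambda>d::diagram. 0) \<noteq> (\<lambda>d. 1::'a)" by (simp add: fun_eq_iff)
    then show "(\<lambda>(x::'a brauer) d. 0) \<noteq> (\<lambda>x. x)" by (metis)
  qed
qed (transfer; simp add: bplus_def bminus_def bscale_def algebra_simps fun_eq_iff)+

end

lift_definition scl :: "'k::field \<Rightarrow> 'k endo \<Rightarrow> 'k endo" (infixr "\<odot>" 75) is "\<lambda>c f x. bscale c (f x)"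
  by (auto simp: bplus_def bscale_def algebra_simps fun_eq_iff)

lemma scl_mult_left [simp]: "(c \<odot> x) * y = c \<odot> (x * y)"
  by transfer simp

lemma scl_mult_right [simp]: "x * (c \<odot> y) = c \<odot> (x * y)"
  by transfer (simp add: fun_eq_iff)

lemma scl_scl [simp]: "c \<odot> d \<odot> x = (c * d) \<odot> x"
  by transfer (simp add: bscale_def mult.assoc)

lemma scl_add_right: "c \<odot> (x + y) = c \<odot> x + c \<odot> y"
  by transfer (simp add: bscale_def bplus_def algebra_simps)

lemma scl_add_left: "(c + d) \<odot> x = c \<odot> x + d \<odot> x"
  by transfer (simp add: bscale_def bplus_def algebra_simps)

lemma scl_diff_right: "c \<odot> (x - y) = c \<odot> x - c \<odot> y"
  by transfer (simp add: bscale_def bminus_def algebra_simps)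

lemma scl_diff_left: "(c - d) \<odot> x = c \<odot> x - d \<odot> x"
  by transfer (simp add: bscale_def bminus_def algebra_simps)

lemma scl_one [simp]: "1 \<odot> x = x" and scl_zero [simp]: "0 \<odot> x = 0" and scl_zero_right [simp]: "c \<odot> 0 = 0"
  by (transfer; simp add: bscale_def)+

lemma scl_minus_left: "(- c) \<odot> x = - (c \<odot> x)" and scl_minus_right: "c \<odot> (- x) = - (c \<odot> x)"
  by (transfer; simp add: bscale_def)+

lemmas scl_algebra = scl_add_right scl_add_left scl_diff_right scl_diff_left scl_minus_left scl_minus_right

lemma scl_sum_right: "c \<odot> (\<Sum>i\<in>I. f i) = (\<Sum>i\<in>I. c \<odot> f i)"
  by (induction I rule: infinite_finite_induct) (simp_all add: scl_add_right)

lemma scl_eq_zero_iff: "c \<odot> x = 0 \<longleftrightarrow> c = 0 \<or> x = 0"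
  by (metis scl_one scl_scl scl_zero scl_zero_right left_inverse)

lemma app_times: "app (f * g) x = app f (app g x)"
  by transfer simp

lemma app_scl: "app (c \<odot> f) x = bscale c (app f x)"
  by transfer simp

lemma app_plus: "app (f + g) x = bplus (app f x) (app g x)"
  and app_minus: "app (f - g) x = bminus (app f x) (app g x)"
  and app_one: "app 1 x = x" and app_zero_endo: "app 0 x = (\<lambda>_. 0)"
  by (transfer; simp)+

subsection \<open>Polynomials in an operator\<close>

definition peval :: "'k::field endo \<Rightarrow> 'k poly \<Rightarrow> 'k endo" where
  "peval x p = fold_coeffs (\<lambda>a f. a \<odot> 1 + x * f) p 0"

lemma peval_0 [simp]: "peval x 0 = 0"
  by (simp add: peval_def)

lemma peval_pCons [simp]: "peval x (pCons a p) = a \<odot> 1 + x * peval x p"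
  by (cases "p = 0 \<and> a = 0") (auto simp: peval_def)

lemma peval_1 [simp]: "peval x 1 = 1"
  by (simp add: one_pCons)

lemma peval_add: "peval x (p + q) = peval x p + peval x q"
proof (induction p arbitrary: q)
  case (pCons a p)
  obtain b r where "q = pCons b r" by (cases q) auto
  then show ?case by (simp add: pCons.IH scl_add_left algebra_simps)
qed simp

lemma peval_smult: "peval x (smult c p) = c \<odot> peval x p"
  by (induction p) (simp_all add: scl_add_right)

lemma peval_mult: "peval x (p * q) = peval x p * peval x q"
  by (induction p) (simp_all add: peval_add peval_smult distrib_right mult.assoc)

lemma peval_sum: "peval x (\<Sum>i\<in>I. p i) = (\<Sum>i\<in>I. peval x (p i))"
  by (induction I rule: infinite_finite_induct) (simp_all add: peval_add)

lemma peval_linear: "peval x [:- a, 1:] = x - a \<odot> 1"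
  by (simp add: scl_minus_left)

lemma peval_eigen: "E * x = c \<odot> E \<Longrightarrow> E * peval x p = poly p c \<odot> E"
proof (induction p)
  case (pCons a p)
  have "E * (x * peval x p) = c \<odot> (E * peval x p)" by (simp add: pCons.prems flip: mult.assoc)
  then show ?case using pCons by (simp add: distrib_left scl_add_left)
qed simp

lemma peval_commute: "A * x = x * A \<Longrightarrow> A * peval x p = peval x p * A"
proof (induction p)
  case (pCons a p)
  have "A * (x * peval x p) = x * peval x p * A"
    by (metis mult.assoc pCons.IH pCons.prems)
  then show ?case by (simp add: distrib_left distrib_right)
qed simp

definition root_poly :: "'k::field set \<Rightarrow> 'k poly" where
  "root_poly A = (\<Prod>a\<in>A. [:- a, 1:])"

lemma poly_root_poly: "finite A \<Longrightarrow> poly (root_poly A) x = (\<Prod>a\<in>A. x - a)"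
  by (simp add: root_poly_def poly_prod)

lemma root_poly_remove: "finite A \<Longrightarrow> a \<in> A \<Longrightarrow> root_poly A = [:- a, 1:] * root_poly (A - {a})"
  by (simp add: root_poly_def prod.remove)

lemma degree_root_poly: "degree (root_poly A :: 'k::field poly) = card A"
proof (induction A rule: infinite_finite_induct)
  case (insert a A)
  have "root_poly A \<noteq> 0" using insert(1) by (simp add: root_poly_def)
  then have "degree ([:- a, 1:] * root_poly A) = Suc (card A)"
    by (subst degree_mult_eq) (simp_all add: insert.IH)
  then show ?case using insert(1,2) by (simp add: root_poly_def)
qed (simp_all add: root_poly_def)

definition lagrange_poly :: "'k::field set \<Rightarrow> 'k \<Rightarrow> 'k poly" where
  "lagrange_poly A a = smult (1 / (\<Prod>b\<in>A - {a}. a - b)) (root_poly (A - {a}))"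

lemma poly_lagrange_poly:
  assumes "finite A" "a \<in> A" "b \<in> A"
  shows "poly (lagrange_poly A a) b = (if a = b then 1 else 0)"
proof (cases "a = b")
  case True
  have "(\<Prod>b\<in>A - {a}. a - b) \<noteq> 0" using assms(1) by simp
  then show ?thesis using True assms(1) by (simp add: lagrange_poly_def poly_root_poly)
next
  case False
  then have "(\<Prod>c\<in>A - {a}. b - c) = 0" using assms by (intro prod_zero) auto
  then show ?thesis using False assms(1) by (simp add: lagrange_poly_def poly_root_poly)
qed

text \<open>Both sides have degree below \<open>card A\<close> and agree on \<open>A\<close>.\<close>

lemma sum_lagrange_poly:
  assumes "finite A" "A \<noteq> {}"
  shows "(\<Sum>a\<in>A. lagrange_poly A a) = (1 :: 'k::field poly)"
proof (rule ccontr)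
  define q where "q = (\<Sum>a\<in>A. lagrange_poly A a) - 1"
  assume "(\<Sum>a\<in>A. lagrange_poly A a) \<noteq> 1"
  then have "q \<noteq> 0" by (simp add: q_def)
  have "degree (lagrange_poly A a) \<le> card A - 1" if "a \<in> A" for a
    using that assms(1) degree_smult_le[of "1 / (\<Prod>b\<in>A - {a}. a - b)" "root_poly (A - {a})"]
    by (simp add: lagrange_poly_def degree_root_poly)
  then have "degree q \<le> card A - 1"
    unfolding q_def by (intro degree_diff_le degree_sum_le assms(1)) auto
  moreover have "poly q a = 0" if "a \<in> A" for a
    using that assms(1) by (simp add: q_def poly_sum poly_lagrange_poly)
  then have "card A \<le> card {x. poly q x = 0}"
    using poly_roots_finite[OF \<open>q \<noteq> 0\<close>] by (intro card_mono) auto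
  then have "card A \<le> degree q" using card_poly_roots_bound[OF \<open>q \<noteq> 0\<close>] by linarith
  ultimately show False using assms by (metis One_nat_def Suc_diff_1 card_gt_0_iff not_less_eq_eq order_trans)
qed

subsection \<open>Left multiplication\<close>

lift_definition left_mult :: "nat \<Rightarrow> 'k::field \<Rightarrow> 'k brauer \<Rightarrow> 'k endo" is bmult
  by (auto simp: bmult_structure_const bplus_def bscale_def fun_eq_iff algebra_simps
      sum.distrib sum_distrib_left intro!: sum.cong)

lemma app_left_mult: "app (left_mult n \<delta> a) x = bmult n \<delta> a x"
  by transfer simp

lemma endo_eqI: "(\<And>x. app f x = app g x) \<Longrightarrow> f = g"
  by (metis app_inject ext)

lemma left_mult_linear:
  "left_mult n \<delta> (bplus a b) = left_mult n \<delta> a + left_mult n \<delta> b"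
  "left_mult n \<delta> (bminus a b) = left_mult n \<delta> a - left_mult n \<delta> b"
  "left_mult n \<delta> (bscale c a) = c \<odot> left_mult n \<delta> a"
  by (rule endo_eqI; simp add: app_left_mult app_plus app_minus app_scl bmult_structure_const
      bplus_def bminus_def bscale_def algebra_simps sum.distrib sum_subtractf sum_distrib_left fun_eq_iff)+

lemma left_mult_zero: "left_mult n \<delta> (\<lambda>_. 0) = 0"
  using left_mult_linear(3)[of n \<delta> 0 "\<lambda>_. 0"] by (simp add: bscale_def)

lemma left_mult_sum:
  "left_mult n \<delta> (\<lambda>d. \<Sum>i\<in>I. f i d) = (\<Sum>i\<in>I. left_mult n \<delta> (f i))"
proof (induction I rule: infinite_finite_induct)
  case (insert i I)
  then have "(\<lambda>d. \<Sum>j\<in>insert i I. f j d) = bplus (f i) (\<lambda>d. \<Sum>j\<in>I. f j d)"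
    by (simp add: bplus_def)
  then show ?case using insert by (simp add: left_mult_linear)
qed (simp_all add: left_mult_zero)

lemma left_mult_bmult: "left_mult n \<delta> (bmult n \<delta> a b) = left_mult n \<delta> a * left_mult n \<delta> b"
  by (rule endo_eqI) (simp add: app_left_mult app_times bmult_assoc)

lemma left_mult_bone:
  "left_mult n \<delta> a * left_mult n \<delta> (bone n) = left_mult n \<delta> a"
  "left_mult n \<delta> (bone n) * left_mult n \<delta> a = left_mult n \<delta> a"
proof -
  have "bmult n \<delta> (bmult n \<delta> a (bone n)) x = bmult n \<delta> a x" for x
    by (auto simp: bmult_bone_right bmult_structure_const fun_eq_iff intro!: sum.cong)
  then show "left_mult n \<delta> a * left_mult n \<delta> (bone n) = left_mult n \<delta> a"
    by (intro endo_eqI) (simp add: app_left_mult app_times flip: bmult_assoc)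
  show "left_mult n \<delta> (bone n) * left_mult n \<delta> a = left_mult n \<delta> a"
    by (intro endo_eqI) (simp add: app_left_mult app_times supported_bmult_bone bmult_supported)
qed

lemma left_mult_inject:
  assumes "supported n a" "supported n b"
  shows "left_mult n \<delta> a = left_mult n \<delta> b \<longleftrightarrow> a = b"
  using assms by (metis app_left_mult supported_bmult_bone(2))

section \<open>Operators satisfying the Brauer relations\<close>

text \<open>
  The arguments about Jucys--Murphy elements and the fusion procedure use these relations between operators.
  The operators \<open>s i j\<close> are invertible, and \<open>unit\<close> stands for the projection onto the algebra.
\<close>

locale brauer_relations =
  fixes N :: nat and \<delta> :: "'k::field" and s e :: "nat \<Rightarrow> nat \<Rightarrow> 'k endo" and unit :: "'k endo"
  assumes s_sym: "i \<in> {1..N} \<Longrightarrow> j \<in> {1..N} \<Longrightarrow> i \<noteq> j \<Longrightarrow> s i j = s j i"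
    and e_sym: "i \<in> {1..N} \<Longrightarrow> j \<in> {1..N} \<Longrightarrow> i \<noteq> j \<Longrightarrow> e i j = e j i"
    and s_s: "i \<in> {1..N} \<Longrightarrow> j \<in> {1..N} \<Longrightarrow> i \<noteq> j \<Longrightarrow> s i j * s i j = 1"
    and e_e: "i \<in> {1..N} \<Longrightarrow> j \<in> {1..N} \<Longrightarrow> i \<noteq> j \<Longrightarrow> e i j * e i j = \<delta> \<odot> e i j"
    and s_e: "i \<in> {1..N} \<Longrightarrow> j \<in> {1..N} \<Longrightarrow> i \<noteq> j \<Longrightarrow> s i j * e i j = e i j"
    and e_s: "i \<in> {1..N} \<Longrightarrow> j \<in> {1..N} \<Longrightarrow> i \<noteq> j \<Longrightarrow> e i j * s i j = e i j"
    and s_s_braid: "i \<in> {1..N} \<Longrightarrow> j \<in> {1..N} \<Longrightarrow> k \<in> {1..N} \<Longrightarrow> i \<noteq> j \<Longrightarrow> i \<noteq> k \<Longrightarrow> j \<noteq> k \<Longrightarrow>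
      s i j * s j k = s i k * s i j"
    and s_e_braid: "i \<in> {1..N} \<Longrightarrow> j \<in> {1..N} \<Longrightarrow> k \<in> {1..N} \<Longrightarrow> i \<noteq> j \<Longrightarrow> i \<noteq> k \<Longrightarrow> j \<noteq> k \<Longrightarrow>
      s i j * e j k = e i k * s i j"
    and e_e_s: "i \<in> {1..N} \<Longrightarrow> j \<in> {1..N} \<Longrightarrow> k \<in> {1..N} \<Longrightarrow> i \<noteq> j \<Longrightarrow> i \<noteq> k \<Longrightarrow> j \<noteq> k \<Longrightarrow>
      e i j * e j k = e i j * s i k"
    and s_e_e: "i \<in> {1..N} \<Longrightarrow> j \<in> {1..N} \<Longrightarrow> k \<in> {1..N} \<Longrightarrow> i \<noteq> j \<Longrightarrow> i \<noteq> k \<Longrightarrow> j \<noteq> k \<Longrightarrow>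
      e i j * e j k = s i k * e j k"
    and s_s_disjoint: "i \<in> {1..N} \<Longrightarrow> j \<in> {1..N} \<Longrightarrow> k \<in> {1..N} \<Longrightarrow> l \<in> {1..N} \<Longrightarrow> distinct [i, j, k, l] \<Longrightarrow>
      s i j * s k l = s k l * s i j"
    and s_e_disjoint: "i \<in> {1..N} \<Longrightarrow> j \<in> {1..N} \<Longrightarrow> k \<in> {1..N} \<Longrightarrow> l \<in> {1..N} \<Longrightarrow> distinct [i, j, k, l] \<Longrightarrow>
      s i j * e k l = e k l * s i j"
    and e_e_disjoint: "i \<in> {1..N} \<Longrightarrow> j \<in> {1..N} \<Longrightarrow> k \<in> {1..N} \<Longrightarrow> l \<in> {1..N} \<Longrightarrow> distinct [i, j, k, l] \<Longrightarrow>
      e i j * e k l = e k l * e i j"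
    and unit_s: "i \<in> {1..N} \<Longrightarrow> j \<in> {1..N} \<Longrightarrow> i \<noteq> j \<Longrightarrow> unit * s i j = s i j * unit"
    and unit_e: "i \<in> {1..N} \<Longrightarrow> j \<in> {1..N} \<Longrightarrow> i \<noteq> j \<Longrightarrow> unit * e i j = e i j * unit"
begin

definition jm :: "nat \<Rightarrow> 'k endo" where
  "jm r = ((\<delta> - 1) / 2) \<odot> 1 + (\<Sum>i\<in>{1..<r}. s i r - e i r)"

end

text \<open>
  The transpositions are completed by the identity outside the algebra, so that they are
  invertible operators.
\<close>

definition s_op :: "nat \<Rightarrow> 'k::field \<Rightarrow> nat \<Rightarrow> nat \<Rightarrow> 'k endo" where
  "s_op n \<delta> i j = left_mult n \<delta> (s_elem n i j) + (1 - left_mult n \<delta> (bone n))"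

definition e_op :: "nat \<Rightarrow> 'k::field \<Rightarrow> nat \<Rightarrow> nat \<Rightarrow> 'k endo" where
  "e_op n \<delta> i j = left_mult n \<delta> (eps_elem n i j)"

lemma left_mult_s_op:
  "left_mult n \<delta> a * s_op n \<delta> i j = left_mult n \<delta> (bmult n \<delta> a (s_elem n i j))"
  "s_op n \<delta> i j * left_mult n \<delta> a = left_mult n \<delta> (bmult n \<delta> (s_elem n i j) a)"
  by (simp_all add: s_op_def left_mult_bmult left_mult_bone algebra_simps)

lemma s_op_s_op:
  "s_op n \<delta> i j * s_op n \<delta> k l =
    left_mult n \<delta> (bmult n \<delta> (s_elem n i j) (s_elem n k l)) + (1 - left_mult n \<delta> (bone n))"
  by (simp add: s_op_def left_mult_bmult left_mult_bone algebra_simps)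

lemma e_op_e_op:
  "e_op n \<delta> i j * e_op n \<delta> k l = left_mult n \<delta> (bmult n \<delta> (eps_elem n i j) (eps_elem n k l))"
  by (simp add: e_op_def left_mult_bmult)

interpretation brauer: brauer_relations N \<delta> "s_op N \<delta>" "e_op N \<delta>" "left_mult N \<delta> (bone N)"
  for N :: nat and \<delta> :: "'k::field"
proof
  fix i j assume ij: "i \<in> {1..N}" "j \<in> {1..N}" "i \<noteq> j"
  show "s_op N \<delta> i j = s_op N \<delta> j i"
    by (simp add: s_op_def s_elem_basis swap_diagram_commute)
  show "e_op N \<delta> i j = e_op N \<delta> j i"
    by (simp add: e_op_def eps_elem_basis cap_diagram_commute)
  show "e_op N \<delta> i j * e_op N \<delta> i j = \<delta> \<odot> e_op N \<delta> i j"
    by (simp only: e_op_e_op generator_relations[OF ij] left_mult_linear) (simp only: e_op_def)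
  show "s_op N \<delta> i j * s_op N \<delta> i j = 1"
    "s_op N \<delta> i j * e_op N \<delta> i j = e_op N \<delta> i j" "e_op N \<delta> i j * s_op N \<delta> i j = e_op N \<delta> i j"
    by (simp_all only: s_op_s_op e_op_def left_mult_s_op generator_relations[OF ij])
      (simp add: algebra_simps)
  show "left_mult N \<delta> (bone N) * s_op N \<delta> i j = s_op N \<delta> i j * left_mult N \<delta> (bone N)"
    by (simp add: s_op_def algebra_simps left_mult_bone)
  show "left_mult N \<delta> (bone N) * e_op N \<delta> i j = e_op N \<delta> i j * left_mult N \<delta> (bone N)"
    by (simp add: e_op_def left_mult_bone)
next
  fix i j k assume ijk: "i \<in> {1..N}" "j \<in> {1..N}" "k \<in> {1..N}" "i \<noteq> j" "i \<noteq> k" "j \<noteq> k"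
  show "s_op N \<delta> i j * s_op N \<delta> j k = s_op N \<delta> i k * s_op N \<delta> i j"
    "s_op N \<delta> i j * e_op N \<delta> j k = e_op N \<delta> i k * s_op N \<delta> i j"
    "e_op N \<delta> i j * e_op N \<delta> j k = e_op N \<delta> i j * s_op N \<delta> i k"
    by (simp_all only: s_op_s_op e_op_def left_mult_s_op generator_relations_three(1-3)[OF ijk]
        left_mult_bmult[symmetric])
  show "e_op N \<delta> i j * e_op N \<delta> j k = s_op N \<delta> i k * e_op N \<delta> j k"
    by (simp only: e_op_def left_mult_s_op generator_relations_three(4)[OF ijk] left_mult_bmult[symmetric])
next
  fix i j k l assume ijkl: "i \<in> {1..N}" "j \<in> {1..N}" "k \<in> {1..N}" "l \<in> {1..N}" "distinct [i, j, k, l]"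
  show "s_op N \<delta> i j * s_op N \<delta> k l = s_op N \<delta> k l * s_op N \<delta> i j"
    "s_op N \<delta> i j * e_op N \<delta> k l = e_op N \<delta> k l * s_op N \<delta> i j"
    "e_op N \<delta> i j * e_op N \<delta> k l = e_op N \<delta> k l * e_op N \<delta> i j"
    by (simp_all only: s_op_s_op e_op_def left_mult_s_op generator_relations_disjoint[OF ijkl]
        left_mult_bmult[symmetric])
qed

text \<open>
  The operator \<open>jm r\<close> is built from the identity and the completed transpositions. The difference to
  elements of the algebra disappears after multiplication with an element of the algebra.
\<close>

lemma left_mult_jm:
  fixes \<delta> :: "'k::field"
  shows "left_mult N \<delta> a * brauer.jm \<delta> N r = left_mult N \<delta> (bmult N \<delta> a (jucys_murphy N \<delta> r))"
proof -
  have eq: "left_mult N \<delta> (jucys_murphy N \<delta> r) = ((\<delta> - 1) / 2) \<odot> left_mult N \<delta> (bone N) +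
      (\<Sum>i\<in>{1..r - 1}. left_mult N \<delta> (s_elem N i r) - left_mult N \<delta> (eps_elem N i r))"
    unfolding jucys_murphy_def by (simp add: left_mult_linear left_mult_sum)
  have "{1..r - 1} = {1..<r}" by (cases r) auto
  then have "left_mult N \<delta> (bmult N \<delta> a (jucys_murphy N \<delta> r)) =
      ((\<delta> - 1) / 2) \<odot> left_mult N \<delta> a + (\<Sum>i\<in>{1..<r}. left_mult N \<delta> a * (s_op N \<delta> i r - e_op N \<delta> i r))"
    by (simp only: left_mult_bmult eq distrib_left left_mult_bone sum_distrib_left left_mult_s_op
        e_op_def right_diff_distrib scl_mult_right)
  then show ?thesis
    by (simp add: brauer.jm_def distrib_left sum_distrib_left)
qed

subsection \<open>Jucys--Murphy elements\<close>

context brauer_relations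
begin

definition jm_term :: "nat \<Rightarrow> nat \<Rightarrow> 'k endo" where
  "jm_term i r = s i r - e i r"

lemma jm_alt: "jm r = ((\<delta> - 1) / 2) \<odot> 1 + (\<Sum>i\<in>{1..<r}. jm_term i r)"
  by (simp add: jm_def jm_term_def)

lemma jm_term_commute:
  assumes "i \<in> {1..N}" "j \<in> {1..N}" "k \<in> {1..N}" "r \<in> {1..N}" "distinct [i, j, k, r]"
  shows "s i j * jm_term k r = jm_term k r * s i j" "e i j * jm_term k r = jm_term k r * e i j"
proof -
  have d: "distinct [k, r, i, j]" using assms(5) by auto
  show "s i j * jm_term k r = jm_term k r * s i j" "e i j * jm_term k r = jm_term k r * e i j"
    unfolding jm_term_def right_diff_distrib left_diff_distrib
    using s_s_disjoint[OF assms] s_e_disjoint[OF assms] e_e_disjoint[OF assms]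
      s_e_disjoint[OF assms(3,4,1,2) d] by simp_all
qed

lemma s_jm_term:
  assumes "i \<in> {1..N}" "j \<in> {1..N}" "r \<in> {1..N}" "i \<noteq> j" "i \<noteq> r" "j \<noteq> r"
  shows "s i j * jm_term j r = jm_term i r * s i j" "s i j * jm_term i r = jm_term j r * s i j"
proof -
  show "s i j * jm_term j r = jm_term i r * s i j"
    unfolding jm_term_def right_diff_distrib left_diff_distrib
    by (simp only: s_s_braid[OF assms] s_e_braid[OF assms])
  have "s j i * jm_term i r = jm_term j r * s j i"
    unfolding jm_term_def right_diff_distrib left_diff_distrib
    by (simp only: s_s_braid[OF assms(2,1,3) assms(4)[symmetric] assms(6,5)]
      s_e_braid[OF assms(2,1,3) assms(4)[symmetric] assms(6,5)])
  then show "s i j * jm_term i r = jm_term j r * s i j"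
    by (simp only: s_sym[OF assms(1,2,4)])
qed

text \<open>A cap annihilates the sum of the contributions of its two ends.\<close>

lemma e_jm_term:
  assumes "i \<in> {1..N}" "j \<in> {1..N}" "r \<in> {1..N}" "i \<noteq> j" "i \<noteq> r" "j \<noteq> r"
  shows "e i j * (jm_term i r + jm_term j r) = 0" "(jm_term i r + jm_term j r) * e i j = 0"
proof -
  note swapped = assms(2,1,3) assms(4)[symmetric] assms(6,5)
  note sym = e_sym[OF assms(1,2,4)] e_sym[OF assms(1,3,5)] e_sym[OF assms(2,3,6)]
    s_sym[OF assms(1,3,5)] s_sym[OF assms(2,3,6)]
  have "e i j * e j r = e i j * s i r" by (rule e_e_s[OF assms])
  moreover have "e j i * e i r = e j i * s j r" by (rule e_e_s[OF swapped])
  ultimately show "e i j * (jm_term i r + jm_term j r) = 0"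
    by (simp add: jm_term_def algebra_simps sym)
  have "e r i * e i j = s r j * e i j"
    by (rule s_e_e) (use assms in auto)
  moreover have "e r j * e j i = s r i * e j i"
    by (rule s_e_e) (use assms in auto)
  ultimately show "(jm_term i r + jm_term j r) * e i j = 0"
    by (simp add: jm_term_def algebra_simps sym)
qed

lemma jm_commute_s:
  assumes "i \<in> {1..<r}" "j \<in> {1..<r}" "i \<noteq> j" "r \<le> N"
  shows "s i j * jm r = jm r * s i j"
proof -
  define R where "R = {1..<r} - {i, j}"
  have split: "(\<Sum>k\<in>{1..<r}. f k) = f i + f j + (\<Sum>k\<in>R. f k)" for f :: "nat \<Rightarrow> 'k endo"
  proof -
    have eq: "{1..<r} = insert i (insert j R)" using assms(1,2) by (auto simp: R_def)
    have "i \<notin> insert j R" "j \<notin> R" "finite R" using assms(3) by (simp_all add: R_def)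
    then show ?thesis unfolding eq by (simp add: add.assoc)
  qed
  have ijr: "i \<in> {1..N}" "j \<in> {1..N}" "r \<in> {1..N}" "i \<noteq> j" "i \<noteq> r" "j \<noteq> r" using assms by auto
  have R: "s i j * jm_term k r = jm_term k r * s i j" if "k \<in> R" for k
    by (rule jm_term_commute) (use assms that in \<open>auto simp: R_def\<close>)
  have "(\<Sum>k\<in>R. s i j * jm_term k r) = (\<Sum>k\<in>R. jm_term k r * s i j)"
    by (rule sum.cong[OF refl R])
  then show ?thesis
    unfolding jm_alt split
    by (simp add: distrib_left distrib_right sum_distrib_left sum_distrib_right s_jm_term[OF ijr])
qed

lemma jm_commute_e:
  assumes "i \<in> {1..<r}" "j \<in> {1..<r}" "i \<noteq> j" "r \<le> N"
  shows "e i j * jm r = jm r * e i j"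
proof -
  define R where "R = {1..<r} - {i, j}"
  have split: "(\<Sum>k\<in>{1..<r}. f k) = f i + f j + (\<Sum>k\<in>R. f k)" for f :: "nat \<Rightarrow> 'k endo"
  proof -
    have eq: "{1..<r} = insert i (insert j R)" using assms(1,2) by (auto simp: R_def)
    have "i \<notin> insert j R" "j \<notin> R" "finite R" using assms(3) by (simp_all add: R_def)
    then show ?thesis unfolding eq by (simp add: add.assoc)
  qed
  have ijr: "i \<in> {1..N}" "j \<in> {1..N}" "r \<in> {1..N}" "i \<noteq> j" "i \<noteq> r" "j \<noteq> r" using assms by auto
  have R: "e i j * jm_term k r = jm_term k r * e i j" if "k \<in> R" for k
    by (rule jm_term_commute) (use assms that in \<open>auto simp: R_def\<close>)
  have "(\<Sum>k\<in>R. e i j * jm_term k r) = (\<Sum>k\<in>R. jm_term k r * e i j)"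
    by (rule sum.cong[OF refl R])
  moreover have "e i j * (((\<delta> - 1) / 2) \<odot> 1 + (jm_term i r + jm_term j r + (\<Sum>k\<in>R. jm_term k r))) =
      ((\<delta> - 1) / 2) \<odot> e i j + e i j * (jm_term i r + jm_term j r) + (\<Sum>k\<in>R. e i j * jm_term k r)"
    by (simp add: distrib_left sum_distrib_left add.assoc)
  moreover have "(((\<delta> - 1) / 2) \<odot> 1 + (jm_term i r + jm_term j r + (\<Sum>k\<in>R. jm_term k r))) * e i j =
      ((\<delta> - 1) / 2) \<odot> e i j + (jm_term i r + jm_term j r) * e i j + (\<Sum>k\<in>R. jm_term k r * e i j)"
    by (simp add: distrib_right sum_distrib_right add.assoc)
  ultimately show ?thesis unfolding jm_alt split e_jm_term[OF ijr] by simp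
qed

text \<open>
  The larger Jucys--Murphy element commutes with all generators on lower strands.
\<close>

lemma jm_commute_jm:
  assumes "k \<le> N" "r \<le> N" shows "jm k * jm r = jm r * jm k"
proof -
  have *: "jm k * jm r = jm r * jm k" if "k < r" "r \<le> N" for k r
  proof -
    have "jm_term i k * jm r = jm r * jm_term i k" if "i \<in> {1..<k}" for i
      unfolding jm_term_def left_diff_distrib right_diff_distrib
      using jm_commute_s[of i r k] jm_commute_e[of i r k] that \<open>k < r\<close> \<open>r \<le> N\<close> by simp
    then show ?thesis
      unfolding jm_alt[of k] by (simp add: distrib_left distrib_right sum_distrib_left sum_distrib_right)
  qed
  show ?thesis using *[of k r] *[of r k] assms by (cases k r rule: linorder_cases) auto
qed

lemma jm_commute_disjoint:
  assumes "i \<in> {1..N}" "j \<in> {1..N}" "i \<noteq> j" "r < i" "r < j"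
  shows "s i j * jm r = jm r * s i j" "e i j * jm r = jm r * e i j"
proof -
  have *: "s i j * jm_term k r = jm_term k r * s i j" "e i j * jm_term k r = jm_term k r * e i j"
    if "k \<in> {1..<r}" for k
    by (rule jm_term_commute; use assms that in auto)+
  show "s i j * jm r = jm r * s i j" "e i j * jm r = jm r * e i j"
    unfolding jm_alt by (simp_all add: distrib_left distrib_right sum_distrib_left sum_distrib_right *)
qed

lemma unit_jm: "r \<le> N \<Longrightarrow> unit * jm r = jm r * unit"
  unfolding jm_def
  by (simp add: distrib_left distrib_right sum_distrib_left sum_distrib_right
      right_diff_distrib left_diff_distrib unit_s unit_e)

lemma jm_one: "jm 1 = ((\<delta> - 1) / 2) \<odot> 1"
  by (simp add: jm_def)

lemma s_jm_conj:
  assumes "n \<ge> 1" "Suc n \<le> N"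
  shows "s n (Suc n) * jm n * s n (Suc n) = jm (Suc n) - s n (Suc n) + e n (Suc n)"
proof -
  note n = assms
  have ss: "s n (Suc n) * s n (Suc n) = 1" using n by (intro s_s) auto
  have "s n (Suc n) * jm_term i n * s n (Suc n) = jm_term i (Suc n)" if "i \<in> {1..<n}" for i
  proof -
    have ij: "n \<in> {1..N}" "Suc n \<in> {1..N}" "i \<in> {1..N}" "n \<noteq> Suc n" "n \<noteq> i" "Suc n \<noteq> i"
      using that n by auto
    have "s n (Suc n) * jm_term n i = jm_term (Suc n) i * s n (Suc n)"
      by (rule s_jm_term(2)[OF ij])
    then have "s n (Suc n) * jm_term n i * s n (Suc n) = jm_term (Suc n) i"
      by (simp add: mult.assoc ss)
    then show ?thesis using ij by (simp add: jm_term_def s_sym e_sym)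
  qed
  then have "s n (Suc n) * jm n * s n (Suc n) = ((\<delta> - 1) / 2) \<odot> 1 + (\<Sum>i\<in>{1..<n}. jm_term i (Suc n))"
    unfolding jm_alt by (simp add: distrib_left distrib_right sum_distrib_left sum_distrib_right ss)
  also have "\<dots> = jm (Suc n) - jm_term n (Suc n)"
    using n by (simp add: jm_alt)
  finally show ?thesis by (simp add: jm_term_def)
qed

lemma e_jm_sum:
  assumes "n \<ge> 1" "Suc n \<le> N" and two: "(2 :: 'k) \<noteq> 0"
  shows "e n (Suc n) * (jm n + jm (Suc n)) = 0" "(jm n + jm (Suc n)) * e n (Suc n) = 0"
proof -
  let ?e = "e n (Suc n)"
  have nn: "n \<in> {1..N}" "Suc n \<in> {1..N}" "n \<noteq> Suc n" using assms by auto
  have *: "?e * (jm_term i n + jm_term i (Suc n)) = 0" "(jm_term i n + jm_term i (Suc n)) * ?e = 0"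
    if "i \<in> {1..<n}" for i
  proof -
    have ij: "n \<in> {1..N}" "Suc n \<in> {1..N}" "i \<in> {1..N}" "n \<noteq> Suc n" "n \<noteq> i" "Suc n \<noteq> i"
      using that assms by auto
    then have "jm_term i n = jm_term n i" "jm_term i (Suc n) = jm_term (Suc n) i"
      by (simp_all add: jm_term_def s_sym e_sym)
    then show "?e * (jm_term i n + jm_term i (Suc n)) = 0" "(jm_term i n + jm_term i (Suc n)) * ?e = 0"
      using e_jm_term[OF ij] by simp_all
  qed
  define X where "X = (\<Sum>i\<in>{1..<n}. jm_term i n + jm_term i (Suc n))"
  have "jm n + jm (Suc n) = (((\<delta> - 1) / 2) \<odot> 1 + ((\<delta> - 1) / 2) \<odot> 1) + X + jm_term n (Suc n)"
    unfolding jm_alt X_def using assms by (simp add: sum.distrib)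
  also have "((\<delta> - 1) / 2) \<odot> 1 + ((\<delta> - 1) / 2) \<odot> 1 = (((\<delta> - 1) / 2) + ((\<delta> - 1) / 2)) \<odot> (1 :: 'k endo)"
    by (rule scl_add_left[symmetric])
  finally have sum: "jm n + jm (Suc n) =
      (((\<delta> - 1) / 2) + ((\<delta> - 1) / 2)) \<odot> 1 + X + (s n (Suc n) - e n (Suc n))"
    by (simp add: jm_term_def)
  have X: "?e * X = 0" "X * ?e = 0"
    unfolding X_def sum_distrib_left sum_distrib_right using * by simp_all
  have two_halves: "(\<delta> - 1) / 2 + (\<delta> - 1) / 2 = \<delta> - 1" using two
    by (simp only: add_divide_distrib[symmetric] mult_2[symmetric]) simp
  show "e n (Suc n) * (jm n + jm (Suc n)) = 0" "(jm n + jm (Suc n)) * e n (Suc n) = 0"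
    unfolding sum distrib_left distrib_right X right_diff_distrib left_diff_distrib
      e_s[OF nn] s_e[OF nn] e_e[OF nn] two_halves
    by (simp_all add: scl_diff_left algebra_simps)
qed

text \<open>
  Double centralizer of \<open>jm 1, \<dots>, jm r\<close> and \<open>unit\<close>. The idempotents of level \<open>r\<close> lie in it, hence
  commute with the generators on the strands above \<open>r\<close> without any reference to a subalgebra.
\<close>

definition bicentral :: "nat \<Rightarrow> 'k endo \<Rightarrow> bool" where
  "bicentral r A \<longleftrightarrow>
    (\<forall>B. (\<forall>k\<in>{1..r}. B * jm k = jm k * B) \<longrightarrow> B * unit = unit * B \<longrightarrow> A * B = B * A)"

lemma bicentral_mult: "bicentral r A \<Longrightarrow> bicentral r B \<Longrightarrow> bicentral r (A * B)"
  unfolding bicentral_def by (metis mult.assoc)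

lemma bicentral_unit: "bicentral r unit"
  unfolding bicentral_def by simp

lemma bicentral_mono: "bicentral r A \<Longrightarrow> r \<le> r' \<Longrightarrow> bicentral r' A"
  unfolding bicentral_def by auto

lemma bicentral_peval: "k \<in> {1..r} \<Longrightarrow> bicentral r (peval (jm k) p)"
  unfolding bicentral_def by (auto intro: peval_commute[symmetric])

lemma bicentral_commute_jm: "bicentral r A \<Longrightarrow> r \<le> N \<Longrightarrow> k \<le> N \<Longrightarrow> A * jm k = jm k * A"
proof -
  assume A: "bicentral r A" and k: "r \<le> N" "k \<le> N"
  have "jm k * jm k' = jm k' * jm k" if "k' \<in> {1..r}" for k'
    by (rule jm_commute_jm) (use that k in auto)
  then show "A * jm k = jm k * A"
    using A unit_jm[OF k(2)] unfolding bicentral_def by simp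
qed

lemma bicentral_commute_above:
  assumes "bicentral r A" "i \<in> {1..N}" "j \<in> {1..N}" "i \<noteq> j" "r < i" "r < j"
  shows "A * s i j = s i j * A" "A * e i j = e i j * A"
proof -
  have k: "k < i" "k < j" if "k \<in> {1..r}" for k using that assms(5,6) by auto
  show "A * s i j = s i j * A" "A * e i j = e i j * A"
    using assms(1) unfolding bicentral_def
    using jm_commute_disjoint[OF assms(2-4)] k unit_s[OF assms(2-4)] unit_e[OF assms(2-4)] by simp_all
qed

subsection \<open>Baxterized elements\<close>

definition rho_op :: "nat \<Rightarrow> nat \<Rightarrow> 'k \<Rightarrow> 'k endo" where
  "rho_op i j u = 1 - (1 / u) \<odot> s i j + (1 / (u - (\<delta> / 2 - 1))) \<odot> e i j"

lemma rho_op_inverse: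
  assumes "i \<in> {1..N}" "j \<in> {1..N}" "i \<noteq> j" "(2 :: 'k) \<noteq> 0"
    and "u \<noteq> 0" "u \<noteq> \<delta> / 2 - 1" "u \<noteq> - (\<delta> / 2 - 1)"
  shows "rho_op i j u * rho_op i j (- u) = (1 - 1 / u ^ 2) \<odot> 1"
proof -
  define k where "k = \<delta> / 2 - 1"
  have d: "\<delta> = 2 * k + 2" using assms(4) by (simp add: k_def field_simps)
  have k: "u - k \<noteq> 0" "u + k \<noteq> 0" using assms(6,7)
    unfolding k_def[symmetric] by (simp_all add: eq_neg_iff_add_eq_0)
  then have k': "- u - k \<noteq> 0" by (metis minus_diff_commute diff_minus_eq_add neg_equal_0_iff_equal add.inverse_inverse minus_add_distrib uminus_add_conv_diff)
  have coeff: "1 / (- u - k) + (1 / u) * - (1 / (- u - k)) + 1 / (u - k) + 1 / (u - k) * (1 / u)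
      + \<delta> * (1 / (u - k) * (1 / (- u - k))) = 0"
    using assms(5) k k' unfolding d by (simp add: divide_simps) (simp add: algebra_simps)
  have "rho_op i j u * rho_op i j (- u) = (1 - 1 / u ^ 2) \<odot> 1 +
      (1 / (- u - k) + (1 / u) * - (1 / (- u - k)) + 1 / (u - k) + 1 / (u - k) * (1 / u)
      + \<delta> * (1 / (u - k) * (1 / (- u - k)))) \<odot> e i j"
    unfolding rho_op_def k_def[symmetric]
    by (simp add: algebra_simps scl_algebra s_s[OF assms(1-3)] s_e[OF assms(1-3)] e_s[OF assms(1-3)]
        e_e[OF assms(1-3)] power2_eq_square)
  then show ?thesis unfolding coeff by simp
qed

text \<open>
  The Yang--Baxter equation. After the products of generators on three strands are reduced to normal
  forms, the difference of both sides is a combination of four elements, whose coefficients are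
  rational functions that vanish identically.
\<close>

lemma rho_op_yang_baxter:
  assumes ijk: "i \<in> {1..N}" "j \<in> {1..N}" "k \<in> {1..N}" "i \<noteq> j" "i \<noteq> k" "j \<noteq> k"
    and two: "(2 :: 'k) \<noteq> 0"
    and nz: "x \<noteq> 0" "y \<noteq> 0" "x + y \<noteq> 0"
      "x \<noteq> \<delta> / 2 - 1" "y \<noteq> \<delta> / 2 - 1" "x + y \<noteq> \<delta> / 2 - 1"
  shows "rho_op i j x * rho_op i k (x + y) * rho_op j k y = rho_op j k y * rho_op i k (x + y) * rho_op i j x"
proof -
  define a b c A B C where "a = s i j" "b = s i k" "c = s j k" "A = e i j" "B = e i k" "C = e j k"
  note defs = this
  have sym: "s j i = a" "s k i = b" "s k j = c" "e j i = A" "e k i = B" "e k j = C"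
    using s_sym[OF ijk(1,2,4)] s_sym[OF ijk(1,3,5)] s_sym[OF ijk(2,3,6)]
      e_sym[OF ijk(1,2,4)] e_sym[OF ijk(1,3,5)] e_sym[OF ijk(2,3,6)] by (simp_all only: defs)
  note fs = sym defs[symmetric]
  have ne: "j \<noteq> i" "k \<noteq> i" "k \<noteq> j" using ijk by auto
  note p1 = ijk and p2 = ijk(1,3,2) ijk(5,4) ne(3) and p3 = ijk(2,1,3) ne(1) ijk(6,5)
    and p4 = ijk(2,3,1) ijk(6) ne(1,2) and p5 = ijk(3,1,2) ne(2,3) ijk(4) and p6 = ijk(3,2,1) ne(3,2,1)
  have rels: "a * a = 1" "b * b = 1" "c * c = 1" "A * A = \<delta> \<odot> A" "B * B = \<delta> \<odot> B" "C * C = \<delta> \<odot> C"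
    "a * A = A" "b * B = B" "c * C = C" "A * a = A" "B * b = B" "C * c = C"
    using s_s[OF ijk(1,2,4)] s_s[OF ijk(1,3,5)] s_s[OF ijk(2,3,6)]
      e_e[OF ijk(1,2,4)] e_e[OF ijk(1,3,5)] e_e[OF ijk(2,3,6)]
      s_e[OF ijk(1,2,4)] s_e[OF ijk(1,3,5)] s_e[OF ijk(2,3,6)]
      e_s[OF ijk(1,2,4)] e_s[OF ijk(1,3,5)] e_s[OF ijk(2,3,6)] by (simp_all add: defs)
  have ss: "b * c = a * b" "c * a = a * b" "a * c = b * a" "c * b = b * a"
    using s_s_braid[OF p1, unfolded fs] s_s_braid[OF p2, unfolded fs] s_s_braid[OF p3, unfolded fs]
      s_s_braid[OF p4, unfolded fs] s_s_braid[OF p5, unfolded fs] s_s_braid[OF p6, unfolded fs] by simp_all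
  have se: "a * B = C * a" "a * C = B * a" "b * A = C * b" "b * C = A * b" "c * A = B * c" "c * B = A * c"
    using s_e_braid[OF p1, unfolded fs] s_e_braid[OF p2, unfolded fs] s_e_braid[OF p3, unfolded fs]
      s_e_braid[OF p4, unfolded fs] s_e_braid[OF p5, unfolded fs] s_e_braid[OF p6, unfolded fs] by simp_all
  have ee: "A * B = A * c" "A * C = A * b" "B * A = B * c" "B * C = B * a" "C * A = C * b" "C * B = C * a"
    using e_e_s[OF p1, unfolded fs] e_e_s[OF p2, unfolded fs] e_e_s[OF p3, unfolded fs]
      e_e_s[OF p4, unfolded fs] e_e_s[OF p5, unfolded fs] e_e_s[OF p6, unfolded fs] by simp_all
  have assoc: "X * Y = Z \<Longrightarrow> X * (Y * W) = Z * W" for X Y Z W :: "'k endo" by (simp flip: mult.assoc)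
  have Ess: "A * (a * b) = A * b" "A * (b * a) = A * c" "B * (a * b) = B * c" "B * (b * a) = B * a"
      "C * (a * b) = C * a" "C * (b * a) = C * b"
    using rels ss by (metis assoc)+
  define \<kappa>' where "\<kappa>' = \<delta> / 2 - 1"
  have d: "\<delta> = 2 * \<kappa>' + 2" using two by (simp add: \<kappa>'_def field_simps)
  define z where "z = x + y"
  define q1 q2 q3 where "q1 = 1 / (x - \<kappa>')" "q2 = 1 / (z - \<kappa>')" "q3 = 1 / (y - \<kappa>')"
  define r1 r2 r3 where "r1 = - (1 / x)" "r2 = - (1 / z)" "r3 = - (1 / y)"
  note coeffs = \<open>q1 = _\<close> \<open>q2 = _\<close> \<open>q3 = _\<close> \<open>r1 = _\<close> \<open>r2 = _\<close> \<open>r3 = _\<close>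
  have nz': "x \<noteq> 0" "y \<noteq> 0" "z \<noteq> 0" "x - \<kappa>' \<noteq> 0" "y - \<kappa>' \<noteq> 0" "z - \<kappa>' \<noteq> 0"
    using nz by (auto simp: z_def \<kappa>'_def)
  have I: "r1 * r2 + r2 * r3 - r1 * r3 = 0" "r1 * q2 - q2 * q3 - r1 * q3 = 0" "q1 * q2 + q1 * r3 - r3 * q2 = 0"
      "q1 * r2 + q1 * q3 + r2 * q3 + r1 * r2 * q3 + q1 * r2 * r3 + \<delta> * q1 * r2 * q3 + q1 * q2 * q3 - r1 * q2 * r3 = 0"
    unfolding coeffs d using nz'
    by (simp_all add: divide_simps) (simp_all add: z_def algebra_simps)
  have "(1 + r1 \<odot> a + q1 \<odot> A) * (1 + r2 \<odot> b + q2 \<odot> B) * (1 + r3 \<odot> c + q3 \<odot> C) -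
      (1 + r3 \<odot> c + q3 \<odot> C) * (1 + r2 \<odot> b + q2 \<odot> B) * (1 + r1 \<odot> a + q1 \<odot> A) =
      (r1 * r2 + r2 * r3 - r1 * r3) \<odot> (a * b - b * a) +
      (r1 * q2 - q2 * q3 - r1 * q3) \<odot> (C * a - B * a) +
      (q1 * q2 + q1 * r3 - r3 * q2) \<odot> (A * c - B * c) +
      (q1 * r2 + q1 * q3 + r2 * q3 + r1 * r2 * q3 + q1 * r2 * r3 + \<delta> * q1 * r2 * q3 + q1 * q2 * q3 - r1 * q2 * r3)
        \<odot> (A * b - C * b)"
    by (simp add: algebra_simps scl_algebra rels ss se ee Ess
        rels[THEN assoc] ss[THEN assoc] se[THEN assoc] ee[THEN assoc])
  then have "(1 + r1 \<odot> a + q1 \<odot> A) * (1 + r2 \<odot> b + q2 \<odot> B) * (1 + r3 \<odot> c + q3 \<odot> C) =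
      (1 + r3 \<odot> c + q3 \<odot> C) * (1 + r2 \<odot> b + q2 \<odot> B) * (1 + r1 \<odot> a + q1 \<odot> A)"
    unfolding I by simp
  moreover have "rho_op i j x = 1 + r1 \<odot> a + q1 \<odot> A" "rho_op i k (x + y) = 1 + r2 \<odot> b + q2 \<odot> B"
    "rho_op j k y = 1 + r3 \<odot> c + q3 \<odot> C"
    by (simp_all add: rho_op_def coeffs z_def \<kappa>'_def defs scl_minus_left)
  ultimately show ?thesis by simp
qed

end

section \<open>Rearranging ordered products\<close>

fun ascending_prod :: "(nat \<Rightarrow> 'a::monoid_mult) \<Rightarrow> nat \<Rightarrow> 'a" where
  "ascending_prod f 0 = 1"
| "ascending_prod f (Suc k) = ascending_prod f k * f (Suc k)"

fun descending_prod :: "(nat \<Rightarrow> 'a::monoid_mult) \<Rightarrow> nat \<Rightarrow> 'a" where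
  "descending_prod f 0 = 1"
| "descending_prod f (Suc k) = f (Suc k) * descending_prod f k"

lemma ascending_prod_commute:
  assumes "\<And>i. i \<in> {1..k} \<Longrightarrow> x * f i = f i * x"
  shows "x * ascending_prod f k = ascending_prod f k * x"
  using assms
proof (induction k)
  case (Suc k)
  have "x * ascending_prod f k = ascending_prod f k * x" "x * f (Suc k) = f (Suc k) * x"
    using Suc by auto
  then show ?case unfolding ascending_prod.simps by (metis mult.assoc)
qed simp

lemma descending_prod_commute:
  assumes "\<And>i. i \<in> {1..k} \<Longrightarrow> x * f i = f i * x"
  shows "x * descending_prod f k = descending_prod f k * x"
  using assms
proof (induction k)
  case (Suc k)
  have "x * descending_prod f k = descending_prod f k * x" "x * f (Suc k) = f (Suc k) * x"
    using Suc by auto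
  then show ?case unfolding descending_prod.simps by (metis mult.assoc)
qed simp

lemma ascending_prod_cong: "(\<And>i. i \<in> {1..k} \<Longrightarrow> f i = g i) \<Longrightarrow> ascending_prod f k = ascending_prod g k"
  by (induction k) auto

definition row_prod :: "(nat \<Rightarrow> nat \<Rightarrow> 'a::monoid_mult) \<Rightarrow> nat \<Rightarrow> nat \<Rightarrow> 'a" where
  "row_prod f n i = prod_list (map (f i) [i + 1..<n + 1])"

definition lex_prod :: "(nat \<Rightarrow> nat \<Rightarrow> 'a::monoid_mult) \<Rightarrow> nat \<Rightarrow> 'a" where
  "lex_prod f n = prod_list (map (\<lambda>(i, j). f i j) (lex_pairs n))"

lemma lex_prod_rows: "lex_prod f n = ascending_prod (row_prod f n) n"
proof -
  have asc: "prod_list (map g [1..<k + 1]) = ascending_prod g k" for g :: "nat \<Rightarrow> 'a" and k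
    by (induction k) auto
  have rows: "prod_list (map (\<lambda>(i, j). f i j) (concat (map (\<lambda>i. map (Pair i) (L i)) xs))) =
      prod_list (map (\<lambda>i. prod_list (map (f i) (L i))) xs)" for L and xs :: "nat list"
    by (induction xs) (simp_all add: comp_def)
  have "lex_prod f n = prod_list (map (row_prod f n) [1..<n + 1])"
    unfolding lex_prod_def lex_pairs_def row_prod_def by (rule rows)
  then show ?thesis by (simp only: asc)
qed

lemma prod_list_commute:
  fixes x :: "'a::monoid_mult"
  shows "(\<And>y. y \<in> set ys \<Longrightarrow> x * y = y * x) \<Longrightarrow> x * prod_list ys = prod_list ys * x"
proof (induction ys)
  case (Cons y ys)
  have "x * (y * prod_list ys) = y * (x * prod_list ys)"
    using Cons.prems[of y] by (simp flip: mult.assoc)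
  then show ?case using Cons by (simp add: mult.assoc)
qed simp

text \<open>
  The last column of the lexicographic product can be moved to the end, since a factor of the
  last column commutes with all later rows.
\<close>

lemma lex_prod_Suc:
  fixes f :: "nat \<Rightarrow> nat \<Rightarrow> 'a::monoid_mult"
  assumes comm: "\<And>i j l. i \<in> {1..n} \<Longrightarrow> i < j \<Longrightarrow> j < l \<Longrightarrow> l \<le> n \<Longrightarrow>
      f i (Suc n) * f j l = f j l * f i (Suc n)"
  shows "lex_prod f (Suc n) = lex_prod f n * ascending_prod (\<lambda>i. f i (Suc n)) n"
proof -
  have row: "row_prod f (Suc n) i = row_prod f n i * f i (Suc n)" if "i \<in> {1..n}" for i
    using that by (simp add: row_prod_def)
  have gr: "f i (Suc n) * row_prod f n j = row_prod f n j * f i (Suc n)" if "i \<in> {1..n}" "i < j" for i j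
    unfolding row_prod_def by (rule prod_list_commute) (use that in \<open>auto intro: comm\<close>)
  have "k \<le> n \<Longrightarrow> ascending_prod (\<lambda>i. row_prod f n i * f i (Suc n)) k =
      ascending_prod (row_prod f n) k * ascending_prod (\<lambda>i. f i (Suc n)) k" for k
  proof (induction k)
    case (Suc k)
    let ?R = "row_prod f n (Suc k)" and ?C = "ascending_prod (\<lambda>i. f i (Suc n)) k"
    have c: "?R * ?C = ?C * ?R"
      by (rule ascending_prod_commute) (use Suc.prems gr in auto)
    have "ascending_prod (\<lambda>i. row_prod f n i * f i (Suc n)) (Suc k) =
        ascending_prod (row_prod f n) k * (?C * ?R) * f (Suc k) (Suc n)"
      using Suc by (simp add: mult.assoc)
    also have "\<dots> = ascending_prod (row_prod f n) (Suc k) * ascending_prod (\<lambda>i. f i (Suc n)) (Suc k)"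
      unfolding c[symmetric] by (simp add: mult.assoc)
    finally show ?case .
  qed simp
  moreover have "row_prod f (Suc n) (Suc n) = 1" by (simp add: row_prod_def)
  moreover have "ascending_prod (row_prod f (Suc n)) n = ascending_prod (\<lambda>i. row_prod f n i * f i (Suc n)) n"
    by (rule ascending_prod_cong) (rule row)
  ultimately show ?thesis by (simp add: lex_prod_rows)
qed

text \<open>
  The first product \<open>\<alpha>\<close> is pulled through the second product \<open>\<beta>\<close> column by column; by the
  Yang--Baxter equation this reverses the order inside the column of \<open>\<alpha>\<close>.
\<close>

lemma column_through_lex_prod:
  fixes \<alpha> \<beta> :: "nat \<Rightarrow> nat \<Rightarrow> 'a::monoid_mult"
  assumes comm: "\<And>i j k l. {i, j, k, l} \<subseteq> {1..n} \<Longrightarrow> distinct [i, j, k, l] \<Longrightarrow> \<alpha> i j * \<beta> k l = \<beta> k l * \<alpha> i j"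
    and comm': "\<And>i j k l. {i, j, k, l} \<subseteq> {1..n} \<Longrightarrow> distinct [i, j, k, l] \<Longrightarrow> \<beta> i j * \<beta> k l = \<beta> k l * \<beta> i j"
    and ybe: "\<And>i j m. 1 \<le> i \<Longrightarrow> i < j \<Longrightarrow> j < m \<Longrightarrow> m \<le> n \<Longrightarrow>
      \<alpha> i m * \<alpha> j m * \<beta> i j = \<beta> i j * \<alpha> j m * \<alpha> i m"
    and "k < m" "m \<le> n"
  shows "ascending_prod (\<lambda>i. \<alpha> i m) k * lex_prod \<beta> k = lex_prod \<beta> k * descending_prod (\<lambda>i. \<alpha> i m) k"
  using \<open>k < m\<close>
proof (induction k)
  case 0
  show ?case by (simp add: lex_prod_rows)
next
  case (Suc k)
  let ?X = "\<alpha> (Suc k) m"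
  have pass: "descending_prod (\<lambda>i. \<alpha> i m) l * ?X * ascending_prod (\<lambda>i. \<beta> i (Suc k)) l =
      ascending_prod (\<lambda>i. \<beta> i (Suc k)) l * ?X * descending_prod (\<lambda>i. \<alpha> i m) l" if "l \<le> k" for l
    using that
  proof (induction l)
    case (Suc l)
    let ?P = "ascending_prod (\<lambda>i. \<beta> i (Suc k)) l" and ?Q = "descending_prod (\<lambda>i. \<alpha> i m) l"
    let ?a = "\<alpha> (Suc l) m" and ?b = "\<beta> (Suc l) (Suc k)"
    have aP: "?a * ?P = ?P * ?a"
      by (rule ascending_prod_commute) (rule comm, use Suc.prems \<open>Suc k < m\<close> \<open>m \<le> n\<close> in auto)
    have Qb: "?b * ?Q = ?Q * ?b"
      by (rule descending_prod_commute) (rule comm[symmetric], use Suc.prems \<open>Suc k < m\<close> \<open>m \<le> n\<close> in auto)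
    have y: "?a * ?X * ?b = ?b * ?X * ?a"
      by (rule ybe) (use Suc.prems \<open>Suc k < m\<close> \<open>m \<le> n\<close> in auto)
    have "descending_prod (\<lambda>i. \<alpha> i m) (Suc l) * ?X * ascending_prod (\<lambda>i. \<beta> i (Suc k)) (Suc l) =
        ?a * (?Q * ?X * ?P) * ?b" by (simp add: mult.assoc)
    also have "\<dots> = (?a * ?P) * ?X * (?Q * ?b)" using Suc by (simp add: mult.assoc)
    also have "\<dots> = ?P * (?a * ?X * ?b) * ?Q" unfolding aP Qb[symmetric] by (simp add: mult.assoc)
    also have "\<dots> = ascending_prod (\<lambda>i. \<beta> i (Suc k)) (Suc l) * ?X * descending_prod (\<lambda>i. \<alpha> i m) (Suc l)"
      unfolding y by (simp add: mult.assoc)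
    finally show ?case .
  qed simp
  let ?C = "ascending_prod (\<lambda>i. \<beta> i (Suc k)) k"
  have lex: "lex_prod \<beta> (Suc k) = lex_prod \<beta> k * ?C"
    by (rule lex_prod_Suc, rule comm') (use \<open>Suc k < m\<close> \<open>m \<le> n\<close> in auto)
  have row: "?X * row_prod \<beta> k j = row_prod \<beta> k j * ?X" if "j \<in> {1..k}" for j
    unfolding row_prod_def
    by (rule prod_list_commute) (use that \<open>Suc k < m\<close> \<open>m \<le> n\<close> in \<open>auto intro!: comm\<close>)
  have X: "?X * lex_prod \<beta> k = lex_prod \<beta> k * ?X"
    unfolding lex_prod_rows by (rule ascending_prod_commute) (rule row)
  have "ascending_prod (\<lambda>i. \<alpha> i m) (Suc k) * lex_prod \<beta> (Suc k) =
      ascending_prod (\<lambda>i. \<alpha> i m) k * (?X * lex_prod \<beta> k) * ?C"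
    by (simp add: lex mult.assoc)
  also have "\<dots> = ascending_prod (\<lambda>i. \<alpha> i m) k * lex_prod \<beta> k * ?X * ?C"
    unfolding X by (simp add: mult.assoc)
  also have "\<dots> = lex_prod \<beta> k * (descending_prod (\<lambda>i. \<alpha> i m) k * ?X * ?C)"
    using Suc by (simp add: mult.assoc)
  also have "\<dots> = lex_prod \<beta> (Suc k) * descending_prod (\<lambda>i. \<alpha> i m) (Suc k)"
    unfolding pass[OF order_refl] lex by (simp add: mult.assoc)
  finally show ?case .
qed

lemma lex_prods_factorize:
  fixes \<alpha> \<beta> :: "nat \<Rightarrow> nat \<Rightarrow> 'a::monoid_mult"
  assumes comm: "\<And>i j k l. {i, j, k, l} \<subseteq> {1..n} \<Longrightarrow> distinct [i, j, k, l] \<Longrightarrow> \<alpha> i j * \<beta> k l = \<beta> k l * \<alpha> i j"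
    and comm': "\<And>i j k l. {i, j, k, l} \<subseteq> {1..n} \<Longrightarrow> distinct [i, j, k, l] \<Longrightarrow> \<beta> i j * \<beta> k l = \<beta> k l * \<beta> i j"
    and comm'': "\<And>i j k l. {i, j, k, l} \<subseteq> {1..n} \<Longrightarrow> distinct [i, j, k, l] \<Longrightarrow> \<alpha> i j * \<alpha> k l = \<alpha> k l * \<alpha> i j"
    and ybe: "\<And>i j m. 1 \<le> i \<Longrightarrow> i < j \<Longrightarrow> j < m \<Longrightarrow> m \<le> n \<Longrightarrow>
      \<alpha> i m * \<alpha> j m * \<beta> i j = \<beta> i j * \<alpha> j m * \<alpha> i m"
    and "r \<le> n"
  shows "lex_prod \<alpha> r * lex_prod \<beta> r =
    ascending_prod (\<lambda>m. descending_prod (\<lambda>i. \<alpha> i m) (m - 1) * ascending_prod (\<lambda>i. \<beta> i m) (m - 1)) r"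
  using \<open>r \<le> n\<close>
proof (induction r)
  case 0
  show ?case by (simp add: lex_prod_rows)
next
  case (Suc r)
  have "lex_prod \<alpha> (Suc r) = lex_prod \<alpha> r * ascending_prod (\<lambda>i. \<alpha> i (Suc r)) r"
    by (rule lex_prod_Suc, rule comm'') (use Suc.prems in auto)
  moreover have "lex_prod \<beta> (Suc r) = lex_prod \<beta> r * ascending_prod (\<lambda>i. \<beta> i (Suc r)) r"
    by (rule lex_prod_Suc, rule comm') (use Suc.prems in auto)
  moreover have "ascending_prod (\<lambda>i. \<alpha> i (Suc r)) r * lex_prod \<beta> r =
      lex_prod \<beta> r * descending_prod (\<lambda>i. \<alpha> i (Suc r)) r"
    by (rule column_through_lex_prod[where n = n]) (use comm comm' ybe Suc.prems in auto)
  ultimately have "lex_prod \<alpha> (Suc r) * lex_prod \<beta> (Suc r) = lex_prod \<alpha> r * lex_prod \<beta> r *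
      (descending_prod (\<lambda>i. \<alpha> i (Suc r)) r * ascending_prod (\<lambda>i. \<beta> i (Suc r)) r)"
    by (metis (no_types, lifting) mult.assoc)
  then show ?case using Suc by simp
qed

lemma diff_diff_eq_self_iff: "a - p - q = a \<longleftrightarrow> p + q = (0 :: 'a::ab_group_add)"
  unfolding diff_diff_eq diff_eq_eq by simp

section \<open>The fusion procedure in an algebra with Brauer relations\<close>

context brauer_relations
begin

lemma rho_op_commute:
  assumes "{i, j, k, l} \<subseteq> {1..N}" "distinct [i, j, k, l]"
  shows "rho_op i j u * rho_op k l v = rho_op k l v * rho_op i j u"
proof -
  have m: "i \<in> {1..N}" "j \<in> {1..N}" "k \<in> {1..N}" "l \<in> {1..N}" using assms(1) by simp_all
  have d: "distinct [k, l, i, j]" using assms(2) by auto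
  show ?thesis unfolding rho_op_def
    by (simp add: algebra_simps scl_algebra s_s_disjoint[OF m assms(2)] e_e_disjoint[OF m assms(2)]
      s_e_disjoint[OF m assms(2)] s_e_disjoint[OF m(3,4,1,2) d])
qed

lemma rho_op_sym: "i \<in> {1..N} \<Longrightarrow> j \<in> {1..N} \<Longrightarrow> i \<noteq> j \<Longrightarrow> rho_op i j u = rho_op j i u"
  by (simp add: rho_op_def s_sym e_sym)

text \<open>
  The factors of the two products in the fusion formula that involve the strand \<open>m\<close>, for the parameters
  \<open>c i\<close> and \<open>u\<close>.
\<close>

definition fusion_factor :: "nat \<Rightarrow> nat \<Rightarrow> (nat \<Rightarrow> 'k) \<Rightarrow> 'k \<Rightarrow> 'k endo" where
  "fusion_factor k m c u = descending_prod (\<lambda>i. rho_op i m ((\<delta> / 2 - 1) - c i - u)) k *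
     ascending_prod (\<lambda>i. rho_op i m (c i - u)) k"

lemma fusion_factor_Suc:
  "fusion_factor (Suc k) m c u =
    rho_op (Suc k) m ((\<delta> / 2 - 1) - c (Suc k) - u) * fusion_factor k m c u * rho_op (Suc k) m (c (Suc k) - u)"
  by (simp add: fusion_factor_def mult.assoc)

text \<open>
  Since \<open>(v i - v j) + (\<kappa> - v i - v m) = \<kappa> - v j - v m\<close>, the parameters satisfy the condition of the
  Yang--Baxter equation, which moves the factors with larger index \<open>m\<close> together.
\<close>

lemma Omega_factorize:
  assumes two: "(2 :: 'k) \<noteq> 0" and n: "n \<le> N"
    and generic: "\<And>i j. 1 \<le> i \<Longrightarrow> i < j \<Longrightarrow> j \<le> n \<Longrightarrow> v i - v j \<noteq> 0 \<and> v i - v j \<noteq> \<delta> / 2 - 1 \<and>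
      (\<delta> / 2 - 1) - v i - v j \<noteq> 0 \<and> v i + v j \<noteq> 0"
  shows "lex_prod (\<lambda>i j. rho_op i j ((\<delta> / 2 - 1) - v i - v j)) n * lex_prod (\<lambda>i j. rho_op i j (v i - v j)) n =
    ascending_prod (\<lambda>m. fusion_factor (m - 1) m v (v m)) n"
  unfolding fusion_factor_def
proof (rule lex_prods_factorize[where n = n])
  fix i j m assume ijm: "1 \<le> i" "i < j" "j < m" "m \<le> n"
  let ?k = "\<delta> / 2 - 1"
  have mem: "j \<in> {1..N}" "i \<in> {1..N}" "m \<in> {1..N}" "j \<noteq> i" "j \<noteq> m" "i \<noteq> m" using ijm n by auto
  have g: "v i - v j \<noteq> 0" "v i - v j \<noteq> ?k" "?k - v i - v m \<noteq> 0" "v i + v m \<noteq> 0"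
    "?k - v j - v m \<noteq> 0" "v j + v m \<noteq> 0"
    using generic[of i j] generic[of i m] generic[of j m] ijm by auto
  have eq: "(v i - v j) + (?k - v i - v m) = ?k - v j - v m" by simp
  have ne: "?k - v i - v m \<noteq> ?k" "?k - v j - v m \<noteq> ?k" using g(4,6) unfolding diff_diff_eq_self_iff by simp_all
  have "rho_op j i (v i - v j) * rho_op j m (?k - v j - v m) * rho_op i m (?k - v i - v m) =
      rho_op i m (?k - v i - v m) * rho_op j m (?k - v j - v m) * rho_op j i (v i - v j)"
    using rho_op_yang_baxter[OF mem two g(1,3)] g(2) g(5) ne unfolding eq by blast
  then show "rho_op i m (?k - v i - v m) * rho_op j m (?k - v j - v m) * rho_op i j (v i - v j) =
      rho_op i j (v i - v j) * rho_op j m (?k - v j - v m) * rho_op i m (?k - v i - v m)"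
    using rho_op_sym[OF mem(1,2,4)] by simp
qed (use n in \<open>auto intro!: rho_op_commute\<close>)

text \<open>
  One step of the fusion procedure between a joint eigenvector \<open>E\<close> of two consecutive Jucys--Murphy
  elements \<open>x\<close>, \<open>y\<close> and an eigenvector \<open>B\<close> of \<open>s x s = y - s + e\<close>. Evaluating \<open>E (s x s) B\<close> and
  \<open>E s (s x s) B\<close> in two ways gives linear relations between \<open>E B\<close>, \<open>E s B\<close> and \<open>E e B\<close>.
  Moreover \<open>E e\<close> vanishes unless the eigenvalues of \<open>E\<close> are opposite, since \<open>(x + y) e = 0\<close>.
  In the remaining cases the coefficients of both sides agree.
\<close>

lemma fusion_step:
  assumes n: "n \<ge> 1" "Suc n \<le> N" and two: "(2 :: 'k) \<noteq> 0"
    and c: "E * jm n = c \<odot> E" and a: "E * jm (Suc n) = a \<odot> E"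
    and u: "u - c \<noteq> 0" "u - c \<noteq> \<delta> / 2 - 1" "u + c \<noteq> 0" "u + c \<noteq> \<delta> / 2 - 1"
    and B: "s n (Suc n) * jm n * s n (Suc n) * B = b \<odot> B"
  shows "((u - a) * (u + b - (\<delta> / 2 - 1))) \<odot> (E * rho_op n (Suc n) ((\<delta> / 2 - 1) - c - u) * B) =
    ((u + a - (\<delta> / 2 - 1)) * (u - b)) \<odot> (E * rho_op n (Suc n) (u - c) * B)"
proof -
  define k where "k = \<delta> / 2 - 1"
  define S where "S = s n (Suc n)"
  define C where "C = e n (Suc n)"
  define X where "X = S * jm n * S"
  have nn: "n \<in> {1..N}" "Suc n \<in> {1..N}" "n \<noteq> Suc n" using n by auto
  have SS: "S * S = 1" unfolding S_def by (rule s_s[OF nn])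
  have X: "X = jm (Suc n) - S + C" unfolding X_def S_def C_def by (rule s_jm_conj[OF n])
  have XB: "X * B = b \<odot> B" using B by (simp add: X_def S_def)
  have EX: "E * X = a \<odot> E - E * S + E * C" by (simp add: X distrib_left right_diff_distrib a)
  have "S * X = jm n * S" unfolding X_def by (simp add: SS flip: mult.assoc)
  then have ESX: "E * S * X = c \<odot> (E * S)" by (simp add: mult.assoc) (simp add: c flip: mult.assoc)
  have "E * ((jm n + jm (Suc n)) * C) = 0"
    unfolding C_def e_jm_sum(2)[OF n two] by simp
  then have "(c + a) \<odot> (E * C) = 0"
    by (simp add: distrib_left distrib_right c a scl_add_left flip: mult.assoc)
  then have cases: "c + a = 0 \<or> E * C = 0" by (simp add: scl_eq_zero_iff)
  have z: "u - c - k \<noteq> 0" "k - c - u \<noteq> 0" "u + c - k \<noteq> 0" "u - c \<noteq> 0" "u + c \<noteq> 0" "- c - u \<noteq> 0"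
  proof -
    show 1: "u - c - k \<noteq> 0" "u + c - k \<noteq> 0" "u - c \<noteq> 0" "u + c \<noteq> 0" using u by (simp_all add: k_def)
    have "k - c - u = - (u + c - k)" "- c - u = - (u + c)" by simp_all
    then show "k - c - u \<noteq> 0" "- c - u \<noteq> 0" using 1 by (metis neg_equal_0_iff_equal)+
  qed
  have EB: "E * (X * B) = b \<odot> (E * B)" "E * S * (X * B) = b \<odot> (E * S * B)" "E * C * (X * B) = b \<odot> (E * C * B)"
    by (simp_all add: XB mult.assoc)
  have r1: "(b - a) \<odot> (E * B) = E * C * B - E * S * B"
    using EB(1) EX by (simp add: scl_diff_left algebra_simps flip: mult.assoc)
  have r2: "(b - c) \<odot> (E * S * B) = 0"
    using EB(2) ESX by (simp add: scl_diff_left algebra_simps flip: mult.assoc)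
  have expand: "E * rho_op n (Suc n) t * B =
      E * B - (1 / t) \<odot> (E * S * B) + (1 / (t - k)) \<odot> (E * C * B)" for t
    unfolding rho_op_def S_def C_def k_def by (simp add: algebra_simps)
  define A where "A = (u - a) * (u + b - k)"
  define A' where "A' = (u + a - k) * (u - b)"
  have AA: "A \<odot> (E * B) = A' \<odot> (E * B) + (2 * u - k) \<odot> (E * C * B - E * S * B)"
  proof -
    have "A = A' + (2 * u - k) * (b - a)" by (simp add: A_def A'_def algebra_simps)
    then show ?thesis unfolding r1[symmetric] by (simp add: scl_add_left)
  qed
  have S0: "(- (A * (1 / (k - c - u))) - (2 * u - k) + A' * (1 / (u - c))) \<odot> (E * S * B) = 0"
  proof (cases "E * S * B = 0")
    case False
    then have "b = c" using r2 by (simp add: scl_eq_zero_iff)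
    then have "A * (1 / (k - c - u)) = - (u - a)" "A' * (1 / (u - c)) = u + a - k"
      using z by (simp_all add: A_def A'_def field_simps)
    then show ?thesis by simp
  qed simp
  have C0: "(A * (1 / (- c - u)) + (2 * u - k) - A' * (1 / (u - c - k))) \<odot> (E * C * B) = 0"
    using cases
  proof
    assume "c + a = 0"
    then have "a = - c" by (simp add: eq_neg_iff_add_eq_0 add.commute)
    then have "A * (1 / (- c - u)) = - (u + b - k)" "A' * (1 / (u - c - k)) = u - b"
      using z by (simp_all add: A_def A'_def field_simps)
    then show ?thesis by simp
  qed simp
  have t: "k - c - u - k = - c - u" by simp
  have "A \<odot> (E * rho_op n (Suc n) (k - c - u) * B) - A' \<odot> (E * rho_op n (Suc n) (u - c) * B) =
      (- (A * (1 / (k - c - u))) - (2 * u - k) + A' * (1 / (u - c))) \<odot> (E * S * B) +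
      (A * (1 / (- c - u)) + (2 * u - k) - A' * (1 / (u - c - k))) \<odot> (E * C * B)"
    unfolding expand t scl_add_right scl_diff_right AA
    by (simp add: scl_algebra algebra_simps)
  then show ?thesis unfolding S0 C0 k_def[symmetric] A_def[symmetric] A'_def[symmetric] by simp
qed

text \<open>
  Induction on \<open>k\<close>. The factor of level \<open>k + 1\<close> consists of two elements \<open>\<rho>\<close> on the last two strands around
  the factor of level \<open>k\<close>, which acts on the last strand. Every eigenvector \<open>G (k + 1) a\<close> absorbs \<open>E k\<close>, so
  the induction hypothesis, conjugated by a transposition, replaces the inner factor by a function of the
  conjugated Jucys--Murphy element \<open>s x s\<close>. The fusion step turns it, together with the left \<open>\<rho>\<close>, into a
  function of the eigenvalue \<open>a\<close> and a factor \<open>\<rho>\<close> which is inverse to the right \<open>\<rho>\<close> up to a scalar.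
\<close>

theorem fusion_procedure:
  fixes E :: "nat \<Rightarrow> 'k endo" and G :: "nat \<Rightarrow> 'k \<Rightarrow> 'k endo" and A :: "nat \<Rightarrow> 'k set"
  assumes two: "(2 :: 'k) \<noteq> 0"
    and A0: "A 0 = {c 1}" "G 0 (c 1) = E 0"
    and decomp: "\<And>k. k \<le> r \<Longrightarrow> E k = (\<Sum>a\<in>A k. G k a)"
    and eigen: "\<And>k a. k \<le> r \<Longrightarrow> a \<in> A k \<Longrightarrow> G k a * jm (Suc k) = a \<odot> G k a"
    and eigen': "\<And>k a. 1 \<le> k \<Longrightarrow> k \<le> r \<Longrightarrow> a \<in> A k \<Longrightarrow> G k a * jm k = c k \<odot> G k a"
    and absorb: "\<And>k a. Suc k \<le> r \<Longrightarrow> a \<in> A (Suc k) \<Longrightarrow> G (Suc k) a * E k = G (Suc k) a"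
    and above: "\<And>k. k \<le> r \<Longrightarrow> bicentral k (E k)"
    and above': "\<And>k a. k \<le> r \<Longrightarrow> a \<in> A k \<Longrightarrow> bicentral (Suc k) (G k a)"
    and u: "\<And>k. 1 \<le> k \<Longrightarrow> k \<le> Suc r \<Longrightarrow> u - c k \<noteq> 0 \<and> u - c k \<noteq> \<delta> / 2 - 1 \<and> c k - u \<noteq> \<delta> / 2 - 1 \<and>
        u + c k \<noteq> 0 \<and> u + c k \<noteq> \<delta> / 2 - 1"
    and uA: "\<And>k a. k \<le> r \<Longrightarrow> a \<in> A k \<Longrightarrow> u \<noteq> a"
    and "Suc r \<le> N" "k \<le> r"
  shows "E k * fusion_factor k (Suc k) c u =
    ((u - c 1) / (u + c 1 - (\<delta> / 2 - 1)) * (\<Prod>i\<in>{1..k}. 1 - 1 / (u - c i) ^ 2)) \<odot>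
      (\<Sum>a\<in>A k. ((u + a - (\<delta> / 2 - 1)) / (u - a)) \<odot> G k a)"
  using \<open>k \<le> r\<close>
proof (induction k)
  case 0
  have "u - c 1 \<noteq> 0" "u + c 1 - (\<delta> / 2 - 1) \<noteq> 0" using u[of 1] by auto
  then show ?case by (simp add: A0[unfolded One_nat_def] fusion_factor_def)
next
  case (Suc k)
  let ?n = "Suc k" and ?n' = "Suc (Suc k)"
  define K where "K = \<delta> / 2 - 1"
  define F where "F = (u - c 1) / (u + c 1 - K) * (\<Prod>i\<in>{1..k}. 1 - 1 / (u - c i) ^ 2)"
  define S where "S = s ?n ?n'"
  define r1 where "r1 = rho_op ?n ?n' (K - c ?n - u)"
  define r2 where "r2 = rho_op ?n ?n' (c ?n - u)"
  define H where "H b = S * G k b * S" for b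
  have n: "?n \<ge> 1" "Suc ?n \<le> N" using Suc.prems \<open>Suc r \<le> N\<close> by auto
  have nn: "?n \<in> {1..N}" "?n' \<in> {1..N}" "?n \<noteq> ?n'" using n by auto
  have SS: "S * S = 1" unfolding S_def by (rule s_s[OF nn])
  have un: "u - c ?n \<noteq> 0" "u - c ?n \<noteq> K" "c ?n - u \<noteq> K" "u + c ?n \<noteq> 0" "u + c ?n \<noteq> K"
    using u[of ?n] Suc.prems by (auto simp: K_def)
  \<comment> \<open>Conjugation by \<open>S\<close> moves the fusion factor of the previous level to the last strand.\<close>
  have rho_conj: "S * rho_op i ?n t * S = rho_op i ?n' t" if "i \<in> {1..k}" for i t
  proof -
    have i: "i \<in> {1..N}" "?n \<noteq> i" "?n' \<noteq> i" using that n by auto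
    have "S * s ?n i = s ?n' i * S" "S * e ?n i = e ?n' i * S"
      using s_s_braid[OF nn(2,1) i(1) nn(3)[symmetric] i(3,2)] s_e_braid[OF nn(2,1) i(1) nn(3)[symmetric] i(3,2)]
      by (simp_all add: S_def s_sym[OF nn])
    then have "S * rho_op ?n i t = rho_op ?n' i t * S"
      by (simp add: rho_op_def algebra_simps)
    then have "S * rho_op ?n i t * S = rho_op ?n' i t" by (simp add: mult.assoc SS)
    then show ?thesis using rho_op_sym[OF nn(1) i(1,2)] rho_op_sym[OF nn(2) i(1,3)] by simp
  qed
  have conj_mult: "S * (X * Y) * S = (S * X * S) * (S * Y * S)" for X Y
  proof -
    have "(S * X * S) * (S * Y * S) = S * X * (S * S) * Y * S" by (simp only: mult.assoc)
    then show ?thesis by (simp add: SS mult.assoc)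
  qed
  have conj_asc: "l \<le> k \<Longrightarrow> S * ascending_prod (\<lambda>i. rho_op i ?n (f i)) l * S = ascending_prod (\<lambda>i. rho_op i ?n' (f i)) l" for l f
    by (induction l) (simp_all add: conj_mult rho_conj SS)
  have conj_desc: "l \<le> k \<Longrightarrow> S * descending_prod (\<lambda>i. rho_op i ?n (f i)) l * S = descending_prod (\<lambda>i. rho_op i ?n' (f i)) l" for l f
    by (induction l) (simp_all add: conj_mult rho_conj SS)
  have D: "fusion_factor k ?n' c u = S * fusion_factor k ?n c u * S"
    unfolding fusion_factor_def conj_mult by (simp add: conj_asc conj_desc)
  have Ek: "bicentral k (E k)" using above Suc.prems by simp
  have ES: "E k * S = S * E k" and Er: "E k * r1 = r1 * E k"
    unfolding S_def r1_def rho_op_def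
    using bicentral_commute_above[OF Ek nn(1,2,3)] by (simp_all add: algebra_simps)
  have SES: "S * E k * S = E k" using SS by (simp flip: ES add: mult.assoc)
  \<comment> \<open>The elements \<open>H b\<close> split \<open>E k\<close> into eigenvectors of the conjugated Jucys--Murphy element.\<close>
  have H_sum: "(\<Sum>b\<in>A k. H b) = E k"
  proof -
    have "(\<Sum>b\<in>A k. H b) = S * E k * S"
      using decomp[of k] Suc.prems by (simp add: H_def sum_distrib_left sum_distrib_right)
    then show ?thesis using SES by simp
  qed
  have IH: "E k * fusion_factor k ?n c u = F \<odot> (\<Sum>b\<in>A k. ((u + b - K) / (u - b)) \<odot> G k b)"
    using Suc by (simp add: F_def K_def)
  have "E k * fusion_factor k ?n' c u = S * (E k * fusion_factor k ?n c u) * S"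
    unfolding D by (simp add: mult.assoc[symmetric] ES)
  then have EkD: "E k * fusion_factor k ?n' c u = F \<odot> (\<Sum>b\<in>A k. ((u + b - K) / (u - b)) \<odot> H b)"
    unfolding IH by (simp add: H_def sum_distrib_left sum_distrib_right)
  have HX: "S * jm ?n * S * H b = b \<odot> H b" if "b \<in> A k" for b
  proof -
    have com: "jm ?n * G k b = G k b * jm ?n"
      by (rule bicentral_commute_jm[OF above', symmetric, of k b]) (use that Suc.prems n in auto)
    have "S * jm ?n * S * H b = S * (jm ?n * G k b) * S"
    proof -
      have "S * jm ?n * S * H b = S * jm ?n * (S * S) * G k b * S"
        unfolding H_def by (simp only: mult.assoc)
      then show ?thesis by (simp add: SS mult.assoc)
    qed
    then show ?thesis unfolding com using eigen[of k b] that Suc.prems by (simp add: H_def)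
  qed
  have step: "G ?n a * r1 * (((u + b - K) / (u - b)) \<odot> H b) =
      ((u + a - K) / (u - a)) \<odot> (G ?n a * rho_op ?n ?n' (u - c ?n) * H b)" if a: "a \<in> A ?n" and b: "b \<in> A k" for a b
  proof -
    have ne: "u - a \<noteq> 0" "u - b \<noteq> 0" using uA[of ?n a] uA[of k b] a b Suc.prems by auto
    have "((u - a) * (u + b - K)) \<odot> (G ?n a * r1 * H b) =
        ((u + a - K) * (u - b)) \<odot> (G ?n a * rho_op ?n ?n' (u - c ?n) * H b)"
      unfolding r1_def K_def
      by (rule fusion_step[OF n two])
        (use eigen'[of ?n a] eigen[of ?n a] a HX[OF b] un Suc.prems in \<open>simp_all add: S_def K_def\<close>)
    then have "(1 / ((u - a) * (u - b))) \<odot> ((u - a) * (u + b - K)) \<odot> (G ?n a * r1 * H b) =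
        (1 / ((u - a) * (u - b))) \<odot> ((u + a - K) * (u - b)) \<odot> (G ?n a * rho_op ?n ?n' (u - c ?n) * H b)"
      by simp
    moreover have "1 / ((u - a) * (u - b)) * ((u - a) * (u + b - K)) = (u + b - K) / (u - b)"
      "1 / ((u - a) * (u - b)) * ((u + a - K) * (u - b)) = (u + a - K) / (u - a)" using ne by simp_all
    ultimately show ?thesis by (simp only: scl_scl scl_mult_right)
  qed
  have inv: "rho_op ?n ?n' (u - c ?n) * r2 = (1 - 1 / (u - c ?n) ^ 2) \<odot> 1"
  proof -
    have "u - c ?n \<noteq> - K" using un(3) by (metis minus_diff_eq minus_minus)
    then show ?thesis
      using rho_op_inverse[OF nn two, of "u - c ?n"] un by (simp add: r2_def K_def)
  qed
  have Ga: "G ?n a * fusion_factor ?n ?n' c u =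
      (F * (1 - 1 / (u - c ?n) ^ 2)) \<odot> ((u + a - K) / (u - a)) \<odot> G ?n a" if a: "a \<in> A ?n" for a
  proof -
    have GE: "G ?n a * E k = G ?n a" using absorb a Suc.prems by simp
    have "G ?n a * fusion_factor ?n ?n' c u = G ?n a * E k * r1 * fusion_factor k ?n' c u * r2"
      unfolding GE by (simp add: fusion_factor_Suc r1_def r2_def K_def mult.assoc)
    also have "\<dots> = G ?n a * (E k * r1) * fusion_factor k ?n' c u * r2"
      by (simp only: mult.assoc)
    also have "\<dots> = G ?n a * r1 * (E k * fusion_factor k ?n' c u) * r2"
      unfolding Er by (simp only: mult.assoc)
    also have "\<dots> = F \<odot> ((\<Sum>b\<in>A k. G ?n a * r1 * (((u + b - K) / (u - b)) \<odot> H b)) * r2)"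
      unfolding EkD by (simp add: sum_distrib_left)
    also have "(\<Sum>b\<in>A k. G ?n a * r1 * (((u + b - K) / (u - b)) \<odot> H b)) =
        ((u + a - K) / (u - a)) \<odot> (G ?n a * rho_op ?n ?n' (u - c ?n) * (\<Sum>b\<in>A k. H b))"
      by (simp only: step[OF a] sum_distrib_left scl_sum_right cong: sum.cong)
    also have "G ?n a * rho_op ?n ?n' (u - c ?n) * (\<Sum>b\<in>A k. H b) =
        G ?n a * E k * rho_op ?n ?n' (u - c ?n)"
      unfolding H_sum rho_op_def
      using bicentral_commute_above[OF Ek nn(1,2,3)] by (simp add: algebra_simps)
    finally show ?thesis unfolding GE by (simp add: mult.assoc inv mult_ac)
  qed
  have "E ?n * fusion_factor ?n ?n' c u = (\<Sum>a\<in>A ?n. G ?n a * fusion_factor ?n ?n' c u)"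
    using decomp[of ?n] Suc.prems by (simp add: sum_distrib_right)
  also have "\<dots> = (F * (1 - 1 / (u - c ?n) ^ 2)) \<odot> (\<Sum>a\<in>A ?n. ((u + a - K) / (u - a)) \<odot> G ?n a)"
    unfolding scl_sum_right by (rule sum.cong[OF refl Ga])
  finally show ?case by (simp add: F_def K_def mult_ac)
qed

end

section \<open>Generating functions of operators\<close>

unbundle fps_syntax

definition fscalar :: "'k::field fps \<Rightarrow> 'k endo fps" where
  "fscalar z = Abs_fps (\<lambda>n. (z $ n) \<odot> 1)"

definition fscl :: "'k::field fps \<Rightarrow> 'k endo fps \<Rightarrow> 'k endo fps" (infixr "\<star>" 75) where
  "z \<star> A = fscalar z * A"

lemma scl_sum_left: "(\<Sum>i\<in>I. c i) \<odot> x = (\<Sum>i\<in>I. c i \<odot> x)"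
  by (induction I rule: infinite_finite_induct) (simp_all add: scl_add_left)

lemma fscalar_mult: "fscalar (z * w) = fscalar z * fscalar w"
  by (rule fps_ext)
    (simp add: fscalar_def fps_mult_nth scl_sum_left, intro sum.cong refl arg_cong2[where f = scl] mult.commute)

lemma fscalar_central: "A * fscalar z = fscalar z * A"
proof (rule fps_ext)
  fix n
  have "(\<Sum>i=0..n. A $ i * ((z $ (n - i)) \<odot> 1)) = (\<Sum>i=0..n. ((z $ i) \<odot> 1) * A $ (n - i))"
    by (rule sum.reindex_bij_witness[of _ "\<lambda>i. n - i" "\<lambda>i. n - i"]) auto
  then show "(A * fscalar z) $ n = (fscalar z * A) $ n"
    by (simp add: fscalar_def fps_mult_nth)
qed

lemma fscl_simps [simp]:
  "(z \<star> A) * B = z \<star> (A * B)" "A * (z \<star> B) = z \<star> (A * B)" "z \<star> w \<star> A = (z * w) \<star> A"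
  by (simp_all add: fscl_def fscalar_mult mult.assoc)
    (simp add: fscalar_central flip: mult.assoc)

lemma fscl_0 [simp]: "0 \<star> A = 0" and fscl_1 [simp]: "1 \<star> A = A" and fscl_0_right [simp]: "z \<star> 0 = 0"
proof -
  show "0 \<star> A = 0" by (simp add: fscl_def fscalar_def fps_eq_iff fps_mult_nth)
  have "fscalar 1 = (1 :: 'a endo fps)" by (rule fps_ext) (simp add: fscalar_def)
  then show "1 \<star> A = A" by (simp add: fscl_def)
qed (simp add: fscl_def)

lemma fscl_algebra:
  "z \<star> (A + B) = z \<star> A + z \<star> B" "z \<star> (A - B) = z \<star> A - z \<star> B" "z \<star> (- A) = - (z \<star> A)"
  "(z + w) \<star> A = z \<star> A + w \<star> A" "(z - w) \<star> A = z \<star> A - w \<star> A" "(- z) \<star> A = - (z \<star> A)"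
proof -
  have add: "fscalar (z + w) = fscalar z + fscalar w" for z w :: "'a fps"
    by (rule fps_ext) (simp add: fscalar_def scl_add_left)
  have diff: "fscalar (z - w) = fscalar z - fscalar w" for z w :: "'a fps"
    by (rule fps_ext) (simp add: fscalar_def scl_diff_left)
  have minus: "fscalar (- z) = - fscalar z" for z :: "'a fps"
    by (rule fps_ext) (simp add: fscalar_def scl_minus_left)
  show "z \<star> (A + B) = z \<star> A + z \<star> B" "z \<star> (A - B) = z \<star> A - z \<star> B" "z \<star> (- A) = - (z \<star> A)"
    by (simp_all add: fscl_def algebra_simps)
  show "(z + w) \<star> A = z \<star> A + w \<star> A" "(z - w) \<star> A = z \<star> A - w \<star> A" "(- z) \<star> A = - (z \<star> A)"
    by (simp_all add: fscl_def add diff minus algebra_simps)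
qed

lemma fscl_fps_X_nth: "(fps_X \<star> A) $ n = (if n = 0 then 0 else A $ (n - 1))"
proof -
  have "fscalar fps_X = (fps_X :: 'a endo fps)" by (rule fps_ext) (simp add: fscalar_def fps_X_def)
  then show ?thesis by (simp add: fscl_def)
qed

lemma fscl_const_nth: "(z \<star> fps_const A) $ n = (z $ n) \<odot> A"
  by (simp add: fscl_def fscalar_def)

text \<open>
  The geometric series of \<open>x\<close>, that is \<open>(1 - X x)\<^sup>-\<^sup>1\<close>.
\<close>

definition resolvent :: "'k::field endo \<Rightarrow> 'k endo fps" where
  "resolvent x = Abs_fps (\<lambda>n. x ^ n)"

lemma resolvent_left: "resolvent x = 1 + fps_X \<star> (fps_const x * resolvent x)"
proof (rule fps_ext)
  fix n show "resolvent x $ n = (1 + fps_X \<star> (fps_const x * resolvent x)) $ n"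
    by (cases n) (simp_all add: resolvent_def fscl_fps_X_nth)
qed

lemma resolvent_right: "resolvent x = 1 + fps_X \<star> (resolvent x * fps_const x)"
proof (rule fps_ext)
  fix n show "resolvent x $ n = (1 + fps_X \<star> (resolvent x * fps_const x)) $ n"
    by (cases n) (simp_all add: resolvent_def fscl_fps_X_nth power_commutes)
qed

lemma resolvent_inverse:
  "resolvent x - fps_X \<star> (fps_const x * resolvent x) = 1"
  "resolvent x - fps_X \<star> (resolvent x * fps_const x) = 1"
  by (subst (1) resolvent_left, simp) (subst (1) resolvent_right, simp)

lemma resolvent_commute: "a * x = x * a \<Longrightarrow> fps_const a * resolvent x = resolvent x * fps_const a"
  by (rule fps_ext) (simp add: resolvent_def power_commuting_commutes)

lemma resolvent_eigen:
  assumes "E * x = c \<odot> E"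
  shows "fps_const E * resolvent x = inverse (1 - fps_const c * fps_X) \<star> fps_const E"
proof -
  have "E * x ^ n = c ^ n \<odot> E" for n
  proof (induction n)
    case (Suc n)
    have "E * x ^ Suc n = E * x * x ^ n" by (simp add: mult.assoc)
    then show ?case by (simp add: assms Suc)
  qed simp
  then have "fps_const E * resolvent x = Abs_fps (\<lambda>n. c ^ n) \<star> fps_const E"
    by (intro fps_ext) (simp add: resolvent_def fscl_const_nth)
  also have "Abs_fps (\<lambda>n. c ^ n) = inverse (1 - fps_const c * fps_X)"
  proof (rule fps_inverse_unique[symmetric])
    show "(1 - fps_const c * fps_X) * Abs_fps (\<lambda>n. c ^ n) = 1"
    proof (rule fps_ext)
      fix n show "((1 - fps_const c * fps_X) * Abs_fps (\<lambda>n. c ^ n)) $ n = 1 $ n"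
        by (cases n) (simp_all add: left_diff_distrib mult.assoc)
    qed
  qed
  finally show ?thesis .
qed

text \<open>
  The recursion for the generating function of the elements \<open>e y\<^sup>k e\<close>, where \<open>x\<close>, \<open>y\<close> are
  consecutive Jucys--Murphy elements, \<open>s\<close>, \<open>d\<close> are the generators on their two strands, and \<open>e\<close>
  and \<open>d'\<close> connect these strands to the next strand. It follows from the commutation relation
  \<open>y s = s x + 1 - d\<close>, which gives
  \<open>(1 - X y)\<^sup>-\<^sup>1 s = s (1 - X x)\<^sup>-\<^sup>1 + X (1 - X y)\<^sup>-\<^sup>1 (1 - X x)\<^sup>-\<^sup>1 - X (1 + X x)\<^sup>-\<^sup>1 d (1 - X x)\<^sup>-\<^sup>1\<close>.
\<close>

lemma resolvent_recursion:
  fixes x y s d d' e E F :: "'k::field endo" and z i j :: "'k fps"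
  assumes xy: "x * y = y * x" and ys: "y * s = s * x + 1 - d" and ss: "s * s = 1"
    and yd: "y * d = - (x * d)" and dy: "d * y = - (d * x)" and ds: "d * s = d"
    and ex: "e * x = x * e" and ese: "e * s * e = e" and ede: "e * d * e = e"
    and es: "e * s = e * d'" and se: "s * e = d' * e" and ed'e: "e * d' * e = e"
    and Fe: "F * e = e * F"
    and Fd: "fps_const (F * d) * resolvent x * fps_const d = z \<star> fps_const (F * d)"
    and Fd': "fps_const (F * d') * resolvent x * fps_const d' = z \<star> fps_const (F * d')"
    and EF: "E * F = E" and Ee: "E * e = e * E"
    and i: "fps_const E * resolvent x = i \<star> fps_const E"
    and j: "fps_const E * resolvent (- x) = j \<star> fps_const E"
  shows "(1 - fps_X * fps_X * i * i) \<star> (fps_const (E * e) * resolvent y * fps_const e) =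
    (z + fps_X * i * i - fps_X * fps_X * i * i * j - fps_X * j * j + fps_X * fps_X * i * j * j
       - fps_X * fps_X * z * j * j) \<star> fps_const (E * e)"
proof -
  let ?c = "fps_const :: 'k endo \<Rightarrow> 'k endo fps"
  let ?X = "fps_X :: 'k fps"
  let ?I = "resolvent x" and ?J = "resolvent (- x)" and ?Y = "resolvent y" and ?Y' = "resolvent (- y)"
  \<comment> \<open>The commutation of \<open>s\<close> past the resolvent, for the parameter \<open>X\<close> and for \<open>-X\<close>.\<close>
  have pass: "resolvent y * ?c s = ?c s * resolvent x + fps_X \<star> (resolvent y * resolvent x)
      - fps_X \<star> (resolvent (- x) * ?c d * resolvent x)"
    if "x * y = y * x" "y * s = s * x + 1 - d" "y * d = - (x * d)" for x y s d :: "'k endo"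
  proof -
    define P where "P = 1 - fps_X \<star> ?c y"
    have Pl: "P * resolvent y = 1" by (simp add: P_def left_diff_distrib resolvent_inverse)
    have Pr: "resolvent y * P = 1" by (simp add: P_def right_diff_distrib resolvent_inverse)
    have yJ: "?c y * resolvent (- x) = resolvent (- x) * ?c y"
      by (rule resolvent_commute) (simp add: that)
    have "resolvent (- x) * ?c d + fps_X \<star> (resolvent (- x) * ?c (x * d)) = ?c d"
    proof -
      have "resolvent (- x) = 1 + fps_X \<star> (resolvent (- x) * fps_const (- x))" by (rule resolvent_right)
      then have "resolvent (- x) * ?c d = ?c d + fps_X \<star> (resolvent (- x) * ?c (- x)) * ?c d"
        by (metis distrib_right mult_1)
      then show ?thesis by (simp add: mult.assoc fscl_algebra flip: fps_const_neg)
    qed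
    then have k1: "resolvent (- x) * ?c d - fps_X \<star> (?c y * resolvent (- x) * ?c d) = ?c d"
      unfolding yJ by (simp add: mult.assoc that(3) fscl_algebra flip: fps_const_neg)
    have k2: "P * ?c s * resolvent x = ?c s - fps_X \<star> ((1 - ?c d) * resolvent x)"
    proof -
      have "P * ?c s = ?c s - fps_X \<star> ?c (y * s)" by (simp add: P_def left_diff_distrib)
      also have "\<dots> = ?c s * (1 - fps_X \<star> ?c x) - fps_X \<star> (1 - ?c d)"
        unfolding that(2) by (simp add: algebra_simps fscl_algebra fps_const_add[symmetric] fps_const_sub[symmetric] fps_const_mult[symmetric]
          del: fps_const_add fps_const_sub fps_const_mult)
      finally have Ps: "P * ?c s = ?c s * (1 - fps_X \<star> ?c x) - fps_X \<star> (1 - ?c d)" .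
      have "P * ?c s * resolvent x = ?c s * ((1 - fps_X \<star> ?c x) * resolvent x) - fps_X \<star> ((1 - ?c d) * resolvent x)"
        unfolding Ps by (simp only: left_diff_distrib mult.assoc fscl_simps)
      moreover have "(1 - fps_X \<star> ?c x) * resolvent x = 1"
        by (simp add: left_diff_distrib resolvent_inverse)
      ultimately show ?thesis by simp
    qed
    let ?R = "?c s * resolvent x + fps_X \<star> (resolvent y * resolvent x)
      - fps_X \<star> (resolvent (- x) * ?c d * resolvent x)"
    have "P * ?R = P * ?c s * resolvent x + fps_X \<star> (P * resolvent y * resolvent x)
        - fps_X \<star> (P * resolvent (- x) * ?c d * resolvent x)"
      by (simp add: algebra_simps)
    also have "P * resolvent (- x) * ?c d = ?c d"
      using k1 by (simp add: P_def left_diff_distrib)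
    finally have "P * ?R = ?c s" unfolding k2 Pl by (simp add: algebra_simps fscl_algebra)
    then have "resolvent y * ?c s = resolvent y * P * ?R" by (simp add: mult.assoc)
    then show ?thesis unfolding Pr by simp
  qed
  have pass1: "?Y * ?c s = ?c s * ?I + ?X \<star> (?Y * ?I) - ?X \<star> (?J * ?c d * ?I)"
    by (rule pass[OF xy ys yd])
  have pass2: "?Y' * ?c s = ?c s * ?J - ?X \<star> (?Y' * ?J) + ?X \<star> (?I * ?c d * ?J)"
  proof -
    have "?Y' * ?c (- s) = ?c (- s) * ?J + ?X \<star> (?Y' * ?J) - ?X \<star> (resolvent (- (- x)) * ?c d * ?J)"
      by (rule pass) (simp_all add: xy ys yd)
    then have "- (?Y' * ?c s) = - (?c s * ?J) + ?X \<star> (?Y' * ?J) - ?X \<star> (?I * ?c d * ?J)"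
      by (simp flip: fps_const_neg)
    then have "?Y' * ?c s = - (- (?c s * ?J) + ?X \<star> (?Y' * ?J) - ?X \<star> (?I * ?c d * ?J))"
      by (metis minus_minus)
    then show ?thesis by simp
  qed
  define w where "w = ?c (E * e)"
  have w_eq: "w = ?c E * ?c e" "w = ?c e * ?c E" by (simp_all add: w_def Ee)
  have eI: "?c e * ?I = ?I * ?c e" and eJ: "?c e * ?J = ?J * ?c e"
    by (rule resolvent_commute; simp add: ex)+
  have wI: "w * ?I = i \<star> w" and wJ: "w * ?J = j \<star> w"
    by (simp_all only: w_eq(2) mult.assoc i j fscl_simps)
  have wF: "w * ?c F = w"
  proof -
    have "E * e * F = E * F * e" by (simp add: mult.assoc Fe)
    then show ?thesis by (simp add: w_def EF)
  qed
  have wse: "w * ?c s * ?c e = w" and wde: "w * ?c d * ?c e = w" and wd'e: "w * ?c d' * ?c e = w"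
    using ese ede ed'e by (simp_all add: w_def mult.assoc)
  have YI: "?Y * ?I = ?I * ?Y"
  proof (rule fps_ext)
    fix n
    have com: "y ^ p * x ^ q = x ^ q * y ^ p" for p q
      by (rule power_commuting_commutes[OF power_commuting_commutes[OF xy[symmetric], symmetric], symmetric])
    have "(\<Sum>p=0..n. y ^ p * x ^ (n - p)) = (\<Sum>p=0..n. x ^ p * y ^ (n - p))"
      by (rule sum.reindex_bij_witness[of _ "\<lambda>p. n - p" "\<lambda>p. n - p"]) (auto simp: com)
    then show "(?Y * ?I) $ n = (?I * ?Y) $ n" by (simp add: resolvent_def fps_mult_nth)
  qed
  have dI: "?c d * ?I = ?c d * ?Y'"
  proof (rule fps_ext)
    fix n
    have "d * x ^ n = d * (- y) ^ n"
    proof (induction n)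
      case (Suc n)
      have "d * x ^ Suc n = - (d * y) * x ^ n" by (simp add: dy mult.assoc)
      also have "\<dots> = d * x ^ n * (- y)"
        using power_commuting_commutes[OF xy, of n] by (simp add: mult.assoc)
      finally show ?case by (simp add: Suc power_Suc2 mult.assoc del: power_Suc)
    qed simp
    then show "(?c d * ?I) $ n = (?c d * ?Y') $ n" by (simp add: resolvent_def)
  qed
  define q where "q = w * ?Y * ?c e"
  have ws: "w * ?c s = w * ?c d'" and se': "?c s * ?c e = ?c d' * ?c e"
    and cs: "?c s * ?c s = 1" and cds: "?c d * ?c s = ?c d"
    by (simp_all add: w_def es se ss ds mult.assoc)
  note fps_const_mult [simp del]
  have wdIe: "w * ?c d * ?I * ?c e = i \<star> w"
    by (simp add: mult.assoc flip: eI) (simp add: wde wI flip: mult.assoc)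
  have wsIe: "w * ?c s * ?I * ?c e = i \<star> w"
    by (simp add: mult.assoc flip: eI) (simp add: wse wI flip: mult.assoc)
  have wYI: "w * (?Y * ?I) = i \<star> (w * ?Y)"
    unfolding YI by (simp add: wI flip: mult.assoc)
  have wYs: "w * ?Y * ?c s = w * ?c s * ?I + (?X * i) \<star> (w * ?Y) - (?X * j) \<star> (w * ?c d * ?I)"
  proof -
    have "w * ?Y * ?c s = w * (?Y * ?c s)" by (simp add: mult.assoc)
    also have "\<dots> = w * ?c s * ?I + ?X \<star> (w * (?Y * ?I)) - ?X \<star> (w * ?J * ?c d * ?I)"
      unfolding pass1 by (simp add: distrib_left right_diff_distrib mult.assoc)
    finally show ?thesis unfolding wYI wJ by simp
  qed
  have wYse: "w * ?Y * ?c s * ?c e = i \<star> w + (?X * i) \<star> q - (?X * j * i) \<star> w"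
    unfolding wYs by (simp add: distrib_right left_diff_distrib wsIe wdIe q_def)
  have T1: "w * ?c s * ?I * ?c s * ?c e = z \<star> w"
  proof -
    have "w * ?c s * ?I * ?c s * ?c e = w * ?c F * ?c d' * ?I * ?c d' * ?c e"
      unfolding wF ws by (simp add: mult.assoc se')
    also have "\<dots> = w * (?c (F * d') * ?I * ?c d') * ?c e" by (simp add: mult.assoc flip: fps_const_mult)
    also have "\<dots> = z \<star> (w * ?c F * ?c d' * ?c e)" unfolding Fd' by (simp add: mult.assoc flip: fps_const_mult)
    finally show ?thesis unfolding wF wd'e .
  qed
  have T4: "w * ?c d * ?I * ?c s * ?c e = j \<star> w - (?X * i * j) \<star> w + (?X * z * j) \<star> w"
  proof -
    have "w * ?c d * ?I * ?c s * ?c e = w * ?c d * (?Y' * ?c s) * ?c e"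
      using dI by (simp add: mult.assoc)
    also have "\<dots> = w * (?c d * ?c s) * ?J * ?c e - ?X \<star> (w * (?c d * ?Y') * ?J * ?c e)
        + ?X \<star> (w * ?c d * ?I * ?c d * ?J * ?c e)"
      unfolding pass2 by (simp add: distrib_left distrib_right right_diff_distrib left_diff_distrib mult.assoc)
    also have "w * (?c d * ?c s) * ?J * ?c e = w * ?c d * ?c e * ?J"
      unfolding cds by (simp add: mult.assoc eJ)
    also have "w * (?c d * ?Y') * ?J * ?c e = w * ?c d * ?I * ?c e * ?J"
      unfolding dI[symmetric] by (simp add: mult.assoc eJ)
    also have "w * ?c d * ?I * ?c d * ?J * ?c e = z \<star> (w * ?c d * ?c e * ?J)"
    proof -
      have "w * ?c d * ?I * ?c d * ?J * ?c e = w * ?c F * ?c d * ?I * ?c d * ?J * ?c e" unfolding wF ..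
      also have "\<dots> = w * (?c (F * d) * ?I * ?c d) * ?J * ?c e" by (simp add: mult.assoc flip: fps_const_mult)
      also have "\<dots> = z \<star> (w * ?c F * ?c d * ?c e * ?J)"
        unfolding Fd by (simp add: mult.assoc eJ flip: fps_const_mult)
      finally show ?thesis unfolding wF .
    qed
    finally show ?thesis unfolding wdIe wde by (simp add: wJ mult_ac)
  qed
  \<comment> \<open>Insert \<open>s * s = 1\<close> and pass both factors through the resolvent, one after the other.\<close>
  have "w * ?Y = w * ?Y * ?c s * ?c s" by (simp add: mult.assoc cs)
  then have "q = w * ?Y * ?c s * ?c s * ?c e" by (simp add: q_def)
  also have "\<dots> = w * ?c s * ?I * ?c s * ?c e + (?X * i) \<star> (w * ?Y * ?c s * ?c e)
      - (?X * j) \<star> (w * ?c d * ?I * ?c s * ?c e)"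
    by (subst wYs) (simp add: distrib_right left_diff_distrib)
  finally have q: "q = z \<star> w + (?X * i) \<star> (i \<star> w + (?X * i) \<star> q - (?X * j * i) \<star> w)
      - (?X * j) \<star> (j \<star> w - (?X * i * j) \<star> w + (?X * z * j) \<star> w)"
    unfolding T1 T4 wYse .
  have "(1 - ?X * ?X * i * i) \<star> q = q - (?X * i) \<star> (?X * i) \<star> q"
    by (simp add: fscl_algebra mult_ac)
  also have "\<dots> = (z + ?X * i * i - ?X * ?X * i * i * j - ?X * j * j + ?X * ?X * i * j * j
       - ?X * ?X * z * j * j) \<star> w"
    by (subst (1) q) (simp add: fscl_algebra algebra_simps)
  finally show ?thesis unfolding q_def w_def .
qed

text \<open>
  The denominator of the generating function of \<open>y\<^sup>k\<close>: multiplying by the product of \<open>1 - a X\<close>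
  over \<open>a \<in> A\<close> turns the coefficients into multiples of \<open>\<Prod>a. (y - a)\<close>.
\<close>

definition root_fps :: "'k::field set \<Rightarrow> 'k fps" where
  "root_fps A = (\<Prod>a\<in>A. 1 - fps_const a * fps_X)"

lemma root_fps_resolvent_nth:
  assumes "finite A" "card A \<le> k"
  shows "(root_fps A \<star> resolvent y) $ k = peval y (root_poly A) * y ^ (k - card A)"
  using assms
proof (induction A arbitrary: k rule: finite_induct)
  case empty
  then show ?case by (simp add: root_fps_def root_poly_def resolvent_def)
next
  case (insert a A)
  then obtain l where k: "k = Suc l" "card A \<le> l" by (cases k) auto
  let ?B = "root_fps A \<star> resolvent y"
  have "root_fps (insert a A) \<star> resolvent y = ?B - fps_X \<star> fps_const a \<star> ?B"
    using insert(1,2) by (simp add: root_fps_def fscl_algebra left_diff_distrib mult_ac)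
  also have "\<dots> $ k = ?B $ k - a \<odot> (?B $ l)"
  proof -
    have "(fps_const a \<star> B) $ l = a \<odot> (B $ l)" for B :: "'a endo fps"
    proof -
      have "fscalar (fps_const a) = fps_const (a \<odot> 1)" by (rule fps_ext) (simp add: fscalar_def)
      then show ?thesis by (simp add: fscl_def)
    qed
    then show ?thesis
      by (simp only: fps_sub_nth fscl_fps_X_nth k nat.distinct if_False diff_Suc_1)
  qed
  also have "?B $ k = peval y (root_poly A) * (y * y ^ (l - card A))"
    using insert.IH[of k] k by (simp add: Suc_diff_le)
  also have "?B $ l = peval y (root_poly A) * y ^ (l - card A)"
    using insert.IH[of l] k by simp
  also have "peval y (root_poly A) * (y * y ^ (l - card A)) - a \<odot> (peval y (root_poly A) * y ^ (l - card A)) =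
      peval y (root_poly A) * (y - a \<odot> 1) * y ^ (l - card A)"
    by (simp add: algebra_simps)
  also have "peval y (root_poly A) * (y - a \<odot> 1) = peval y (root_poly (insert a A))"
  proof -
    have "root_poly (insert a A) = root_poly A * [:- a, 1:]"
      using insert(1,2) by (simp add: root_poly_def mult.commute)
    then show ?thesis by (simp only: peval_mult peval_pCons) (simp add: scl_minus_left)
  qed
  finally show ?case using insert k by simp
qed

lemma root_fps_nth:
  assumes "finite A"
  shows "card A < k \<Longrightarrow> root_fps A $ k = 0" "root_fps A $ card A = (\<Prod>a\<in>A. - a)" "root_fps A $ 0 = 1"
proof -
  have *: "(\<forall>k > card A. root_fps A $ k = 0) \<and> root_fps A $ card A = (\<Prod>a\<in>A. - a) \<and> root_fps A $ 0 = 1"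
    using assms
  proof (induction A rule: finite_induct)
    case empty
    then show ?case by (auto simp: root_fps_def)
  next
    case (insert a A)
    have "root_fps (insert a A) = root_fps A - fps_const a * (fps_X * root_fps A)"
      using insert(1,2) by (simp add: root_fps_def left_diff_distrib mult.assoc)
    then show ?case using insert by (auto simp: less_Suc_eq_0_disj gr0_conv_Suc)
  qed
  then show "card A < k \<Longrightarrow> root_fps A $ k = 0" "root_fps A $ card A = (\<Prod>a\<in>A. - a)" "root_fps A $ 0 = 1"
    by blast+
qed

section \<open>Contents of Young diagrams\<close>

definition downset :: "box set \<Rightarrow> bool" where
  "downset \<mu> \<longleftrightarrow> finite \<mu> \<and> (\<forall>(i, j)\<in>\<mu>. 1 \<le> i \<and> 1 \<le> j \<and>
    (\<forall>i' j'. 1 \<le> i' \<longrightarrow> i' \<le> i \<longrightarrow> 1 \<le> j' \<longrightarrow> j' \<le> j \<longrightarrow> (i', j') \<in> \<mu>))"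

lemma downsetD:
  "downset \<mu> \<Longrightarrow> (i, j) \<in> \<mu> \<Longrightarrow> 1 \<le> i' \<Longrightarrow> i' \<le> i \<Longrightarrow> 1 \<le> j' \<Longrightarrow> j' \<le> j \<Longrightarrow> (i', j') \<in> \<mu>"
  unfolding downset_def by blast

definition row_length :: "box set \<Rightarrow> nat \<Rightarrow> nat" where
  "row_length \<mu> i = card {j. (i, j) \<in> \<mu>}"

lemma initial_segment:
  fixes S :: "nat set"
  assumes "finite S" "\<And>j. j \<in> S \<Longrightarrow> 1 \<le> j" "\<And>j j'. j \<in> S \<Longrightarrow> 1 \<le> j' \<Longrightarrow> j' \<le> j \<Longrightarrow> j' \<in> S"
  shows "j \<in> S \<longleftrightarrow> 1 \<le> j \<and> j \<le> card S"
proof (cases "S = {}")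
  case False
  have "j \<in> S \<longleftrightarrow> j \<in> {1..Max S}" for j
    using assms(2)[of j] assms(3)[OF Max_in[OF assms(1) False], of j] Max_ge[OF assms(1), of j]
    by (metis atLeastAtMost_iff)
  then have "S = {1..Max S}" by (rule set_eqI)
  then have "card S = Max S" by (metis card_atLeastAtMost diff_Suc_1 One_nat_def)
  then show ?thesis using \<open>S = {1..Max S}\<close> by (metis atLeastAtMost_iff)
qed auto

lemma downset_row:
  assumes "downset \<mu>" shows "(i, j) \<in> \<mu> \<longleftrightarrow> 1 \<le> i \<and> 1 \<le> j \<and> j \<le> row_length \<mu> i"
proof (cases "1 \<le> i")
  case True
  have "finite \<mu>" using assms by (simp add: downset_def)
  moreover have "{j. (i, j) \<in> \<mu>} \<subseteq> snd ` \<mu>" by force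
  ultimately have fin: "finite {j. (i, j) \<in> \<mu>}" by (meson finite_imageI finite_subset)
  have "j \<in> {j. (i, j) \<in> \<mu>} \<longleftrightarrow> 1 \<le> j \<and> j \<le> card {j. (i, j) \<in> \<mu>}"
  proof (rule initial_segment[OF fin])
    show "1 \<le> j" if "j \<in> {j. (i, j) \<in> \<mu>}" for j using that assms unfolding downset_def by blast
    show "j' \<in> {j. (i, j) \<in> \<mu>}" if "j \<in> {j. (i, j) \<in> \<mu>}" "1 \<le> j'" "j' \<le> j" for j j'
      using that downsetD[OF assms, of i j i j'] True by simp
  qed
  then show ?thesis using True by (simp add: row_length_def)
next
  case False
  then show ?thesis using assms unfolding downset_def by blast
qed

lemma downset_rows:
  assumes "finite \<mu>" "\<And>i j. (i, j) \<in> \<mu> \<longleftrightarrow> 1 \<le> i \<and> 1 \<le> j \<and> j \<le> l i"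
    "\<And>i. 1 \<le> i \<Longrightarrow> l (Suc i) \<le> l i"
  shows "downset \<mu>"
proof -
  have mono: "l i \<le> l i'" if "1 \<le> i'" "i' \<le> i" for i i'
    using that(2)
  proof (induction i rule: dec_induct)
    case (step m)
    have "1 \<le> m" using step.hyps(1) that(1) by linarith
    then have "l (Suc m) \<le> l m" by (rule assms(3))
    then show ?case using step.IH by linarith
  qed simp
  show ?thesis unfolding downset_def
  proof (intro conjI ballI, rule assms(1), clarify)
    fix i j assume "(i, j) \<in> \<mu>"
    then have ij: "1 \<le> i" "1 \<le> j" "j \<le> l i" by (auto simp: assms(2))
    show "1 \<le> i \<and> 1 \<le> j \<and> (\<forall>i' j'. 1 \<le> i' \<longrightarrow> i' \<le> i \<longrightarrow> 1 \<le> j' \<longrightarrow> j' \<le> j \<longrightarrow> (i', j') \<in> \<mu>)"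
      using ij mono[of _ i] by (auto simp: assms(2)) (meson order_trans)
  qed
qed

lemma row_length_mono:
  assumes "downset \<mu>" "1 \<le> i" "i \<le> i'" shows "row_length \<mu> i' \<le> row_length \<mu> i"
proof (cases "row_length \<mu> i'")
  case (Suc k)
  then have pos: "1 \<le> row_length \<mu> i'" by simp
  then have "(i', row_length \<mu> i') \<in> \<mu>" unfolding downset_row[OF assms(1)] using assms(2,3) by simp
  then have "(i, row_length \<mu> i') \<in> \<mu>" by (rule downsetD[OF assms(1) _ assms(2,3) pos order_refl])
  then show ?thesis unfolding downset_row[OF assms(1)] by simp
qed simp

lemma downset_num_rows:
  assumes "downset \<mu>"
  obtains l where "\<And>i. 1 \<le> i \<Longrightarrow> 0 < row_length \<mu> i \<longleftrightarrow> i \<le> l"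
proof -
  have "finite \<mu>" using assms by (simp add: downset_def)
  moreover have "{i. (i, 1) \<in> \<mu>} \<subseteq> fst ` \<mu>" by force
  ultimately have fin: "finite {i. (i, 1) \<in> \<mu>}" by (meson finite_imageI finite_subset)
  define l where "l = card {i. (i, 1) \<in> \<mu>}"
  have mem: "i \<in> {i. (i, 1) \<in> \<mu>} \<longleftrightarrow> 1 \<le> i \<and> i \<le> l" for i
    unfolding l_def
  proof (rule initial_segment[OF fin])
    show "1 \<le> i" if "i \<in> {i. (i, 1) \<in> \<mu>}" for i using that downset_row[OF assms, of i 1] by simp
    show "i' \<in> {i. (i, 1) \<in> \<mu>}" if "i \<in> {i. (i, 1) \<in> \<mu>}" "1 \<le> i'" "i' \<le> i" for i i'
      using that downsetD[OF assms, of i 1 i' 1] by simp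
  qed
  have rows: "0 < row_length \<mu> i \<longleftrightarrow> i \<le> l" if i: "1 \<le> i" for i
  proof -
    have "(i, 1) \<in> \<mu> \<longleftrightarrow> 1 \<le> row_length \<mu> i"
      unfolding downset_row[OF assms, of i 1] using i by simp
    then show ?thesis using mem[of i] i by (simp only: mem_Collect_eq simp_thms) linarith
  qed
  show ?thesis by (rule that) (rule rows)
qed

lemma is_young_diagram_iff: "is_young_diagram \<mu> \<longleftrightarrow> downset \<mu>"
proof
  assume "is_young_diagram \<mu>"
  then obtain p where p: "is_partition p" "\<mu> = young_diagram p" by (auto simp: is_young_diagram_def)
  define l where "l i = (if i \<in> {1..length p} then p ! (i - 1) else 0)" for i
  have mem: "(i, j) \<in> \<mu> \<longleftrightarrow> 1 \<le> i \<and> 1 \<le> j \<and> j \<le> l i" for i j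
    by (auto simp: p(2) young_diagram_def l_def)
  have "\<mu> = Sigma {1..length p} (\<lambda>i. {1..p ! (i - 1)})"
    by (auto simp: p(2) young_diagram_def)
  then have "finite \<mu>" by simp
  moreover have "l (Suc i) \<le> l i" if "1 \<le> i" for i
  proof (cases "Suc i \<le> length p")
    case True
    have "sorted_wrt (\<ge>) p" using p(1) by (simp add: is_partition_def)
    then have "p ! (i - 1) \<ge> p ! i"
      by (rule sorted_wrt_nth_less) (use that True in auto)
    then show ?thesis using that True by (simp add: l_def)
  qed (simp add: l_def)
  ultimately show "downset \<mu>" using mem by (intro downset_rows)
next
  assume d: "downset \<mu>"
  obtain l where l: "\<And>i. 1 \<le> i \<Longrightarrow> 0 < row_length \<mu> i \<longleftrightarrow> i \<le> l" using downset_num_rows[OF d] by blast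
  define p where "p = map (row_length \<mu>) [1..<l + 1]"
  have len: "length p = l" by (simp add: p_def)
  have nth: "p ! k = row_length \<mu> (Suc k)" if "k < l" for k
    using that unfolding p_def by (subst nth_map) (simp_all add: nth_upt del: upt_Suc)
  have "sorted_wrt (\<ge>) p"
    by (auto simp: sorted_wrt_iff_nth_less len nth intro: row_length_mono[OF d])
  moreover have "0 \<notin> set p"
  proof
    assume "0 \<in> set p"
    then obtain i where "0 = row_length \<mu> i" "i \<in> {1..<l + 1}"
      unfolding p_def set_map set_upt by (rule imageE)
    then show False using l[of i] by auto
  qed
  moreover have "\<mu> = young_diagram p"
  proof (intro set_eqI iffI)
    fix x assume x: "x \<in> \<mu>"
    obtain i j where ij: "x = (i, j)" by (cases x)
    then have "1 \<le> i" "1 \<le> j" "j \<le> row_length \<mu> i" using x downset_row[OF d] by auto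
    moreover from this have "i \<le> l" using l[of i] by linarith
    ultimately show "x \<in> young_diagram p"
      using nth[of "i - 1"] by (auto simp: young_diagram_def len ij)
  next
    fix x assume x: "x \<in> young_diagram p"
    obtain i j where ij: "x = (i, j)" by (cases x)
    then have "1 \<le> i" "i \<le> l" "1 \<le> j" "j \<le> p ! (i - 1)" using x by (auto simp: young_diagram_def len)
    then show "x \<in> \<mu>" unfolding ij downset_row[OF d] using nth[of "i - 1"] by auto
  qed
  ultimately show "is_young_diagram \<mu>" unfolding is_young_diagram_def is_partition_def
    by (intro exI[of _ p] conjI)
qed

lemma addable_iff:
  assumes d: "downset \<mu>"
  shows "(i, j) \<in> addable \<mu> \<longleftrightarrow> 1 \<le> i \<and> j = Suc (row_length \<mu> i) \<and>
    (i = 1 \<or> row_length \<mu> i < row_length \<mu> (i - 1))"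
proof
  assume a: "(i, j) \<in> addable \<mu>"
  then have d': "downset (insert (i, j) \<mu>)" and n: "(i, j) \<notin> \<mu>"
    by (auto simp: addable_def is_young_diagram_iff)
  have ij: "1 \<le> i" "1 \<le> j" using d' by (auto simp: downset_def)
  then have gt: "row_length \<mu> i < j" using n downset_row[OF d] by auto
  have below: "(i', j') \<in> \<mu>" if "1 \<le> i'" "i' \<le> i" "1 \<le> j'" "j' \<le> j" "(i', j') \<noteq> (i, j)" for i' j'
    using downsetD[OF d' insertI1 that(1-4)] that(5) by auto
  have "j - 1 \<le> row_length \<mu> i"
    using below[of i "j - 1"] ij downset_row[OF d, of i "j - 1"] by (cases "j = 1") auto
  moreover have "i = 1 \<or> j \<le> row_length \<mu> (i - 1)"
    using below[of "i - 1" j] ij downset_row[OF d, of "i - 1" j] by (cases "i = 1") auto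
  ultimately show "1 \<le> i \<and> j = Suc (row_length \<mu> i) \<and>
    (i = 1 \<or> row_length \<mu> i < row_length \<mu> (i - 1))" using gt ij by auto
next
  assume a: "1 \<le> i \<and> j = Suc (row_length \<mu> i) \<and> (i = 1 \<or> row_length \<mu> i < row_length \<mu> (i - 1))"
  then have n: "(i, j) \<notin> \<mu>" using downset_row[OF d] by auto
  have "downset (insert (i, j) \<mu>)"
  proof (rule downset_rows[where l = "(row_length \<mu>)(i := j)"])
    show "finite (insert (i, j) \<mu>)" using d by (simp add: downset_def)
    show "(i', j') \<in> insert (i, j) \<mu> \<longleftrightarrow> 1 \<le> i' \<and> 1 \<le> j' \<and> j' \<le> ((row_length \<mu>)(i := j)) i'" for i' j'
      using a downset_row[OF d, of i' j'] by auto
    show "((row_length \<mu>)(i := j)) (Suc i') \<le> ((row_length \<mu>)(i := j)) i'" if "1 \<le> i'" for i'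
      using a that row_length_mono[OF d that, of "Suc i'"] by (cases "Suc i' = i") auto
  qed
  then show "(i, j) \<in> addable \<mu>" using n by (simp add: addable_def is_young_diagram_iff)
qed

lemma removable_iff:
  assumes d: "downset \<mu>"
  shows "(i, j) \<in> removable \<mu> \<longleftrightarrow> 1 \<le> i \<and> j = row_length \<mu> i \<and> row_length \<mu> (Suc i) < row_length \<mu> i"
proof
  assume a: "(i, j) \<in> removable \<mu>"
  then have d': "downset (\<mu> - {(i, j)})" and m: "(i, j) \<in> \<mu>"
    by (auto simp: removable_def is_young_diagram_iff)
  have ij: "1 \<le> i" "1 \<le> j" "j \<le> row_length \<mu> i" using m downset_row[OF d] by auto
  have above: "(i', j') \<notin> \<mu>" if "i \<le> i'" "j \<le> j'" "(i', j') \<noteq> (i, j)" for i' j'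
  proof
    assume "(i', j') \<in> \<mu>"
    then have "(i', j') \<in> \<mu> - {(i, j)}" using that(3) by simp
    then have "(i, j) \<in> \<mu> - {(i, j)}" by (rule downsetD[OF d' _ ij(1) that(1) ij(2) that(2)])
    then show False by simp
  qed
  have "(i, Suc j) \<notin> \<mu>" "(Suc i, j) \<notin> \<mu>" using above by auto
  then show "1 \<le> i \<and> j = row_length \<mu> i \<and> row_length \<mu> (Suc i) < row_length \<mu> i"
    using ij downset_row[OF d, of i "Suc j"] downset_row[OF d, of "Suc i" j] by auto
next
  assume a: "1 \<le> i \<and> j = row_length \<mu> i \<and> row_length \<mu> (Suc i) < row_length \<mu> i"
  then have m: "(i, j) \<in> \<mu>" using downset_row[OF d] by auto
  have "downset (\<mu> - {(i, j)})"
  proof (rule downset_rows[where l = "(row_length \<mu>)(i := j - 1)"])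
    show "finite (\<mu> - {(i, j)})" using d by (simp add: downset_def)
    show "(i', j') \<in> \<mu> - {(i, j)} \<longleftrightarrow> 1 \<le> i' \<and> 1 \<le> j' \<and> j' \<le> ((row_length \<mu>)(i := j - 1)) i'" for i' j'
      using a downset_row[OF d, of i' j'] by auto
    show "((row_length \<mu>)(i := j - 1)) (Suc i') \<le> ((row_length \<mu>)(i := j - 1)) i'" if "1 \<le> i'" for i'
      using a that row_length_mono[OF d that, of "Suc i'"] by (cases "Suc i' = i") auto
  qed
  then show "(i, j) \<in> removable \<mu>" using m by (simp add: removable_def is_young_diagram_iff)
qed

definition int_content :: "box \<Rightarrow> int" where
  "int_content \<alpha> = int (snd \<alpha>) - int (fst \<alpha>)"

lemma row_telescope:
  fixes f :: "int \<Rightarrow> 'a::comm_ring_1"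
  shows "f (int L - i) * f (1 - i) * (\<Prod>j=1..L. f (int j - i - 1) * f (int j - i + 1)) =
    f (- i) * f (int L + 1 - i) * (\<Prod>j=1..L. f (int j - i) ^ 2)"
proof (induction L)
  case (Suc L)
  have e: "int (Suc L) - i = int L + 1 - i" "int (Suc L) + 1 - i = int L + 1 - i + 1"
    "int (Suc L) - i - 1 = int L - i" "int (Suc L) - i + 1 = int L + 1 - i + 1" by simp_all
  let ?N = "\<Prod>j=1..L. f (int j - i - 1) * f (int j - i + 1)" and ?D = "\<Prod>j=1..L. f (int j - i) ^ 2"
  have N: "(\<Prod>j=1..Suc L. f (int j - i - 1) * f (int j - i + 1)) = ?N * (f (int L - i) * f (int L + 1 - i + 1))"
    and D: "(\<Prod>j=1..Suc L. f (int j - i) ^ 2) = ?D * f (int L + 1 - i) ^ 2"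
    by (simp_all add: e del: of_nat_Suc)
  have "f (int (Suc L) - i) * f (1 - i) * (\<Prod>j=1..Suc L. f (int j - i - 1) * f (int j - i + 1)) =
      f (int L + 1 - i) * f (int L + 1 - i + 1) * (f (int L - i) * f (1 - i) * ?N)"
    unfolding N e by (simp add: mult_ac)
  also have "\<dots> = f (int L + 1 - i) * f (int L + 1 - i + 1) * (f (- i) * f (int L + 1 - i) * ?D)"
    unfolding Suc ..
  also have "\<dots> = f (- i) * f (int (Suc L) + 1 - i) * (\<Prod>j=1..Suc L. f (int j - i) ^ 2)"
    unfolding D e by (simp add: power2_eq_square mult_ac)
  finally show ?case .
qed simp

text \<open>
  The product over the boxes telescopes along the rows to a product over the right ends of the
  rows. Consecutive rows of equal length cancel there, and the remaining factors are those of the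
  addable and the removable boxes.
\<close>

lemma addable_removable_product:
  fixes f :: "int \<Rightarrow> 'a::idom"
  assumes d: "downset \<mu>" and f: "\<And>m. f m \<noteq> 0"
  shows "f 0 * (\<Prod>\<alpha>\<in>\<mu>. f (int_content \<alpha> - 1) * f (int_content \<alpha> + 1)) * (\<Prod>\<alpha>\<in>removable \<mu>. f (int_content \<alpha>)) =
      (\<Prod>\<alpha>\<in>\<mu>. f (int_content \<alpha>) ^ 2) * (\<Prod>\<alpha>\<in>addable \<mu>. f (int_content \<alpha>))"
    and "card (addable \<mu>) = Suc (card (removable \<mu>))" "finite (addable \<mu>)" "finite (removable \<mu>)"
proof -
  define r where "r = row_length \<mu>"
  obtain l where l: "\<And>i. 1 \<le> i \<Longrightarrow> 0 < r i \<longleftrightarrow> i \<le> l"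
    using downset_num_rows[OF d] unfolding r_def by blast
  have mono: "r i' \<le> r i" if "1 \<le> i" "i \<le> i'" for i i' using row_length_mono[OF d that] by (simp add: r_def)
  have r0: "r (Suc l) = 0" using l[of "Suc l"] by auto
  define C where "C = {i \<in> {1..l}. r i = r (Suc i)}"
  define R where "R = {1..l} - C"
  define A where "A = {1..Suc l} - Suc ` C"
  have rem: "removable \<mu> = (\<lambda>i. (i, r i)) ` R"
  proof (intro set_eqI)
    fix x :: box obtain i j where x: "x = (i, j)" by (cases x)
    have "i \<in> R \<longleftrightarrow> 1 \<le> i \<and> r (Suc i) < r i"
      using l[of i] mono[of i "Suc i"] by (auto simp: R_def C_def)
    then show "x \<in> removable \<mu> \<longleftrightarrow> x \<in> (\<lambda>i. (i, r i)) ` R"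
      unfolding x removable_iff[OF d] r_def[symmetric] by auto
  qed
  have add: "addable \<mu> = (\<lambda>i. (i, Suc (r i))) ` A"
  proof (intro set_eqI)
    fix x :: box obtain i j where x: "x = (i, j)" by (cases x)
    have "i \<in> A \<longleftrightarrow> 1 \<le> i \<and> (i = 1 \<or> r i < r (i - 1))"
    proof (cases "i \<le> 1")
      case True
      then show ?thesis by (auto simp: A_def C_def)
    next
      case False
      then obtain k where k: "i = Suc k" "1 \<le> k" by (cases i) auto
      then show ?thesis using l[of k] l[of "Suc k"] mono[of k "Suc k"] by (auto simp: A_def C_def)
    qed
    then show "x \<in> addable \<mu> \<longleftrightarrow> x \<in> (\<lambda>i. (i, Suc (r i))) ` A"
      unfolding x addable_iff[OF d] r_def[symmetric] by auto
  qed
  have inj: "inj_on (\<lambda>i. (i, r i)) S" "inj_on (\<lambda>i. (i, Suc (r i))) S" for S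
    by (auto simp: inj_on_def)
  have CS: "C \<subseteq> {1..l}" "Suc ` C \<subseteq> {1..Suc l}" by (auto simp: C_def)
  have fin: "finite C" "finite R" "finite A" by (auto simp: C_def R_def A_def)
  then show "finite (addable \<mu>)" "finite (removable \<mu>)" by (auto simp: add rem)
  have "card R = l - card C" "card A = Suc l - card C" "card C \<le> l"
    using CS fin card_mono[OF _ CS(1)]
    by (simp_all add: R_def A_def card_Diff_subset card_image)
  then show "card (addable \<mu>) = Suc (card (removable \<mu>))"
    by (simp add: add rem card_image inj)
  define a where "a i = f (int (r i) - int i)" for i
  define b where "b i = f (int (r i) + 1 - int i)" for i
  define N where "N = (\<Prod>\<alpha>\<in>\<mu>. f (int_content \<alpha> - 1) * f (int_content \<alpha> + 1))"
  define D where "D = (\<Prod>\<alpha>\<in>\<mu>. f (int_content \<alpha>) ^ 2)"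
  have mu: "\<mu> = Sigma {1..l} (\<lambda>i. {1..r i})"
  proof (intro set_eqI)
    fix x :: box obtain i j where x: "x = (i, j)" by (cases x)
    show "x \<in> \<mu> \<longleftrightarrow> x \<in> Sigma {1..l} (\<lambda>i. {1..r i})"
      unfolding x downset_row[OF d] r_def[symmetric] using l[of i] by auto
  qed
  have rows: "(\<Prod>\<alpha>\<in>\<mu>. g (int_content \<alpha>)) = (\<Prod>i=1..l. \<Prod>j=1..r i. g (int j - int i))" for g :: "int \<Rightarrow> 'a"
    unfolding mu by (subst prod.Sigma) (simp_all add: int_content_def split_def)
  define G where "G i = (\<Prod>j=1..r i. f (int j - int i - 1) * f (int j - int i + 1))" for i
  define H where "H i = (\<Prod>j=1..r i. f (int j - int i) ^ 2)" for i
  have "N = (\<Prod>i=1..l. G i)" "D = (\<Prod>i=1..l. H i)"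
    unfolding N_def D_def G_def H_def by (rule rows)+
  moreover have "(\<Prod>i=1..l. a i * f (1 - int i) * G i) = (\<Prod>i=1..l. f (- int i) * b i * H i)"
    unfolding a_def b_def G_def H_def by (rule prod.cong[OF refl]) (rule row_telescope)
  ultimately have eq1: "(\<Prod>i=1..l. a i) * (\<Prod>i=1..l. f (1 - int i)) * N =
      (\<Prod>i=1..l. f (- int i)) * (\<Prod>i=1..l. b i) * D"
    by (simp only: prod.distrib)
  have eq2: "(\<Prod>i=1..k. f (1 - int i)) * f (- int k) = f 0 * (\<Prod>i=1..k. f (- int i))" for k
    by (induction k) (simp_all add: mult_ac)
  have bl: "b (Suc l) = f (- int l)" by (simp add: b_def r0)
  have "(\<Prod>i=1..l. f (- int i)) * (f 0 * (\<Prod>i=1..l. a i) * N) =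
      (\<Prod>i=1..l. f (- int i)) * ((\<Prod>i=1..Suc l. b i) * D)"
  proof -
    have "(\<Prod>i=1..l. f (- int i)) * (f 0 * (\<Prod>i=1..l. a i) * N) =
        (f 0 * (\<Prod>i=1..l. f (- int i))) * (\<Prod>i=1..l. a i) * N" by (simp add: mult_ac)
    also have "\<dots> = ((\<Prod>i=1..l. a i) * (\<Prod>i=1..l. f (1 - int i)) * N) * f (- int l)"
      unfolding eq2[symmetric] by (simp add: mult_ac)
    also have "\<dots> = (\<Prod>i=1..l. f (- int i)) * ((\<Prod>i=1..Suc l. b i) * D)"
      unfolding eq1 by (simp add: bl mult_ac)
    finally show ?thesis .
  qed
  then have eq3: "f 0 * (\<Prod>i=1..l. a i) * N = (\<Prod>i=1..Suc l. b i) * D"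
    using f by simp
  have "(\<Prod>i=1..l. a i) = (\<Prod>i\<in>R. a i) * (\<Prod>i\<in>C. a i)"
    unfolding R_def by (rule prod.subset_diff[OF CS(1)]) simp
  moreover have "(\<Prod>i=1..Suc l. b i) = (\<Prod>i\<in>A. b i) * (\<Prod>i\<in>Suc ` C. b i)"
    unfolding A_def by (rule prod.subset_diff[OF CS(2)]) simp
  moreover have "(\<Prod>i\<in>Suc ` C. b i) = (\<Prod>i\<in>C. a i)"
    by (subst prod.reindex) (auto simp: a_def b_def C_def intro!: prod.cong)
  ultimately have "(\<Prod>i\<in>C. a i) * (f 0 * N * (\<Prod>i\<in>R. a i)) = (\<Prod>i\<in>C. a i) * (D * (\<Prod>i\<in>A. b i))"
    using eq3 by (simp add: mult_ac)
  moreover have "(\<Prod>i\<in>C. a i) \<noteq> 0" using fin f by (simp add: a_def)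
  ultimately have "f 0 * N * (\<Prod>i\<in>R. a i) = D * (\<Prod>i\<in>A. b i)" by simp
  moreover have "(\<Prod>\<alpha>\<in>removable \<mu>. f (int_content \<alpha>)) = (\<Prod>i\<in>R. a i)"
    unfolding rem by (subst prod.reindex[OF inj(1)]) (simp add: a_def int_content_def)
  moreover have "(\<Prod>\<alpha>\<in>addable \<mu>. f (int_content \<alpha>)) = (\<Prod>i\<in>A. b i)"
    unfolding add by (subst prod.reindex[OF inj(2)]) (simp add: b_def int_content_def add.commute)
  ultimately show "f 0 * (\<Prod>\<alpha>\<in>\<mu>. f (int_content \<alpha> - 1) * f (int_content \<alpha> + 1)) * (\<Prod>\<alpha>\<in>removable \<mu>. f (int_content \<alpha>)) =
      (\<Prod>\<alpha>\<in>\<mu>. f (int_content \<alpha>) ^ 2) * (\<Prod>\<alpha>\<in>addable \<mu>. f (int_content \<alpha>))"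
    unfolding N_def D_def by simp
qed

subsection \<open>Contents for a generic parameter\<close>

text \<open>
  The field has characteristic zero and the parameter is irrational. Then the contents of distinct boxes
  that can be added or removed are distinct.
\<close>

definition generic_parameter :: "'k::field \<Rightarrow> bool" where
  "generic_parameter \<delta> \<longleftrightarrow> (\<forall>a b. of_int a * \<delta> + of_int b = 0 \<longrightarrow> a = 0 \<and> b = 0)"

lemma generic_nonzero:
  "generic_parameter \<delta> \<Longrightarrow> a \<noteq> 0 \<or> b \<noteq> 0 \<Longrightarrow> of_int a * \<delta> + of_int b \<noteq> 0"
  by (auto simp: generic_parameter_def)

lemma generic_of_int: "generic_parameter (\<delta> :: 'k::field) \<Longrightarrow> (of_int b :: 'k) = 0 \<longleftrightarrow> b = 0"
  using generic_nonzero[of \<delta> 0 b] by auto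

lemma generic_two: "generic_parameter (\<delta> :: 'k::field) \<Longrightarrow> (2 :: 'k) \<noteq> 0"
  using generic_of_int[of \<delta> 2] by simp

definition next_contents :: "'k::field \<Rightarrow> box set \<Rightarrow> 'k set" where
  "next_contents \<delta> \<mu> = box_content \<delta> \<mu> ` (addable \<mu> \<union> removable \<mu>)"

lemma box_content_alt:
  "box_content \<delta> \<mu> \<alpha> = (if \<alpha> \<in> \<mu> then - ((\<delta> - 1) / 2 + of_int (int_content \<alpha>)) else (\<delta> - 1) / 2 + of_int (int_content \<alpha>))"
  by (simp add: box_content_def int_content_def Let_def algebra_simps)

lemma addable_removable_disjoint: "addable \<mu> \<inter> removable \<mu> = {}"
  by (auto simp: addable_def removable_def)

lemma int_content_inj_on:
  assumes d: "downset \<mu>"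
  shows "inj_on int_content (addable \<mu>)" "inj_on int_content (removable \<mu>)"
proof -
  show "inj_on int_content (addable \<mu>)"
  proof (rule inj_onI)
    fix x y assume x: "x \<in> addable \<mu>" and y: "y \<in> addable \<mu>" and eq: "int_content x = int_content y"
    obtain i j i' j' where ij: "x = (i, j)" "y = (i', j')" by (cases x, cases y)
    have *: "j = Suc (row_length \<mu> i)" "j' = Suc (row_length \<mu> i')" "1 \<le> i" "1 \<le> i'"
      using x y unfolding ij addable_iff[OF d] by auto
    then have "i = i'" using eq row_length_mono[OF d, of i i'] row_length_mono[OF d, of i' i]
      by (cases i i' rule: linorder_cases) (auto simp: int_content_def ij)
    then show "x = y" using * ij by simp
  qed
  show "inj_on int_content (removable \<mu>)"
  proof (rule inj_onI)
    fix x y assume x: "x \<in> removable \<mu>" and y: "y \<in> removable \<mu>" and eq: "int_content x = int_content y"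
    obtain i j i' j' where ij: "x = (i, j)" "y = (i', j')" by (cases x, cases y)
    have *: "j = row_length \<mu> i" "j' = row_length \<mu> i'" "1 \<le> i" "1 \<le> i'"
      using x y unfolding ij removable_iff[OF d] by auto
    then have "i = i'" using eq row_length_mono[OF d, of i i'] row_length_mono[OF d, of i' i]
      by (cases i i' rule: linorder_cases) (auto simp: int_content_def ij)
    then show "x = y" using * ij by simp
  qed
qed

lemma box_content_inj_on:
  fixes \<delta> :: "'k::field"
  assumes d: "downset \<mu>" and g: "generic_parameter \<delta>"
  shows "inj_on (box_content \<delta> \<mu>) (addable \<mu> \<union> removable \<mu>)"
proof -
  have out: "\<alpha> \<notin> \<mu>" if "\<alpha> \<in> addable \<mu>" for \<alpha> using that by (simp add: addable_def)
  have inn: "\<alpha> \<in> \<mu>" if "\<alpha> \<in> removable \<mu>" for \<alpha> using that by (simp add: removable_def)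
  have int_eq: "a = b" if "(of_int a :: 'k) = of_int b" for a b
    using generic_of_int[OF g, of "a - b"] that by simp
  have mixed: "(\<delta> - 1) / 2 + of_int a \<noteq> - ((\<delta> - 1) / 2 + of_int b)" for a b
  proof
    assume "(\<delta> - 1) / 2 + of_int a = - ((\<delta> - 1) / 2 + of_int b)"
    then have "((\<delta> - 1) / 2 + (\<delta> - 1) / 2) + of_int a + of_int b = 0"
      by (simp add: eq_neg_iff_add_eq_0 add_ac)
    moreover have "(\<delta> - 1) / 2 + (\<delta> - 1) / 2 = \<delta> - 1"
      using generic_two[OF g] by (simp only: add_divide_distrib[symmetric] mult_2[symmetric]) simp
    ultimately have "of_int 1 * \<delta> + of_int (a + b - 1) = 0" by (simp add: algebra_simps)
    then show False using generic_nonzero[OF g, of 1 "a + b - 1"] by simp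
  qed
  show ?thesis
  proof (rule inj_onI)
    fix \<alpha> \<beta> assume \<alpha>: "\<alpha> \<in> addable \<mu> \<union> removable \<mu>" and \<beta>: "\<beta> \<in> addable \<mu> \<union> removable \<mu>"
      and eq: "box_content \<delta> \<mu> \<alpha> = box_content \<delta> \<mu> \<beta>"
    consider "\<alpha> \<in> addable \<mu>" "\<beta> \<in> addable \<mu>" | "\<alpha> \<in> removable \<mu>" "\<beta> \<in> removable \<mu>"
      | "\<alpha> \<in> addable \<mu>" "\<beta> \<in> removable \<mu>" | "\<alpha> \<in> removable \<mu>" "\<beta> \<in> addable \<mu>"
      using \<alpha> \<beta> by blast
    then show "\<alpha> = \<beta>"
    proof cases
      case 1
      then have "int_content \<alpha> = int_content \<beta>" using eq out int_eq by (simp add: box_content_alt)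
      then show ?thesis using int_content_inj_on(1)[OF d] 1 by (meson inj_onD)
    next
      case 2
      then have "int_content \<alpha> = int_content \<beta>" using eq inn int_eq by (simp add: box_content_alt)
      then show ?thesis using int_content_inj_on(2)[OF d] 2 by (meson inj_onD)
    next
      case 3
      then show ?thesis using eq out[of \<alpha>] inn[of \<beta>] mixed by (simp add: box_content_alt)
    next
      case 4
      then show ?thesis using eq out[of \<beta>] inn[of \<alpha>] mixed by (metis box_content_alt)
    qed
  qed
qed

text \<open>
  There is one more addable than removable box.
\<close>

lemma next_contents_finite_odd:
  assumes d: "downset \<mu>" and g: "generic_parameter \<delta>"
  shows "finite (next_contents \<delta> \<mu>)" "odd (card (next_contents \<delta> \<mu>))"
proof -
  have f: "(1::int) \<noteq> 0" by simp
  note ar = addable_removable_product[where f = "\<lambda>_. 1 :: int", OF d f]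
  show "finite (next_contents \<delta> \<mu>)" using ar(3,4) by (simp add: next_contents_def)
  have "card (next_contents \<delta> \<mu>) = card (addable \<mu>) + card (removable \<mu>)"
    using card_image[OF box_content_inj_on[OF d g]] card_Un_disjoint[OF ar(3,4) addable_removable_disjoint]
    by (simp add: next_contents_def)
  then show "odd (card (next_contents \<delta> \<mu>))" using ar(2) by simp
qed

text \<open>
  One step of a tableau with content \<open>c\<close> changes the generating function of the contents by the quotient
  of these series at \<open>- c\<close> and \<open>c\<close>.
\<close>

definition step_ratio :: "'k::field \<Rightarrow> 'k fps" where
  "step_ratio c = ((1 - fps_const c * fps_X) ^ 2 - fps_X ^ 2) * (1 + fps_const c * fps_X) ^ 2"

lemma root_fps_next_contents:
  fixes \<delta> :: "'k::field"
  assumes d: "downset \<mu>" and g: "generic_parameter \<delta>"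
  defines "f \<equiv> \<lambda>m. 1 - fps_const ((\<delta> - 1) / 2 + of_int m) * fps_X"
  defines "f' \<equiv> \<lambda>m. 1 + fps_const ((\<delta> - 1) / 2 + of_int m) * fps_X"
  shows "root_fps (uminus ` next_contents \<delta> \<mu>) *
      (f 0 * (\<Prod>\<alpha>\<in>\<mu>. f (int_content \<alpha> - 1) * f (int_content \<alpha> + 1)) * (\<Prod>\<alpha>\<in>\<mu>. f' (int_content \<alpha>) ^ 2)) =
    root_fps (next_contents \<delta> \<mu>) *
      (f' 0 * (\<Prod>\<alpha>\<in>\<mu>. f' (int_content \<alpha> - 1) * f' (int_content \<alpha> + 1)) * (\<Prod>\<alpha>\<in>\<mu>. f (int_content \<alpha>) ^ 2))"
proof -
  have nz: "f m \<noteq> 0" "f' m \<noteq> 0" for m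
  proof -
    have "f m $ 0 = 1" "f' m $ 0 = 1" by (simp_all add: f_def f'_def)
    then show "f m \<noteq> 0" "f' m \<noteq> 0" by (metis fps_zero_nth zero_neq_one)+
  qed
  note F = addable_removable_product[where f = f, OF d nz(1)]
  note F' = addable_removable_product(1)[where f = f', OF d nz(2)]
  have out: "\<alpha> \<notin> \<mu>" if "\<alpha> \<in> addable \<mu>" for \<alpha> using that by (simp add: addable_def)
  have inn: "\<alpha> \<in> \<mu>" if "\<alpha> \<in> removable \<mu>" for \<alpha> using that by (simp add: removable_def)
  have P: "(\<Prod>a\<in>next_contents \<delta> \<mu>. h a) =
      (\<Prod>\<alpha>\<in>addable \<mu>. h (box_content \<delta> \<mu> \<alpha>)) * (\<Prod>\<alpha>\<in>removable \<mu>. h (box_content \<delta> \<mu> \<alpha>))"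
    for h :: "'k \<Rightarrow> 'k fps"
    unfolding next_contents_def prod.reindex[OF box_content_inj_on[OF d g]]
    using prod.union_disjoint[OF F(3,4) addable_removable_disjoint] by simp
  have P1: "root_fps (next_contents \<delta> \<mu>) =
      (\<Prod>\<alpha>\<in>addable \<mu>. f (int_content \<alpha>)) * (\<Prod>\<alpha>\<in>removable \<mu>. f' (int_content \<alpha>))"
    unfolding root_fps_def P
    by (intro arg_cong2[where f = "(*)"] prod.cong refl)
      (simp_all add: box_content_alt out inn f_def f'_def algebra_simps flip: fps_const_neg fps_const_add fps_const_sub)
  have "root_fps (uminus ` next_contents \<delta> \<mu>) = (\<Prod>a\<in>next_contents \<delta> \<mu>. 1 + fps_const a * fps_X)"
    unfolding root_fps_def by (subst prod.reindex) (simp_all flip: fps_const_neg)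
  also have "\<dots> = (\<Prod>\<alpha>\<in>addable \<mu>. f' (int_content \<alpha>)) * (\<Prod>\<alpha>\<in>removable \<mu>. f (int_content \<alpha>))"
    unfolding P
    by (intro arg_cong2[where f = "(*)"] prod.cong refl)
      (simp_all add: box_content_alt out inn f_def f'_def algebra_simps flip: fps_const_neg fps_const_add fps_const_sub)
  finally have P2: "root_fps (uminus ` next_contents \<delta> \<mu>) =
      (\<Prod>\<alpha>\<in>addable \<mu>. f' (int_content \<alpha>)) * (\<Prod>\<alpha>\<in>removable \<mu>. f (int_content \<alpha>))" .
  have regroup: "a' * r * (f0 * N * D') = a * r' * (f0' * N' * D)"
    if "f0 * N * r = D * a" "f0' * N' * r' = D' * a'"
    for a r a' r' f0 N D f0' N' D' :: "'k fps"
  proof -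
    have "a' * r * (f0 * N * D') = (f0 * N * r) * (D' * a')" by (simp only: mult_ac)
    also have "\<dots> = (f0' * N' * r') * (D * a)" unfolding that by (simp only: mult_ac)
    finally show ?thesis by (simp only: mult_ac)
  qed
  show ?thesis unfolding P1 P2 by (rule regroup[OF F(1) F'])
qed

text \<open>
  By the product formula the quotient of the two series \<open>root_fps\<close> is, up to a factor that does not depend
  on \<open>\<mu>\<close>, a product over the boxes of \<open>\<mu>\<close>. Adding or removing a box changes one factor of it.
\<close>

lemma root_fps_step:
  fixes \<delta> :: "'k::field"
  assumes d: "downset \<mu>" and g: "generic_parameter \<delta>" and \<alpha>: "\<alpha> \<in> addable \<mu> \<union> removable \<mu>"
  defines "c \<equiv> box_content \<delta> \<mu> \<alpha>" and "\<mu>' \<equiv> sym_diff \<mu> {\<alpha>}"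
  shows "root_fps (uminus ` next_contents \<delta> \<mu>') * root_fps (next_contents \<delta> \<mu>) * step_ratio c =
    root_fps (next_contents \<delta> \<mu>') * root_fps (uminus ` next_contents \<delta> \<mu>) * step_ratio (- c)"
proof -
  define f where "f = (\<lambda>m. 1 - fps_const ((\<delta> - 1) / 2 + of_int m) * fps_X)"
  define f' where "f' = (\<lambda>m. 1 + fps_const ((\<delta> - 1) / 2 + of_int m) * fps_X)"
  define B where "B \<nu> = f 0 * (\<Prod>\<alpha>\<in>\<nu>. f (int_content \<alpha> - 1) * f (int_content \<alpha> + 1)) * (\<Prod>\<alpha>\<in>\<nu>. f' (int_content \<alpha>) ^ 2)" for \<nu>
  define B' where "B' \<nu> = f' 0 * (\<Prod>\<alpha>\<in>\<nu>. f' (int_content \<alpha> - 1) * f' (int_content \<alpha> + 1)) * (\<Prod>\<alpha>\<in>\<nu>. f (int_content \<alpha>) ^ 2)" for \<nu>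
  have nz: "f m \<noteq> 0" "f' m \<noteq> 0" for m
  proof -
    have "f m $ 0 = 1" "f' m $ 0 = 1" by (simp_all add: f_def f'_def)
    then show "f m \<noteq> 0" "f' m \<noteq> 0" by (metis fps_zero_nth zero_neq_one)+
  qed
  have main: "root_fps (uminus ` next_contents \<delta> \<nu>) * B \<nu> = root_fps (next_contents \<delta> \<nu>) * B' \<nu>"
    if "downset \<nu>" for \<nu>
    using root_fps_next_contents[OF that g] by (simp only: f_def f'_def B_def B'_def)
  define k where "k = int_content \<alpha>"
  define n where "n = f (k - 1) * f (k + 1) * f' k ^ 2"
  define n' where "n' = f' (k - 1) * f' (k + 1) * f k ^ 2"
  have shift: "f (k - 1) * f (k + 1) = f k ^ 2 - fps_X ^ 2" "f' (k - 1) * f' (k + 1) = f' k ^ 2 - fps_X ^ 2"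
    by (simp_all add: f_def f'_def power2_eq_square algebra_simps flip: fps_const_add fps_const_sub)
  have B_insert: "B (insert \<alpha> \<nu>) = B \<nu> * n" "B' (insert \<alpha> \<nu>) = B' \<nu> * n'"
    if "finite \<nu>" "\<alpha> \<notin> \<nu>" for \<nu>
    using that by (simp_all add: B_def B'_def n_def n'_def k_def mult_ac)
  have Bnz: "B \<nu> \<noteq> 0" if "finite \<nu>" for \<nu>
    using that nz by (simp add: B_def)
  have fin: "finite \<mu>" using d by (simp add: downset_def)
  let ?P = "\<lambda>\<nu>. root_fps (next_contents \<delta> \<nu>)" and ?Q = "\<lambda>\<nu>. root_fps (uminus ` next_contents \<delta> \<nu>)"
  have dm: "?Q \<mu> * B \<mu> = ?P \<mu> * B' \<mu>" by (rule main[OF d])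
  define u where "u = (\<delta> - 1) / 2 + of_int k"
  have fk: "f k = 1 - fps_const u * fps_X" "f' k = 1 + fps_const u * fps_X"
    by (simp_all add: f_def f'_def u_def)
  have cu: "c = (if \<alpha> \<in> \<mu> then - u else u)" by (simp add: c_def box_content_alt u_def k_def)
  have c_out: "step_ratio c = n" "step_ratio (- c) = n'" if "\<alpha> \<notin> \<mu>"
    using that unfolding step_ratio_def n_def n'_def shift fk cu
    by (simp_all flip: fps_const_neg)
  have c_in: "step_ratio c = n'" "step_ratio (- c) = n" if "\<alpha> \<in> \<mu>"
    using that unfolding step_ratio_def n_def n'_def shift fk cu
    by (simp_all flip: fps_const_neg)
  show ?thesis
  proof (cases "\<alpha> \<in> \<mu>")
    case False
    then have mu': "\<mu>' = insert \<alpha> \<mu>" by (auto simp: \<mu>'_def)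
    have "downset \<mu>'" using \<alpha> False unfolding mu' by (auto simp: addable_def removable_def is_young_diagram_iff)
    then have dm': "?Q \<mu>' * (B \<mu> * n) = ?P \<mu>' * (B' \<mu> * n')"
      using main[of \<mu>'] B_insert[OF fin False] by (simp add: mu')
    have "B \<mu> * (?Q \<mu>' * ?P \<mu> * n) = ?P \<mu> * (?Q \<mu>' * (B \<mu> * n))" by (simp add: mult_ac)
    also have "\<dots> = ?P \<mu>' * n' * (?P \<mu> * B' \<mu>)" unfolding dm' by (simp add: mult_ac)
    also have "\<dots> = B \<mu> * (?P \<mu>' * ?Q \<mu> * n')" unfolding dm[symmetric] by (simp add: mult_ac)
    finally show ?thesis using Bnz[OF fin] c_out[OF False] by simp
  next
    case True
    then have mu': "\<mu>' = \<mu> - {\<alpha>}" by (auto simp: \<mu>'_def)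
    have "downset \<mu>'" using \<alpha> True unfolding mu' by (auto simp: addable_def removable_def is_young_diagram_iff)
    then have dm': "?Q \<mu>' * B \<mu>' = ?P \<mu>' * B' \<mu>'" by (rule main)
    have fin': "finite \<mu>'" using fin by (simp add: mu')
    have "insert \<alpha> \<mu>' = \<mu>" using True by (auto simp: mu')
    then have Bm: "B \<mu> = B \<mu>' * n" "B' \<mu> = B' \<mu>' * n'" using B_insert[OF fin'] by (simp_all add: mu')
    have "B \<mu>' * (?Q \<mu>' * ?P \<mu> * n') = ?P \<mu> * n' * (?Q \<mu>' * B \<mu>')" by (simp add: mult_ac)
    also have "\<dots> = ?P \<mu>' * (?P \<mu> * (B' \<mu>' * n'))" unfolding dm' by (simp add: mult_ac)
    also have "\<dots> = B \<mu>' * (?P \<mu>' * ?Q \<mu> * n)"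
      unfolding dm[symmetric, unfolded Bm] by (simp add: mult_ac)
    finally show ?thesis using Bnz[OF fin'] c_in[OF True] by simp
  qed
qed

section \<open>A positive form on the Brauer algebra\<close>

definition joint_class :: "nat \<Rightarrow> diagram \<Rightarrow> diagram \<Rightarrow> (dot \<times> dot) set" where
  "joint_class n d d' = {(x, y). x \<in> outer_dots n \<and> y \<in> outer_dots n \<and> (x, y) \<in> {(x, y). {x, y} \<in> d \<union> d'}\<^sup>*}"

text \<open>
  The number of closed loops obtained by gluing the top row of \<open>d\<close> to the top row of \<open>d'\<close> and the bottom row
  to the bottom row.
\<close>

definition num_components :: "nat \<Rightarrow> diagram \<Rightarrow> diagram \<Rightarrow> nat" where
  "num_components n d d' = card (outer_dots n // joint_class n d d')"

lemma joint_class_equiv: "equiv (outer_dots n) (joint_class n d d')"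
proof (rule equivI)
  show "joint_class n d d' \<subseteq> outer_dots n \<times> outer_dots n" by (auto simp: joint_class_def)
  show "refl_on (outer_dots n) (joint_class n d d')" by (auto simp: refl_on_def joint_class_def)
  have "sym ({(x, y). {x, y} \<in> d \<union> d'}\<^sup>*)"
    by (rule sym_rtrancl) (auto intro!: symI simp: insert_commute)
  then show "sym (joint_class n d d')" unfolding joint_class_def sym_def by blast
  show "trans (joint_class n d d')" unfolding joint_class_def trans_def by (blast intro: rtrancl_trans)
qed

lemma fits_joint:
  assumes "is_diagram n d" "is_diagram n d'"
  shows "fits d A B \<and> fits d' A B \<longleftrightarrow>
    (\<forall>x y. (x, y) \<in> joint_class n d d' \<longrightarrow> colour A {} B x = colour A {} B y)"
proof -
  let ?E = "{(x, y). {x, y} \<in> d \<union> d'}"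
  have "fits d A B \<and> fits d' A B \<longleftrightarrow> (\<forall>x y. (x, y) \<in> ?E \<longrightarrow> colour A {} B x = colour A {} B y)"
    unfolding fits_def by auto
  also have "\<dots> \<longleftrightarrow> (\<forall>x y. (x, y) \<in> joint_class n d d' \<longrightarrow> colour A {} B x = colour A {} B y)"
  proof
    assume *: "\<forall>x y. (x, y) \<in> ?E \<longrightarrow> colour A {} B x = colour A {} B y"
    then have "\<forall>x y. (x, y) \<in> ?E\<^sup>* \<longrightarrow> colour A {} B x = colour A {} B y"
      by (rule constant_on_rtrancl[THEN iffD1])
    then show "\<forall>x y. (x, y) \<in> joint_class n d d' \<longrightarrow> colour A {} B x = colour A {} B y"
      by (simp add: joint_class_def)
  next
    assume *: "\<forall>x y. (x, y) \<in> joint_class n d d' \<longrightarrow> colour A {} B x = colour A {} B y"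
    show "\<forall>x y. (x, y) \<in> ?E \<longrightarrow> colour A {} B x = colour A {} B y"
    proof (intro allI impI)
      fix x y assume E: "(x, y) \<in> ?E"
      then have "x \<in> outer_dots n \<and> y \<in> outer_dots n"
        using diagram_edge_outer[OF assms(1), of x y] diagram_edge_outer[OF assms(2), of x y] by auto
      then have "(x, y) \<in> joint_class n d d'" using E by (auto simp: joint_class_def)
      then show "colour A {} B x = colour A {} B y" using * by blast
    qed
  qed
  finally show ?thesis .
qed

lemma card_joint_colourings:
  assumes d: "is_diagram n d" "is_diagram n d'"
  shows "card {(A, B). A \<subseteq> {1..n} \<and> B \<subseteq> {1..n} \<and> fits d A B \<and> fits d' A B} = 2 ^ num_components n d d'"
proof -
  define V where "V = outer_dots n"
  define R where "R = joint_class n d d'"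
  define Q where "Q = V // R"
  have eq: "equiv V R" unfolding V_def R_def by (rule joint_class_equiv)
  have fin: "finite Q" unfolding Q_def using eq by (intro finite_quotient) (auto simp: V_def equiv_def)
  define F where "F S = ({i. Top i \<in> \<Union>S}, {i. Bot i \<in> \<Union>S})" for S :: "dot set set"
  define G where "G p = {C \<in> Q. \<exists>x\<in>C. colour (fst p) {} (snd p) x}" for p
  have QV: "C \<subseteq> V" if "C \<in> Q" for C using that eq in_quotient_imp_subset unfolding Q_def by metis
  have col: "colour (fst (F S)) {} (snd (F S)) x \<longleftrightarrow> x \<in> \<Union>S" if "S \<subseteq> Q" for S x
  proof (cases x)
    case (Mid i)
    then have "x \<notin> V" by (auto simp: V_def outer_dots_def)
    then show ?thesis using that QV Mid by (auto simp: F_def)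
  qed (simp_all add: F_def)
  have same: "C = D" if "C \<in> Q" "D \<in> Q" "x \<in> C" "x \<in> D" for C D x
    using that quotient_disj[OF eq] unfolding Q_def by blast
  have inR: "(x, y) \<in> R" if "C \<in> Q" "x \<in> C" "y \<in> C" for C x y
    using that in_quotient_imp_in_rel[OF eq, of C x y] by (simp add: Q_def)
  let ?P = "{(A, B). A \<subseteq> {1..n} \<and> B \<subseteq> {1..n} \<and> fits d A B \<and> fits d' A B}"
  have P: "(A, B) \<in> ?P \<longleftrightarrow> A \<subseteq> {1..n} \<and> B \<subseteq> {1..n} \<and>
      (\<forall>x y. (x, y) \<in> R \<longrightarrow> colour A {} B x = colour A {} B y)" for A B
    unfolding R_def by (simp only: mem_Collect_eq case_prod_conv fits_joint[OF d])
  have "bij_betw F (Pow Q) ?P"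
  proof (rule bij_betw_byWitness[where f' = G])
    show "\<forall>S\<in>Pow Q. G (F S) = S"
    proof
      fix S assume "S \<in> Pow Q"
      then have S: "S \<subseteq> Q" by simp
      show "G (F S) = S"
      proof (intro set_eqI iffI)
        fix C assume "C \<in> G (F S)"
        then obtain x D where "C \<in> Q" "x \<in> C" "x \<in> D" "D \<in> S" unfolding G_def using col[OF S] by blast
        then show "C \<in> S" using same[of C D x] S by blast
      next
        fix C assume C: "C \<in> S"
        then have "C \<noteq> {}" using S in_quotient_imp_non_empty[OF eq] unfolding Q_def by blast
        then show "C \<in> G (F S)" unfolding G_def using col[OF S] C S by blast
      qed
    qed
    show "\<forall>p\<in>?P. F (G p) = p"
    proof
      fix p assume p: "p \<in> ?P"
      obtain A B where pAB: "p = (A, B)" by (cases p)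
      have AB: "A \<subseteq> {1..n}" "B \<subseteq> {1..n}" and c: "\<And>x y. (x, y) \<in> R \<Longrightarrow> colour A {} B x = colour A {} B y"
        using p unfolding pAB P by blast+
      have "x \<in> \<Union>(G p) \<longleftrightarrow> colour A {} B x" if "x \<in> V" for x
      proof
        assume "x \<in> \<Union>(G p)"
        then obtain C y where "C \<in> Q" "x \<in> C" "y \<in> C" "colour A {} B y" unfolding G_def pAB by auto
        then show "colour A {} B x" using c inR[of C x y] by blast
      next
        assume x: "colour A {} B x"
        have "R `` {x} \<in> Q" "x \<in> R `` {x}"
          unfolding Q_def by (rule quotientI[OF that], rule equiv_class_self[OF eq that])
        then show "x \<in> \<Union>(G p)" using x unfolding G_def pAB by auto
      qed
      moreover have "x \<notin> \<Union>(G p)" if "x \<notin> V" for x using that QV by (auto simp: G_def)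
      ultimately have "x \<in> \<Union>(G p) \<longleftrightarrow> x \<in> V \<and> colour A {} B x" for x by blast
      then have "F (G p) = ({i. Top i \<in> V \<and> i \<in> A}, {i. Bot i \<in> V \<and> i \<in> B})"
        unfolding F_def by simp
      then show "F (G p) = p" using AB unfolding pAB V_def outer_dots_def by auto
    qed
    show "F ` Pow Q \<subseteq> ?P"
    proof
      fix p assume "p \<in> F ` Pow Q"
      then obtain S where S: "S \<subseteq> Q" "p = F S" by blast
      obtain A B where pAB: "F S = (A, B)" by (cases "F S")
      have "\<Union>S \<subseteq> V" using S QV by blast
      then have "A \<subseteq> {1..n}" "B \<subseteq> {1..n}" using pAB by (auto simp: F_def V_def outer_dots_def)
      moreover have "colour A {} B x = colour A {} B y" if "(x, y) \<in> R" for x y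
      proof -
        have *: "y \<in> \<Union>S" if xy: "(x, y) \<in> R" and xS: "x \<in> \<Union>S" for x y
        proof -
          obtain C where C: "C \<in> S" "x \<in> C" using xS by blast
          then have "y \<in> C" using S xy in_quotient_imp_closed[OF eq, of C x y] by (auto simp: Q_def)
          then show ?thesis using C by blast
        qed
        have "(y, x) \<in> R" using that eq by (auto simp: equiv_def sym_def)
        then have "x \<in> \<Union>S \<longleftrightarrow> y \<in> \<Union>S" using *[OF that] *[of y x] by blast
        then show ?thesis using col[OF S(1), of x] col[OF S(1), of y] pAB by simp
      qed
      ultimately show "p \<in> ?P" unfolding S(2) pAB P by blast
    qed
    show "G ` ?P \<subseteq> Pow Q" by (auto simp: G_def)
  qed
  then have "card ?P = card (Pow Q)" by (rule bij_betw_same_card[symmetric])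
  then show ?thesis using fin by (simp add: card_Pow num_components_def Q_def V_def R_def)
qed

definition joint_count :: "nat \<Rightarrow> diagram \<Rightarrow> diagram \<Rightarrow> nat" where
  "joint_count n d d' = (\<Sum>A\<in>Pow {1..n}. \<Sum>B\<in>Pow {1..n}. if fits d A B \<and> fits d' A B then 1 else 0)"

lemma joint_count:
  assumes "is_diagram n d" "is_diagram n d'" shows "joint_count n d d' = 2 ^ num_components n d d'"
proof -
  have "{(A, B). A \<subseteq> {1..n} \<and> B \<subseteq> {1..n} \<and> fits d A B \<and> fits d' A B} =
      Sigma (Pow {1..n}) (\<lambda>A. {B \<in> Pow {1..n}. fits d A B \<and> fits d' A B})" by auto
  moreover have "card (Sigma (Pow {1..n}) (\<lambda>A. {B \<in> Pow {1..n}. fits d A B \<and> fits d' A B})) =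
      (\<Sum>A\<in>Pow {1..n}. card {B \<in> Pow {1..n}. fits d A B \<and> fits d' A B})"
    by (rule card_SigmaI) simp_all
  ultimately have "2 ^ num_components n d d' = (\<Sum>A\<in>Pow {1..n}. card {B \<in> Pow {1..n}. fits d A B \<and> fits d' A B})"
    using card_joint_colourings[OF assms] by simp
  also have "\<dots> = joint_count n d d'"
    unfolding joint_count_def by (intro sum.cong refl) (simp add: sum.inter_filter[symmetric] del: Pow_iff)
  finally show ?thesis ..
qed

text \<open>
  Distinct diagrams fit different sets of colourings, so fewer colourings fit both of them than one of them.
\<close>

lemma num_components_less:
  assumes d: "is_diagram n d" "is_diagram n d'" and "d \<noteq> d'"
  shows "num_components n d d' < num_components n d d" "num_components n d d' < num_components n d' d'"
proof -
  have *: "num_components n d d' < num_components n e e"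
    if e: "e = d \<and> e' = d' \<or> e = d' \<and> e' = d" for e e'
  proof -
    have ed: "is_diagram n e" "is_diagram n e'" "e \<noteq> e'" using e d assms(3) by auto
    have "\<not> e \<subseteq> e'"
    proof
      assume sub: "e \<subseteq> e'"
      have M: "matching (outer_dots n) e" "matching (outer_dots n) e'" using ed by (simp_all add: is_diagram_matching)
      have "h \<in> e" if h: "h \<in> e'" for h
      proof -
        obtain x y where xy: "h = {x, y}" using matching_edge_form[OF M(2) h] by blast
        then have "x \<in> outer_dots n" using matching_edge_in[OF M(2)] h by blast
        then obtain z where z: "{x, z} \<in> e" using matching_has_edge[OF M(1)] by blast
        then have "z = y" using matching_edge_unique[OF M(2), of x z y] sub h xy by blast
        then show ?thesis using z xy by simp
      qed
      then show False using sub ed(3) by blast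
    qed
    then obtain A B where AB: "A \<subseteq> {1..n}" "B \<subseteq> {1..n}" "fits e A B" "\<not> fits e' A B"
      using fits_determines_subset[OF ed(1,2)] by blast
    let ?P = "\<lambda>d d'. {(A, B). A \<subseteq> {1..n} \<and> B \<subseteq> {1..n} \<and> fits d A B \<and> fits d' A B}"
    have "finite (?P e e)" by (rule finite_subset[of _ "Pow {1..n} \<times> Pow {1..n}"]) auto
    moreover have "?P d d' \<subset> ?P e e"
    proof
      show "?P d d' \<subseteq> ?P e e" using e by blast
      show "?P d d' \<noteq> ?P e e"
      proof
        assume "?P d d' = ?P e e"
        moreover have "(A, B) \<in> ?P e e" using AB by simp
        ultimately have "(A, B) \<in> ?P d d'" by simp
        then show False using AB e by auto
      qed
    qed
    ultimately have "card (?P d d') < card (?P e e)" by (rule psubset_card_mono)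
    then show ?thesis unfolding card_joint_colourings[OF d] card_joint_colourings[OF ed(1,1)] by simp
  qed
  show "num_components n d d' < num_components n d d" "num_components n d d' < num_components n d' d'"
    using *[of d d'] *[of d' d] by blast+
qed

definition form :: "nat \<Rightarrow> 'k::field \<Rightarrow> 'k brauer \<Rightarrow> 'k brauer \<Rightarrow> 'k" where
  "form n \<delta> f g = (\<Sum>d\<in>diagrams n. \<Sum>d'\<in>diagrams n. f d * g d' * \<delta> ^ num_components n d d')"

text \<open>
  Both sides are the exponent of two in the number of colourings of three rows which fit \<open>g\<close>, \<open>d\<close> and \<open>d'\<close>
  arranged in a cycle.
\<close>

lemma num_components_adjoint:
  assumes sym: "\<And>A B. fits g A B \<longleftrightarrow> fits g B A"
    and d: "is_diagram n g" "is_diagram n d" "is_diagram n d'"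
  shows "num_loops n g d + num_components n (compose_diagrams n g d) d' =
    num_loops n g d' + num_components n d (compose_diagrams n g d')"
proof -
  let ?P = "Pow {1..n}"
  let ?T = "\<lambda>d d'. \<Sum>A\<in>?P. \<Sum>B\<in>?P. \<Sum>G\<in>?P. if fits g A G \<and> fits d G B \<and> fits d' A B then 1 else (0::nat)"
  have count: "2 ^ num_loops n g d * joint_count n (compose_diagrams n g d) d' = ?T d d'"
    if "is_diagram n d" for d d'
  proof -
    have "2 ^ num_loops n g d * (if fits (compose_diagrams n g d) A B \<and> fits d' A B then 1 else 0) =
        (\<Sum>G\<in>?P. if fits g A G \<and> fits d G B \<and> fits d' A B then 1 else (0::nat))" for A B
    proof -
      have "(\<Sum>G\<in>?P. if fits g A G \<and> fits d G B then 1 else (0::nat)) =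
          card {G \<in> ?P. fits g A G \<and> fits d G B}"
        by (simp add: sum.inter_filter[symmetric] del: Pow_iff)
      then show ?thesis unfolding card_middle_colourings[OF d(1) that]
        by (cases "fits d' A B") auto
    qed
    then show ?thesis by (simp add: joint_count_def sum_distrib_left)
  qed
  have "?T d d' = (\<Sum>B\<in>?P. \<Sum>A\<in>?P. \<Sum>G\<in>?P. if fits g A G \<and> fits d G B \<and> fits d' A B then 1 else (0::nat))"
    by (rule sum.swap)
  also have "\<dots> = (\<Sum>B\<in>?P. \<Sum>G\<in>?P. \<Sum>A\<in>?P. if fits g A G \<and> fits d G B \<and> fits d' A B then 1 else (0::nat))"
    by (rule sum.cong[OF refl], rule sum.swap)
  also have "\<dots> = (\<Sum>G\<in>?P. \<Sum>B\<in>?P. \<Sum>A\<in>?P. if fits g G A \<and> fits d' A B \<and> fits d G B then 1 else (0::nat))"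
    by (subst sum.swap, intro sum.cong refl) (auto simp: sym)
  finally have T: "?T d d' = ?T d' d" .
  have jc: "joint_count n (compose_diagrams n g d') d = joint_count n d (compose_diagrams n g d')"
    by (simp add: joint_count_def conj_commute)
  have "(2::nat) ^ (num_loops n g d + num_components n (compose_diagrams n g d) d') =
      2 ^ (num_loops n g d' + num_components n d (compose_diagrams n g d'))"
    using count[OF d(2), of d'] count[OF d(3), of d] jc
      joint_count[OF compose_is_diagram[OF d(1,2)] d(3)] joint_count[OF d(2) compose_is_diagram[OF d(1,3)]]
    unfolding T power_add by metis
  then show ?thesis by simp
qed

definition self_adjoint :: "nat \<Rightarrow> 'k::field \<Rightarrow> 'k endo \<Rightarrow> bool" where
  "self_adjoint n \<delta> A \<longleftrightarrow> (\<forall>f g. form n \<delta> (app A f) g = form n \<delta> f (app A g))"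

lemma form_bplus: "form n \<delta> (bplus f f') g = form n \<delta> f g + form n \<delta> f' g"
  and form_bplus': "form n \<delta> f (bplus g g') = form n \<delta> f g + form n \<delta> f g'"
  and form_bscale: "form n \<delta> (bscale c f) g = c * form n \<delta> f g"
  and form_bscale': "form n \<delta> f (bscale c g) = c * form n \<delta> f g"
  by (simp_all add: form_def bplus_def bscale_def algebra_simps sum.distrib sum_distrib_left)

lemma self_adjoint_basis:
  assumes sym: "\<And>A B. fits g A B \<longleftrightarrow> fits g B A" and g: "is_diagram n g"
  shows "self_adjoint n \<delta> (left_mult n \<delta> (basis g))"
  unfolding self_adjoint_def
proof (intro allI)
  fix f f'
  let ?D = "diagrams n"
  have mult: "bmult n \<delta> (basis g) f d = (\<Sum>e\<in>?D. f e * structure_const n \<delta> g e d)" for f :: "'a brauer" and d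
  proof -
    have "bmult n \<delta> (basis g) f d = (\<Sum>e\<in>?D. \<Sum>d1\<in>?D. if d1 = g then f e * structure_const n \<delta> g e d else 0)"
      unfolding bmult_structure_const by (subst sum.swap, intro sum.cong refl) (simp add: basis_def)
    then show ?thesis using g by simp
  qed
  have sc: "(\<Sum>d\<in>?D. structure_const n \<delta> g e d * w d) = \<delta> ^ num_loops n g e * w (compose_diagrams n g e)"
    if "e \<in> ?D" for e and w :: "diagram \<Rightarrow> 'a"
  proof -
    have "(\<Sum>d\<in>?D. structure_const n \<delta> g e d * w d) =
        (\<Sum>d\<in>?D. if d = compose_diagrams n g e then \<delta> ^ num_loops n g e * w d else 0)"
      by (intro sum.cong refl) (simp add: structure_const_def)
    then show ?thesis using compose_is_diagram[OF g, of e] that by simp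
  qed
  have l: "form n \<delta> (bmult n \<delta> (basis g) f) f' = (\<Sum>e\<in>?D. \<Sum>d'\<in>?D. f e * f' d' *
      (\<delta> ^ num_loops n g e * \<delta> ^ num_components n (compose_diagrams n g e) d'))"
  proof -
    have "form n \<delta> (bmult n \<delta> (basis g) f) f' = (\<Sum>d\<in>?D. \<Sum>d'\<in>?D. \<Sum>e\<in>?D.
        f e * f' d' * (structure_const n \<delta> g e d * \<delta> ^ num_components n d d'))"
      unfolding form_def mult by (intro sum.cong refl) (simp add: sum_distrib_left sum_distrib_right mult_ac)
    also have "\<dots> = (\<Sum>e\<in>?D. \<Sum>d'\<in>?D. \<Sum>d\<in>?D.
        f e * f' d' * (structure_const n \<delta> g e d * \<delta> ^ num_components n d d'))"
      by (subst sum.swap, subst (2) sum.swap, subst sum.swap, rule refl)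
    also have "\<dots> = (\<Sum>e\<in>?D. \<Sum>d'\<in>?D. f e * f' d' *
        (\<delta> ^ num_loops n g e * \<delta> ^ num_components n (compose_diagrams n g e) d'))"
      by (intro sum.cong refl, subst sum_distrib_left[symmetric], subst sc) auto
    finally show ?thesis .
  qed
  have r: "form n \<delta> f (bmult n \<delta> (basis g) f') = (\<Sum>d\<in>?D. \<Sum>e\<in>?D. f d * f' e *
      (\<delta> ^ num_loops n g e * \<delta> ^ num_components n d (compose_diagrams n g e)))"
  proof -
    have "form n \<delta> f (bmult n \<delta> (basis g) f') = (\<Sum>d\<in>?D. \<Sum>d'\<in>?D. \<Sum>e\<in>?D.
        f d * f' e * (structure_const n \<delta> g e d' * \<delta> ^ num_components n d d'))"
      unfolding form_def mult by (intro sum.cong refl) (simp add: sum_distrib_left sum_distrib_right mult_ac)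
    also have "\<dots> = (\<Sum>d\<in>?D. \<Sum>e\<in>?D. \<Sum>d'\<in>?D.
        f d * f' e * (structure_const n \<delta> g e d' * \<delta> ^ num_components n d d'))"
      by (rule sum.cong[OF refl], rule sum.swap)
    also have "\<dots> = (\<Sum>d\<in>?D. \<Sum>e\<in>?D. f d * f' e *
        (\<delta> ^ num_loops n g e * \<delta> ^ num_components n d (compose_diagrams n g e)))"
      by (intro sum.cong refl, subst sum_distrib_left[symmetric], subst sc) auto
    finally show ?thesis .
  qed
  show "form n \<delta> (app (left_mult n \<delta> (basis g)) f) f' = form n \<delta> f (app (left_mult n \<delta> (basis g)) f')"
    unfolding app_left_mult l r power_add[symmetric]
    by (intro sum.cong refl) (use num_components_adjoint[OF sym g] in simp)
qed

lemma self_adjoint_closed: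
  "self_adjoint n \<delta> A \<Longrightarrow> self_adjoint n \<delta> B \<Longrightarrow> self_adjoint n \<delta> (A + B)"
  "self_adjoint n \<delta> A \<Longrightarrow> self_adjoint n \<delta> B \<Longrightarrow> self_adjoint n \<delta> (A - B)"
  "self_adjoint n \<delta> A \<Longrightarrow> self_adjoint n \<delta> (c \<odot> A)"
  "self_adjoint n \<delta> A \<Longrightarrow> self_adjoint n \<delta> B \<Longrightarrow> A * B = B * A \<Longrightarrow> self_adjoint n \<delta> (A * B)"
  "self_adjoint n \<delta> 1" "self_adjoint n \<delta> 0"
proof -
  show "self_adjoint n \<delta> A \<Longrightarrow> self_adjoint n \<delta> B \<Longrightarrow> self_adjoint n \<delta> (A + B)"
    "self_adjoint n \<delta> A \<Longrightarrow> self_adjoint n \<delta> B \<Longrightarrow> self_adjoint n \<delta> (A - B)"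
    "self_adjoint n \<delta> A \<Longrightarrow> self_adjoint n \<delta> (c \<odot> A)"
    by (simp_all add: self_adjoint_def app_plus app_minus app_scl form_bplus form_bplus' form_bscale form_bscale' bminus_conv)
  show "self_adjoint n \<delta> 1" "self_adjoint n \<delta> 0"
    by (simp_all add: self_adjoint_def app_one app_zero_endo form_def)
  assume A: "self_adjoint n \<delta> A" and B: "self_adjoint n \<delta> B" and AB: "A * B = B * A"
  have "form n \<delta> (app (A * B) f) g = form n \<delta> f (app (B * A) g)" for f g
    using A B by (simp add: self_adjoint_def app_times)
  then show "self_adjoint n \<delta> (A * B)" by (simp add: self_adjoint_def AB)
qed

lemma self_adjoint_sum: "(\<And>i. i \<in> I \<Longrightarrow> self_adjoint n \<delta> (F i)) \<Longrightarrow> self_adjoint n \<delta> (\<Sum>i\<in>I. F i)"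
  by (induction I rule: infinite_finite_induct) (simp_all add: self_adjoint_closed)

lemma self_adjoint_peval: "self_adjoint n \<delta> x \<Longrightarrow> self_adjoint n \<delta> (peval x p)"
proof (induction p)
  case (pCons a p)
  have "x * peval x p = peval x p * x" by (rule peval_commute) simp
  then show ?case using pCons by (simp add: self_adjoint_closed)
qed (simp add: self_adjoint_closed)

lemma self_adjoint_unit: "self_adjoint n \<delta> (left_mult n \<delta> (bone n))"
  unfolding bone_def
  by (rule self_adjoint_basis[OF _ identity_is_diagram]) (unfold identity_diagram_def fits_vertical, blast)

lemma fits_generator_sym:
  "fits (swap_diagram n i j) A B \<longleftrightarrow> fits (swap_diagram n i j) B A"
  "fits (cap_diagram n i j) A B \<longleftrightarrow> fits (cap_diagram n i j) B A"
proof -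
  have s: "fits (swap_diagram n i j) A B \<Longrightarrow> fits (swap_diagram n i j) B A"
    and c: "fits (cap_diagram n i j) A B \<Longrightarrow> fits (cap_diagram n i j) B A" for A B
    unfolding fits_swap fits_cap by (elim conjE, intro conjI ballI; simp)+
  show "fits (swap_diagram n i j) A B \<longleftrightarrow> fits (swap_diagram n i j) B A"
    by (rule iffI) (rule s, assumption)+
  show "fits (cap_diagram n i j) A B \<longleftrightarrow> fits (cap_diagram n i j) B A"
    by (rule iffI) (rule c, assumption)+
qed

lemma self_adjoint_generators:
  assumes "i \<in> {1..n}" "j \<in> {1..n}" "i \<noteq> j"
  shows "self_adjoint n \<delta> (s_op n \<delta> i j)" "self_adjoint n \<delta> (e_op n \<delta> i j)"
proof -
  have "self_adjoint n \<delta> (left_mult n \<delta> (s_elem n i j))"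
    unfolding s_elem_basis
    by (rule self_adjoint_basis[OF _ swap_is_diagram[OF assms]]) (rule fits_generator_sym)
  then show "self_adjoint n \<delta> (s_op n \<delta> i j)"
    unfolding s_op_def
    by (rule self_adjoint_closed(1)[OF _ self_adjoint_closed(2)[OF self_adjoint_closed(5) self_adjoint_unit]])
  show "self_adjoint n \<delta> (e_op n \<delta> i j)"
    unfolding e_op_def eps_elem_basis
    by (rule self_adjoint_basis[OF _ cap_is_diagram[OF assms]]) (rule fits_generator_sym)
qed

lemma self_adjoint_jm: "r \<le> n \<Longrightarrow> self_adjoint n \<delta> (brauer.jm \<delta> n r)"
  unfolding brauer.jm_def
  by (rule self_adjoint_closed(1)[OF self_adjoint_closed(3)[OF self_adjoint_closed(5)] self_adjoint_sum],
      rule self_adjoint_closed(2); rule self_adjoint_generators) auto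

text \<open>
  If the parameter is larger than the number of diagrams, the diagonal terms of the form
  dominate, since distinct diagrams have fewer common components than each of them alone.
\<close>

lemma form_positive:
  fixes \<delta> :: "'k::linordered_field"
  assumes \<delta>: "of_nat (card (diagrams n)) < \<delta>" "1 \<le> \<delta>" and zero: "form n \<delta> f f = 0" and d0: "is_diagram n d0"
  shows "f d0 = 0"
proof (rule ccontr)
  assume "f d0 \<noteq> 0"
  let ?D = "diagrams n"
  define c where "c = num_components n"
  define w where "w d = f d ^ 2 * \<delta> ^ c d d" for d
  have \<delta>0: "0 < \<delta>" using \<delta>(2) by simp
  have w0: "0 \<le> w d" for d using \<delta>0 by (simp add: w_def)
  \<comment> \<open>Arithmetic-geometric mean; off the diagonal the exponent of \<open>\<delta>\<close> is smaller by at least one.\<close>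
  have cross: "\<delta> * (\<bar>f d * f d'\<bar> * \<delta> ^ c d d') \<le> (w d + w d') / 2" if "d \<in> ?D" "d' \<in> ?D" "d \<noteq> d'" for d d'
  proof -
    have "c d d' < c d d" "c d d' < c d' d'" using num_components_less[of n d d'] that by (auto simp: c_def)
    then have "\<delta> ^ Suc (c d d') \<le> \<delta> ^ c d d" "\<delta> ^ Suc (c d d') \<le> \<delta> ^ c d' d'"
      using \<delta>(2) by (intro power_increasing; simp)+
    then have "f d ^ 2 * \<delta> ^ Suc (c d d') \<le> w d" "f d' ^ 2 * \<delta> ^ Suc (c d d') \<le> w d'"
      unfolding w_def by (intro mult_left_mono; simp)+
    then have sum: "(f d ^ 2 + f d' ^ 2) * \<delta> ^ Suc (c d d') \<le> w d + w d'" by (simp add: distrib_right)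
    have "0 \<le> (\<bar>f d\<bar> - \<bar>f d'\<bar>) ^ 2" by simp
    then have "2 * \<bar>f d * f d'\<bar> \<le> f d ^ 2 + f d' ^ 2"
      by (simp add: power2_eq_square algebra_simps abs_mult)
    then have "2 * \<bar>f d * f d'\<bar> * \<delta> ^ Suc (c d d') \<le> (f d ^ 2 + f d' ^ 2) * \<delta> ^ Suc (c d d')"
      using \<delta>0 by (intro mult_right_mono) auto
    with sum have "2 * \<bar>f d * f d'\<bar> * \<delta> ^ Suc (c d d') \<le> w d + w d'" by linarith
    then show ?thesis by (simp add: field_simps)
  qed
  define W where "W = (\<Sum>d\<in>?D. w d)"
  have "W > 0" unfolding W_def
    using d0 \<open>f d0 \<noteq> 0\<close> \<delta>0 w0 by (intro sum_pos2[of _ d0]) (auto simp: w_def)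
  have "form n \<delta> f f = W + (\<Sum>d\<in>?D. \<Sum>d'\<in>?D - {d}. f d * f d' * \<delta> ^ c d d')"
    unfolding form_def W_def sum.distrib[symmetric]
    by (intro sum.cong refl) (simp add: sum.remove w_def c_def power2_eq_square)
  then have "W = - (\<Sum>d\<in>?D. \<Sum>d'\<in>?D - {d}. f d * f d' * \<delta> ^ c d d')"
    using zero by (simp add: eq_neg_iff_add_eq_0)
  then have "\<delta> * W = - (\<delta> * (\<Sum>d\<in>?D. \<Sum>d'\<in>?D - {d}. f d * f d' * \<delta> ^ c d d'))" by simp
  then have "\<delta> * W = - (\<Sum>d\<in>?D. \<Sum>d'\<in>?D - {d}. \<delta> * (f d * f d' * \<delta> ^ c d d'))"
    by (simp only: sum_distrib_left)
  also have "\<dots> \<le> (\<Sum>d\<in>?D. \<Sum>d'\<in>?D - {d}. (w d + w d') / 2)"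
    unfolding sum_negf[symmetric]
  proof (intro sum_mono)
    fix d d' assume dd: "d \<in> ?D" "d' \<in> ?D - {d}"
    have "- (\<delta> * (f d * f d' * \<delta> ^ c d d')) \<le> \<delta> * (\<bar>f d * f d'\<bar> * \<delta> ^ c d d')"
    proof -
      have "- (f d * f d') \<le> \<bar>f d * f d'\<bar>" by (rule abs_ge_minus_self)
      then have "- (f d * f d') * (\<delta> * \<delta> ^ c d d') \<le> \<bar>f d * f d'\<bar> * (\<delta> * \<delta> ^ c d d')"
        using \<delta>0 by (intro mult_right_mono) auto
      then show ?thesis by (simp add: mult_ac)
    qed
    then show "- (\<delta> * (f d * f d' * \<delta> ^ c d d')) \<le> (w d + w d') / 2"
      by (rule order_trans) (rule cross, use dd in auto)
  qed
  also have "\<dots> \<le> (\<Sum>d\<in>?D. \<Sum>d'\<in>?D. (w d + w d') / 2)"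
    using w0 by (intro sum_mono sum_mono2) (auto simp: add_nonneg_nonneg)
  also have "\<dots> = of_nat (card ?D) * W"
    by (simp add: add_divide_distrib sum.distrib W_def flip: sum_divide_distrib sum_distrib_left)
  finally have "\<delta> * W \<le> of_nat (card ?D) * W" .
  then show False using \<open>W > 0\<close> \<delta>(1) by simp
qed

section \<open>Multiplication by a cap is injective on the smaller algebra\<close>

text \<open>
  In the composite with the cap, the edge of the diagram that ends in the dot \<open>n\<close> of the bottom row ends in
  the dot \<open>n + 1\<close> of the top row instead. Thus the diagram can be recovered, here by summing over the colours
  of that dot.
\<close>

lemma cap_mult_injective_diagrams:
  fixes n :: nat
  defines "v \<equiv> {Top (Suc n), Bot (Suc n)}"
  assumes n: "1 \<le> n" and d: "is_diagram n d1" "is_diagram n d2"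
    and eq: "compose_diagrams (Suc n) (insert v d1) (cap_diagram (Suc n) n (Suc n)) =
      compose_diagrams (Suc n) (insert v d2) (cap_diagram (Suc n) n (Suc n))"
  shows "d1 = d2"
proof -
  define E where "E = cap_diagram (Suc n) n (Suc n)"
  have nn: "n \<in> {1..Suc n}" "Suc n \<in> {1..Suc n}" "n \<noteq> Suc n" using n by auto
  have E: "is_diagram (Suc n) E" unfolding E_def by (rule cap_is_diagram[OF nn])
  define l where "l d = num_loops (Suc n) (insert v d) E" for d
  have recover: "transfer_op n d \<psi> A =
      transfer_op (Suc n) (insert v d) (transfer_op (Suc n) E (\<lambda>H. if Suc n \<in> H then 0 else \<psi> H)) A +
      transfer_op (Suc n) (insert v d) (transfer_op (Suc n) E (\<lambda>H. if Suc n \<in> H then \<psi> (H - {Suc n}) else 0)) (insert (Suc n) A)"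
    if d: "is_diagram n d" and A: "A \<subseteq> {1..n}" for d \<psi> A
  proof -
    have A': "A \<subseteq> {1..Suc n}" "insert (Suc n) A \<subseteq> {1..Suc n}" "A \<inter> {1..n} = A" "A \<inter> {Suc n} = {}"
      "insert (Suc n) A \<inter> {1..n} = A" "insert (Suc n) A \<inter> {Suc n} = {Suc n}" using A by auto
    have "transfer_op (Suc n) E (\<lambda>H. if Suc n \<in> H then 0 else \<psi> H) G +
        transfer_op (Suc n) E (\<lambda>H. if Suc n \<in> H then \<psi> (H - {Suc n}) else 0) (G \<union> {Suc n}) = \<psi> G"
      if G: "G \<subseteq> {1..n}" for G
    proof -
      have G': "G \<subseteq> {1..Suc n}" "G \<union> {Suc n} \<subseteq> {1..Suc n}" "Suc n \<notin> G" using G by auto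
      have s: "n \<notin> G \<Longrightarrow> G - {n, Suc n} = G" "n \<in> G \<Longrightarrow> G \<union> {Suc n} \<union> {n, Suc n} - {Suc n} = G" using G'(3) by auto
      show ?thesis
        unfolding E_def transfer_cap[OF nn(1,2) G'(1)] transfer_cap[OF nn(1,2) G'(2)]
        using G'(3) s by (cases "n \<in> G") simp_all
    qed
    then have "transfer_op n d \<psi> A = transfer_op n d (\<lambda>G.
        transfer_op (Suc n) E (\<lambda>H. if Suc n \<in> H then 0 else \<psi> H) G +
        transfer_op (Suc n) E (\<lambda>H. if Suc n \<in> H then \<psi> (H - {Suc n}) else 0) (G \<union> {Suc n})) A"
      unfolding transfer_op_sum[of n d] by (intro sum.cong refl) simp
    also have "\<dots> = transfer_op n d (transfer_op (Suc n) E (\<lambda>H. if Suc n \<in> H then 0 else \<psi> H)) A +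
        transfer_op n d (\<lambda>G. transfer_op (Suc n) E (\<lambda>H. if Suc n \<in> H then \<psi> (H - {Suc n}) else 0) (G \<union> {Suc n})) A"
      unfolding transfer_op_sum[of n d] by (rule sum.distrib)
    finally show ?thesis
      unfolding v_def transfer_add_strand[OF d A'(1)] transfer_add_strand[OF d A'(2)] A'(3-6) Un_empty_right .
  qed
  have tr: "2 ^ l d2 * transfer_op (Suc n) (insert v d1) (transfer_op (Suc n) E \<phi>) A =
      2 ^ l d1 * transfer_op (Suc n) (insert v d2) (transfer_op (Suc n) E \<phi>) A" for \<phi> A
    using eq transfer_op_compose[OF vertical_strand_diagram(1)[OF d(1)] E, folded v_def]
      transfer_op_compose[OF vertical_strand_diagram(1)[OF d(2)] E, folded v_def]
    by (simp add: l_def E_def[symmetric])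
  have "2 ^ l d2 * transfer_op n d1 \<psi> A = 2 ^ l d1 * transfer_op n d2 \<psi> A" if "A \<subseteq> {1..n}" for \<psi> A
    unfolding recover[OF d(1) that] recover[OF d(2) that] distrib_left tr ..
  then show ?thesis by (rule transfer_op_determines(1)[OF d])
qed

lemma cap_mult_injective:
  fixes \<alpha> :: "'k::field brauer"
  assumes n: "1 \<le> n" and \<alpha>: "supported n \<alpha>" and \<delta>: "\<delta> \<noteq> 0"
    and zero: "bmult (Suc n) \<delta> (bembed (Suc n) \<alpha>) (eps_elem (Suc n) n (Suc n)) = (\<lambda>_. 0)"
  shows "\<alpha> = (\<lambda>_. 0)"
proof
  fix d
  show "\<alpha> d = 0"
  proof (cases "is_diagram n d")
    case d: True
    let ?v = "{Top (Suc n), Bot (Suc n)}" and ?E = "cap_diagram (Suc n) n (Suc n)"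
    have E: "is_diagram (Suc n) ?E" by (rule cap_is_diagram) (use n in auto)
    define D where "D = compose_diagrams (Suc n) (insert ?v d) ?E"
    have "bmult (Suc n) \<delta> (bembed (Suc n) \<alpha>) (eps_elem (Suc n) n (Suc n)) D =
        (\<Sum>d1\<in>diagrams (Suc n). \<Sum>d2\<in>diagrams (Suc n).
          if d2 = ?E then bembed (Suc n) \<alpha> d1 * structure_const (Suc n) \<delta> d1 ?E D else 0)"
      unfolding bmult_structure_const eps_elem_basis by (intro sum.cong refl) (simp add: basis_def)
    also have "\<dots> = (\<Sum>d1\<in>diagrams (Suc n). bembed (Suc n) \<alpha> d1 * structure_const (Suc n) \<delta> d1 ?E D)"
      using E by simp
    also have "\<dots> = (\<Sum>d1\<in>diagrams (Suc n). if d1 = insert ?v d then \<alpha> d * \<delta> ^ num_loops (Suc n) (insert ?v d) ?E else 0)"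
    proof (intro sum.cong refl)
      fix d1 assume d1: "d1 \<in> diagrams (Suc n)"
      show "bembed (Suc n) \<alpha> d1 * structure_const (Suc n) \<delta> d1 ?E D =
          (if d1 = insert ?v d then \<alpha> d * \<delta> ^ num_loops (Suc n) (insert ?v d) ?E else 0)"
      proof (cases "d1 = insert ?v d")
        case True
        then show ?thesis using vertical_strand_diagram(2)[OF d]
          by (simp add: bembed_def structure_const_def D_def)
      next
        case False
        have "bembed (Suc n) \<alpha> d1 = 0 \<or> D \<noteq> compose_diagrams (Suc n) d1 ?E"
        proof (cases "?v \<in> d1")
          case True
          then have dd: "is_diagram n (d1 - {?v})" "insert ?v (d1 - {?v}) = d1"
            using remove_vertical_strand d1 by auto
          then show ?thesis using cap_mult_injective_diagrams[OF n d dd(1)] False unfolding D_def by auto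
        qed (simp add: bembed_def)
        then show ?thesis using False by (auto simp: structure_const_def)
      qed
    qed
    also have "\<dots> = \<alpha> d * \<delta> ^ num_loops (Suc n) (insert ?v d) ?E"
      using vertical_strand_diagram(1)[OF d] by simp
    finally show ?thesis using zero \<delta> by simp
  qed (use \<alpha> in \<open>simp add: supported_def\<close>)
qed

section \<open>Spectral decomposition in an algebra with Brauer relations\<close>

context brauer_relations
begin

text \<open>
  If \<open>A k\<close> contains all eigenvalues of \<open>jm (k + 1)\<close> on \<open>idem A c k\<close>, this is the projection to the joint
  eigenspace with the eigenvalues \<open>c 1, \<dots>, c r\<close>.
\<close>

primrec idem :: "(nat \<Rightarrow> 'k set) \<Rightarrow> (nat \<Rightarrow> 'k) \<Rightarrow> nat \<Rightarrow> 'k endo" where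
  "idem A c 0 = unit"
| "idem A c (Suc r) = idem A c r * peval (jm (Suc r)) (lagrange_poly (A r) (c (Suc r)))"

lemma idem_bicentral: "bicentral r (idem A c r)"
proof (induction r)
  case (Suc r)
  then show ?case
    by (auto intro!: bicentral_mult bicentral_peval intro: bicentral_mono)
qed (simp add: bicentral_unit)

lemma idem_unit:
  assumes "unit * unit = unit" "r \<le> N" shows "idem A c r * unit = idem A c r"
  using assms(2)
proof (induction r)
  case (Suc r)
  have com: "unit * peval (jm (Suc r)) p = peval (jm (Suc r)) p * unit" for p
    by (rule peval_commute) (rule unit_jm[OF Suc.prems])
  have "idem A c r * unit = idem A c r" using Suc by simp
  then show ?case unfolding idem.simps by (simp add: mult.assoc flip: com) (simp flip: mult.assoc)
qed (simp add: assms)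

lemma jm_peval_commute: "k \<le> N \<Longrightarrow> r \<le> N \<Longrightarrow> jm k * peval (jm r) p = peval (jm r) p * jm k"
  by (intro peval_commute jm_commute_jm)

lemma idem_eigen:
  assumes eig: "\<And>k. 1 \<le> k \<Longrightarrow> k \<le> r \<Longrightarrow> idem A c k * jm k = c k \<odot> idem A c k"
    and "r \<le> N" "1 \<le> k" "k \<le> r"
  shows "idem A c r * jm k = c k \<odot> idem A c r"
  using \<open>k \<le> r\<close> \<open>r \<le> N\<close> eig
proof (induction r rule: dec_induct)
  case base
  then show ?case using \<open>1 \<le> k\<close> by simp
next
  case (step m)
  have IH: "idem A c m * jm k = c k \<odot> idem A c m" using step by simp
  have "idem A c (Suc m) * jm k = idem A c m * jm k * peval (jm (Suc m)) (lagrange_poly (A m) (c (Suc m)))"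
    using jm_peval_commute[of k "Suc m"] step.hyps step.prems(1) by (simp add: mult.assoc)
  then show ?case by (simp add: IH)
qed

lemma idem_absorb:
  assumes eig: "\<And>k. 1 \<le> k \<Longrightarrow> k \<le> r \<Longrightarrow> idem A c k * jm k = c k \<odot> idem A c k"
    and A: "\<And>k. k < r \<Longrightarrow> finite (A k) \<and> c (Suc k) \<in> A k"
    and unit: "unit * unit = unit" and "r \<le> N" "k \<le> r"
  shows "idem A c r * idem A c k = idem A c r"
  using \<open>k \<le> r\<close>
proof (induction k)
  case 0
  then show ?case using idem_unit[OF unit \<open>r \<le> N\<close>] by simp
next
  case (Suc k)
  have "idem A c r * idem A c (Suc k) = idem A c r * peval (jm (Suc k)) (lagrange_poly (A k) (c (Suc k)))"
    using Suc by (simp flip: mult.assoc)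
  also have "\<dots> = poly (lagrange_poly (A k) (c (Suc k))) (c (Suc k)) \<odot> idem A c r"
    by (rule peval_eigen, rule idem_eigen[OF eig]) (use Suc.prems \<open>r \<le> N\<close> in auto)
  finally show ?case using A[of k] Suc.prems by (simp add: poly_lagrange_poly)
qed

text \<open>
  Multiplying the interpolation polynomial by \<open>X - a\<close> gives a multiple of the polynomial that annihilates
  \<open>E\<close>.
\<close>

lemma lagrange_eigen:
  assumes "finite B" "a \<in> B" "E * peval x (root_poly B) = 0"
  shows "E * peval x (lagrange_poly B a) * x = a \<odot> (E * peval x (lagrange_poly B a))"
proof -
  define k where "k = 1 / (\<Prod>b\<in>B - {a}. a - b)"
  have "root_poly B = root_poly (B - {a}) * [:- a, 1:]"
    using root_poly_remove[OF assms(1,2)] by (simp only: mult.commute)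
  then have "smult k (root_poly B) = lagrange_poly B a * [:- a, 1:]"
    by (simp only: lagrange_poly_def k_def mult_smult_left)
  then have "k \<odot> peval x (root_poly B) = peval x (lagrange_poly B a) * (x - a \<odot> 1)"
    by (metis (no_types, lifting) peval_smult peval_mult peval_linear)
  then have "E * (peval x (lagrange_poly B a) * (x - a \<odot> 1)) = 0"
    using assms(3) by (metis scl_mult_right scl_zero_right)
  then show ?thesis by (simp add: right_diff_distrib mult.assoc)
qed

subsection \<open>The generating function of the moments of a Jucys--Murphy element\<close>

lemma e_e_e:
  assumes "i \<in> {1..N}" "j \<in> {1..N}" "k \<in> {1..N}" "i \<noteq> j" "i \<noteq> k" "j \<noteq> k"
  shows "e i j * s j k * e i j = e i j" "e i j * e j k * e i j = e i j"
proof -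
  note ij = assms(1,2,4) and ik = assms(1,3,5) and jk = assms(2,3,6)
  have "e i j * e j k * e i j = s i k * (e j k * e i j)"
    by (simp only: s_e_e[OF assms] mult.assoc)
  also have "e j k * e i j = s i k * e i j"
    using s_e_e[OF jk(2,1) assms(1) jk(3)[symmetric] ik(3)[symmetric] ij(3)[symmetric]] s_sym[OF ik] e_sym[OF jk] e_sym[OF ij]
    by simp
  finally show 1: "e i j * e j k * e i j = e i j"
    using s_s[OF ik] by (simp flip: mult.assoc)
  have "e i j * s j k = e i j * e i k"
    using e_e_s[OF assms(2,1,3) ij(3)[symmetric] jk(3) ik(3)] e_sym[OF ij] by simp
  then have "e i j * s j k * e i j = e j i * e i k * e j i" using e_sym[OF ij] by simp
  also have "\<dots> = e j i"
  proof -
    have "e j i * e i k * e j i = s j k * (e i k * e j i)"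
      by (simp only: s_e_e[OF assms(2,1,3) ij(3)[symmetric] jk(3) ik(3)] mult.assoc)
    also have "e i k * e j i = s j k * e j i"
      using s_e_e[OF ik(2,1) assms(2) ik(3)[symmetric] jk(3)[symmetric] ij(3)] s_sym[OF jk] e_sym[OF ik] e_sym[OF ij]
      by simp
    finally show ?thesis using s_s[OF jk] by (simp flip: mult.assoc)
  qed
  finally show "e i j * s j k * e i j = e i j" using e_sym[OF ij] by simp
qed

text \<open>
  The series \<open>1 - X/2 + X z\<close> is multiplied by the same quotient in the recursion for the resolvents as
  \<open>root_fps (- A) / root_fps A\<close> in a step of the contents. For a single strand \<open>jm 1\<close> is a scalar, and the
  equation expresses the parameter through it.
\<close>

lemma resolvent_moments:
  assumes two: "(2 :: 'k) \<noteq> 0" and unit: "unit * unit = unit"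
    and A0: "A 0 = {(\<delta> - 1) / 2}"
    and A: "\<And>k. k < r \<Longrightarrow> finite (A k) \<and> c (Suc k) \<in> A k"
    and ratio: "\<And>k. k < r \<Longrightarrow>
      root_fps (uminus ` A (Suc k)) * root_fps (A k) * step_ratio (c (Suc k)) =
      root_fps (A (Suc k)) * root_fps (uminus ` A k) * step_ratio (- c (Suc k))"
    and eig: "\<And>k. 1 \<le> k \<Longrightarrow> k \<le> r \<Longrightarrow> idem A c k * jm k = c k \<odot> idem A c k"
    and "Suc (Suc r) \<le> N"
  defines "h \<equiv> fps_const (1 / 2) * fps_X"
  shows "\<exists>z. (1 - h + fps_X * z) * root_fps (A r) = (1 + h) * root_fps (uminus ` A r) \<and>
    fps_const (idem A c r * e (Suc r) (Suc (Suc r))) * resolvent (jm (Suc r)) * fps_const (e (Suc r) (Suc (Suc r))) =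
    z \<star> fps_const (idem A c r * e (Suc r) (Suc (Suc r)))"
  using A ratio eig \<open>Suc (Suc r) \<le> N\<close>
proof (induction r)
  case 0
  define c0 where "c0 = (\<delta> - 1) / 2"
  have "c0 + c0 = \<delta> - 1"
    unfolding c0_def using two by (simp only: add_divide_distrib[symmetric] mult_2[symmetric]) simp
  then have d: "\<delta> = c0 + c0 + 1" by simp
  let ?u = "1 - fps_const c0 * fps_X"
  have u: "?u $ 0 \<noteq> 0" by simp
  define i where "i = inverse ?u"
  have i: "?u * i = 1" unfolding i_def by (rule inverse_mult_eq_1'[OF u])
  define E where "E = idem A c 0 * e (Suc 0) (Suc (Suc 0))"
  have "E * jm (Suc 0) = c0 \<odot> E" using jm_one by (simp add: c0_def)
  then have "fps_const E * resolvent (jm (Suc 0)) = i \<star> fps_const E" unfolding i_def by (rule resolvent_eigen)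
  moreover have "E * e (Suc 0) (Suc (Suc 0)) = \<delta> \<odot> E"
    unfolding E_def using e_e[of "Suc 0" "Suc (Suc 0)"] 0 by (simp add: mult.assoc)
  ultimately have "fps_const E * resolvent (jm (Suc 0)) * fps_const (e (Suc 0) (Suc (Suc 0))) = i \<star> fps_const (\<delta> \<odot> E)"
    by simp
  also have "fps_const (\<delta> \<odot> E) = fps_const \<delta> \<star> fps_const E"
    by (rule fps_ext) (simp add: fscl_const_nth)
  finally have E: "fps_const E * resolvent (jm (Suc 0)) * fps_const (e (Suc 0) (Suc (Suc 0))) = (i * fps_const \<delta>) \<star> fps_const E"
    by simp
  have hh: "h + h = fps_X"
  proof -
    have "h + h = fps_const (1 / 2 + 1 / 2) * fps_X"
      unfolding h_def by (simp only: distrib_right fps_const_add[symmetric])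
    also have "1 / 2 + 1 / 2 = (1 :: 'k)" using two by (simp only: add_divide_distrib[symmetric] one_add_one) simp
    finally show ?thesis by simp
  qed
  have X: "fps_X * fps_const \<delta> = (h + h) * (fps_const c0 + fps_const c0 + 1)" unfolding hh d
    by (simp only: fps_const_add[symmetric] fps_const_1_eq_1)
  have gen: "(1 - h) * (1 - v * (h + h)) + (h + h) * (v + v + 1) = (1 + h) * (1 + v * (h + h))" for v
    by (simp add: algebra_simps)
  have "(1 - h + fps_X * (i * fps_const \<delta>)) * ?u = (1 - h) * ?u + fps_X * fps_const \<delta> * (?u * i)"
    by (simp add: algebra_simps)
  also have "\<dots> = (1 - h) * ?u + (h + h) * (fps_const c0 + fps_const c0 + 1)"
    unfolding i X by simp
  also have "\<dots> = (1 + h) * (1 + fps_const c0 * fps_X)"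
    unfolding hh[symmetric] by (rule gen)
  finally have "(1 - h + fps_X * (i * fps_const \<delta>)) * root_fps (A 0) = (1 + h) * root_fps (uminus ` A 0)"
    by (simp add: A0 root_fps_def c0_def flip: fps_const_neg)
  then show ?case using E unfolding E_def by blast
next
  case (Suc r)
  let ?n = "Suc r" and ?n1 = "Suc (Suc r)" and ?n2 = "Suc (Suc (Suc r))"
  obtain z where z: "(1 - h + fps_X * z) * root_fps (A r) = (1 + h) * root_fps (uminus ` A r)"
    and zr: "fps_const (idem A c r * e ?n ?n1) * resolvent (jm ?n) * fps_const (e ?n ?n1) =
      z \<star> fps_const (idem A c r * e ?n ?n1)"
  proof -
    have "\<exists>z. (1 - h + fps_X * z) * root_fps (A r) = (1 + h) * root_fps (uminus ` A r) \<and>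
      fps_const (idem A c r * e ?n ?n1) * resolvent (jm ?n) * fps_const (e ?n ?n1) =
      z \<star> fps_const (idem A c r * e ?n ?n1)"
      by (rule Suc.IH) (use Suc.prems in auto)
    then show ?thesis using that by blast
  qed
  define F where "F = idem A c r"
  define E where "E = idem A c ?n"
  define x where "x = jm ?n"
  define y where "y = jm ?n1"
  define S where "S = s ?n ?n1"
  define d where "d = e ?n ?n1"
  define d' where "d' = e ?n ?n2"
  define e1 where "e1 = e ?n1 ?n2"
  define t where "t = s ?n1 ?n2"
  have n: "?n \<ge> 1" "?n1 \<le> N" using Suc.prems by auto
  have m: "?n \<in> {1..N}" "?n1 \<in> {1..N}" "?n2 \<in> {1..N}" using Suc.prems(4) by auto
  have ne: "?n \<noteq> ?n1" "?n \<noteq> ?n2" "?n1 \<noteq> ?n2" by auto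
  note p123 = m ne
  have SS: "S * S = 1" and dS: "d * S = d" and tt: "t * t = 1"
    unfolding S_def d_def t_def by (rule s_s[OF m(1,2) ne(1)], rule e_s[OF m(1,2) ne(1)], rule s_s[OF m(2,3) ne(3)])
  have conj: "S * x * S = y - S + d" unfolding S_def x_def y_def d_def by (rule s_jm_conj[OF n])
  have yS: "y * S = S * x + 1 - d"
  proof -
    have y: "y = S * x * S + S - d" using conj by simp
    have "y * S = S * x * (S * S) + S * S - d * S"
      unfolding y by (simp only: distrib_right left_diff_distrib mult.assoc)
    then show ?thesis by (simp add: SS dS)
  qed
  have xy: "x * y = y * x" unfolding x_def y_def by (rule jm_commute_jm) (use n in auto)
  have yd: "y * d = - (x * d)" and dy: "d * y = - (d * x)"
    using e_jm_sum[OF n two] unfolding x_def y_def d_def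
    by (simp_all add: distrib_left distrib_right eq_neg_iff_add_eq_0 add.commute)
  have e1x: "e1 * x = x * e1" unfolding e1_def x_def
    by (rule jm_commute_disjoint(2)) (use m in auto)
  note p231 = m(2,3,1) ne(3) ne(1)[symmetric] ne(2)[symmetric]
  have "e ?n1 ?n2 = e ?n2 ?n1" by (rule e_sym[OF m(2,3) ne(3)])
  note p321 = m(3,2,1) ne(3)[symmetric] ne(2)[symmetric] ne(1)[symmetric]
  have e1S: "e1 * S * e1 = e1" and e1d: "e1 * d * e1 = e1"
    using e_e_e[OF p321] unfolding e1_def S_def d_def
    by (simp_all add: e_sym[OF m(3,2) ne(3)[symmetric]] s_sym[OF m(2,1) ne(1)[symmetric]] e_sym[OF m(2,1) ne(1)[symmetric]])
  have e1d': "e1 * d' * e1 = e1"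
    using e_e_e(2)[OF p231] unfolding e1_def d'_def by (simp add: e_sym[OF m(3,1) ne(2)[symmetric]])
  have es: "e1 * S = e1 * d'"
    using e_e_s[OF p231] unfolding e1_def S_def d'_def
    by (simp add: e_sym[OF m(3,1) ne(2)[symmetric]] s_sym[OF m(2,1) ne(1)[symmetric]])
  have se: "S * e1 = d' * e1"
  proof -
    have "e ?n ?n2 * e ?n2 ?n1 = s ?n ?n1 * e ?n2 ?n1"
      by (rule s_e_e) (use m in auto)
    then show ?thesis unfolding e1_def S_def d'_def by (simp add: e_sym[OF m(3,2) ne(3)[symmetric]])
  qed
  have Fb: "bicentral r F" unfolding F_def by (rule idem_bicentral)
  have Fe1: "F * e1 = e1 * F" and Ft: "F * t = t * F"
    unfolding e1_def t_def by (rule bicentral_commute_above[OF Fb m(2,3) ne(3)]; simp)+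
  have Eb: "bicentral ?n E" unfolding E_def by (rule idem_bicentral)
  have Ee1: "E * e1 = e1 * E"
    unfolding e1_def by (rule bicentral_commute_above[OF Eb m(2,3) ne(3)]; simp)
  have EF: "E * F = E"
    unfolding E_def F_def by (rule idem_absorb[OF _ _ unit]) (use Suc.prems in auto)
  have Ex: "E * x = c ?n \<odot> E" unfolding E_def x_def using Suc.prems(3)[of ?n] by simp
  have "E * (- x) = (- c ?n) \<odot> E" by (simp add: Ex scl_minus_left)
  note eigens = resolvent_eigen[OF Ex] resolvent_eigen[OF this]
  define i where "i = inverse (1 - fps_const (c ?n) * fps_X)"
  define j where "j = inverse (1 - fps_const (- c ?n) * fps_X)"
  have Fd: "fps_const (F * d) * resolvent x * fps_const d = z \<star> fps_const (F * d)"
    using zr by (simp add: F_def d_def x_def)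
  have Fd': "fps_const (F * d') * resolvent x * fps_const d' = z \<star> fps_const (F * d')"
  proof -
    have td: "t * d * t = d'"
    proof -
      have "s ?n2 ?n1 * e ?n1 ?n = e ?n2 ?n * s ?n2 ?n1" by (rule s_e_braid) (use m in auto)
      then have "t * d = d' * t" unfolding t_def d_def d'_def
        by (simp add: s_sym[OF m(3,2) ne(3)[symmetric]] e_sym[OF m(3,1) ne(2)[symmetric]] e_sym[OF m(2,1) ne(1)[symmetric]])
      then show ?thesis by (simp add: mult.assoc tt)
    qed
    have tx: "fps_const t * resolvent x = resolvent x * fps_const t"
      unfolding t_def x_def by (rule resolvent_commute, rule jm_commute_disjoint(1)) (use m in auto)
    have Fd't: "F * d' = t * (F * d) * t" unfolding td[symmetric] using Ft by (simp flip: mult.assoc)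
    have "fps_const (F * d') * resolvent x * fps_const d' =
        fps_const t * fps_const (F * d) * (fps_const t * resolvent x) * fps_const (t * d * t)"
      unfolding Fd't td by (simp add: mult.assoc flip: fps_const_mult)
    also have "\<dots> = fps_const t * (fps_const (F * d) * resolvent x * (fps_const (t * t) * fps_const d)) * fps_const t"
      unfolding tx by (simp only: mult.assoc fps_const_mult[symmetric])
    also have "fps_const (t * t) * fps_const d = fps_const d" by (simp add: tt)
    also have "fps_const t * (fps_const (F * d) * resolvent x * fps_const d) * fps_const t = z \<star> fps_const (F * d')"
      unfolding Fd Fd't by (simp only: fscl_simps mult.assoc fps_const_mult)
    finally show ?thesis .
  qed
  note rec = resolvent_recursion[OF xy yS SS yd dy dS e1x e1S e1d es se e1d' Fe1 Fd Fd' EF Ee1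
      eigens, folded i_def j_def]
  define b where "b = 1 - fps_X * fps_X * i * i"
  have b0: "b $ 0 \<noteq> 0" by (simp add: b_def mult.assoc)
  define num where "num = z + fps_X * i * i - fps_X * fps_X * i * i * j - fps_X * j * j + fps_X * fps_X * i * j * j
       - fps_X * fps_X * z * j * j"
  define z' where "z' = inverse b * num"
  have bb: "inverse b * b = 1" by (rule inverse_mult_eq_1[OF b0])
  have "inverse b \<star> b \<star> (fps_const (E * e1) * resolvent y * fps_const e1) = inverse b \<star> num \<star> fps_const (E * e1)"
    using rec by (simp only: b_def num_def)
  then have z'r: "fps_const (E * e1) * resolvent y * fps_const e1 = z' \<star> fps_const (E * e1)"
    by (simp add: bb z'_def)
  define p where "p = fps_const (c ?n) * fps_X"
  have ij: "(1 - p) * i = 1" "(1 + p) * j = 1"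
    unfolding i_def j_def p_def
    using inverse_mult_eq_1'[of "1 - fps_const (c ?n) * fps_X"] inverse_mult_eq_1'[of "1 + fps_const (c ?n) * fps_X"]
    by (simp_all flip: fps_const_neg)
  have sum_ij: "i + j = 2 * (i * j)"
  proof -
    have "(1 + p) * j * i + (1 - p) * i * j = 2 * (i * j)" by (simp add: algebra_simps)
    then show ?thesis unfolding ij by (simp add: add.commute)
  qed
  have X2: "fps_X = 2 * h"
  proof -
    have "2 * h = fps_const (1 / 2 + 1 / 2) * fps_X"
      unfolding h_def mult_2 by (simp only: distrib_right fps_const_add[symmetric])
    also have "1 / 2 + 1 / 2 = (1 :: 'k)" using two by (simp only: add_divide_distrib[symmetric] one_add_one) simp
    finally show ?thesis by simp
  qed
  have bz': "b * z' = num"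
    using bb by (simp add: z'_def mult.assoc[symmetric]) (simp add: mult.commute)
  \<comment> \<open>In the combination \<open>1 - h + X z\<close> the recursion has no inhomogeneous term.\<close>
  have main: "(1 - h + fps_X * z') * b = (1 - h + fps_X * z) * (1 - fps_X * fps_X * j * j)"
  proof -
    have "(1 - h + fps_X * z') * b = (1 - h) * b + fps_X * num"
      unfolding bz'[symmetric] by (simp add: algebra_simps)
    also have "\<dots> - (1 - h + fps_X * z) * (1 - fps_X * fps_X * j * j) =
        fps_X * fps_X * (i - j) * (h * (i + j) - fps_X * (i * j))"
      unfolding b_def num_def by (simp add: algebra_simps)
    also have "h * (i + j) - fps_X * (i * j) = 0" unfolding sum_ij X2 by (simp add: algebra_simps)
    finally show ?thesis by simp
  qed
  have ratio_i: "b * (1 - p) ^ 2 = (1 - p) ^ 2 - fps_X ^ 2"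
  proof -
    have "b * (1 - p) ^ 2 = (1 - p) ^ 2 - fps_X ^ 2 * ((1 - p) * i) ^ 2"
      unfolding b_def by (simp add: algebra_simps power2_eq_square)
    then show ?thesis by (simp add: ij)
  qed
  have ratio_j: "(1 - fps_X * fps_X * j * j) * (1 + p) ^ 2 = (1 + p) ^ 2 - fps_X ^ 2"
  proof -
    have "(1 - fps_X * fps_X * j * j) * (1 + p) ^ 2 = (1 + p) ^ 2 - fps_X ^ 2 * ((1 + p) * j) ^ 2"
      by (simp add: algebra_simps power2_eq_square)
    then show ?thesis by (simp add: ij)
  qed
  have sr: "step_ratio (c ?n) = b * (1 - p) ^ 2 * (1 + p) ^ 2"
      "step_ratio (- c ?n) = (1 - fps_X * fps_X * j * j) * (1 + p) ^ 2 * (1 - p) ^ 2"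
    unfolding step_ratio_def ratio_i ratio_j by (simp_all add: p_def flip: fps_const_neg)
  define w where "w = (1 - p) ^ 2 * (1 + p) ^ 2"
  have w0: "w $ 0 = 1" by (simp add: w_def p_def power2_eq_square)
  have "w \<noteq> 0" using w0 by (metis fps_zero_nth zero_neq_one)
  define P Q P' Q' where "P = root_fps (A r)" "Q = root_fps (uminus ` A r)"
    "P' = root_fps (A ?n)" "Q' = root_fps (uminus ` A ?n)"
  note PQ = this
  have "P $ 0 = 1"
    unfolding PQ using Suc.prems(1)[of r] by (intro root_fps_nth(3)) auto
  then have "P \<noteq> 0" by (metis fps_zero_nth zero_neq_one)
  have bnz: "b \<noteq> 0" using b0 by auto
  have "w * (Q' * P * b) = w * (P' * Q * (1 - fps_X * fps_X * j * j))"
    using Suc.prems(2)[of r] unfolding sr PQ w_def by (simp add: mult_ac)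
  then have r': "Q' * P * b = P' * Q * (1 - fps_X * fps_X * j * j)" using \<open>w \<noteq> 0\<close> by simp
  have zPQ: "(1 - h + fps_X * z) * P = (1 + h) * Q" using z by (simp add: PQ)
  have "(P * b) * ((1 - h + fps_X * z') * P') = P * P' * ((1 - h + fps_X * z') * b)" by (simp add: mult_ac)
  also have "\<dots> = P' * ((1 - h + fps_X * z) * P) * (1 - fps_X * fps_X * j * j)"
    unfolding main by (simp add: mult_ac)
  also have "\<dots> = (1 + h) * (P' * Q * (1 - fps_X * fps_X * j * j))" unfolding zPQ by (simp add: mult_ac)
  also have "\<dots> = (P * b) * ((1 + h) * Q')" unfolding r'[symmetric] by (simp add: mult_ac)
  finally have "(1 - h + fps_X * z') * P' = (1 + h) * Q'" using \<open>P \<noteq> 0\<close> bnz by simp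
  then show ?case using z'r unfolding PQ E_def e1_def y_def by blast
qed

text \<open>
  The product of \<open>z\<close> and its denominator \<open>root_fps B\<close> is a polynomial of degree less than \<open>card B\<close>: the
  coefficients that could spoil this cancel, because the number of contents is odd. The remaining
  coefficients are the moments with respect to multiples of \<open>root_poly B\<close>.
\<close>

lemma cap_root_poly_cap:
  assumes two: "(2 :: 'k) \<noteq> 0" and fin: "finite B" and odd: "odd (card B)"
    and z: "(1 - fps_const (1 / 2) * fps_X + fps_X * z) * root_fps B =
      (1 + fps_const (1 / 2) * fps_X) * root_fps (uminus ` B)"
    and E: "fps_const (E * f) * resolvent y * fps_const f = z \<star> fps_const (E * f)"
  shows "E * f * (peval y (root_poly B) * peval y q) * f = 0"
proof -
  have card: "card (uminus ` B) = card B" by (rule card_image) simp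
  have zB: "(root_fps B * z) $ k = 0" if "card B \<le> k" for k
  proof -
    have "fps_X * (root_fps B * z) = (1 + fps_const (1 / 2) * fps_X) * root_fps (uminus ` B) -
        (1 - fps_const (1 / 2) * fps_X) * root_fps B"
      using z by (simp add: algebra_simps)
    then have "(fps_X * (root_fps B * z)) $ Suc k = ((1 + fps_const (1 / 2) * fps_X) * root_fps (uminus ` B) -
        (1 - fps_const (1 / 2) * fps_X) * root_fps B) $ Suc k" by simp
    then have "(root_fps B * z) $ k = root_fps (uminus ` B) $ Suc k + (1 / 2) * root_fps (uminus ` B) $ k -
        (root_fps B $ Suc k - (1 / 2) * root_fps B $ k)"
      by (simp add: distrib_right left_diff_distrib mult.assoc)
    also have "\<dots> = (1 / 2) * (root_fps (uminus ` B) $ k + root_fps B $ k)"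
      using root_fps_nth(1)[OF fin, of "Suc k"] root_fps_nth(1)[of "uminus ` B" "Suc k"] fin that card
      by (simp add: distrib_left)
    also have "root_fps (uminus ` B) $ k + root_fps B $ k = 0"
    proof (cases "k = card B")
      case True
      have "root_fps (uminus ` B) $ k = (\<Prod>a\<in>uminus ` B. - a)"
        using root_fps_nth(2)[of "uminus ` B"] fin card True by simp
      also have "\<dots> = (\<Prod>a\<in>B. a)" by (subst prod.reindex) simp_all
      finally have "root_fps (uminus ` B) $ k = (\<Prod>a\<in>B. a)" .
      moreover have "(\<Prod>a\<in>B. - a) = - (\<Prod>a\<in>B. a)"
        using prod_uminus[of "\<lambda>a. a" B] odd by simp
      ultimately show ?thesis using root_fps_nth(2)[OF fin] True by simp
    next
      case False
      then have "card B < k" using that by simp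
      then show ?thesis using root_fps_nth(1)[OF fin] root_fps_nth(1)[of "uminus ` B" k] fin card by simp
    qed
    finally show ?thesis by simp
  qed
  have power: "E * f * (peval y (root_poly B) * y ^ k) * f = 0" for k
  proof -
    have "fps_const (E * f) * (root_fps B \<star> resolvent y) * fps_const f = (root_fps B * z) \<star> fps_const (E * f)"
      using E by simp
    then have "(fps_const (E * f) * (root_fps B \<star> resolvent y) * fps_const f) $ (card B + k) =
        ((root_fps B * z) \<star> fps_const (E * f)) $ (card B + k)" by (rule arg_cong)
    then show ?thesis
      unfolding fps_mult_left_const_nth fps_mult_right_const_nth fscl_const_nth
      using root_fps_resolvent_nth[OF fin, of "card B + k" y] zB[of "card B + k"] by simp
  qed
  have "E * f * (peval y (root_poly B) * (y ^ k * peval y q)) * f = 0" for k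
  proof (induction q arbitrary: k)
    case (pCons a q)
    have "y ^ k * peval y (pCons a q) = a \<odot> y ^ k + y ^ Suc k * peval y q"
      by (simp add: distrib_left power_commutes flip: mult.assoc)
    then show ?case using power[of k] pCons.IH[of "Suc k"] by (simp add: distrib_left distrib_right del: power_Suc)
  qed simp
  from this[of 0] show ?thesis by simp
qed

end

section \<open>The primitive idempotents as polynomials in the Jucys--Murphy elements\<close>

definition bpeval :: "nat \<Rightarrow> 'k::field \<Rightarrow> nat \<Rightarrow> 'k poly \<Rightarrow> 'k brauer" where
  "bpeval n \<delta> r p =
    fold_coeffs (\<lambda>a f. bplus (bscale a (bone n)) (bmult n \<delta> (jucys_murphy n \<delta> r) f)) p (\<lambda>_. 0)"

lemma bscale_zero [simp]: "bscale 0 a = (\<lambda>_. 0)" and bplus_zero [simp]: "bplus a (\<lambda>_. 0) = a"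
  and bmult_zero [simp]: "bmult n \<delta> a (\<lambda>_. 0) = (\<lambda>_. 0)"
  by (simp_all add: bscale_def bplus_def bmult_def)

lemma bpeval_0 [simp]: "bpeval n \<delta> r 0 = (\<lambda>_. 0)"
  by (simp add: bpeval_def)

lemma bpeval_pCons:
  "bpeval n \<delta> r (pCons a p) = bplus (bscale a (bone n)) (bmult n \<delta> (jucys_murphy n \<delta> r) (bpeval n \<delta> r p))"
  by (cases "p = 0 \<and> a = 0") (auto simp: bpeval_def)

lemma supported_zero: "supported n (\<lambda>_. 0)"
  by (simp add: supported_def)

lemma bpeval_supported: "supported n (bpeval n \<delta> r p)"
  by (induction p) (simp_all add: bpeval_pCons supported_zero supported_linear supported_bone bmult_supported)

lemma left_mult_jucys_murphy: "left_mult n \<delta> (jucys_murphy n \<delta> r) = left_mult n \<delta> (bone n) * brauer.jm \<delta> n r"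
  unfolding left_mult_jm by (simp add: left_mult_bmult left_mult_bone)

lemma jm_unit: "r \<le> n \<Longrightarrow> brauer.jm \<delta> n r * left_mult n \<delta> (bone n) = left_mult n \<delta> (bone n) * brauer.jm \<delta> n r"
  using brauer.unit_jm[of r n \<delta>] by simp

lemma left_mult_bpeval:
  assumes "r \<le> n"
  shows "left_mult n \<delta> (bpeval n \<delta> r p) = left_mult n \<delta> (bone n) * peval (brauer.jm \<delta> n r) p"
proof (induction p)
  case (pCons a p)
  let ?u = "left_mult n \<delta> (bone n)" and ?x = "brauer.jm \<delta> n r"
  have "?u * ?x * (?u * peval ?x p) = ?u * (?x * ?u) * peval ?x p" by (simp only: mult.assoc)
  also have "\<dots> = (?u * ?u) * ?x * peval ?x p" unfolding jm_unit[OF assms] by (simp only: mult.assoc)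
  finally have "?u * ?x * (?u * peval ?x p) = ?u * ?x * peval ?x p" by (simp only: left_mult_bone)
  then show ?case
    by (simp add: bpeval_pCons left_mult_linear left_mult_bmult left_mult_jucys_murphy pCons.IH
      distrib_left mult.assoc)
qed (simp add: left_mult_zero)

lemma bembed_zero [simp]: "bembed n (\<lambda>_. 0) = (\<lambda>_. 0)"
  by (simp add: bembed_def)

lemma bembed_bpeval: "r \<in> {1..m} \<Longrightarrow> bembed (Suc m) (bpeval m \<delta> r p) = bpeval (Suc m) \<delta> r p"
  by (induction p) (simp_all add: bpeval_pCons bembed_linear bembed_bone bembed_bmult bembed_jucys_murphy)

lemma bpeval_eqI:
  "r \<le> n \<Longrightarrow> supported n a \<Longrightarrow> left_mult n \<delta> a = left_mult n \<delta> (bone n) * peval (brauer.jm \<delta> n r) p \<Longrightarrow>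
    a = bpeval n \<delta> r p"
  using left_mult_inject[OF _ bpeval_supported] left_mult_bpeval by metis

lemma linear_factor: "r \<le> n \<Longrightarrow>
  left_mult n \<delta> (bminus (jucys_murphy n \<delta> r) (bscale a (bone n))) =
    left_mult n \<delta> (bone n) * peval (brauer.jm \<delta> n r) [:- a, 1:]"
  by (simp only: left_mult_linear left_mult_jucys_murphy peval_linear right_diff_distrib scl_mult_right mult_1_right)

lemma unit_peval_mult:
  assumes "r \<le> n"
  shows "left_mult n \<delta> (bone n) * peval (brauer.jm \<delta> n r) p * (left_mult n \<delta> (bone n) * peval (brauer.jm \<delta> n r) q) =
    left_mult n \<delta> (bone n) * peval (brauer.jm \<delta> n r) (p * q)"
proof -
  let ?u = "left_mult n \<delta> (bone n)" and ?x = "brauer.jm \<delta> n r"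
  have com: "peval ?x p * ?u = ?u * peval ?x p"
    using peval_commute[of ?u ?x p] jm_unit[OF assms, of \<delta>] by simp
  have "?u * peval ?x p * (?u * peval ?x q) = ?u * (peval ?x p * ?u) * peval ?x q" by (simp only: mult.assoc)
  also have "\<dots> = (?u * ?u) * (peval ?x p * peval ?x q)" unfolding com by (simp only: mult.assoc)
  finally show ?thesis by (simp only: left_mult_bone peval_mult)
qed

lemma linear_factors_commute:
  fixes \<delta> :: "'k::field"
  assumes "r \<le> n"
  shows "comp_fun_commute (\<lambda>\<beta>. bmult n \<delta> (bminus (jucys_murphy n \<delta> r) (bscale (a \<beta>) (bone n))))"
proof
  fix \<beta> \<gamma>
  let ?f = "\<lambda>\<beta>. bminus (jucys_murphy n \<delta> r) (bscale (a \<beta>) (bone n))"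
  have "left_mult n \<delta> (bmult n \<delta> (?f \<beta>) (?f \<gamma>)) = left_mult n \<delta> (bmult n \<delta> (?f \<gamma>) (?f \<beta>))"
    unfolding left_mult_bmult linear_factor[OF assms] unit_peval_mult[OF assms] by (simp only: mult.commute)
  then have "bmult n \<delta> (?f \<beta>) (?f \<gamma>) = bmult n \<delta> (?f \<gamma>) (?f \<beta>)"
    by (simp only: left_mult_inject[OF bmult_supported bmult_supported])
  then show "bmult n \<delta> (?f \<gamma>) \<circ> bmult n \<delta> (?f \<beta>) = bmult n \<delta> (?f \<beta>) \<circ> bmult n \<delta> (?f \<gamma>)"
    by (intro ext) (simp flip: bmult_assoc)
qed

lemma fold_linear_factors:
  assumes "r \<le> n" "finite B"
  shows "Finite_Set.fold (\<lambda>\<beta>. bmult n \<delta> (bminus (jucys_murphy n \<delta> r) (bscale (a \<beta>) (bone n)))) (bone n) B =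
    bpeval n \<delta> r (\<Prod>\<beta>\<in>B. [:- a \<beta>, 1:])"
  using assms(2)
proof (induction B rule: finite_induct)
  case empty
  show ?case by (rule bpeval_eqI[OF assms(1)]) (simp_all add: supported_bone)
next
  case (insert \<beta> B)
  interpret comp_fun_commute "\<lambda>\<beta>. bmult n \<delta> (bminus (jucys_murphy n \<delta> r) (bscale (a \<beta>) (bone n)))"
    by (rule linear_factors_commute[OF assms(1)])
  have "left_mult n \<delta> (bmult n \<delta> (bminus (jucys_murphy n \<delta> r) (bscale (a \<beta>) (bone n)))
      (bpeval n \<delta> r (\<Prod>\<beta>\<in>B. [:- a \<beta>, 1:]))) =
      left_mult n \<delta> (bone n) * peval (brauer.jm \<delta> n r) (\<Prod>\<beta>\<in>insert \<beta> B. [:- a \<beta>, 1:])"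
    unfolding left_mult_bmult linear_factor[OF assms(1)] left_mult_bpeval[OF assms(1)] unit_peval_mult[OF assms(1)]
      prod.insert[OF insert(1,2)] ..
  then show ?case
    unfolding fold_insert[OF insert(1,2)] insert.IH by (rule bpeval_eqI[OF assms(1) bmult_supported])
qed

lemma bpeval_smult: "r \<le> n \<Longrightarrow> bscale k (bpeval n \<delta> r p) = bpeval n \<delta> r (smult k p)"
  by (rule bpeval_eqI) (simp_all add: supported_linear bpeval_supported left_mult_linear left_mult_bpeval peval_smult)

text \<open>
  Updown tableaux without a prescribed final diagram, so that truncating and extending them is possible.
  Adding and removing a box are both symmetric differences.
\<close>

definition updown_path :: "nat \<Rightarrow> (nat \<Rightarrow> box set) \<Rightarrow> bool" where
  "updown_path n T \<longleftrightarrow> T 0 = {} \<and> (\<forall>r<n. step_box T (Suc r) \<in> addable (T r) \<union> removable (T r) \<and>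
    T (Suc r) = sym_diff (T r) {step_box T (Suc r)})"

lemma updown_tableau_path:
  assumes "updown_tableau n lam T" shows "updown_path n T"
  unfolding updown_path_def
proof (intro conjI allI impI)
  show "T 0 = {}" using assms by (simp add: updown_tableau_def)
  fix r assume "r < n"
  then have r: "Suc r \<in> {1..n}" by simp
  have "\<forall>r\<in>{1..n}. is_young_diagram (T r) \<and>
      ((\<exists>\<alpha>\<in>addable (T (r - 1)). T r = insert \<alpha> (T (r - 1))) \<or>
       (\<exists>\<alpha>\<in>removable (T (r - 1)). T r = T (r - 1) - {\<alpha>}))"
    using assms unfolding updown_tableau_def by (elim conjE)
  from bspec[OF this r]
  have "(\<exists>\<alpha>\<in>addable (T r). T (Suc r) = insert \<alpha> (T r)) \<or> (\<exists>\<alpha>\<in>removable (T r). T (Suc r) = T r - {\<alpha>})"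
    unfolding diff_Suc_1 by (rule conjunct2)
  then obtain \<alpha> where \<alpha>: "\<alpha> \<in> addable (T r) \<union> removable (T r)" "T (Suc r) = sym_diff (T r) {\<alpha>}"
  proof (elim disjE bexE)
    fix \<alpha> assume a: "\<alpha> \<in> addable (T r)" "T (Suc r) = insert \<alpha> (T r)"
    then have "\<alpha> \<notin> T r" by (simp add: addable_def)
    then have "insert \<alpha> (T r) = sym_diff (T r) {\<alpha>}" by blast
    then show ?thesis using that[of \<alpha>] a by simp
  next
    fix \<alpha> assume a: "\<alpha> \<in> removable (T r)" "T (Suc r) = T r - {\<alpha>}"
    then have "\<alpha> \<in> T r" by (simp add: removable_def)
    then have "T r - {\<alpha>} = sym_diff (T r) {\<alpha>}" by blast
    then show ?thesis using that[of \<alpha>] a by simp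
  qed
  have "sym_diff (T r) (sym_diff (T r) {\<alpha>}) = {\<alpha>}" by blast
  then have "step_box T (Suc r) = \<alpha>" by (simp add: step_box_def \<alpha>(2))
  then show "step_box T (Suc r) \<in> addable (T r) \<union> removable (T r)"
    "T (Suc r) = sym_diff (T r) {step_box T (Suc r)}" using \<alpha> by simp_all
qed

lemma updown_path_mono: "updown_path n T \<Longrightarrow> m \<le> n \<Longrightarrow> updown_path m T"
  by (simp add: updown_path_def)

lemma path_downset:
  assumes "updown_path n T" "r \<le> n" shows "downset (T r)"
  using assms(2)
proof (induction r)
  case 0
  then show ?case using assms(1) by (simp add: updown_path_def downset_def)
next
  case (Suc r)
  let ?\<alpha> = "step_box T (Suc r)"
  have s: "?\<alpha> \<in> addable (T r) \<union> removable (T r)" "T (Suc r) = sym_diff (T r) {?\<alpha>}"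
    using assms(1) Suc.prems by (auto simp: updown_path_def)
  have "is_young_diagram (T (Suc r))" using s(1)
  proof
    assume a: "?\<alpha> \<in> addable (T r)"
    then have "?\<alpha> \<notin> T r" by (simp add: addable_def)
    then have "T (Suc r) = insert ?\<alpha> (T r)" using s(2) by blast
    then show ?thesis using a by (simp only: addable_def mem_Collect_eq)
  next
    assume a: "?\<alpha> \<in> removable (T r)"
    then have "?\<alpha> \<in> T r" by (simp add: removable_def)
    then have "T (Suc r) = T r - {?\<alpha>}" using s(2) by blast
    then show ?thesis using a by (simp only: removable_def mem_Collect_eq)
  qed
  then show ?case by (simp only: is_young_diagram_iff)
qed

lemma path_content:
  assumes "updown_path n T" "r < n"
  shows "tableau_content \<delta> T (Suc r) = box_content \<delta> (T r) (step_box T (Suc r))"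
    "tableau_content \<delta> T (Suc r) \<in> next_contents \<delta> (T r)"
  using assms by (auto simp: tableau_content_def next_contents_def updown_path_def)

lemma addable_empty: "addable {} = {(1, 1)}" and removable_empty: "removable {} = {}"
proof -
  have d: "downset {}" by (simp add: downset_def)
  have "(i, j) \<in> addable {} \<longleftrightarrow> i = 1 \<and> j = 1" for i j
    unfolding addable_iff[OF d] by (auto simp: row_length_def)
  then show "addable {} = {(1, 1)}" by auto
qed (simp add: removable_def)

lemma next_contents_empty: "next_contents \<delta> {} = {(\<delta> - 1) / 2}"
  by (simp add: next_contents_def addable_empty removable_empty box_content_alt int_content_def)

text \<open>
  Distinct boxes have distinct contents, so the product over the other boxes in the definition is a product
  over the other contents. For \<open>r = 0\<close> there is only one content and the interpolation polynomial is \<open>1\<close>.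
\<close>

lemma primitive_idempotent_Suc:
  fixes \<delta> :: "'k::field"
  assumes T: "updown_path (Suc r) T" and g: "generic_parameter \<delta>"
  shows "primitive_idempotent \<delta> (Suc r) T = bmult (Suc r) \<delta> (bembed (Suc r) (primitive_idempotent \<delta> r T))
    (bpeval (Suc r) \<delta> (Suc r) (lagrange_poly (next_contents \<delta> (T r)) (tableau_content \<delta> T (Suc r))))"
proof (cases r)
  case 0
  have "T 0 = {}" using T by (simp add: updown_path_def)
  moreover have "tableau_content \<delta> T (Suc 0) \<in> next_contents \<delta> (T 0)"
    by (rule path_content(2)[OF T]) simp
  ultimately have "lagrange_poly (next_contents \<delta> (T 0)) (tableau_content \<delta> T (Suc 0)) = 1"
    by (simp add: next_contents_empty lagrange_poly_def root_poly_def)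
  moreover have "bpeval (Suc 0) \<delta> (Suc 0) 1 = bone (Suc 0)"
    by (rule bpeval_eqI[symmetric]) (simp_all add: supported_bone)
  ultimately show ?thesis
    using bembed_bone[of 0, where 'a = 'k] by (simp add: 0 supported_bmult_bone supported_bone)
next
  case (Suc m)
  let ?n = "Suc r"
  let ?B = "other_boxes T ?n" and ?a = "box_content \<delta> (T r)" and ?c = "tableau_content \<delta> T ?n"
  let ?S = "addable (T r) \<union> removable (T r)" and ?\<alpha> = "step_box T ?n"
  have d: "downset (T r)" by (rule path_downset[OF T]) simp
  have \<alpha>: "?\<alpha> \<in> ?S" using T by (simp add: updown_path_def)
  have fin: "finite ?S"
    using addable_removable_product(3,4)[OF d, of "\<lambda>_. 1 :: int"] by simp
  have B: "?B = ?S - {?\<alpha>}" by (simp add: other_boxes_def)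
  have inj: "inj_on ?a ?S" by (rule box_content_inj_on[OF d g])
  have c: "?c = ?a ?\<alpha>" by (rule path_content(1)[OF T]) simp
  have img: "next_contents \<delta> (T r) - {?c} = ?a ` ?B"
    unfolding next_contents_def c B using inj \<alpha> by (auto simp: inj_on_def)
  have injB: "inj_on ?a ?B" using inj unfolding B by (rule inj_on_subset) blast
  have "bscale (1 / (\<Prod>\<beta>\<in>?B. ?c - ?a \<beta>))
      (Finite_Set.fold (\<lambda>\<beta>. bmult ?n \<delta> (bminus (jucys_murphy ?n \<delta> ?n) (bscale (?a \<beta>) (bone ?n)))) (bone ?n) ?B) =
      bpeval ?n \<delta> ?n (smult (1 / (\<Prod>\<beta>\<in>?B. ?c - ?a \<beta>)) (\<Prod>\<beta>\<in>?B. [:- ?a \<beta>, 1:]))"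
    using fin by (simp only: fold_linear_factors[OF order_refl] B finite_Diff bpeval_smult order_refl)
  also have "smult (1 / (\<Prod>\<beta>\<in>?B. ?c - ?a \<beta>)) (\<Prod>\<beta>\<in>?B. [:- ?a \<beta>, 1:]) = lagrange_poly (next_contents \<delta> (T r)) ?c"
    unfolding lagrange_poly_def root_poly_def img prod.reindex[OF injB] comp_def ..
  finally show ?thesis
    unfolding Suc by (simp only: primitive_idempotent.simps Let_def diff_Suc_1)
qed

lemma primitive_idempotent_supported:
  assumes "updown_path n T" "generic_parameter \<delta>" shows "supported n (primitive_idempotent \<delta> n T)"
proof (cases n)
  case (Suc r)
  then show ?thesis using primitive_idempotent_Suc[of r T \<delta>] assms by (simp add: bmult_supported)
qed (simp add: supported_bone)

primrec lift_brauer :: "nat \<Rightarrow> nat \<Rightarrow> 'k::comm_ring_1 brauer \<Rightarrow> 'k brauer" where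
  "lift_brauer r 0 a = a"
| "lift_brauer r (Suc k) a = bembed (Suc (r + k)) (lift_brauer r k a)"

lemma lift_brauer_bmult: "lift_brauer r k (bmult r \<delta> a b) = bmult (r + k) \<delta> (lift_brauer r k a) (lift_brauer r k b)"
  by (induction k) (simp_all add: bembed_bmult)

lemma lift_brauer_bscale: "lift_brauer r k (bscale c a) = bscale c (lift_brauer r k a)"
  by (induction k) (simp_all add: bembed_linear)

lemma lift_brauer_bpeval: "1 \<le> r \<Longrightarrow> lift_brauer r k (bpeval r \<delta> r p) = bpeval (r + k) \<delta> r p"
  by (induction k) (simp_all add: bembed_bpeval)

lemma lift_brauer_jm: "1 \<le> r \<Longrightarrow> lift_brauer r k (jucys_murphy r \<delta> r) = jucys_murphy (r + k) \<delta> r"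
  by (induction k) (simp_all add: bembed_jucys_murphy)

lemma lift_brauer_bone: "lift_brauer r k (bone r) = bone (r + k)"
  by (induction k) (simp_all add: bembed_bone)

lemma lift_brauer_bembed: "lift_brauer (Suc r) k (bembed (Suc r) a) = lift_brauer r (Suc k) a"
  by (induction k) simp_all

definition tableau_idem :: "nat \<Rightarrow> 'k::field \<Rightarrow> (nat \<Rightarrow> box set) \<Rightarrow> nat \<Rightarrow> 'k endo" where
  "tableau_idem N \<delta> T = brauer.idem \<delta> N (\<lambda>r. next_contents \<delta> (T r)) (tableau_content \<delta> T)"

lemma unit_idem: "left_mult n \<delta> (bone n) * left_mult n \<delta> (bone n) = left_mult n \<delta> (bone n)"
  by (rule left_mult_bone)

text \<open>
  The idempotents of all truncations of a tableau act on the algebra with the full number of strands, where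
  they are given by the recursion for spectral projections.
\<close>

lemma left_mult_primitive_idempotent:
  assumes "updown_path r T" "generic_parameter \<delta>"
  shows "left_mult (r + k) \<delta> (lift_brauer r k (primitive_idempotent \<delta> r T)) = tableau_idem (r + k) \<delta> T r"
  using assms(1)
proof (induction r arbitrary: k)
  case 0
  then show ?case using lift_brauer_bone[of 0 k, where 'a = 'a] by (simp add: tableau_idem_def)
next
  case (Suc r)
  let ?N = "Suc r + k" and ?p = "lagrange_poly (next_contents \<delta> (T r)) (tableau_content \<delta> T (Suc r))"
  have path: "updown_path r T" using Suc.prems by (rule updown_path_mono) simp
  have IH: "left_mult ?N \<delta> (lift_brauer r (Suc k) (primitive_idempotent \<delta> r T)) = tableau_idem ?N \<delta> T r"
    using Suc.IH[OF path, of "Suc k"] by simp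
  have "left_mult ?N \<delta> (lift_brauer (Suc r) k (primitive_idempotent \<delta> (Suc r) T)) =
      tableau_idem ?N \<delta> T r * left_mult ?N \<delta> (bpeval ?N \<delta> (Suc r) ?p)"
    unfolding primitive_idempotent_Suc[OF Suc.prems assms(2)] lift_brauer_bmult left_mult_bmult lift_brauer_bembed IH
    using lift_brauer_bpeval[of "Suc r" k \<delta> ?p] by simp
  also have "left_mult ?N \<delta> (bpeval ?N \<delta> (Suc r) ?p) = left_mult ?N \<delta> (bone ?N) * peval (brauer.jm \<delta> ?N (Suc r)) ?p"
    by (rule left_mult_bpeval) simp
  also have "tableau_idem ?N \<delta> T r * (left_mult ?N \<delta> (bone ?N) * peval (brauer.jm \<delta> ?N (Suc r)) ?p) =
      tableau_idem ?N \<delta> T r * peval (brauer.jm \<delta> ?N (Suc r)) ?p"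
    using brauer.idem_unit[OF unit_idem, of r "Suc r + k" \<delta>]
    by (simp only: tableau_idem_def mult.assoc[symmetric] le_add1 le_SucI add_Suc)
  finally show ?case by (simp add: tableau_idem_def)
qed

lemma tableau_idem_eigen:
  assumes "updown_path r T" "generic_parameter \<delta>" "1 \<le> r" "r \<le> N"
    and "bmult r \<delta> (primitive_idempotent \<delta> r T) (jucys_murphy r \<delta> r) =
      bscale (tableau_content \<delta> T r) (primitive_idempotent \<delta> r T)"
  shows "tableau_idem N \<delta> T r * brauer.jm \<delta> N r = tableau_content \<delta> T r \<odot> tableau_idem N \<delta> T r"
proof -
  define a where "a = lift_brauer r (N - r) (primitive_idempotent \<delta> r T)"
  have N: "r + (N - r) = N" using assms(4) by simp
  have a: "left_mult N \<delta> a = tableau_idem N \<delta> T r"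
    using left_mult_primitive_idempotent[OF assms(1,2), of "N - r"] by (simp add: a_def N)
  have "lift_brauer r (N - r) (bmult r \<delta> (primitive_idempotent \<delta> r T) (jucys_murphy r \<delta> r)) =
      lift_brauer r (N - r) (bscale (tableau_content \<delta> T r) (primitive_idempotent \<delta> r T))"
    using assms(5) by (rule arg_cong)
  then have "bmult N \<delta> a (jucys_murphy N \<delta> r) = bscale (tableau_content \<delta> T r) a"
    unfolding lift_brauer_bmult lift_brauer_bscale lift_brauer_jm[OF assms(3)] N a_def[symmetric] .
  then have "left_mult N \<delta> a * brauer.jm \<delta> N r = left_mult N \<delta> (bscale (tableau_content \<delta> T r) a)"
    by (simp only: left_mult_jm)
  then show ?thesis by (simp add: left_mult_linear a)
qed

section \<open>Eigenvalues of the Jucys--Murphy elements over an ordered field\<close>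

lemma generic_of_infinite:
  fixes \<delta> :: "'k::linordered_field"
  assumes "\<And>n. of_nat n < \<delta>"
  shows "generic_parameter \<delta>"
  unfolding generic_parameter_def
proof (intro allI impI)
  fix a b :: int assume eq: "of_int a * \<delta> + of_int b = 0"
  have pos: "0 < \<delta>" using assms[of 0] by simp
  have "a = 0"
  proof (rule ccontr)
    assume "a \<noteq> 0"
    then have "1 \<le> \<bar>a\<bar>" by linarith
    then have "(1 :: 'k) \<le> of_int \<bar>a\<bar>" by (simp only: of_int_1_le_iff)
    then have "1 * \<delta> \<le> of_int \<bar>a\<bar> * \<delta>" using pos by (intro mult_right_mono) auto
    also have "\<dots> = \<bar>of_int a * \<delta>\<bar>" using pos by (simp add: abs_mult)
    also have "of_int a * \<delta> = - of_int b" using eq by (simp add: eq_neg_iff_add_eq_0)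
    also have "\<bar>- of_int b :: 'k\<bar> = of_nat (nat \<bar>b\<bar>)" by simp
    finally show False using assms[of "nat \<bar>b\<bar>"] by simp
  qed
  then show "a = 0 \<and> b = 0" using eq by simp
qed

text \<open>
  Induction on the length of the tableau. Let \<open>a\<close> be the product of the idempotent of the truncated tableau
  with the product of \<open>x\<^sub>n - b\<close> over all contents \<open>b\<close>. The generating function of the moments gives
  \<open>e a\<^sup>2 e = 0\<close> for the cap \<open>e\<close> on the strands \<open>n\<close> and \<open>n + 1\<close>. As \<open>a\<close> and \<open>e\<close> are self-adjoint for a
  definite form, the element that represents \<open>a e\<close> is zero, and multiplication by the cap is injective.
  Thus the Lagrange polynomial in the last factor of the idempotent projects to an eigenspace.
\<close>

theorem primitive_idempotent_eigen_ordered: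
  fixes \<delta> :: "'k::linordered_field"
  assumes \<delta>: "\<And>n. of_nat n < \<delta>" and "updown_path n T" "1 \<le> n"
  shows "bmult n \<delta> (primitive_idempotent \<delta> n T) (jucys_murphy n \<delta> n) =
    bscale (tableau_content \<delta> T n) (primitive_idempotent \<delta> n T)"
  using assms(2,3)
proof (induction n rule: less_induct)
  case (less n)
  obtain r where r: "n = Suc r" using less.prems by (cases n) auto
  have g: "generic_parameter \<delta>" by (rule generic_of_infinite[OF \<delta>])
  have two: "(2 :: 'k) \<noteq> 0" by simp
  have path: "updown_path r T" using less.prems(1) by (rule updown_path_mono) (simp add: r)
  define N where "N = Suc n"
  define A where "A = (\<lambda>r. next_contents \<delta> (T r))"
  define c where "c = tableau_content \<delta> T"
  define u where "u = left_mult N \<delta> (bone N)"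
  define I where "I = brauer.idem \<delta> N A c"
  have I: "tableau_idem N \<delta> T = I" by (simp add: tableau_idem_def I_def A_def c_def)
  have down: "downset (T k)" if "k \<le> n" for k by (rule path_downset[OF less.prems(1) that])
  have eig: "I k * brauer.jm \<delta> N k = c k \<odot> I k" if "1 \<le> k" "k \<le> r" for k
  proof -
    have pk: "updown_path k T" by (rule updown_path_mono[OF path that(2)])
    have kN: "k \<le> N" using that by (simp add: N_def r)
    have "bmult k \<delta> (primitive_idempotent \<delta> k T) (jucys_murphy k \<delta> k) =
        bscale (tableau_content \<delta> T k) (primitive_idempotent \<delta> k T)"
      by (rule less.IH[OF _ pk that(1)]) (use that in \<open>simp add: r\<close>)
    then show ?thesis unfolding I[symmetric] c_def
      by (rule tableau_idem_eigen[OF pk g that(1) kN])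
  qed
  have A: "finite (A k) \<and> c (Suc k) \<in> A k" if "k < n" for k
    using next_contents_finite_odd(1)[OF down g, of k] path_content(2)[OF less.prems(1) that] that
    by (simp add: A_def c_def)
  have ratio: "root_fps (uminus ` A (Suc k)) * root_fps (A k) * step_ratio (c (Suc k)) =
      root_fps (A (Suc k)) * root_fps (uminus ` A k) * step_ratio (- c (Suc k))" if "k < r" for k
  proof -
    have s: "step_box T (Suc k) \<in> addable (T k) \<union> removable (T k)" "T (Suc k) = sym_diff (T k) {step_box T (Suc k)}"
      using less.prems(1) that by (auto simp: updown_path_def r)
    have "c (Suc k) = box_content \<delta> (T k) (step_box T (Suc k))"
      unfolding c_def by (rule path_content(1)[OF less.prems(1)]) (use that r in simp)
    then show ?thesis using root_fps_step[OF down g s(1)] that s(2) by (simp add: A_def r)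
  qed
  define x where "x = brauer.jm \<delta> N n"
  define e where "e = e_op N \<delta> n N"
  define R where "R = peval x (root_poly (A r))"
  define a where "a = I r * R"
  have nN: "n \<in> {1..N}" "N \<in> {1..N}" "n \<noteq> N" using r by (auto simp: N_def)
  have A0: "A 0 = {(\<delta> - 1) / 2}" using less.prems(1) by (simp add: A_def updown_path_def next_contents_empty)
  have Ix: "I r * x = x * I r" unfolding I_def x_def
    by (rule brauer.bicentral_commute_jm[OF brauer.idem_bicentral]) (simp_all add: N_def r)
  have Ie: "I r * e = e * I r" unfolding I_def e_def
    by (rule brauer.bicentral_commute_above(2)[OF brauer.idem_bicentral nN]) (simp_all add: N_def r)
  have IR: "I r * R = R * I r" unfolding R_def by (rule peval_commute[OF Ix])
  have II: "I r * I r = I r"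
    unfolding I_def by (rule brauer.idem_absorb[OF eig[unfolded I_def] A unit_idem]) (auto simp: N_def r)
  have "I r * e * (R * R) * e = 0"
  proof -
    obtain z where z: "(1 - fps_const (1 / 2) * fps_X + fps_X * z) * root_fps (A r) =
        (1 + fps_const (1 / 2) * fps_X) * root_fps (uminus ` A r)"
      "fps_const (I r * e) * resolvent x * fps_const e = z \<star> fps_const (I r * e)"
    proof -
      have A': "finite (A k) \<and> c (Suc k) \<in> A k" if "k < r" for k using A[of k] that by (simp add: r)
      have N: "Suc (Suc r) \<le> N" by (simp add: N_def r)
      show ?thesis
        using that brauer.resolvent_moments[where N = N and \<delta> = \<delta> and A = A and c = c and r = r,
            OF two unit_idem A0 A' ratio eig[unfolded I_def] N]
        unfolding I_def x_def e_def r N_def by blast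
    qed
    have "finite (A r)" "odd (card (A r))"
      using next_contents_finite_odd[OF down g, of r] by (simp_all add: A_def r)
    then show ?thesis unfolding R_def
      by (rule brauer.cap_root_poly_cap[OF two _ _ z])
  qed
  moreover have "e * (a * (a * e)) = I r * e * (R * R) * e"
  proof -
    have "e * (a * (a * e)) = e * (I r * (R * I r) * R) * e" by (simp add: a_def mult.assoc)
    also have "\<dots> = e * (I r * I r) * (R * R) * e" unfolding IR[symmetric] by (simp add: mult.assoc)
    finally show ?thesis unfolding II Ie .
  qed
  ultimately have zero: "e * (a * (a * e)) = 0" by simp
  define \<alpha> where "\<alpha> = bmult n \<delta> (bembed n (primitive_idempotent \<delta> r T)) (bpeval n \<delta> n (root_poly (A r)))"
  have "left_mult n \<delta> (bembed n (primitive_idempotent \<delta> r T)) = tableau_idem n \<delta> T r"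
    using left_mult_primitive_idempotent[OF path g, of "Suc 0"] by (simp add: r)
  then have \<alpha>n: "left_mult n \<delta> \<alpha> = tableau_idem n \<delta> T r * peval (brauer.jm \<delta> n n) (root_poly (A r))"
    using brauer.idem_unit[OF unit_idem, of r n \<delta>]
    by (simp add: \<alpha>_def left_mult_bmult left_mult_bpeval tableau_idem_def r flip: mult.assoc)
  have "left_mult N \<delta> (bembed N (bembed n (primitive_idempotent \<delta> r T))) = I r"
    using left_mult_primitive_idempotent[OF path g, of "Suc (Suc 0)"] by (simp add: r N_def I[symmetric])
  then have a: "left_mult N \<delta> (bembed N \<alpha>) = a"
    using brauer.idem_unit[OF unit_idem, of r N \<delta>] bembed_bpeval[of n n \<delta> "root_poly (A r)"]
    by (simp add: \<alpha>_def N_def bembed_bmult left_mult_bmult left_mult_bpeval a_def R_def x_def I_def r flip: mult.assoc)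
  define v where "v = bmult N \<delta> (bembed N \<alpha>) (eps_elem N n N)"
  have ae: "a * e = left_mult N \<delta> v" by (simp add: v_def left_mult_bmult a e_def e_op_def)
  have vs: "supported N v" unfolding v_def by (rule bmult_supported)
  have v: "app (a * e) (bone N) = v" unfolding ae app_left_mult using supported_bmult_bone[OF vs] by simp
  have sa: "self_adjoint N \<delta> a"
  proof -
    have x: "self_adjoint N \<delta> (brauer.jm \<delta> N k)" if "k \<le> N" for k by (rule self_adjoint_jm[OF that])
    have sI: "self_adjoint N \<delta> (I k)" if "k \<le> n" for k
      using that
    proof (induction k)
      case 0
      then show ?case by (simp add: I_def self_adjoint_unit)
    next
      case (Suc k)
      have "I k * brauer.jm \<delta> N (Suc k) = brauer.jm \<delta> N (Suc k) * I k" unfolding I_def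
        by (rule brauer.bicentral_commute_jm[OF brauer.idem_bicentral]) (use Suc.prems in \<open>simp_all add: N_def\<close>)
      then have "I k * peval (brauer.jm \<delta> N (Suc k)) p = peval (brauer.jm \<delta> N (Suc k)) p * I k" for p
        by (rule peval_commute)
      moreover have "I (Suc k) = I k * peval (brauer.jm \<delta> N (Suc k)) (lagrange_poly (A k) (c (Suc k)))"
        by (simp add: I_def)
      ultimately show ?case
        using Suc x[of "Suc k"] by (simp add: self_adjoint_closed self_adjoint_peval N_def)
    qed
    show ?thesis unfolding a_def
      using sI[of r] x[of n] IR by (simp add: self_adjoint_closed self_adjoint_peval R_def x_def r N_def)
  qed
  have se: "self_adjoint N \<delta> e" unfolding e_def by (rule self_adjoint_generators(2)[OF nN])
  \<comment> \<open>The element representing \<open>a * e\<close> has norm zero, because \<open>a\<close> and \<open>e\<close> are self-adjoint.\<close>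
  have "form N \<delta> v v = form N \<delta> (app a (app e (bone N))) (app (a * e) (bone N))"
    by (simp add: v flip: app_times)
  also have "\<dots> = form N \<delta> (bone N) (app (e * (a * (a * e))) (bone N))"
    using sa se by (simp add: self_adjoint_def app_times)
  also have "\<dots> = 0" unfolding zero by (simp add: app_zero_endo form_def)
  finally have "v d = 0" if "is_diagram N d" for d
    using form_positive[OF \<delta>[of "card (diagrams N)"] _ _ that] \<delta>[of 1] by simp
  then have "v = (\<lambda>_. 0)" using vs unfolding supported_def by blast
  then have "\<alpha> = (\<lambda>_. 0)"
    using cap_mult_injective[of n \<alpha> \<delta>] \<delta>[of 0] less.prems(2) unfolding v_def N_def
    by (simp add: \<alpha>_def bmult_supported)
  then have root: "tableau_idem n \<delta> T r * peval (brauer.jm \<delta> n n) (root_poly (A r)) = 0"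
    using \<alpha>n by (simp add: left_mult_zero)
  have "tableau_idem n \<delta> T n = tableau_idem n \<delta> T r * peval (brauer.jm \<delta> n n) (lagrange_poly (A r) (c n))"
    by (simp add: tableau_idem_def r A_def c_def)
  then have "tableau_idem n \<delta> T n * brauer.jm \<delta> n n = c n \<odot> tableau_idem n \<delta> T n"
    using brauer.lagrange_eigen[OF _ _ root, of "c n"] A[of r] by (simp add: r)
  moreover have "left_mult n \<delta> (primitive_idempotent \<delta> n T) = tableau_idem n \<delta> T n"
    using left_mult_primitive_idempotent[OF less.prems(1) g, of 0] by simp
  ultimately have "left_mult n \<delta> (bmult n \<delta> (primitive_idempotent \<delta> n T) (jucys_murphy n \<delta> n)) =
      left_mult n \<delta> (bscale (c n) (primitive_idempotent \<delta> n T))"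
    unfolding left_mult_jm[symmetric] left_mult_linear by simp
  then show ?case
    using left_mult_inject[OF bmult_supported supported_linear(3)[OF primitive_idempotent_supported[OF less.prems(1) g]]]
    by (simp add: c_def)
qed

section \<open>Change of the coefficient field\<close>

text \<open>
  The eigenvalue equation is an identity between coefficients, so it can be transported along an embedding of
  fields.
\<close>

locale field_embedding =
  fixes h :: "'a::field \<Rightarrow> 'b::field"
  assumes one [simp]: "h 1 = 1" and add: "h (x + y) = h x + h y" and mult: "h (x * y) = h x * h y"
begin

lemma zero [simp]: "h 0 = 0"
  using add[of 0 0] unfolding add_0_left by (metis add_cancel_right_right)

lemma minus: "h (- x) = - h x"
  using add[of x "- x"] by (simp add: eq_neg_iff_add_eq_0 add.commute)

lemma diff: "h (x - y) = h x - h y"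
  using add[of x "- y"] by (simp add: minus)

lemma inverse: "h (inverse x) = inverse (h x)"
proof (cases "x = 0")
  case False
  then have "h x * h (inverse x) = 1" by (simp flip: mult)
  then show ?thesis by (metis inverse_unique)
qed simp

lemma divide: "h (x / y) = h x / h y"
  by (simp only: divide_inverse mult inverse)

lemma eq_zero_iff: "h x = 0 \<longleftrightarrow> x = 0"
proof
  assume x: "h x = 0"
  show "x = 0"
  proof (rule ccontr)
    assume "x \<noteq> 0"
    then have "h (x * inverse x) = 1" by simp
    then show False using x by (simp only: mult) simp
  qed
qed simp

lemma sum: "h (sum f A) = (\<Sum>x\<in>A. h (f x))"
  by (induction A rule: infinite_finite_induct) (simp_all add: add)

lemma prod: "h (prod f A) = (\<Prod>x\<in>A. h (f x))"
  by (induction A rule: infinite_finite_induct) (simp_all add: mult)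

lemma power: "h (x ^ n) = h x ^ n"
  by (induction n) (simp_all add: mult)

lemma of_nat: "h (of_nat n) = of_nat n"
  by (induction n) (simp_all add: add)

lemma of_int: "h (of_int z) = of_int z"
  by (cases z rule: int_cases2) (simp_all add: minus of_nat)

lemma numeral: "h (numeral n) = numeral n"
  using of_nat[of "numeral n"] by simp

lemmas homs = add mult minus diff divide sum prod power of_nat of_int numeral

definition coeffwise :: "'a brauer \<Rightarrow> 'b brauer" where
  "coeffwise a = (\<lambda>d. h (a d))"

lemma coeffwise_linear:
  "coeffwise (basis d) = basis d" "coeffwise (bone n) = bone n"
  "coeffwise (bplus a b) = bplus (coeffwise a) (coeffwise b)"
  "coeffwise (bminus a b) = bminus (coeffwise a) (coeffwise b)"
  "coeffwise (bscale c a) = bscale (h c) (coeffwise a)"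
  "coeffwise (bembed n a) = bembed n (coeffwise a)"
  by (auto simp: coeffwise_def basis_def bone_def bplus_def bminus_def bscale_def bembed_def homs)

lemma coeffwise_bmult: "coeffwise (bmult n \<delta> a b) = bmult n (h \<delta>) (coeffwise a) (coeffwise b)"
proof -
  have b: "h (basis x d) = basis x d" for x d by (simp add: basis_def)
  show ?thesis unfolding coeffwise_def bmult_def by (simp only: homs b)
qed

lemma coeffwise_jucys_murphy: "coeffwise (jucys_murphy n \<delta> r) = jucys_murphy n (h \<delta>) r"
proof -
  have g: "h (s_elem n i r d) = s_elem n i r d" "h (eps_elem n i r d) = eps_elem n i r d" for i d
    by (simp_all add: s_elem_def eps_elem_def basis_def)
  have b: "h (bone n d) = bone n d" for d by (simp add: bone_def basis_def)
  show ?thesis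
    unfolding coeffwise_def jucys_murphy_def bplus_def bscale_def bminus_def by (simp only: homs g b one)
qed

lemma box_content: "h (box_content \<delta> \<mu> \<alpha>) = box_content (h \<delta>) \<mu> \<alpha>"
  by (simp add: box_content_def Let_def homs)

lemma tableau_content: "h (tableau_content \<delta> T r) = tableau_content (h \<delta>) T r"
  by (simp add: tableau_content_def box_content)

lemma coeffwise_fold:
  assumes "r \<le> n"
  shows "coeffwise (Finite_Set.fold (\<lambda>\<beta>. bmult n \<delta> (bminus (jucys_murphy n \<delta> r) (bscale (a \<beta>) (bone n)))) (bone n) B) =
    Finite_Set.fold (\<lambda>\<beta>. bmult n (h \<delta>) (bminus (jucys_murphy n (h \<delta>) r) (bscale (h (a \<beta>)) (bone n)))) (bone n) B"
proof (induction B rule: infinite_finite_induct)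
  case (infinite B)
  then show ?case by (simp add: Finite_Set.fold_def coeffwise_linear)
next
  case empty
  show ?case by (simp add: coeffwise_linear)
next
  case (insert \<beta> B)
  interpret f: comp_fun_commute "\<lambda>\<beta>. bmult n \<delta> (bminus (jucys_murphy n \<delta> r) (bscale (a \<beta>) (bone n)))"
    by (rule linear_factors_commute[OF assms])
  interpret g: comp_fun_commute "\<lambda>\<beta>. bmult n (h \<delta>) (bminus (jucys_murphy n (h \<delta>) r) (bscale (h (a \<beta>)) (bone n)))"
    by (rule linear_factors_commute[OF assms])
  show ?case
    unfolding f.fold_insert[OF insert(1,2)] g.fold_insert[OF insert(1,2)] coeffwise_bmult insert.IH
    by (simp only: coeffwise_linear coeffwise_jucys_murphy)
qed

lemma coeffwise_primitive_idempotent: "coeffwise (primitive_idempotent \<delta> n T) = primitive_idempotent (h \<delta>) n T"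
proof (induction n rule: induct_nat_012)
  case (ge2 n)
  show ?case
    by (simp only: primitive_idempotent.simps Let_def coeffwise_bmult coeffwise_linear coeffwise_fold[OF order_refl]
        ge2 homs one box_content tableau_content)
qed (simp_all add: coeffwise_linear)

lemma generic_parameter: "generic_parameter \<delta> \<Longrightarrow> generic_parameter (h \<delta>)"
proof -
  assume g: "generic_parameter \<delta>"
  have "of_int a * h \<delta> + of_int b = h (of_int a * \<delta> + of_int b)" for a b by (simp only: homs)
  then show ?thesis using g unfolding generic_parameter_def by (simp only: eq_zero_iff)
qed

lemma primitive_idempotent_eigen:
  assumes "bmult n \<delta> (primitive_idempotent \<delta> n T) (jucys_murphy n \<delta> n) =
    bscale (tableau_content \<delta> T n) (primitive_idempotent \<delta> n T)"
  shows "bmult n (h \<delta>) (primitive_idempotent (h \<delta>) n T) (jucys_murphy n (h \<delta>) n) =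
    bscale (tableau_content (h \<delta>) T n) (primitive_idempotent (h \<delta>) n T)"
  using arg_cong[OF assms, of coeffwise]
  by (simp only: coeffwise_bmult coeffwise_linear coeffwise_primitive_idempotent coeffwise_jucys_murphy tableau_content)

end

lemma fract_embedding:
  fixes f :: "'a::idom \<Rightarrow> 'b::field"
  assumes one: "f 1 = 1" and add: "\<And>x y. f (x + y) = f x + f y" and mult: "\<And>x y. f (x * y) = f x * f y"
    and inj: "\<And>x. f x = 0 \<Longrightarrow> x = 0"
  obtains h where "field_embedding h" "\<And>x. h (to_fract x) = f x"
proof -
  define h where "h x = (SOME y. \<exists>p q. q \<noteq> 0 \<and> x = Fract p q \<and> y = f p / f q)" for x
  have h: "h (Fract p q) = f p / f q" if "q \<noteq> 0" for p q
  proof -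
    have "\<exists>p' q'. q' \<noteq> 0 \<and> Fract p q = Fract p' q' \<and> h (Fract p q) = f p' / f q'"
      unfolding h_def by (rule someI[of _ "f p / f q"]) (use that in blast)
    then obtain p' q' where pq: "q' \<noteq> 0" "Fract p q = Fract p' q'" "h (Fract p q) = f p' / f q'" by blast
    have "f (p * q') = f (p' * q)" using pq(1,2) that by (simp add: eq_fract)
    then have "f p * f q' = f p' * f q" by (simp only: mult)
    moreover have "f q \<noteq> 0" "f q' \<noteq> 0" using that pq(1) inj by blast+
    ultimately show ?thesis unfolding pq(3) by (simp add: divide_eq_eq mult.commute)
  qed
  have nz: "f q \<noteq> 0" if "q \<noteq> 0" for q using that inj by blast
  have "field_embedding h"
  proof
    show "h 1 = 1" using h[of 1 1] by (simp add: one One_fract_def)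
    fix x y :: "'a fract"
    obtain p q where x: "x = Fract p q" "q \<noteq> 0" by (cases x)
    obtain p' q' where y: "y = Fract p' q'" "q' \<noteq> 0" by (cases y)
    have xy: "q * q' \<noteq> 0" using x y by simp
    show "h (x + y) = h x + h y"
      using nz[OF x(2)] nz[OF y(2)] unfolding x(1) y(1) add_fract[OF x(2) y(2)] h[OF xy] h[OF x(2)] h[OF y(2)]
      by (simp add: add mult add_frac_eq)
    show "h (x * y) = h x * h y"
      unfolding x(1) y(1) mult_fract h[OF xy] h[OF x(2)] h[OF y(2)] by (simp add: mult)
  qed
  moreover have "h (to_fract x) = f x" for x using h[of 1 x] by (simp add: to_fract_def one)
  ultimately show ?thesis using that by blast
qed

text \<open>
  In the order of rational functions by their sign near infinity the indeterminate exceeds all constants.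
\<close>

lemma infinite_indeterminate: "of_nat n < (to_fract [:0, 1:] :: rat poly fract)"
proof -
  have "of_nat n < ([:0, 1:] :: rat poly)" by (simp add: less_poly_def of_nat_poly pos_poly_pCons)
  then have "Fract (of_nat n) 1 < (Fract [:0, 1:] 1 :: rat poly fract)" by simp
  then show ?thesis by (simp only: of_nat_fract to_fract_def)
qed

text \<open>
  The inclusion of \<open>\<rat>(\<omega>)\<close> into \<open>\<complex>(\<omega>)\<close>: the second field has no order.
\<close>

lemma rational_functions_embedding:
  obtains h :: "rat poly fract \<Rightarrow> scalar" where "field_embedding h" "h (to_fract [:0, 1:]) = \<omega>"
proof -
  define f :: "rat poly \<Rightarrow> scalar" where "f p = to_fract (map_poly of_rat p)" for p
  have "map_poly of_rat (p + q) = map_poly of_rat p + (map_poly of_rat q :: complex poly)" for p q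
    by (rule poly_eqI) (simp add: coeff_map_poly of_rat_add)
  then have add: "f (p + q) = f p + f q" for p q by (simp add: f_def)
  have "map_poly of_rat (p * q) = map_poly of_rat p * (map_poly of_rat q :: complex poly)" for p q
    by (rule poly_eqI) (simp add: coeff_map_poly coeff_mult of_rat_sum of_rat_mult)
  then have mult: "f (p * q) = f p * f q" for p q by (simp add: f_def)
  have inj: "p = 0" if "f p = 0" for p
  proof (rule poly_eqI)
    fix k
    have "map_poly of_rat p = (0 :: complex poly)" using that by (simp add: f_def)
    then have "coeff (map_poly of_rat p) k = (0 :: complex)" by simp
    then show "coeff p k = coeff 0 k" by (simp add: coeff_map_poly)
  qed
  have one: "f 1 = 1" by (simp add: f_def map_poly_pCons flip: one_pCons)
  obtain h where h: "field_embedding h" "\<And>x. h (to_fract x) = f x"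
    using fract_embedding[OF one add mult inj] by blast
  have "h (to_fract [:0, 1:]) = \<omega>" unfolding h(2) f_def \<omega>_def by (simp add: map_poly_pCons)
  then show ?thesis using that h(1) by blast
qed

interpretation const: field_embedding const
  by unfold_locales (simp_all add: const_def single_add mult_single flip: to_fract_add to_fract_mult)

lemma generic_omega: "generic_parameter \<omega>" "generic_parameter (const \<omega>)"
proof -
  obtain h :: "rat poly fract \<Rightarrow> scalar" where h: "field_embedding h" "h (to_fract [:0, 1:]) = \<omega>"
    by (rule rational_functions_embedding)
  show "generic_parameter \<omega>"
    using field_embedding.generic_parameter[OF h(1) generic_of_infinite[OF infinite_indeterminate]] h(2) by simp
  then show "generic_parameter (const \<omega>)" by (rule const.generic_parameter)
qed

theorem primitive_idempotent_eigen:
  assumes "updown_path n T" "1 \<le> n"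
  shows "bmult n (const \<omega>) (primitive_idempotent (const \<omega>) n T) (jucys_murphy n (const \<omega>) n) =
    bscale (tableau_content (const \<omega>) T n) (primitive_idempotent (const \<omega>) n T)"
proof -
  obtain h :: "rat poly fract \<Rightarrow> scalar" where h: "field_embedding h" "h (to_fract [:0, 1:]) = \<omega>"
    by (rule rational_functions_embedding)
  show ?thesis
    using const.primitive_idempotent_eigen[OF field_embedding.primitive_idempotent_eigen[OF h(1)
      primitive_idempotent_eigen_ordered[OF infinite_indeterminate assms]]] h(2) by simp
qed

section \<open>The fusion procedure for an updown tableau\<close>

lemma updown_path_extend:
  assumes T: "updown_path r T" and \<beta>: "\<beta> \<in> addable (T r) \<union> removable (T r)"
  defines "T' \<equiv> T(Suc r := sym_diff (T r) {\<beta>})"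
  shows "updown_path (Suc r) T'" "tableau_content \<delta> T' (Suc r) = box_content \<delta> (T r) \<beta>"
    "\<And>k. k < r \<Longrightarrow> tableau_content \<delta> T' (Suc k) = tableau_content \<delta> T (Suc k)"
proof -
  have T': "T' k = T k" if "k \<le> r" for k using that by (simp add: T'_def)
  have step: "step_box T' (Suc k) = step_box T (Suc k)" if "k < r" for k
    using that T'[of k] T'[of "Suc k"] by (simp add: step_box_def)
  have "sym_diff (T r) (sym_diff (T r) {\<beta>}) = {\<beta>}" by blast
  then have step_r: "step_box T' (Suc r) = \<beta>" by (simp add: step_box_def T'_def)
  show "updown_path (Suc r) T'"
    unfolding updown_path_def
  proof (intro conjI allI impI)
    show "T' 0 = {}" using T by (simp add: T' updown_path_def)
    fix k assume "k < Suc r"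
    then consider "k < r" | "k = r" by linarith
    then have "step_box T' (Suc k) \<in> addable (T' k) \<union> removable (T' k) \<and>
        T' (Suc k) = sym_diff (T' k) {step_box T' (Suc k)}"
    proof cases
      case 1
      then have "T' k = T k" "T' (Suc k) = T (Suc k)" by (simp_all add: T')
      then show ?thesis using T 1 unfolding updown_path_def step[OF 1] by simp
    next
      case 2
      then show ?thesis using \<beta> T'[of r] by (simp only: step_r order_refl) (simp add: T'_def)
    qed
    then show "step_box T' (Suc k) \<in> addable (T' k) \<union> removable (T' k)"
      "T' (Suc k) = sym_diff (T' k) {step_box T' (Suc k)}" by blast+
  qed
  show "tableau_content \<delta> T' (Suc r) = box_content \<delta> (T r) \<beta>"
    by (simp add: tableau_content_def step_r T')
  show "tableau_content \<delta> T' (Suc k) = tableau_content \<delta> T (Suc k)" if "k < r" for k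
    using that by (simp add: tableau_content_def step T')
qed

lemma idem_cong:
  assumes "\<And>k. k < r \<Longrightarrow> A k = A' k \<and> c (Suc k) = c' (Suc k)"
  shows "brauer.idem \<delta> N A c r = brauer.idem \<delta> N A' c' r"
  using assms by (induction r) simp_all

lemma fusion_factor_cong:
  assumes "\<And>i. i \<in> {1..k} \<Longrightarrow> c i = c' i"
  shows "brauer.fusion_factor \<delta> N k m c u = brauer.fusion_factor \<delta> N k m c' u"
  using assms by (induction k) (simp_all add: brauer.fusion_factor_Suc, simp add: brauer.fusion_factor_def)

text \<open>
  The part of the idempotent of a tableau on which the next Jucys--Murphy element has the eigenvalue \<open>a\<close>.
\<close>

definition branch_idem :: "nat \<Rightarrow> 'k::field \<Rightarrow> (nat \<Rightarrow> box set) \<Rightarrow> nat \<Rightarrow> 'k \<Rightarrow> 'k endo" where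
  "branch_idem N \<delta> T k a =
    tableau_idem N \<delta> T k * peval (brauer.jm \<delta> N (Suc k)) (lagrange_poly (next_contents \<delta> (T k)) a)"

lemma tableau_idem_Suc: "tableau_idem N \<delta> T (Suc k) = branch_idem N \<delta> T k (tableau_content \<delta> T (Suc k))"
  by (simp add: tableau_idem_def branch_idem_def)

lemma branch_idem_extend:
  assumes "updown_path k T" "\<beta> \<in> addable (T k) \<union> removable (T k)"
  shows "branch_idem N \<delta> T k (box_content \<delta> (T k) \<beta>) =
    tableau_idem N \<delta> (T(Suc k := sym_diff (T k) {\<beta>})) (Suc k)"
proof -
  let ?T = "T(Suc k := sym_diff (T k) {\<beta>})"
  have "tableau_idem N \<delta> ?T k = tableau_idem N \<delta> T k"
    unfolding tableau_idem_def
    by (rule idem_cong) (use updown_path_extend(3)[OF assms, of _ \<delta>] in auto)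
  then show ?thesis
    unfolding tableau_idem_Suc branch_idem_def updown_path_extend(2)[OF assms] by simp
qed

text \<open>
  The hypotheses of the fusion procedure hold because each \<open>branch_idem\<close> is the idempotent of the tableau
  extended by one box, and the Lagrange polynomials sum up to \<open>1\<close>.
\<close>

lemma tableau_fusion:
  fixes \<delta> :: "'k::field"
  assumes g: "generic_parameter \<delta>"
    and eig: "\<And>m S. updown_path m S \<Longrightarrow> 1 \<le> m \<Longrightarrow> bmult m \<delta> (primitive_idempotent \<delta> m S) (jucys_murphy m \<delta> m) =
      bscale (tableau_content \<delta> S m) (primitive_idempotent \<delta> m S)"
    and T: "updown_path (Suc r) T" and r: "Suc r \<le> N"
  defines "c \<equiv> tableau_content \<delta> T"
  assumes u: "\<And>k. 1 \<le> k \<Longrightarrow> k \<le> Suc r \<Longrightarrow> u - c k \<noteq> 0 \<and> u - c k \<noteq> \<delta> / 2 - 1 \<and> c k - u \<noteq> \<delta> / 2 - 1 \<and>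
      u + c k \<noteq> 0 \<and> u + c k \<noteq> \<delta> / 2 - 1"
    and uA: "\<And>k a. k \<le> r \<Longrightarrow> a \<in> next_contents \<delta> (T k) \<Longrightarrow> u \<noteq> a"
  shows "tableau_idem N \<delta> T r * brauer.fusion_factor \<delta> N r (Suc r) c u =
    ((u - c 1) / (u + c 1 - (\<delta> / 2 - 1)) * (\<Prod>i\<in>{1..r}. 1 - 1 / (u - c i) ^ 2)) \<odot>
      (\<Sum>a\<in>next_contents \<delta> (T r). ((u + a - (\<delta> / 2 - 1)) / (u - a)) \<odot> branch_idem N \<delta> T r a)"
proof -
  define A where "A = (\<lambda>k. next_contents \<delta> (T k))"
  define I where "I = tableau_idem N \<delta> T"
  define G where "G = branch_idem N \<delta> T"
  define x where "x = brauer.jm \<delta> N"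
  have I: "I = brauer.idem \<delta> N A c" by (simp add: I_def tableau_idem_def A_def c_def)
  have G: "G k a = I k * peval (x (Suc k)) (lagrange_poly (A k) a)" for k a
    by (simp add: G_def branch_idem_def I_def x_def A_def)
  have path: "updown_path k T" if "k \<le> Suc r" for k by (rule updown_path_mono[OF T that])
  have A: "finite (A k)" "A k \<noteq> {}" "c (Suc k) \<in> A k" if "k \<le> r" for k
  proof -
    have d: "downset (T k)" by (rule path_downset[OF T]) (use that in simp)
    show "finite (A k)" unfolding A_def by (rule next_contents_finite_odd(1)[OF d g])
    show "c (Suc k) \<in> A k" unfolding A_def c_def by (rule path_content(2)[OF T]) (use that in simp)
    then show "A k \<noteq> {}" by blast
  qed
  have eigI: "I k * x k = c k \<odot> I k" if "1 \<le> k" "k \<le> Suc r" for k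
  proof -
    have "k \<le> N" using that r by simp
    from tableau_idem_eigen[OF path[OF that(2)] g that(1) this eig[OF path[OF that(2)] that(1)]]
    show ?thesis by (simp add: I_def x_def c_def)
  qed
  have xx: "x k * peval (x m) p = peval (x m) p * x k" if "k \<le> N" "m \<le> N" for k m p
    unfolding x_def by (rule brauer.jm_peval_commute[OF that])
  have Ak: "next_contents \<delta> (T k) = A k" for k by (simp add: A_def)
  show ?thesis
    unfolding Ak I_def[symmetric] G_def[symmetric]
  proof (rule brauer.fusion_procedure[where r = r and E = I and G = G and A = A and c = c])
    show "(2 :: 'k) \<noteq> 0" by (rule generic_two[OF g])
    have "T 0 = {}" using T by (simp add: updown_path_def)
    then have A0: "A 0 = {(\<delta> - 1) / 2}" by (simp add: A_def next_contents_empty)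
    then show A1: "A 0 = {c 1}" using A(3)[of 0] by simp
    show "G 0 (c 1) = I 0" unfolding G A1 by (simp add: lagrange_poly_def root_poly_def)
    show "I k = (\<Sum>a\<in>A k. G k a)" if "k \<le> r" for k
      unfolding G by (simp only: sum_distrib_left[symmetric] peval_sum[symmetric]
          sum_lagrange_poly[OF A(1,2)[OF that]] peval_1 mult_1_right)
    \<comment> \<open>This is the eigenvalue equation of the tableau extended by a box of content \<open>a\<close>.\<close>
    show "G k a * brauer.jm \<delta> N (Suc k) = a \<odot> G k a" if k: "k \<le> r" and a: "a \<in> A k" for k a
    proof -
      obtain \<beta> where \<beta>: "\<beta> \<in> addable (T k) \<union> removable (T k)" "a = box_content \<delta> (T k) \<beta>"
        using a unfolding A_def next_contents_def by blast
      have k1: "k \<le> Suc r" "Suc k \<le> N" using k r by auto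
      note ext = updown_path_extend[OF path[OF k1(1)] \<beta>(1)]
      have 1: "1 \<le> Suc k" by simp
      from tableau_idem_eigen[OF ext(1) g 1 k1(2) eig[OF ext(1) 1]]
      show ?thesis unfolding G_def \<beta>(2) branch_idem_extend[OF path[OF k1(1)] \<beta>(1)] ext(2) .
    qed
    show "G k a * brauer.jm \<delta> N k = c k \<odot> G k a" if "1 \<le> k" "k \<le> r" "a \<in> A k" for k a
    proof -
      have "G k a * x k = I k * x k * peval (x (Suc k)) (lagrange_poly (A k) a)"
        using xx[of k "Suc k"] that r by (simp add: G mult.assoc)
      then show ?thesis using eigI[of k] that by (simp add: G x_def)
    qed
    have bi: "brauer.bicentral \<delta> N k (I k)" for k unfolding I by (rule brauer.idem_bicentral)
    show "brauer.bicentral \<delta> N k (I k)" if "k \<le> r" for k by (rule bi)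
    show "brauer.bicentral \<delta> N (Suc k) (G k a)" if "k \<le> r" "a \<in> A k" for k a
      unfolding G x_def
      by (intro brauer.bicentral_mult brauer.bicentral_peval brauer.bicentral_mono[OF bi]) simp_all
    show "G (Suc k) a * I k = G (Suc k) a" if "Suc k \<le> r" "a \<in> A (Suc k)" for k a
    proof -
      have "I k * x (Suc (Suc k)) = x (Suc (Suc k)) * I k"
        unfolding x_def by (rule brauer.bicentral_commute_jm[OF bi]) (use that r in simp_all)
      then have com: "I k * peval (x (Suc (Suc k))) p = peval (x (Suc (Suc k))) p * I k" for p by (rule peval_commute)
      have "I (Suc k) * I k = I (Suc k)" unfolding I
      proof (rule brauer.idem_absorb[OF _ _ unit_idem])
        show "brauer.idem \<delta> N A c m * brauer.jm \<delta> N m = c m \<odot> brauer.idem \<delta> N A c m" if "1 \<le> m" "m \<le> Suc k" for m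
          using eigI[of m] that \<open>Suc k \<le> r\<close> by (simp add: I x_def)
        show "finite (A m) \<and> c (Suc m) \<in> A m" if "m < Suc k" for m
          using A(1,3)[of m] that \<open>Suc k \<le> r\<close> by simp
      qed (use that r in simp_all)
      then show ?thesis unfolding G by (simp add: mult.assoc com[symmetric]) (simp flip: mult.assoc)
    qed
  qed (rule u uA[unfolded Ak] r order_refl; assumption?)+
qed

section \<open>Evaluation of rational functions\<close>

lemma subst_one [simp]: "subst r c 1 = 1"
proof -
  have "Poly_Mapping.update r 0 (0 :: nat \<Rightarrow>\<^sub>0 nat) = 0" by (rule poly_mapping_eqI) (simp add: lookup_update)
  then show ?thesis using subst_single[of r c 0 1] by simp
qed

lemma evaluates_to_const: "evaluates_to r c (const a) (const a)"
proof -
  have "Poly_Mapping.update r 0 (0 :: nat \<Rightarrow>\<^sub>0 nat) = 0" by (rule poly_mapping_eqI) (simp add: lookup_update)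
  then have "subst r c (Poly_Mapping.single 0 a) = Poly_Mapping.single 0 a" by (simp add: subst_single)
  then show ?thesis
    unfolding evaluates_to_def const_def to_fract_def
    by (intro exI[of _ "Poly_Mapping.single 0 a"] exI[of _ 1]) simp
qed

lemma evaluates_to_var:
  "evaluates_to r c (var r) (const c)" "m \<noteq> r \<Longrightarrow> evaluates_to r c (var m) (var m)"
proof -
  let ?p = "\<lambda>m. Poly_Mapping.single (Poly_Mapping.single m 1) 1 :: mpoly"
  have "Poly_Mapping.update r 0 (Poly_Mapping.single r 1) = (0 :: nat \<Rightarrow>\<^sub>0 nat)"
    by (rule poly_mapping_eqI) (simp add: lookup_update lookup_single)
  then have "subst r c (?p r) = Poly_Mapping.single 0 c" by (simp add: subst_single)
  then show "evaluates_to r c (var r) (const c)"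
    unfolding evaluates_to_def const_def to_fract_def var_def
    by (intro exI[of _ "?p r"] exI[of _ 1]) simp
  assume m: "m \<noteq> r"
  have "Poly_Mapping.update r 0 (Poly_Mapping.single m 1) = (Poly_Mapping.single m 1 :: nat \<Rightarrow>\<^sub>0 nat)"
    by (rule poly_mapping_eqI) (use m in \<open>simp add: lookup_update lookup_single\<close>)
  then have "subst r c (?p m) = ?p m" using m by (simp add: subst_single lookup_single)
  then show "evaluates_to r c (var m) (var m)"
    unfolding evaluates_to_def to_fract_def var_def
    by (intro exI[of _ "?p m"] exI[of _ 1]) simp
qed

lemma evaluates_to_add:
  assumes "evaluates_to r c f f'" "evaluates_to r c g g'" shows "evaluates_to r c (f + g) (f' + g')"
proof -
  obtain p q where f: "subst r c q \<noteq> 0" "f = Fract p q" "f' = Fract (subst r c p) (subst r c q)"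
    using assms(1) unfolding evaluates_to_def by blast
  obtain p' q' where g: "subst r c q' \<noteq> 0" "g = Fract p' q'" "g' = Fract (subst r c p') (subst r c q')"
    using assms(2) unfolding evaluates_to_def by blast
  have "q \<noteq> 0" "q' \<noteq> 0" using f g by auto
  then show ?thesis unfolding evaluates_to_def
    by (intro exI[of _ "p * q' + p' * q"] exI[of _ "q * q'"]) (use f g in \<open>simp add: subst_add subst_mult\<close>)
qed

lemma evaluates_to_mult:
  assumes "evaluates_to r c f f'" "evaluates_to r c g g'" shows "evaluates_to r c (f * g) (f' * g')"
proof -
  obtain p q where f: "subst r c q \<noteq> 0" "f = Fract p q" "f' = Fract (subst r c p) (subst r c q)"
    using assms(1) unfolding evaluates_to_def by blast
  obtain p' q' where g: "subst r c q' \<noteq> 0" "g = Fract p' q'" "g' = Fract (subst r c p') (subst r c q')"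
    using assms(2) unfolding evaluates_to_def by blast
  show ?thesis unfolding evaluates_to_def
    by (intro exI[of _ "p * p'"] exI[of _ "q * q'"]) (use f g in \<open>simp add: subst_mult\<close>)
qed

lemma evaluates_to_inverse:
  assumes "evaluates_to r c f f'" "f' \<noteq> 0" shows "evaluates_to r c (inverse f) (inverse f')"
proof -
  obtain p q where f: "subst r c q \<noteq> 0" "f = Fract p q" "f' = Fract (subst r c p) (subst r c q)"
    using assms(1) unfolding evaluates_to_def by blast
  have "subst r c p \<noteq> 0" using assms(2) unfolding f by (metis fract_collapse(1))
  then show ?thesis unfolding evaluates_to_def
    by (intro exI[of _ "q"] exI[of _ "p"]) (use f in simp)
qed

lemma evaluates_to_numeral: "evaluates_to r c 0 0" "evaluates_to r c 1 1" "evaluates_to r c (numeral k) (numeral k)"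
  using evaluates_to_const[of r c 0] evaluates_to_const[of r c 1] evaluates_to_const[of r c "numeral k"]
  by (simp_all only: const.zero const.one const.numeral)

lemma evaluates_to_minus: "evaluates_to r c f f' \<Longrightarrow> evaluates_to r c (- f) (- f')"
  using evaluates_to_mult[OF evaluates_to_const[of r c "- 1"], of f f'] by (simp add: const.minus)

lemma evaluates_to_diff:
  "evaluates_to r c f f' \<Longrightarrow> evaluates_to r c g g' \<Longrightarrow> evaluates_to r c (f - g) (f' - g')"
  using evaluates_to_add[of r c f f' "- g" "- g'"] evaluates_to_minus by simp

lemma evaluates_to_divide:
  "evaluates_to r c f f' \<Longrightarrow> evaluates_to r c g g' \<Longrightarrow> g' \<noteq> 0 \<Longrightarrow> evaluates_to r c (f / g) (f' / g')"
  unfolding divide_inverse by (intro evaluates_to_mult evaluates_to_inverse)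

lemma evaluates_to_power: "evaluates_to r c f f' \<Longrightarrow> evaluates_to r c (f ^ k) (f' ^ k)"
  by (induction k) (simp_all add: evaluates_to_numeral evaluates_to_mult)

lemma evaluates_to_sum:
  "(\<And>i. i \<in> I \<Longrightarrow> evaluates_to r c (f i) (f' i)) \<Longrightarrow> evaluates_to r c (\<Sum>i\<in>I. f i) (\<Sum>i\<in>I. f' i)"
  by (induction I rule: infinite_finite_induct) (simp_all add: evaluates_to_numeral evaluates_to_add)

lemma evaluates_to_prod:
  "(\<And>i. i \<in> I \<Longrightarrow> evaluates_to r c (f i) (f' i)) \<Longrightarrow> evaluates_to r c (\<Prod>i\<in>I. f i) (\<Prod>i\<in>I. f' i)"
  by (induction I rule: infinite_finite_induct) (simp_all add: evaluates_to_numeral evaluates_to_mult)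

text \<open>
  A rational function that is unchanged by every substitution for \<open>u\<^sub>m\<close> differs from \<open>u\<^sub>m\<close>,
  because \<open>u\<^sub>m\<close> itself takes different values.
\<close>

definition independent_of :: "nat \<Rightarrow> ratfun \<Rightarrow> bool" where
  "independent_of m f \<longleftrightarrow> (\<forall>c. evaluates_to m c f f)"

lemma var_neq_independent:
  assumes "independent_of m f" shows "var m \<noteq> f"
proof
  assume f: "var m = f"
  have "f = const c" for c
    using evaluates_to_unique[of m c f f "const c"] evaluates_to_var(1)[of m c] assms
    unfolding f independent_of_def by blast
  from this[of 0] this[of 1] show False by simp
qed

lemma independent_ofI:
  "independent_of m (const a)" "i \<noteq> m \<Longrightarrow> independent_of m (var i)"
  "independent_of m f \<Longrightarrow> independent_of m g \<Longrightarrow> independent_of m (f + g)"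
  "independent_of m f \<Longrightarrow> independent_of m g \<Longrightarrow> independent_of m (f - g)"
  "independent_of m f \<Longrightarrow> independent_of m (- f)"
  "independent_of m 0" "independent_of m 1"
  unfolding independent_of_def
  by (simp_all add: evaluates_to_const evaluates_to_var evaluates_to_add evaluates_to_diff evaluates_to_minus
      evaluates_to_numeral)

text \<open>
  Operators that are compatible with evaluation in the variable \<open>u\<^sub>r\<close>. They are closed under products, so
  the factors of the fusion formula can be evaluated separately.
\<close>

definition op_evaluates_to :: "nat \<Rightarrow> scalar \<Rightarrow> ratfun endo \<Rightarrow> ratfun endo \<Rightarrow> bool" where
  "op_evaluates_to r c X Y \<longleftrightarrow>
    (\<forall>a b. brauer_evaluates_to r c a b \<longrightarrow> brauer_evaluates_to r c (app X a) (app Y b))"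

lemma op_evaluates_to_algebra:
  "op_evaluates_to r c 0 0" "op_evaluates_to r c 1 1"
  "op_evaluates_to r c X X' \<Longrightarrow> op_evaluates_to r c Y Y' \<Longrightarrow> op_evaluates_to r c (X * Y) (X' * Y')"
  "op_evaluates_to r c X X' \<Longrightarrow> op_evaluates_to r c Y Y' \<Longrightarrow> op_evaluates_to r c (X + Y) (X' + Y')"
  "op_evaluates_to r c X X' \<Longrightarrow> op_evaluates_to r c Y Y' \<Longrightarrow> op_evaluates_to r c (X - Y) (X' - Y')"
  "evaluates_to r c f f' \<Longrightarrow> op_evaluates_to r c X X' \<Longrightarrow> op_evaluates_to r c (f \<odot> X) (f' \<odot> X')"
  unfolding op_evaluates_to_def brauer_evaluates_to_def
  by (simp_all add: app_zero_endo app_one app_times app_plus app_minus app_scl bplus_def bminus_def bscale_def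
      evaluates_to_numeral evaluates_to_add evaluates_to_diff evaluates_to_mult)

lemma op_evaluates_to_sum:
  "(\<And>i. i \<in> I \<Longrightarrow> op_evaluates_to r c (X i) (Y i)) \<Longrightarrow> op_evaluates_to r c (\<Sum>i\<in>I. X i) (\<Sum>i\<in>I. Y i)"
  by (induction I rule: infinite_finite_induct) (simp_all add: op_evaluates_to_algebra)

lemma op_evaluates_to_left_mult:
  "op_evaluates_to r c (left_mult n (const \<omega>) (const.coeffwise a)) (left_mult n (const \<omega>) (const.coeffwise a))"
proof -
  have b: "evaluates_to r c (basis d x) (basis d x)" for d x by (simp add: basis_def evaluates_to_numeral)
  show ?thesis
    unfolding op_evaluates_to_def brauer_evaluates_to_def app_left_mult bmult_def const.coeffwise_def
    by (intro allI impI evaluates_to_sum evaluates_to_mult evaluates_to_power evaluates_to_const b) simp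
qed

lemma op_evaluates_to_generators:
  "op_evaluates_to r c (left_mult n (const \<omega>) (bone n)) (left_mult n (const \<omega>) (bone n))"
  "op_evaluates_to r c (s_op n (const \<omega>) i j) (s_op n (const \<omega>) i j)"
  "op_evaluates_to r c (e_op n (const \<omega>) i j) (e_op n (const \<omega>) i j)"
proof -
  show 1: "op_evaluates_to r c (left_mult n (const \<omega>) (bone n)) (left_mult n (const \<omega>) (bone n))"
    using op_evaluates_to_left_mult[of r c n "bone n"] by (simp add: const.coeffwise_linear)
  show "op_evaluates_to r c (s_op n (const \<omega>) i j) (s_op n (const \<omega>) i j)"
    using op_evaluates_to_left_mult[of r c n "basis (swap_diagram n i j)"] 1
    by (simp add: s_op_def s_elem_basis const.coeffwise_linear op_evaluates_to_algebra)
  show "op_evaluates_to r c (e_op n (const \<omega>) i j) (e_op n (const \<omega>) i j)"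
    using op_evaluates_to_left_mult[of r c n "basis (cap_diagram n i j)"]
    by (simp add: e_op_def eps_elem_basis const.coeffwise_linear)
qed

lemma op_evaluates_to_rho:
  assumes "evaluates_to r c u u'" "u' \<noteq> 0" "u' \<noteq> \<kappa>"
  shows "op_evaluates_to r c (brauer.rho_op (const \<omega>) n i j u) (brauer.rho_op (const \<omega>) n i j u')"
proof -
  have k: "const \<omega> / 2 - 1 = \<kappa>" by (simp only: \<kappa>_def const.homs const.one)
  have "evaluates_to r c (u - \<kappa>) (u' - \<kappa>)"
    unfolding \<kappa>_def by (rule evaluates_to_diff[OF assms(1) evaluates_to_const])
  then show ?thesis
    using assms unfolding brauer.rho_op_def k
    by (intro op_evaluates_to_algebra op_evaluates_to_generators evaluates_to_divide evaluates_to_numeral) simp_all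
qed

lemma op_evaluates_to_tableau_idem:
  assumes "updown_path r T" "r \<le> N"
  shows "op_evaluates_to q c (tableau_idem N (const \<omega>) T r) (tableau_idem N (const \<omega>) T r)"
proof -
  have lift: "const.coeffwise (lift_brauer r k a) = lift_brauer r k (const.coeffwise a)" for k a
    by (induction k) (simp_all add: const.coeffwise_linear)
  have N: "r + (N - r) = N" using assms(2) by simp
  have "tableau_idem N (const \<omega>) T r =
      left_mult N (const \<omega>) (const.coeffwise (lift_brauer r (N - r) (primitive_idempotent \<omega> r T)))"
    using left_mult_primitive_idempotent[OF assms(1) generic_omega(2), of "N - r"]
    unfolding lift const.coeffwise_primitive_idempotent N by simp
  then show ?thesis by (simp only: op_evaluates_to_left_mult)
qed

lemma op_evaluates_to_ascending_prod:
  "(\<And>i. i \<in> {1..k} \<Longrightarrow> op_evaluates_to r c (X i) (Y i)) \<Longrightarrow>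
    op_evaluates_to r c (ascending_prod X k) (ascending_prod Y k)"
  by (induction k) (simp_all add: op_evaluates_to_algebra)

lemma op_evaluates_to_descending_prod:
  "(\<And>i. i \<in> {1..k} \<Longrightarrow> op_evaluates_to r c (X i) (Y i)) \<Longrightarrow>
    op_evaluates_to r c (descending_prod X k) (descending_prod Y k)"
  by (induction k) (simp_all add: op_evaluates_to_algebra)

section \<open>Consecutive evaluations\<close>

lemma kappa_eq: "const \<omega> / 2 - 1 = \<kappa>"
  by (simp only: \<kappa>_def const.homs const.one)

lemma var_combination_neq:
  assumes "independent_of m w" "independent_of m z"
  shows "var m - w \<noteq> z" "w - var m \<noteq> z" "var m + w \<noteq> z"
  using var_neq_independent[OF independent_ofI(3)[OF assms(2,1)]]
    var_neq_independent[OF independent_ofI(4)[OF assms]]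
    var_neq_independent[OF independent_ofI(4)[OF assms(2,1)]]
  by (auto simp: algebra_simps)

text \<open>
  The values of the variables after the first \<open>r\<close> evaluations.
\<close>

definition partial_var :: "(nat \<Rightarrow> box set) \<Rightarrow> nat \<Rightarrow> nat \<Rightarrow> ratfun" where
  "partial_var T r i = (if i \<le> r then const (tableau_content \<omega> T i) else var i)"

definition fusion_scalar :: "(nat \<Rightarrow> box set) \<Rightarrow> nat \<Rightarrow> nat \<Rightarrow> ratfun" where
  "fusion_scalar T r m =
    ((var m - const (tableau_content \<omega> T m)) * (var m + const (tableau_content \<omega> T 1) - \<kappa>)) /
      ((var m - const (tableau_content \<omega> T 1)) * (var m + const (tableau_content \<omega> T m) - \<kappa>)) *
    (\<Prod>i = 1..m - 1. (var m - partial_var T r i) ^ 2 / ((var m - partial_var T r i) ^ 2 - 1))"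

text \<open>
  The product of the factors of level above \<open>k\<close>. The factors of lower level are replaced by \<open>1\<close> to keep the
  index range of the ordered product.
\<close>

definition fusion_tail :: "nat \<Rightarrow> (nat \<Rightarrow> box set) \<Rightarrow> nat \<Rightarrow> nat \<Rightarrow> ratfun endo" where
  "fusion_tail n T r k = ascending_prod (\<lambda>m. if m \<le> k then 1 else
    brauer.fusion_factor (const \<omega>) n (m - 1) m (partial_var T r) (var m)) n"

text \<open>
  The function in the fusion formula after the first \<open>r\<close> evaluations, as an operator. The factors of level at
  most \<open>r\<close> and their scalars have become the idempotent of the truncated tableau. The scalar of level \<open>1\<close>,
  which does not occur in the formula, is \<open>1\<close>.
\<close>

definition partial_fusion :: "nat \<Rightarrow> (nat \<Rightarrow> box set) \<Rightarrow> nat \<Rightarrow> ratfun endo" where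
  "partial_fusion n T r = (\<Prod>m\<in>{Suc r..n}. fusion_scalar T r m) \<odot>
    (tableau_idem n (const \<omega>) T r * fusion_tail n T r r)"

lemma ascending_prod_tail:
  fixes g :: "nat \<Rightarrow> 'a::monoid_mult"
  shows "n \<le> r \<Longrightarrow> ascending_prod (\<lambda>m. if m \<le> r then 1 else g m) n = 1"
    and "r < n \<Longrightarrow> ascending_prod (\<lambda>m. if m \<le> r then 1 else g m) n =
      g (Suc r) * ascending_prod (\<lambda>m. if m \<le> Suc r then 1 else g m) n"
proof -
  show 1: "ascending_prod (\<lambda>m. if m \<le> r then 1 else g m) n = 1" if "n \<le> r" for n r
    using that by (induction n) auto
  show "ascending_prod (\<lambda>m. if m \<le> r then 1 else g m) n =
      g (Suc r) * ascending_prod (\<lambda>m. if m \<le> Suc r then 1 else g m) n" if "r < n"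
    using that
  proof (induction n)
    case (Suc n)
    show ?case
    proof (cases "r = n")
      case True
      then show ?thesis using 1[of n n] 1[of n "Suc n"] by simp
    next
      case False
      then show ?thesis using Suc by (simp add: mult.assoc)
    qed
  qed simp
qed

lemma independent_of_partial_var: "i \<noteq> m \<Longrightarrow> independent_of m (partial_var T r i)"
  by (simp add: partial_var_def independent_ofI)

lemma partial_var_evaluates_to:
  "evaluates_to (Suc r) (tableau_content \<omega> T (Suc r)) (partial_var T r i) (partial_var T (Suc r) i)"
proof -
  consider "i \<le> r" | "i = Suc r" | "Suc r < i" by linarith
  then show ?thesis
    by cases (simp_all add: partial_var_def evaluates_to_const evaluates_to_var)
qed

lemma independent_of_kappa: "independent_of m \<kappa>"
  unfolding \<kappa>_def by (rule independent_ofI)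

lemma fusion_scalar_evaluates_to:
  assumes "Suc r < m"
  shows "evaluates_to (Suc r) (tableau_content \<omega> T (Suc r)) (fusion_scalar T r m) (fusion_scalar T (Suc r) m)"
proof -
  let ?c = "\<lambda>i. const (tableau_content \<omega> T i)" and ?v = "partial_var T (Suc r)"
  have u: "evaluates_to (Suc r) c (var m) (var m)" for c by (rule evaluates_to_var) (use assms in simp)
  have "var m - ?c 1 \<noteq> 0" "var m + ?c m \<noteq> \<kappa>"
    by (rule var_combination_neq(1)[OF independent_ofI(1) independent_ofI(6)],
        rule var_combination_neq(3)[OF independent_ofI(1) independent_of_kappa])
  then have den: "(var m - ?c 1) * (var m + ?c m - \<kappa>) \<noteq> 0" by simp
  have sq: "(var m - ?v i) ^ 2 - 1 \<noteq> 0" if "i \<in> {1..m - 1}" for i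
  proof -
    have "independent_of m (?v i)" by (rule independent_of_partial_var) (use that assms in auto)
    then have "var m - ?v i \<noteq> 1" "var m - ?v i \<noteq> - 1"
      by (rule var_combination_neq(1)[OF _ independent_ofI(7)],
          rule var_combination_neq(1)[OF _ independent_ofI(5)[OF independent_ofI(7)]])
    then show ?thesis by (simp add: power2_eq_1_iff)
  qed
  show ?thesis
    unfolding fusion_scalar_def \<kappa>_def
    by (intro evaluates_to_mult evaluates_to_divide evaluates_to_prod evaluates_to_power evaluates_to_diff
        evaluates_to_add evaluates_to_const evaluates_to_numeral u partial_var_evaluates_to sq
        den[unfolded \<kappa>_def])
qed

lemma fusion_tail_evaluates_to:
  "op_evaluates_to (Suc r) (tableau_content \<omega> T (Suc r)) (fusion_tail n T r (Suc r)) (fusion_tail n T (Suc r) (Suc r))"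
  unfolding fusion_tail_def
proof (rule op_evaluates_to_ascending_prod)
  fix m assume "m \<in> {1..n}"
  show "op_evaluates_to (Suc r) (tableau_content \<omega> T (Suc r))
      (if m \<le> Suc r then 1 else brauer.fusion_factor (const \<omega>) n (m - 1) m (partial_var T r) (var m))
      (if m \<le> Suc r then 1 else brauer.fusion_factor (const \<omega>) n (m - 1) m (partial_var T (Suc r)) (var m))"
  proof (cases "m \<le> Suc r")
    case False
    have u: "evaluates_to (Suc r) c (var m) (var m)" for c by (rule evaluates_to_var) (use False in simp)
    have nz: "\<kappa> - partial_var T (Suc r) i - var m \<noteq> 0" "\<kappa> - partial_var T (Suc r) i - var m \<noteq> \<kappa>"
        "partial_var T (Suc r) i - var m \<noteq> 0" "partial_var T (Suc r) i - var m \<noteq> \<kappa>"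
      if "i \<in> {1..m - 1}" for i
    proof -
      have v: "independent_of m (partial_var T (Suc r) i)"
        by (rule independent_of_partial_var) (use that False in auto)
      note w = independent_ofI(4)[OF independent_of_kappa v]
      show "\<kappa> - partial_var T (Suc r) i - var m \<noteq> 0" "\<kappa> - partial_var T (Suc r) i - var m \<noteq> \<kappa>"
        "partial_var T (Suc r) i - var m \<noteq> 0" "partial_var T (Suc r) i - var m \<noteq> \<kappa>"
        by (rule var_combination_neq(2)[OF w independent_ofI(6)], rule var_combination_neq(2)[OF w independent_of_kappa],
            rule var_combination_neq(2)[OF v independent_ofI(6)], rule var_combination_neq(2)[OF v independent_of_kappa])
    qed
    have "op_evaluates_to (Suc r) (tableau_content \<omega> T (Suc r))
        (brauer.fusion_factor (const \<omega>) n (m - 1) m (partial_var T r) (var m))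
        (brauer.fusion_factor (const \<omega>) n (m - 1) m (partial_var T (Suc r)) (var m))"
      unfolding brauer.fusion_factor_def kappa_eq
      by (intro op_evaluates_to_algebra(3) op_evaluates_to_ascending_prod op_evaluates_to_descending_prod
          op_evaluates_to_rho evaluates_to_diff u partial_var_evaluates_to nz)
        (simp_all add: \<kappa>_def evaluates_to_const)
    then show ?thesis using False by simp
  qed (simp add: op_evaluates_to_algebra)
qed

text \<open>
  The denominator \<open>u + c - \<kappa>\<close> of the prefactor does not vanish at \<open>u = c\<close>.
\<close>

lemma double_content_neq:
  assumes g: "generic_parameter (\<delta> :: 'k::field)"
  shows "box_content \<delta> \<mu> \<alpha> + box_content \<delta> \<mu> \<alpha> \<noteq> \<delta> / 2 - 1"
proof
  let ?k = "int_content \<alpha>"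
  define x h where "x = (\<delta> - 1) / 2" and "h = \<delta> / 2"
  have half: "y / 2 + y / 2 = y" for y :: 'k
    using generic_two[OF g] by (simp only: add_divide_distrib[symmetric] mult_2[symmetric]) simp
  have xx: "x + x = \<delta> - 1" and hh: "h + h = \<delta>" by (simp_all only: x_def h_def half)
  assume eq: "box_content \<delta> \<mu> \<alpha> + box_content \<delta> \<mu> \<alpha> = \<delta> / 2 - 1"
  show False
  proof (cases "\<alpha> \<in> \<mu>")
    case True
    then have "- (x + of_int ?k) + - (x + of_int ?k) = h - 1"
      using eq by (simp add: box_content_alt x_def h_def)
    then have "h + (x * 2 + of_int ?k * 2) = 1" by (simp add: algebra_simps eq_neg_iff_add_eq_0)
    from arg_cong2[OF this this, of "(+)"]
    have "0 = (h + h) + ((x + x) + (x + x)) + (of_int ?k + of_int ?k + of_int ?k + of_int ?k) - 2"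
      by (simp add: algebra_simps)
    also have "\<dots> = of_int 3 * \<delta> + of_int (4 * ?k - 4)" unfolding xx hh by simp
    finally show False using generic_nonzero[OF g, of 3 "4 * ?k - 4"] by simp
  next
    case False
    then have "(x + of_int ?k) + (x + of_int ?k) = h - 1"
      using eq by (simp add: box_content_alt x_def h_def)
    then have "1 + (x * 2 + of_int ?k * 2) = h" by (simp add: algebra_simps)
    from arg_cong2[OF this this, of "(+)"]
    have "0 = ((x + x) + (x + x)) - (h + h) + (of_int ?k + of_int ?k + of_int ?k + of_int ?k) + 2"
      by (simp add: algebra_simps)
    also have "\<dots> = of_int 1 * \<delta> + of_int (4 * ?k)" unfolding xx hh by simp
    finally show False using generic_nonzero[OF g, of 1 "4 * ?k"] by simp
  qed
qed

text \<open>
  The prefactor cancels the scalars of the fusion procedure except for the pole at the content of the step.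
\<close>

lemma fusion_at_content:
  assumes T: "updown_path n T" and r: "r < n"
  defines "c \<equiv> \<lambda>i. const (tableau_content \<omega> T i)" and "u \<equiv> var (Suc r)"
  shows "fusion_scalar T r (Suc r) \<odot> (tableau_idem n (const \<omega>) T r *
      brauer.fusion_factor (const \<omega>) n r (Suc r) (partial_var T r) u) =
    (\<Sum>a\<in>next_contents (const \<omega>) (T r).
      (((u - c (Suc r)) * (u + a - \<kappa>)) / ((u + c (Suc r) - \<kappa>) * (u - a))) \<odot> branch_idem n (const \<omega>) T r a)"
proof -
  have path: "updown_path (Suc r) T" by (rule updown_path_mono[OF T]) (use r in simp)
  have c: "tableau_content (const \<omega>) T i = c i" for i by (simp add: c_def const.tableau_content)
  have cc: "const (tableau_content \<omega> T i) = c i" for i by (simp add: c_def)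
  have ind: "independent_of (Suc r) (const z)" for z by (rule independent_ofI)
  have uc: "u - c i \<noteq> 0" "u - c i \<noteq> \<kappa>" "c i - u \<noteq> \<kappa>" "u + c i \<noteq> 0" "u + c i \<noteq> \<kappa>"
      "u - c i \<noteq> 1" "u - c i \<noteq> - 1" for i
    unfolding c_def u_def
    by (rule var_combination_neq(1)[OF ind independent_ofI(6)], rule var_combination_neq(1)[OF ind independent_of_kappa],
        rule var_combination_neq(2)[OF ind independent_of_kappa], rule var_combination_neq(3)[OF ind independent_ofI(6)],
        rule var_combination_neq(3)[OF ind independent_of_kappa], rule var_combination_neq(1)[OF ind independent_ofI(7)],
        rule var_combination_neq(1)[OF ind independent_ofI(5)[OF independent_ofI(7)]])
  have A: "a \<in> range const" if "a \<in> next_contents (const \<omega>) \<mu>" for a \<mu>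
    using that unfolding next_contents_def by (auto simp flip: const.box_content)
  have uA: "u \<noteq> a" if "a \<in> next_contents (const \<omega>) \<mu>" for a \<mu>
    using A[OF that] var_neq_independent[OF ind] unfolding u_def by auto
  have "brauer.fusion_factor (const \<omega>) n r (Suc r) (partial_var T r) u =
      brauer.fusion_factor (const \<omega>) n r (Suc r) (tableau_content (const \<omega>) T) u"
    by (rule fusion_factor_cong) (simp add: partial_var_def const.tableau_content)
  then have fusion: "tableau_idem n (const \<omega>) T r * brauer.fusion_factor (const \<omega>) n r (Suc r) (partial_var T r) u =
      ((u - c 1) / (u + c 1 - \<kappa>) * (\<Prod>i\<in>{1..r}. 1 - 1 / (u - c i) ^ 2)) \<odot>
      (\<Sum>a\<in>next_contents (const \<omega>) (T r). ((u + a - \<kappa>) / (u - a)) \<odot> branch_idem n (const \<omega>) T r a)"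
    using tableau_fusion[where r = r and N = n and u = u and T = T, OF generic_omega(2) primitive_idempotent_eigen path]
      r uc uA unfolding kappa_eq c by simp
  have "(\<Prod>i\<in>{1..Suc r - 1}. (u - partial_var T r i) ^ 2 / ((u - partial_var T r i) ^ 2 - 1)) *
      (\<Prod>i\<in>{1..r}. 1 - 1 / (u - c i) ^ 2) = 1"
    unfolding diff_Suc_1 prod.distrib[symmetric]
  proof (rule prod.neutral, rule ballI)
    fix i assume "i \<in> {1..r}"
    then have v: "partial_var T r i = c i" by (simp add: partial_var_def c_def)
    have "(u - c i) ^ 2 \<noteq> 0" using uc(1)[of i] by simp
    moreover have "(u - c i) ^ 2 - 1 \<noteq> 0" using uc(6,7)[of i] by (simp add: power2_eq_1_iff)
    ultimately show "(u - partial_var T r i) ^ 2 / ((u - partial_var T r i) ^ 2 - 1) * (1 - 1 / (u - c i) ^ 2) = 1"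
      unfolding v by (simp add: diff_divide_eq_iff)
  qed
  moreover have "((u - c (Suc r)) * (u + c 1 - \<kappa>)) / ((u - c 1) * (u + c (Suc r) - \<kappa>)) * ((u - c 1) / (u + c 1 - \<kappa>)) =
      (u - c (Suc r)) / (u + c (Suc r) - \<kappa>)"
    using uc(1,5)[of 1] uc(5)[of "Suc r"] by simp
  moreover have "(A * P) * (B * Q) = (A * B) * (P * Q)" for A B P Q :: ratfun by (simp add: mult_ac)
  ultimately have key: "fusion_scalar T r (Suc r) * ((u - c 1) / (u + c 1 - \<kappa>) * (\<Prod>i\<in>{1..r}. 1 - 1 / (u - c i) ^ 2)) =
      (u - c (Suc r)) / (u + c (Suc r) - \<kappa>)"
    unfolding fusion_scalar_def u_def[symmetric] cc by (simp only: mult_1_right)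
  show ?thesis unfolding fusion scl_scl key by (simp add: scl_sum_right)
qed

text \<open>
  In the decomposition by eigenvalues, the coefficient of the eigenvalue \<open>c\<close> is constant. All other
  coefficients contain the factor \<open>u - c\<close>, and their denominators do not vanish at \<open>u = c\<close>.
\<close>

lemma partial_fusion_step:
  assumes T: "updown_path n T" and r: "r < n"
  shows "op_evaluates_to (Suc r) (tableau_content \<omega> T (Suc r)) (partial_fusion n T r) (partial_fusion n T (Suc r))"
proof -
  let ?c = "tableau_content \<omega> T (Suc r)" and ?u = "var (Suc r)"
  let ?A = "next_contents (const \<omega>) (T r)" and ?G = "branch_idem n (const \<omega>) T r"
  let ?z = "\<lambda>a. ((?u - const ?c) * (?u + a - \<kappa>)) / ((?u + const ?c - \<kappa>) * (?u - a))"
  define Y where "Y = (\<Sum>a\<in>?A. ?z a \<odot> ?G a)"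
  have path: "updown_path r T" by (rule updown_path_mono[OF T]) (use r in simp)
  have "fusion_tail n T r r = brauer.fusion_factor (const \<omega>) n r (Suc r) (partial_var T r) ?u * fusion_tail n T r (Suc r)"
    unfolding fusion_tail_def
    using ascending_prod_tail(2)[OF r, of "\<lambda>m. brauer.fusion_factor (const \<omega>) n (m - 1) m (partial_var T r) (var m)"]
    by (simp only: diff_Suc_1)
  moreover have "{Suc r..n} = insert (Suc r) {Suc (Suc r)..n}" using r by auto
  ultimately have eq: "partial_fusion n T r = (\<Prod>m\<in>{Suc (Suc r)..n}. fusion_scalar T r m) \<odot> (Y * fusion_tail n T r (Suc r))"
    unfolding partial_fusion_def Y_def fusion_at_content[OF T r, symmetric]
    by (simp add: mult.assoc mult.commute)
  have content: "const ?c = box_content (const \<omega>) (T r) (step_box T (Suc r))" "const ?c \<in> ?A"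
    using path_content[OF T r, of "const \<omega>"] by (simp_all add: const.tableau_content)
  \<comment> \<open>For \<open>a = c\<close> the coefficient is \<open>1\<close> before the evaluation.\<close>
  have z: "evaluates_to (Suc r) ?c (?z a) (if a = const ?c then 1 else 0)" if a: "a \<in> ?A" for a
  proof (cases "a = const ?c")
    case True
    have "?u - const ?c \<noteq> 0" "?u + const ?c \<noteq> \<kappa>"
      by (rule var_combination_neq(1)[OF independent_ofI(1,6)],
          rule var_combination_neq(3)[OF independent_ofI(1) independent_of_kappa])
    then have "?z a = 1" unfolding True by simp
    then show ?thesis by (simp add: True evaluates_to_numeral)
  next
    case False
    obtain b where b: "a = const b" using a unfolding next_contents_def by (auto simp flip: const.box_content)
    have "const ?c + const ?c \<noteq> \<kappa>"
      using double_content_neq[OF generic_omega(2), of "T r" "step_box T (Suc r)"]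
      unfolding content(1) kappa_eq .
    then have den: "(const ?c + const ?c - \<kappa>) * (const ?c - const b) \<noteq> 0" using False b by simp
    have "evaluates_to (Suc r) ?c (?z a)
        (((const ?c - const ?c) * (const ?c + const b - \<kappa>)) / ((const ?c + const ?c - \<kappa>) * (const ?c - const b)))"
      unfolding b \<kappa>_def
      by (intro evaluates_to_divide evaluates_to_mult evaluates_to_diff evaluates_to_add evaluates_to_const
          evaluates_to_var den[unfolded \<kappa>_def])
    then show ?thesis using False by simp
  qed
  have G: "op_evaluates_to (Suc r) ?c (?G a) (?G a)" if a: "a \<in> ?A" for a
  proof -
    obtain \<beta> where \<beta>: "\<beta> \<in> addable (T r) \<union> removable (T r)" "a = box_content (const \<omega>) (T r) \<beta>"
      using a unfolding next_contents_def by blast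
    show ?thesis unfolding \<beta>(2) branch_idem_extend[OF path \<beta>(1)]
      by (rule op_evaluates_to_tableau_idem[OF updown_path_extend(1)[OF path \<beta>(1)]]) (use r in simp)
  qed
  have "finite ?A" by (rule next_contents_finite_odd(1)[OF path_downset[OF path order_refl] generic_omega(2)])
  then have sum: "(\<Sum>a\<in>?A. (if a = const ?c then 1 else 0) \<odot> ?G a) = tableau_idem n (const \<omega>) T (Suc r)"
    using content(2) by (simp add: if_distrib[of "\<lambda>x. x \<odot> _"] sum.delta tableau_idem_Suc const.tableau_content
        cong: if_cong)
  have "op_evaluates_to (Suc r) ?c Y (tableau_idem n (const \<omega>) T (Suc r))"
    unfolding Y_def sum[symmetric] by (intro op_evaluates_to_sum op_evaluates_to_algebra z G)
  then show ?thesis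
    unfolding eq unfolding partial_fusion_def
    by (intro op_evaluates_to_algebra fusion_tail_evaluates_to evaluates_to_prod fusion_scalar_evaluates_to) simp_all
qed

lemma left_mult_rho:
  "left_mult n (const \<omega>) (rho n i j u) = left_mult n (const \<omega>) (bone n) * brauer.rho_op (const \<omega>) n i j u"
  unfolding rho_def brauer.rho_op_def kappa_eq
  by (simp add: left_mult_linear distrib_left right_diff_distrib left_mult_s_op e_op_def left_mult_bmult left_mult_bone)

lemma left_mult_bprod_list:
  assumes "\<And>a. a \<in> set as \<Longrightarrow> left_mult n \<delta> (g a) = left_mult n \<delta> (bone n) * f a"
  shows "left_mult n \<delta> x * left_mult n \<delta> (bprod_list n \<delta> (map g as)) = left_mult n \<delta> x * prod_list (map f as)"
  using assms
proof (induction as arbitrary: x)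
  case Nil
  then show ?case by (simp add: bprod_list_def left_mult_bone)
next
  case (Cons a as)
  have "left_mult n \<delta> x * left_mult n \<delta> (bprod_list n \<delta> (map g (a # as))) =
      left_mult n \<delta> (bmult n \<delta> x (g a)) * left_mult n \<delta> (bprod_list n \<delta> (map g as))"
    by (simp add: bprod_list_def left_mult_bmult mult.assoc)
  also have "\<dots> = left_mult n \<delta> (bmult n \<delta> x (g a)) * prod_list (map f as)"
    by (rule Cons.IH) (use Cons.prems in simp)
  also have "left_mult n \<delta> (bmult n \<delta> x (g a)) = left_mult n \<delta> x * left_mult n \<delta> (bone n) * f a"
    using Cons.prems[of a] by (simp add: left_mult_bmult mult.assoc)
  finally show ?case by (simp add: left_mult_bone mult.assoc)
qed

text \<open>
  The operator of multiplication by \<open>rho\<close> differs from \<open>rho_op\<close> by the projection onto the algebra, which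
  needs to occur only once in a product.
\<close>

lemma left_mult_Omega:
  "left_mult n (const \<omega>) (Omega n) = left_mult n (const \<omega>) (bone n) *
    ascending_prod (\<lambda>m. brauer.fusion_factor (const \<omega>) n (m - 1) m var (var m)) n"
proof -
  let ?L = "left_mult n (const \<omega>)" and ?R = "brauer.rho_op (const \<omega>) n"
  let ?as = "map (\<lambda>(i, j). (i, j, \<kappa> - var i - var j)) (lex_pairs n) @
    map (\<lambda>(i, j). (i, j, var i - var j)) (lex_pairs n)"
  have arg: "- var i - var j + \<kappa> = \<kappa> - var i - var j" for i j by simp
  have Omega: "Omega n = bprod_list n (const \<omega>) (map (\<lambda>(i, j, u). rho n i j u) ?as)"
    unfolding Omega_def arg by (simp add: comp_def split_def)
  have "?L (Omega n) = ?L (bone n) * ?L (Omega n)" by (simp only: left_mult_bone)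
  also have "\<dots> = ?L (bone n) * prod_list (map (\<lambda>(i, j, u). ?R i j u) ?as)"
    unfolding Omega by (rule left_mult_bprod_list) (auto simp: left_mult_rho)
  also have "prod_list (map (\<lambda>(i, j, u). ?R i j u) ?as) =
      lex_prod (\<lambda>i j. ?R i j (\<kappa> - var i - var j)) n * lex_prod (\<lambda>i j. ?R i j (var i - var j)) n"
    unfolding lex_prod_def by (simp add: comp_def split_def)
  also have "\<dots> = ascending_prod (\<lambda>m. brauer.fusion_factor (const \<omega>) n (m - 1) m var (var m)) n"
  proof (rule brauer.Omega_factorize[where n = n and N = n and \<delta> = "const \<omega>" and v = var, unfolded kappa_eq])
    show "(2 :: ratfun) \<noteq> 0" by (rule generic_two[OF generic_omega(2)])
    show "var i - var j \<noteq> 0 \<and> var i - var j \<noteq> \<kappa> \<and> \<kappa> - var i - var j \<noteq> 0 \<and> var i + var j \<noteq> 0"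
      if "1 \<le> i" "i < j" "j \<le> n" for i j
    proof -
      have i: "independent_of j (var i)" by (rule independent_ofI) (use that in simp)
      note 0 = independent_ofI(6)[of j]
      note neq = var_combination_neq(2)[OF i 0] var_combination_neq(2)[OF i independent_of_kappa]
        var_combination_neq(2)[OF independent_ofI(4)[OF independent_of_kappa i] 0] var_combination_neq(3)[OF i 0]
      then show ?thesis by (simp add: add.commute)
    qed
  qed simp
  finally show ?thesis .
qed

lemma partial_fusion_0:
  assumes "1 \<le> n" shows "app (partial_fusion n T 0) (bone n) = Omega_T n T"
proof -
  let ?c = "\<lambda>i. const (tableau_content \<omega> T i)"
  let ?f = "\<lambda>m. ((var m - ?c m) * (var m + ?c 1 - \<kappa>)) / ((var m - ?c 1) * (var m + ?c m - \<kappa>)) *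
    (\<Prod>i = 1..m - 1. (var m - var i) ^ 2 / ((var m - var i) ^ 2 - 1))"
  have f: "fusion_scalar T 0 m = ?f m" for m
    unfolding fusion_scalar_def partial_var_def by (intro arg_cong2[of _ _ _ _ "(*)"] refl prod.cong) auto
  have "var 1 - ?c 1 \<noteq> 0" "var 1 + ?c 1 \<noteq> \<kappa>"
    by (rule var_combination_neq(1)[OF independent_ofI(1,6)],
        rule var_combination_neq(3)[OF independent_ofI(1) independent_of_kappa])
  then have f1: "?f 1 = 1" by simp
  have "{Suc 0..n} = insert 1 {2..n}" using assms by auto
  then have scalar: "(\<Prod>m\<in>{Suc 0..n}. fusion_scalar T 0 m) = (\<Prod>m = 2..n. ?f m)"
    unfolding f using f1 by simp
  have "fusion_tail n T 0 0 = ascending_prod (\<lambda>m. brauer.fusion_factor (const \<omega>) n (m - 1) m var (var m)) n"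
    unfolding fusion_tail_def
  proof (rule ascending_prod_cong)
    fix m assume m: "m \<in> {1..n}"
    have "brauer.fusion_factor (const \<omega>) n (m - 1) m (partial_var T 0) (var m) =
        brauer.fusion_factor (const \<omega>) n (m - 1) m var (var m)"
      by (rule fusion_factor_cong) (simp add: partial_var_def)
    then show "(if m \<le> 0 then 1 else brauer.fusion_factor (const \<omega>) n (m - 1) m (partial_var T 0) (var m)) =
        brauer.fusion_factor (const \<omega>) n (m - 1) m var (var m)"
      using m by simp
  qed
  then have "tableau_idem n (const \<omega>) T 0 * fusion_tail n T 0 0 = left_mult n (const \<omega>) (Omega n)"
    unfolding left_mult_Omega by (simp add: tableau_idem_def)
  then have "partial_fusion n T 0 = left_mult n (const \<omega>) (Omega_T n T)"
    unfolding partial_fusion_def scalar Omega_T_def Let_def left_mult_linear by simp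
  moreover have "supported n (bprod_list n (const \<omega>) as)" for as
    unfolding bprod_list_def by (cases as) (simp_all add: supported_bone bmult_supported)
  then have "supported n (Omega_T n T)"
    unfolding Omega_T_def Let_def Omega_def by (intro supported_linear(3))
  ultimately show ?thesis by (simp add: app_left_mult supported_bmult_bone)
qed

lemma partial_fusion_n:
  assumes "updown_path n T"
  shows "app (partial_fusion n T n) (bone n) = const.coeffwise (primitive_idempotent \<omega> n T)"
proof -
  have "fusion_tail n T n n = 1" unfolding fusion_tail_def by (rule ascending_prod_tail(1)) simp
  then have "partial_fusion n T n = tableau_idem n (const \<omega>) T n" by (simp add: partial_fusion_def)
  also have "\<dots> = left_mult n (const \<omega>) (primitive_idempotent (const \<omega>) n T)"
    using left_mult_primitive_idempotent[OF assms generic_omega(2), of 0] by simp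
  finally show ?thesis
    using primitive_idempotent_supported[OF assms generic_omega(2)]
    by (simp add: app_left_mult supported_bmult_bone const.coeffwise_primitive_idempotent)
qed

theorem theorem2p2:
  fixes n :: nat and lam :: "box set" and T :: "nat \<Rightarrow> box set"
  assumes "n \<ge> 1"
    and "updown_tableau n lam T"
  shows "consecutive_evaluation n (tableau_content \<omega> T) (Omega_T n T)
           (\<lambda>d. const (primitive_idempotent \<omega> n T d))"
  unfolding consecutive_evaluation_def
proof (intro exI conjI ballI)
  let ?H = "\<lambda>r. app (partial_fusion n T r) (bone n)"
  have T: "updown_path n T" using assms(2) by (rule updown_tableau_path)
  show "?H 0 = Omega_T n T" by (rule partial_fusion_0[OF assms(1)])
  show "?H n = (\<lambda>d. const (primitive_idempotent \<omega> n T d))"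
    unfolding partial_fusion_n[OF T] const.coeffwise_def ..
  fix r assume r: "r \<in> {1..n}"
  then obtain k where k: "r = Suc k" "k < n" by (cases r) auto
  have "brauer_evaluates_to r c (bone n) (bone n)" for c
    by (simp add: brauer_evaluates_to_def bone_def basis_def evaluates_to_numeral)
  then show "brauer_evaluates_to r (tableau_content \<omega> T r) (?H (r - 1)) (?H r)"
    using partial_fusion_step[OF T k(2)] unfolding k(1) op_evaluates_to_def by simp
qed

end
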